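(* Let $K$ be an algebraically closed field, let $R$ be a normal standard graded $K$-algebra and let $f_1,\dots,f_n\in R$ be primary homogeneous elements of degrees $d_i$. Let $f_0\in R$ be another homogeneous element of degree $d_0\leq\min_i d_i$. Then $f_0\in(f_1,\dots,f_n)^{\star}$ (solid closure) is only possible if $f_0\in(f_1,\dots,f_n)$.
   Context: A standard graded $K$-algebra is an $\mathbb{N}$-graded ring $R=\bigoplus_{k\ge 0}R_k$ with $R_0=K$, generated over $K$ by finitely many elements of degree one; $R_+=\bigoplus_{k\ge1}R_k$. Normal means integrally closed domain. Homogeneous elements $f_1,\dots,f_n$ are primary if $R_+$ is contained in the radical of $(f_1,\dots,f_n)$. Solid closure: $f_0\in(f_1,\dots,f_n)^{\star}$ if and only if for every local complete domain $R'=\widehat{R_{\mathfrak m}}/\mathfrak q$ (with $\mathfrak m$ a maximal ideal of $R$ and $\mathfrak q$ a minimal prime of $\widehat{R_{\mathfrak m}}$) one has $H^{\dim R'}_{\mathfrak m'}(A')\neq0$, where $\mathfrak m'$ is the maximal ideal of $R'$ and $A'=R'[T_1,\dots,T_n]/(f_1T_1+\dots+f_nT_n+f_0)$. *)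

theory Defs
  imports "HOL-Algebra.Algebra" "HOL-Library.Extended_Nat"
begin

section \<open>Localization, normality and completion\<close>

definition loc_rel :: "('a, 'x) ring_scheme \<Rightarrow> 'a set \<Rightarrow> (('a \<times> 'a) \<times> ('a \<times> 'a)) set" where
  "loc_rel R S = {((a, s), (b, t)) | a s b t. a \<in> carrier R \<and> s \<in> S \<and> b \<in> carrier R \<and> t \<in> S \<and>
     (\<exists>u\<in>S. u \<otimes>\<^bsub>R\<^esub> (a \<otimes>\<^bsub>R\<^esub> t \<ominus>\<^bsub>R\<^esub> b \<otimes>\<^bsub>R\<^esub> s) = \<zero>\<^bsub>R\<^esub>)}"

definition loc_frac :: "('a, 'x) ring_scheme \<Rightarrow> 'a set \<Rightarrow> 'a \<Rightarrow> 'a \<Rightarrow> ('a \<times> 'a) set" where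
  "loc_frac R S a s = loc_rel R S `` {(a, s)}"

text \<open>The localization of \<open>R\<close> at a multiplicative set \<open>S\<close>.  As for quotient rings in the library,
  the operations are unions over representatives; all the sets in such a union are equal.\<close>

definition localization :: "('a, 'x) ring_scheme \<Rightarrow> 'a set \<Rightarrow> (('a \<times> 'a) set) ring" where
  "localization R S =
    \<lparr>carrier = (carrier R \<times> S) // loc_rel R S,
     monoid.mult = (\<lambda>A B. \<Union>p\<in>A. \<Union>q\<in>B.
              loc_frac R S (fst p \<otimes>\<^bsub>R\<^esub> fst q) (snd p \<otimes>\<^bsub>R\<^esub> snd q)),
     one = loc_frac R S \<one>\<^bsub>R\<^esub> \<one>\<^bsub>R\<^esub>,
     ring.zero = loc_frac R S \<zero>\<^bsub>R\<^esub> \<one>\<^bsub>R\<^esub>,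
     add = (\<lambda>A B. \<Union>p\<in>A. \<Union>q\<in>B.
              loc_frac R S (fst p \<otimes>\<^bsub>R\<^esub> snd q \<oplus>\<^bsub>R\<^esub> fst q \<otimes>\<^bsub>R\<^esub> snd p) (snd p \<otimes>\<^bsub>R\<^esub> snd q))\<rparr>"

text \<open>An integrally closed domain: every element of the fraction field that is a root of a monic
  polynomial over \<open>R\<close> (list of coefficients, leading one first) lies in \<open>R\<close>.\<close>

definition normal_domain :: "('a, 'x) ring_scheme \<Rightarrow> bool" where
  "normal_domain R \<longleftrightarrow> domain R \<and>
     (let S = carrier R - {\<zero>\<^bsub>R\<^esub>}; F = localization R S; \<iota> = (\<lambda>a. loc_frac R S a \<one>\<^bsub>R\<^esub>) in
      \<forall>x\<in>carrier F. (\<exists>p. p \<noteq> [] \<and> hd p = \<one>\<^bsub>F\<^esub> \<and> set p \<subseteq> \<iota> ` carrier R \<and> ring.eval F p x = \<zero>\<^bsub>F\<^esub>)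
        \<longrightarrow> x \<in> \<iota> ` carrier R)"

text \<open>Meant for local rings, where the maximal ideal is unique.\<close>

definition max_ideal_of :: "('a, 'x) ring_scheme \<Rightarrow> 'a set" where
  "max_ideal_of L = (THE m. maximalideal m L)"

definition ideal_power :: "('a, 'x) ring_scheme \<Rightarrow> 'a set \<Rightarrow> nat \<Rightarrow> 'a set" where
  "ideal_power R I k = I [^]\<^bsub>ideals_set R\<^esub> k"

text \<open>The \<open>I\<close>-adic completion as the inverse limit of the rings \<open>R / I^k\<close>.  A coset of \<open>I^(k+1)\<close>
  is mapped to a given coset of \<open>I^k\<close> iff it is contained in it.\<close>

definition adic_completion :: "('a, 'x) ring_scheme \<Rightarrow> 'a set \<Rightarrow> (nat \<Rightarrow> 'a set) ring" where
  "adic_completion R I =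
    \<lparr>carrier = {x. (\<forall>k. x k \<in> carrier (R Quot ideal_power R I k)) \<and> (\<forall>k. x (Suc k) \<subseteq> x k)},
     monoid.mult = (\<lambda>x y k. x k \<otimes>\<^bsub>R Quot ideal_power R I k\<^esub> y k),
     one = (\<lambda>k. \<one>\<^bsub>R Quot ideal_power R I k\<^esub>),
     ring.zero = (\<lambda>k. \<zero>\<^bsub>R Quot ideal_power R I k\<^esub>),
     add = (\<lambda>x y k. x k \<oplus>\<^bsub>R Quot ideal_power R I k\<^esub> y k)\<rparr>"

definition minimal_prime :: "'a set \<Rightarrow> ('a, 'x) ring_scheme \<Rightarrow> bool" where
  "minimal_prime q R \<longleftrightarrow> primeideal q R \<and> (\<forall>p. primeideal p R \<and> p \<subseteq> q \<longrightarrow> p = q)"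

definition krull_dim :: "('a, 'x) ring_scheme \<Rightarrow> enat" where
  "krull_dim R = Sup {enat l | l. \<exists>P :: nat \<Rightarrow> 'a set.
     (\<forall>i\<le>l. primeideal (P i) R) \<and> (\<forall>i<l. P i \<subset> P (Suc i))}"

section \<open>Local cohomology\<close>

definition module_hom ::
    "('r, 'x) ring_scheme \<Rightarrow> ('r, 'm, 'y) module_scheme \<Rightarrow> ('r, 'n, 'z) module_scheme \<Rightarrow> ('m \<Rightarrow> 'n) set" where
  "module_hom R M N = {h \<in> carrier M \<rightarrow> carrier N.
     (\<forall>x\<in>carrier M. \<forall>y\<in>carrier M. h (x \<oplus>\<^bsub>M\<^esub> y) = h x \<oplus>\<^bsub>N\<^esub> h y) \<and>
     (\<forall>a\<in>carrier R. \<forall>x\<in>carrier M. h (a \<odot>\<^bsub>M\<^esub> x) = a \<odot>\<^bsub>N\<^esub> h x)}"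

text \<open>Injectivity is tested against the modules \<open>P\<close>, \<open>Q\<close> with elements in the same type as those
  of \<open>E\<close>.  If this type is at least as large as the type of elements of \<open>R\<close> (as it is below), then
  \<open>R\<close> and its ideals occur among these modules up to isomorphism, so that by Baer's criterion this
  is injectivity with respect to all modules.\<close>

definition injective_module :: "('r, 'x) ring_scheme \<Rightarrow> ('r, 'e) module \<Rightarrow> bool" where
  "injective_module R E \<longleftrightarrow> module R E \<and>
     (\<forall>(P :: ('r, 'e) module) (Q :: ('r, 'e) module) i g.
        module R P \<and> module R Q \<and> i \<in> module_hom R P Q \<and> inj_on i (carrier P) \<and>
        g \<in> module_hom R P E \<longrightarrow>
        (\<exists>h \<in> module_hom R Q E. \<forall>x\<in>carrier P. h (i x) = g x))"

definition injective_resolution ::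
    "('r, 'x) ring_scheme \<Rightarrow> ('r, 'm, 'y) module_scheme \<Rightarrow>
     (nat \<Rightarrow> ('r, 'e) module) \<Rightarrow> ('m \<Rightarrow> 'e) \<Rightarrow> (nat \<Rightarrow> 'e \<Rightarrow> 'e) \<Rightarrow> bool" where
  "injective_resolution R M E \<epsilon> d \<longleftrightarrow>
     (\<forall>i. injective_module R (E i)) \<and>
     \<epsilon> \<in> module_hom R M (E 0) \<and> (\<forall>i. d i \<in> module_hom R (E i) (E (Suc i))) \<and>
     inj_on \<epsilon> (carrier M) \<and>
     {x \<in> carrier (E 0). d 0 x = \<zero>\<^bsub>E 1\<^esub>} = \<epsilon> ` carrier M \<and>
     (\<forall>i. {x \<in> carrier (E (Suc i)). d (Suc i) x = \<zero>\<^bsub>E (Suc (Suc i))\<^esub>} = d i ` carrier (E i))"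

definition torsion_part ::
    "('r, 'x) ring_scheme \<Rightarrow> 'r set \<Rightarrow> ('r, 'm, 'y) module_scheme \<Rightarrow> 'm set" (\<open>\<Gamma>\<close>) where
  "\<Gamma> R I M = {x \<in> carrier M. \<exists>t. \<forall>a \<in> ideal_power R I t. a \<odot>\<^bsub>M\<^esub> x = \<zero>\<^bsub>M\<^esub>}"

text \<open>The cohomology in degree \<open>i\<close> of the complex \<open>\<Gamma>\<^sub>I(E 0) \<rightarrow> \<Gamma>\<^sub>I(E 1) \<rightarrow> \<dots>\<close>,
  as a (multiplicatively written) quotient group.\<close>

definition torsion_cohomology ::
    "('r, 'x) ring_scheme \<Rightarrow> 'r set \<Rightarrow> (nat \<Rightarrow> ('r, 'e) module) \<Rightarrow> (nat \<Rightarrow> 'e \<Rightarrow> 'e) \<Rightarrow> nat \<Rightarrow> 'e set monoid" where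
  "torsion_cohomology R I E d i =
     (add_monoid (E i)) \<lparr>carrier := {x \<in> \<Gamma> R I (E i). d i x = \<zero>\<^bsub>E (Suc i)\<^esub>}\<rparr>
       Mod (case i of 0 \<Rightarrow> {\<zero>\<^bsub>E 0\<^esub>} | Suc j \<Rightarrow> d j ` \<Gamma> R I (E j))"

text \<open>\<open>local_cohomology_nonzero R I M i\<close> says that \<open>H\<^sup>i\<^sub>I(M) \<noteq> 0\<close>, the \<open>i\<close>-th right derived functor
  of \<open>\<Gamma>\<^sub>I\<close> being computed with an injective resolution of \<open>M\<close>; up to isomorphism it does not
  depend on the resolution.

  HOL cannot quantify over all resolutions, only over those with elements in a fixed type.  The
  type chosen here has cardinality \<open>\<kappa> = (2\<mu>)^(\<rho>\<aleph>\<^sub>0)\<close>, where \<open>\<rho>\<close> and \<open>\<mu>\<close> are the cardinalities of the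
  types of the elements of \<open>R\<close> and of \<open>M\<close>.  This is large enough for every \<open>R\<close> and \<open>M\<close>: a module
  \<open>N\<close> with at most \<open>\<kappa>\<close> elements embeds into a divisible group \<open>D\<close> with at most \<open>\<kappa>\<close> elements, hence into
  the injective module \<open>Hom\<^sub>\<int>(R, D)\<close>, which has at most \<open>\<kappa>^\<rho> = \<kappa>\<close> elements, and the cokernel is again
  at most that large.  So an injective resolution of \<open>M\<close> exists within this type.\<close>

type_synonym ('r, 'm) resolution_elt = "'r \<times> nat \<Rightarrow> 'm \<times> bool"

definition local_cohomology_nonzero ::
    "('r, 'x) ring_scheme \<Rightarrow> 'r set \<Rightarrow> ('r, 'm, 'y) module_scheme \<Rightarrow> nat \<Rightarrow> bool" where
  "local_cohomology_nonzero R I M i \<longleftrightarrow>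
     (\<exists>(E :: nat \<Rightarrow> ('r, ('r, 'm) resolution_elt) module) \<epsilon> d.
        injective_resolution R M E \<epsilon> d \<and>
        carrier (torsion_cohomology R I E d i) \<noteq> {\<one>\<^bsub>torsion_cohomology R I E d i\<^esub>})"

section \<open>Forcing algebras and solid closure\<close>

text \<open>The library provides the carrier of the polynomial ring in the variables \<open>I\<close>, whose elements
  map monomials (multisets of variables) to coefficients, but no ring structure on it.\<close>

definition mpoly_ring :: "('a, 'x) ring_scheme \<Rightarrow> 'v set \<Rightarrow> ('v multiset \<Rightarrow> 'a) ring" where
  "mpoly_ring R I =
    \<lparr>carrier = ring.indexed_pset R I (carrier R),
     monoid.mult = (\<lambda>P Q m. \<Oplus>\<^bsub>R\<^esub>k\<in>{k. k \<subseteq># m}. P k \<otimes>\<^bsub>R\<^esub> Q (m - k)),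
     one = ring.indexed_const R \<one>\<^bsub>R\<^esub>,
     ring.zero = ring.indexed_const R \<zero>\<^bsub>R\<^esub>,
     add = ring.indexed_padd R\<rparr>"

definition forcing_poly :: "('a, 'x) ring_scheme \<Rightarrow> nat \<Rightarrow> (nat \<Rightarrow> 'a) \<Rightarrow> 'a \<Rightarrow> nat multiset \<Rightarrow> 'a" where
  "forcing_poly R n f f0 = (let P = mpoly_ring R {1..n} in
     (\<Oplus>\<^bsub>P\<^esub>i\<in>{1..n}. ring.indexed_const R (f i) \<otimes>\<^bsub>P\<^esub> ring.indexed_var R i)
       \<oplus>\<^bsub>P\<^esub> ring.indexed_const R f0)"

text \<open>The forcing algebra \<open>R[T\<^sub>1, \<dots>, T\<^sub>n] / (f\<^sub>1 T\<^sub>1 + \<dots> + f\<^sub>n T\<^sub>n + f\<^sub>0)\<close>, a ring together with its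
  structure of an \<open>R\<close>-module.\<close>

definition forcing_algebra ::
    "('a, 'x) ring_scheme \<Rightarrow> nat \<Rightarrow> (nat \<Rightarrow> 'a) \<Rightarrow> 'a \<Rightarrow> ('a, (nat multiset \<Rightarrow> 'a) set) module" where
  "forcing_algebra R n f f0 =
    (let P = mpoly_ring R {1..n}; J = PIdl\<^bsub>P\<^esub> (forcing_poly R n f f0); A = P Quot J in
     ring.extend A (module.fields (\<lambda>a x. (J +>\<^bsub>P\<^esub> ring.indexed_const R a) \<otimes>\<^bsub>A\<^esub> x)))"

definition local_ring_at :: "('a, 'x) ring_scheme \<Rightarrow> 'a set \<Rightarrow> (('a \<times> 'a) set) ring" where
  "local_ring_at R m = localization R (carrier R - m)"

definition completed_local_ring_at ::
    "('a, 'x) ring_scheme \<Rightarrow> 'a set \<Rightarrow> (nat \<Rightarrow> ('a \<times> 'a) set set) ring" where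
  "completed_local_ring_at R m =
     adic_completion (local_ring_at R m) (max_ideal_of (local_ring_at R m))"

definition to_completed_local_ring ::
    "('a, 'x) ring_scheme \<Rightarrow> 'a set \<Rightarrow> 'a \<Rightarrow> nat \<Rightarrow> ('a \<times> 'a) set set" where
  "to_completed_local_ring R m a = (let L = local_ring_at R m in
     (\<lambda>k. ideal_power L (max_ideal_of L) k +>\<^bsub>L\<^esub> loc_frac R (carrier R - m) a \<one>\<^bsub>R\<^esub>))"

text \<open>The closure of the ideal generated by \<open>f 1, \<dots>, f n\<close>.  For Noetherian \<open>R\<close> the ring \<open>R'\<close> below is a
  Noetherian local ring, so its dimension is finite.\<close>

definition solid_closure :: "('a, 'x) ring_scheme \<Rightarrow> nat \<Rightarrow> (nat \<Rightarrow> 'a) \<Rightarrow> 'a set" where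
  "solid_closure R n f = {f0 \<in> carrier R. \<forall>m q.
     maximalideal m R \<and> minimal_prime q (completed_local_ring_at R m) \<longrightarrow>
     (let C = completed_local_ring_at R m;
          R' = C Quot q;
          \<phi> = (\<lambda>a. q +>\<^bsub>C\<^esub> to_completed_local_ring R m a)
      in local_cohomology_nonzero R' (max_ideal_of R')
           (forcing_algebra R' n (\<lambda>i. \<phi> (f i)) (\<phi> f0)) (the_enat (krull_dim R')))}"

section \<open>Standard graded algebras\<close>

definition graded_ring :: "('a, 'x) ring_scheme \<Rightarrow> (nat \<Rightarrow> 'a set) \<Rightarrow> bool" where
  "graded_ring R gr \<longleftrightarrow> cring R \<and>
     (\<forall>k. additive_subgroup (gr k) R) \<and>
     (\<forall>j k. \<forall>x\<in>gr j. \<forall>y\<in>gr k. x \<otimes>\<^bsub>R\<^esub> y \<in> gr (j + k)) \<and>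
     (\<forall>x\<in>carrier R. \<exists>!c. (\<forall>k. c k \<in> gr k) \<and> finite {k. c k \<noteq> \<zero>\<^bsub>R\<^esub>} \<and>
        x = (\<Oplus>\<^bsub>R\<^esub>k\<in>{k. c k \<noteq> \<zero>\<^bsub>R\<^esub>}. c k))"

definition standard_graded_algebra ::
    "'a set \<Rightarrow> ('a, 'x) ring_scheme \<Rightarrow> (nat \<Rightarrow> 'a set) \<Rightarrow> bool" where
  "standard_graded_algebra K R gr \<longleftrightarrow> graded_ring R gr \<and> subfield K R \<and> gr 0 = K \<and>
     (\<exists>G. finite G \<and> G \<subseteq> gr 1 \<and> carrier R = generate_ring R (K \<union> G))"

definition irrelevant_ideal :: "('a, 'x) ring_scheme \<Rightarrow> (nat \<Rightarrow> 'a set) \<Rightarrow> 'a set" where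
  "irrelevant_ideal R gr =
     {\<Oplus>\<^bsub>R\<^esub>k\<in>F. c k | F c. finite F \<and> (\<forall>k\<in>F. 1 \<le> k \<and> c k \<in> gr k)}"

definition ideal_radical :: "('a, 'x) ring_scheme \<Rightarrow> 'a set \<Rightarrow> 'a set" where
  "ideal_radical R I = {x \<in> carrier R. \<exists>k::nat. x [^]\<^bsub>R\<^esub> k \<in> I}"

definition primary_family ::
    "('a, 'x) ring_scheme \<Rightarrow> (nat \<Rightarrow> 'a set) \<Rightarrow> nat \<Rightarrow> (nat \<Rightarrow> 'a) \<Rightarrow> bool" where
  "primary_family R gr n f \<longleftrightarrow> irrelevant_ideal R gr \<subseteq> ideal_radical R (Idl\<^bsub>R\<^esub> (f ` {1..n}))"

end

theory Submission
 imports Defs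
begin

text \<open>
  Suppose \<open>f0\<close> is not in the ideal \<open>I\<close> of the \<open>f i\<close>. The completion \<open>B\<close> of \<open>R\<close> at the irrelevant ideal is a
  local domain with finite dimension at least \<open>r\<close>, the number of parameters \<open>x\<close> of degree one found by prime
  avoidance. For \<open>A\<close> the forcing algebra, \<open>H\<^sup>j(A) = 0\<close> for all \<open>j \<ge> r\<close>: since injective modules are divisible
  modulo torsion, this reduces to showing that every power product \<open>(x\<^sub>0 \<dots> x\<^sub>r\<^sub>-\<^sub>1)\<^sup>u\<close> lies in the ideal of the
  \<open>x\<^sub>i\<^sup>t\<^sup>+\<^sup>u\<close> of \<open>A\<close> for large \<open>u\<close>.

  Otherwise let \<open>Z \<subset> A\<close> be the ideal of the elements whose product with such a power product lies in the
  corresponding ideal, and let \<open>W\<close> be the image in \<open>A / Z\<close> of the last graded piece of \<open>R\<close> that does not vanish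
  there. Multiplication by a nonzero form \<open>f\<close> of degree \<open>d0\<close> is onto \<open>W\<close>, and the terms \<open>f i\<close> of degree
  greater than \<open>d0\<close> act as zero, so the forcing equation becomes a relation between \<open>f0\<close> and the \<open>f i\<close> of
  degree \<open>d0\<close> only. The multipliers \<open>T i\<close> define a pencil of linear maps on a finite dimensional space, which has
  an eigenvector over the algebraically closed field \<open>K\<close>; it corresponds to a form \<open>f = \<Sum> \<mu> j f j\<close> that is not
  onto, hence \<open>f = 0\<close>, contradicting \<open>f0 \<notin> I\<close>.
\<close>

text \<open>Top cohomology is handled through fractions \<open>a / (x_0 ... x_(r-1))^t\<close>.
  Degrees are read off numerators coming from \<open>R\<close>: expanding a fraction by a power
  product does not change its degree. The degrees in which some fraction survives are bounded above,
  and \<open>W\<close> sits in the largest one. A nonzero form \<open>f\<close> is algebraic over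
  the parameters, so high power products fall into the ideal of \<open>f\<close> and the
  \<open>x_i^t\<close>; this is why multiplication by \<open>f\<close> reaches the largest degree. A
  form of degree above \<open>d0\<close>, applied to the same multiplier, overshoots that degree,
  and here \<open>d0 \<le> d i\<close> enters. The obstacle is that the \<open>T i\<close> need not
  preserve \<open>W\<close>: they generate ever larger spaces on which none of them has to be
  invertible. Eigenvalues are therefore taken of one multiplier relative to another along this
  growing sequence of spaces; if no eigenvalue existed, every linear factor of a binary form could
  be cancelled. Algebraic closedness enters a second time through the infinity of \<open>K\<close>,
  on which prime avoidance in degree one depends.\<close>

lemma ideal_zero: "ideal I R ==> \<zero>\<^bsub>R\<^esub> \<in> I"
 and ideal_neg: "ideal I R ==> a \<in> I ==> \<ominus>\<^bsub>R\<^esub> a \<in> I"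
 and ideal_mem: "ideal I R ==> a \<in> I ==> a \<in> carrier R"
 and ideal_sum: "ideal I R ==> a \<in> I ==> b \<in> I ==> a \<oplus>\<^bsub>R\<^esub> b \<in> I"
 by (rule additive_subgroup.zero_closed additive_subgroup.a_inv_closed additive_subgroup.a_Hcarr
  additive_subgroup.a_closed; (assumption | erule ideal.axioms(1)))+

\<comment> \<open>Any term may follow \<open>\<^sub>\<close> as a structure index, so that
  operations of the members of a family such as \<open>E n\<close> can be written directly.\<close>
syntax "_subscript_index" :: "logic => index" (\<open>\<^sub>_\<close> [1000] 1000)
translations "_subscript_index x" => "_index x"

section \<open>Linear combinations and ideals generated by indexed families\<close>

lemma (in cring) idealI_comm:
 assumes T: "T <= carrier R" "\<zero> \<in> T" "!!a b. a \<in> T ==> b \<in> T ==> a \<oplus> b \<in> T"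
  "!!a x. a \<in> T ==> x \<in> carrier R ==> x \<otimes> a \<in> T"
 shows "ideal T R"
proof (rule idealI[OF ring_axioms])
 show "subgroup T (add_monoid R)"
 proof (rule add.subgroupI)
  fix a assume a: "a \<in> T"
  then have "\<ominus> a = (\<ominus> \<one>) \<otimes> a" using T(1) by (auto simp: l_minus)
  then show "\<ominus> a \<in> T" using T(4)[OF a] by simp
 qed (use T in auto)
 fix a x assume a: "a \<in> T" and x: "x \<in> carrier R"
 then have "a \<otimes> x = x \<otimes> a" using T(1) by (auto simp: m_comm)
 then show "a \<otimes> x \<in> T" using T(4)[OF a x] by simp
qed (rule T(4))

lemma (in ring_hom_cring) hom_finsum_mult:
 assumes "!!i. i \<in> I ==> a i \<in> carrier R & b i \<in> carrier R"
 shows "h (\<Oplus>i\<in>I. a i \<otimes> b i) = (\<Oplus>\<^sub>S i\<in>I. h (a i) \<otimes>\<^sub>S h (b i))"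
proof -
 have "h (\<Oplus>i\<in>I. a i \<otimes> b i) = (\<Oplus>\<^sub>S i\<in>I. (h \<circ> (%i. a i \<otimes> b i)) i)"
  by (subst hom_finsum) (use assms in auto)
 also have "\<dots> = (\<Oplus>\<^sub>S i\<in>I. h (a i) \<otimes>\<^sub>S h (b i))" by (rule S.finsum_cong') (use assms in auto)
 finally show ?thesis .
qed

text \<open>The combinations form an ideal, and the indicator of \<open>j\<close> as coefficient
  shows that it contains \<open>h j\<close>. Summation is over the index set, so \<open>h\<close>
  may repeat values.\<close>

lemma (in cring) genideal_combination:
 assumes "finite I" "!!i. i \<in> I ==> h i \<in> carrier R" "a \<in> Idl (h ` I)"
 shows "\<exists>t. (\<forall>i\<in>I. t i \<in> carrier R) & a = (\<Oplus>i\<in>I. t i \<otimes> h i)"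
proof -
 let ?T = "{a. \<exists>t. (\<forall>i\<in>I. t i \<in> carrier R) & a = (\<Oplus>i\<in>I. t i \<otimes> h i)}"
 have "ideal ?T R"
 proof (rule idealI_comm)
  show "?T <= carrier R" using assms by (auto intro!: finsum_closed)
  have "(\<Oplus>i\<in>I. \<zero> \<otimes> h i) = (\<Oplus>i\<in>I. \<zero>)" by (rule finsum_cong') (use assms in auto)
  then show "\<zero> \<in> ?T" by (intro CollectI exI[of _ "%_. \<zero>"]) auto
  next
   fix a a' assume "a \<in> ?T" "a' \<in> ?T"
   then obtain t t' where t: "\<forall>i\<in>I. t i \<in> carrier R" "a = (\<Oplus>i\<in>I. t i \<otimes> h i)"
    "\<forall>i\<in>I. t' i \<in> carrier R" "a' = (\<Oplus>i\<in>I. t' i \<otimes> h i)" by auto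
   have "a \<oplus> a' = (\<Oplus>i\<in>I. t i \<otimes> h i \<oplus> t' i \<otimes> h i)" unfolding t by (rule finsum_addf[symmetric]) (use t assms in auto)
   also have "\<dots> = (\<Oplus>i\<in>I. (t i \<oplus> t' i) \<otimes> h i)" by (rule finsum_cong') (use t assms in "auto simp: l_distr")
   finally show "a \<oplus> a' \<in> ?T" using t by (intro CollectI exI[of _ "%i. t i \<oplus> t' i"]) auto
 next
  fix a x assume "a \<in> ?T" and x: "x \<in> carrier R"
  then obtain t where t: "\<forall>i\<in>I. t i \<in> carrier R" "a = (\<Oplus>i\<in>I. t i \<otimes> h i)" by auto
  have "x \<otimes> a = (\<Oplus>i\<in>I. x \<otimes> (t i \<otimes> h i))" unfolding t(2) by (rule finsum_rdistr) (use t assms x in auto)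
  also have "\<dots> = (\<Oplus>i\<in>I. (x \<otimes> t i) \<otimes> h i)" by (rule finsum_cong') (use t assms x in "auto simp: m_assoc")
  finally show "x \<otimes> a \<in> ?T" using t x by (intro CollectI exI[of _ "%i. x \<otimes> t i"]) auto
 qed
 moreover have "h ` I <= ?T"
 proof
  fix y assume "y \<in> h ` I"
  then obtain j where j: "j \<in> I" "y = h j" by auto
  have "(\<Oplus>i\<in>I. (if i = j then \<one> else \<zero>) \<otimes> h i) = (\<Oplus>i\<in>I. if j = i then h i else \<zero>)"
   by (rule finsum_cong') (use assms in auto)
  also have "\<dots> = h j" by (rule finsum_singleton) (use j assms in auto)
  finally show "y \<in> ?T" using j by (intro CollectI exI[of _ "%i. if i = j then \<one> else \<zero>"]) auto
 qed
 ultimately have "Idl (h ` I) <= ?T" by (rule genideal_minimal)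
 then show ?thesis using assms(3) by blast
qed

lemma (in cring) ideal_finsum:
 assumes "ideal J R" "!!i. i \<in> I ==> f i \<in> J" shows "finsum R f I \<in> J"
 using assms(2)
proof (induction I rule: infinite_finite_induct)
 case (insert i I)
 note c = ideal_mem[OF assms(1)]
 have "finsum R f (insert i I) = f i \<oplus> finsum R f I" by (rule finsum_insert) (use insert c in auto)
 then show ?case using insert ideal_sum[OF assms(1)] by simp
qed (use ideal_zero[OF assms(1)] in auto)

lemma (in module) annihilator_ideal: assumes e: "e \<in> carrier M" shows "ideal {a \<in> carrier R. a \<odot>\<^sub>M e = \<zero>\<^sub>M} R"
 by (rule idealI_comm) (use e in "auto simp: smult_l_distr smult_assoc1")

section \<open>Linear algebra over a subfield\<close>

text \<open>Vector spaces are subsets of one ambient commutative ring that contains the field. The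
  same linear algebra then serves \<open>R\<close>, its completion and the forcing algebra, with the
  image of the field in each.\<close>

locale cring_over = cring R for R (structure) +
 fixes k :: "'a set"
 assumes subfield: "subfield k R"
begin

lemma scal_closed [simp, intro]: "c \<in> k ==> c \<in> carrier R"
 using subfieldE(3)[OF subfield] by auto

lemma scal_ring: "\<zero> \<in> k" "\<one> \<in> k" "!!a b. a \<in> k ==> b \<in> k ==> a \<oplus> b \<in> k"
 "!!a b. a \<in> k ==> b \<in> k ==> a \<otimes> b \<in> k" "!!a. a \<in> k ==> \<ominus> a \<in> k"
 using subringE[OF subfieldE(1)[OF subfield]] by auto

lemma scal_inv: assumes "c \<in> k" "c ~= \<zero>" shows "inv c \<in> k" "c \<otimes> inv c = \<one>" "inv c \<otimes> c = \<one>"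
 using subfield_m_inv[OF subfield, of c] assms by auto

lemma scal_finsum: "(!!i. i \<in> I ==> f i \<in> k) ==> finsum R f I \<in> k"
proof (induction I rule: infinite_finite_induct)
 case (insert i I)
 then have "finsum R f (insert i I) = f i \<oplus> finsum R f I" by (intro finsum_insert) auto
 then show ?case using insert scal_ring by auto
qed (auto simp: scal_ring)

definition lin_sub :: "'a set => bool" where
 "lin_sub T \<longleftrightarrow> T <= carrier R & \<zero> \<in> T & (\<forall>x\<in>T. \<forall>y\<in>T. x \<oplus> y \<in> T) & (\<forall>c\<in>k. \<forall>x\<in>T. c \<otimes> x \<in> T)"

definition lin_span :: "'a set => 'a set" where
 "lin_span S = \<Inter>{T. lin_sub T & S <= T}"

lemma lin_subD:
 assumes "lin_sub T"
 shows "T <= carrier R" "\<zero> \<in> T" "!!x y. x \<in> T ==> y \<in> T ==> x \<oplus> y \<in> T"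
  "!!c x. c \<in> k ==> x \<in> T ==> c \<otimes> x \<in> T" "!!x. x \<in> T ==> x \<in> carrier R"
 using assms unfolding lin_sub_def by auto

lemma lin_sub_neg: assumes "lin_sub T" "x \<in> T" shows "\<ominus> x \<in> T"
proof -
 have "(\<ominus> \<one>) \<otimes> x \<in> T" using assms scal_ring lin_subD(4)[OF assms(1)] by auto
 then show ?thesis using lin_subD(5)[OF assms] by (simp add: l_minus)
qed

lemma lin_sub_minus: "lin_sub T ==> x \<in> T ==> y \<in> T ==> x \<ominus> y \<in> T"
 unfolding a_minus_def using lin_sub_neg lin_subD(3) by blast

lemma lin_sub_finsum: "lin_sub T ==> (!!i. i \<in> I ==> f i \<in> T) ==> finsum R f I \<in> T"
proof (induction I rule: infinite_finite_induct)
 case (insert i I)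
 then have "finsum R f (insert i I) = f i \<oplus> finsum R f I" using lin_subD(5) by (intro finsum_insert) auto
 then show ?case using insert lin_subD(3) by auto
qed (auto simp: lin_subD)

lemma ideal_lin_sub: assumes "ideal I R" shows "lin_sub I"
 unfolding lin_sub_def using assms
 by (auto simp: ideal.I_l_closed additive_subgroup.a_closed[OF ideal.axioms(1)]
   additive_subgroup.zero_closed[OF ideal.axioms(1)]
   dest: additive_subgroup.a_Hcarr[OF ideal.axioms(1)])

lemma lin_sub_carrier: "lin_sub (carrier R)"
 unfolding lin_sub_def by auto

lemma lin_sub_span: assumes "S <= carrier R" shows "lin_sub (lin_span S)"
proof -
 have "lin_span S <= carrier R" unfolding lin_span_def using lin_sub_carrier assms by blast
 then show ?thesis unfolding lin_sub_def lin_span_def by auto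
qed

lemma lin_span_base: "S <= lin_span S"
 unfolding lin_span_def by auto

lemma lin_span_least: "lin_sub T ==> S <= T ==> lin_span S <= T"
 unfolding lin_span_def by auto

lemma lin_span_mono: "S <= T ==> lin_span S <= lin_span T"
 unfolding lin_span_def by auto

lemma lin_sub_plus:
 assumes "lin_sub S" "lin_sub T" shows "lin_sub {s \<oplus> t | s t. s \<in> S & t \<in> T}"
proof -
 note S = lin_subD[OF assms(1)] and T = lin_subD[OF assms(2)]
 show ?thesis unfolding lin_sub_def
 proof (intro conjI ballI)
  show "{s \<oplus> t | s t. s \<in> S & t \<in> T} <= carrier R" using S(5) T(5) by auto
  show "\<zero> \<in> {s \<oplus> t | s t. s \<in> S & t \<in> T}" using S(2) T(2) l_zero[OF zero_closed] by force
 next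
  fix x y assume "x \<in> {s \<oplus> t | s t. s \<in> S & t \<in> T}" "y \<in> {s \<oplus> t | s t. s \<in> S & t \<in> T}"
  then obtain s t s' t' where *: "x = s \<oplus> t" "y = s' \<oplus> t'" "s \<in> S" "t \<in> T" "s' \<in> S" "t' \<in> T" by auto
  then have "x \<oplus> y = (s \<oplus> s') \<oplus> (t \<oplus> t')"
   using S(5) T(5) by (metis a_ac(1,2) a_closed a_lcomm)
  then show "x \<oplus> y \<in> {s \<oplus> t | s t. s \<in> S & t \<in> T}" using * S(3) T(3) by blast
 next
  fix c x assume "c \<in> k" "x \<in> {s \<oplus> t | s t. s \<in> S & t \<in> T}"
  then obtain s t where *: "x = s \<oplus> t" "s \<in> S" "t \<in> T" "c \<in> k" by auto
  then have "c \<otimes> x = c \<otimes> s \<oplus> c \<otimes> t" using S(5) T(5) by (simp add: r_distr)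
  then show "c \<otimes> x \<in> {s \<oplus> t | s t. s \<in> S & t \<in> T}" using * S(4) T(4) by blast
 qed
qed

lemma lin_sub_mult:
 assumes "lin_sub S" "g \<in> carrier R" shows "lin_sub ((%x. g \<otimes> x) ` S)"
proof -
 note S = lin_subD[OF assms(1)]
 show ?thesis unfolding lin_sub_def
 proof (intro conjI ballI)
  show "(\<otimes>) g ` S <= carrier R" using S(5) assms(2) by auto
  show "\<zero> \<in> (\<otimes>) g ` S" using S(2) assms(2) r_null by force
 next
  fix x y assume "x \<in> (\<otimes>) g ` S" "y \<in> (\<otimes>) g ` S"
  then obtain s t where *: "x = g \<otimes> s" "y = g \<otimes> t" "s \<in> S" "t \<in> S" by auto
  then have "x \<oplus> y = g \<otimes> (s \<oplus> t)" using S(5) assms(2) by (simp add: r_distr)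
  then show "x \<oplus> y \<in> (\<otimes>) g ` S" using * S(3) by blast
 next
  fix c x assume "c \<in> k" "x \<in> (\<otimes>) g ` S"
  then obtain s where *: "x = g \<otimes> s" "s \<in> S" "c \<in> k" by auto
  then have "c \<otimes> x = g \<otimes> (c \<otimes> s)" using S(5) assms(2) by (simp add: m_lcomm)
  then show "c \<otimes> x \<in> (\<otimes>) g ` S" using * S(4) by blast
 qed
qed

lemma lin_sub_vimage:
 assumes "lin_sub T" "g \<in> carrier R" shows "lin_sub {x \<in> carrier R. g \<otimes> x \<in> T}"
 unfolding lin_sub_def
proof (intro conjI ballI)
 fix c x assume "c \<in> k" "x \<in> {x \<in> carrier R. g \<otimes> x \<in> T}"
 moreover from this have "g \<otimes> (c \<otimes> x) = c \<otimes> (g \<otimes> x)" using assms(2) by (simp add: m_lcomm)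
 ultimately show "c \<otimes> x \<in> {x \<in> carrier R. g \<otimes> x \<in> T}" using lin_subD(4)[OF assms(1)] by auto
qed (use lin_subD[OF assms(1)] assms(2) in "auto simp: r_distr")

lemma lin_span_insert:
 assumes "W <= carrier R" "w \<in> carrier R" "x \<in> lin_span (insert w W)"
 shows "\<exists>c\<in>k. \<exists>q\<in>lin_span W. x = c \<otimes> w \<oplus> q"
proof -
 let ?T = "{s \<oplus> t | s t. s \<in> (%x. w \<otimes> x) ` k & t \<in> lin_span W}"
 have k: "lin_sub k" unfolding lin_sub_def using scal_ring by auto
 have T: "lin_sub ?T"
  by (rule lin_sub_plus[OF lin_sub_mult[OF k assms(2)] lin_sub_span[OF assms(1)]])
 have L: "lin_sub (lin_span W)" by (rule lin_sub_span[OF assms(1)])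
 have "w = w \<otimes> \<one> \<oplus> \<zero>" using assms(2) by simp
 moreover have "w \<otimes> \<one> \<in> (%x. w \<otimes> x) ` k" using scal_ring by blast
 ultimately have 1: "w \<in> ?T" using lin_subD(2)[OF L] by blast
 have "W <= ?T"
 proof
  fix y assume "y \<in> W"
  then have "y = w \<otimes> \<zero> \<oplus> y" "y \<in> lin_span W" using assms lin_span_base by auto
  moreover have "w \<otimes> \<zero> \<in> (%x. w \<otimes> x) ` k" using scal_ring by blast
  ultimately show "y \<in> ?T" by blast
 qed
 then have "x \<in> ?T" using lin_span_least[OF T, of "insert w W"] 1 assms(3) by auto
 then obtain c q where "c \<in> k" "q \<in> lin_span W" "x = w \<otimes> c \<oplus> q" by auto
 then show ?thesis using assms(2) by (metis m_comm scal_closed)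
qed

lemma ring_identities:
 assumes "a \<in> carrier R" "b \<in> carrier R" "c \<in> carrier R" "d \<in> carrier R" "e \<in> carrier R" "g \<in> carrier R"
 shows "(a \<oplus> b) \<ominus> (a \<oplus> c) = b \<ominus> c"
  and "(a \<oplus> b) \<otimes> c \<oplus> g \<otimes> (d \<oplus> e) = (a \<otimes> c \<oplus> g \<otimes> d) \<oplus> (b \<otimes> c \<oplus> g \<otimes> e)"
  and "a \<otimes> b \<otimes> c \<oplus> g \<otimes> (a \<otimes> d) = a \<otimes> (b \<otimes> c \<oplus> g \<otimes> d)"
  and "a \<otimes> (b \<otimes> c) \<oplus> g \<otimes> (c \<otimes> d) = c \<otimes> (a \<otimes> b \<oplus> g \<otimes> d)"
  and "c \<otimes> (d \<otimes> g \<otimes> e) = g \<otimes> (c \<otimes> (d \<otimes> e))"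
  and "(a \<otimes> b \<oplus> g \<otimes> c) \<otimes> d = g \<otimes> (c \<otimes> d) \<oplus> a \<otimes> (b \<otimes> d)"
 using assms by algebra+

text \<open>Gaussian elimination modulo the subspace \<open>S\<close>. Either no \<open>v i\<close>
  involves a chosen generator \<open>w\<close>, or one of them serves as a pivot, and eliminating
  \<open>w\<close> removes one vector and one generator. Carrying \<open>S\<close> along spares the
  formation of quotient spaces.\<close>

lemma linear_dependence:
 assumes "finite W" "W <= carrier R" "lin_sub S" "finite I" "card W < card I"
  "!!i. i \<in> I ==> v i \<in> lin_span (S \<union> W)"
 shows "\<exists>u. (\<forall>i\<in>I. u i \<in> k) & (\<exists>i\<in>I. u i ~= \<zero>) & (\<Oplus>i\<in>I. u i \<otimes> v i) \<in> S"
 using assms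
proof (induction W arbitrary: I v rule: finite_induct)
 case empty
 note S = lin_subD[OF empty(2)]
 have v: "v i \<in> S" if "i \<in> I" for i using empty that lin_span_least[OF empty(2), of S] by auto
 obtain i where "i \<in> I" using empty by fastforce
 \<comment> \<open>With no generators left, all \<open>v i\<close> lie in \<open>S\<close>, and the
   relation with all coefficients one will do.\<close>
 have "(\<Oplus>i\<in>I. \<one> \<otimes> v i) \<in> S" using lin_sub_finsum[OF empty(2), of I] v S scal_ring by simp
 then show ?case
 proof (cases "\<one> = \<zero>")
  case True
  then show ?thesis using subfieldE(6)[OF subfield] by simp
 next
  case False
  then show ?thesis using \<open>(\<Oplus>i\<in>I. \<one> \<otimes> v i) \<in> S\<close> \<open>i \<in> I\<close> scal_ring by (intro exI[of _ "%_. \<one>"]) auto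
 qed
next
 case (insert w W)
 note S = lin_subD[OF insert.prems(2)]
 have W: "W <= carrier R" "w \<in> carrier R" "S \<union> W <= carrier R" using insert.prems S by auto
 note L = lin_sub_span[OF W(3)]
 have "\<exists>c q. c \<in> k & q \<in> lin_span (S \<union> W) & v i = c \<otimes> w \<oplus> q" if "i \<in> I" for i
  using lin_span_insert[OF W(3,2), of "v i"] insert.prems(5)[OF that] by auto
 then obtain c q where cq: "!!i. i \<in> I ==> c i \<in> k & q i \<in> lin_span (S \<union> W) & v i = c i \<otimes> w \<oplus> q i"
  by metis
 have v: "v i \<in> carrier R" "q i \<in> carrier R" "c i \<in> carrier R" if "i \<in> I" for i
  using cq[OF that] W lin_subD(5)[OF L] by auto
 show ?case
 proof (cases "\<forall>i\<in>I. c i = \<zero>")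
  case True
  then have "v i \<in> lin_span (S \<union> W)" if "i \<in> I" for i using cq[OF that] v[OF that] W that by auto
  moreover have "card W < card I" using insert by simp
  ultimately show ?thesis using insert.IH W insert.prems by blast
 next
  case False
  then obtain j where j: "j \<in> I" "c j ~= \<zero>" by auto
  \<comment> \<open>The multiple of the pivot \<open>v j\<close> that cancels the coefficient of
    \<open>w\<close> in \<open>v i\<close>.\<close>
  define e where "e i = c i \<otimes> inv c j" for i
  define I' where "I' = I - {j}"
  note cj = scal_inv[OF conjunct1[OF cq[OF j(1)]] j(2)]
  have e: "e i \<in> k" if "i \<in> I" for i unfolding e_def using cq[OF that] cj scal_ring by auto
  define v' where "v' i = v i \<ominus> e i \<otimes> v j" for i
  have v'q: "v' i = q i \<ominus> e i \<otimes> q j" if i: "i \<in> I" for i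
  proof -
   note [simp] = v[OF i] v[OF j(1)] scal_closed[OF cj(1)] W(2)
   have "e i \<otimes> (c j \<otimes> w) = c i \<otimes> w"
    unfolding e_def using cj by (simp add: m_assoc) (simp flip: m_assoc)
   then have "v' i = (c i \<otimes> w \<oplus> q i) \<ominus> (c i \<otimes> w \<oplus> e i \<otimes> q j)"
    unfolding v'_def using cq[OF i] cq[OF j(1)] e[OF i] by (simp add: r_distr)
   also have "\<dots> = q i \<ominus> e i \<otimes> q j"
    using scal_closed[OF e[OF i]] by (intro ring_identities(1)) (auto intro!: m_closed)
   finally show ?thesis .
  qed
  have "v' i \<in> lin_span (S \<union> W)" if "i \<in> I'" for i
  proof -
   have i: "i \<in> I" using that I'_def by auto
   show ?thesis unfolding v'q[OF i]
    by (rule lin_sub_minus[OF L]) (use cq[OF i] cq[OF j(1)] e[OF i] lin_subD(4)[OF L] in auto)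
  qed
  moreover have "card W < card I'" using insert j unfolding I'_def by simp
  moreover have "finite I'" using insert.prems I'_def by auto
  ultimately obtain u where u: "\<forall>i\<in>I'. u i \<in> k" "\<exists>i\<in>I'. u i ~= \<zero>" "(\<Oplus>i\<in>I'. u i \<otimes> v' i) \<in> S"
   using insert.IH[OF W(1) insert.prems(2), of I' v'] by blast
  define s where "s = (\<Oplus>i\<in>I'. u i \<otimes> e i)"
  have I: "!!i. i \<in> I' ==> i \<in> I" "I = insert j I'" "j \<notin> I'" unfolding I'_def using j by auto
  have s: "s \<in> k" unfolding s_def using u e I by (auto intro!: scal_finsum scal_ring)
  \<comment> \<open>The pivot receives the negative of all the multiples of it that were
    subtracted.\<close>
  define u' where "u' i = (if i = j then \<ominus> s else u i)" for i
  have "(\<Oplus>i\<in>I'. u i \<otimes> v' i) = (\<Oplus>i\<in>I'. u i \<otimes> v i \<oplus> (\<ominus> v j) \<otimes> (u i \<otimes> e i))"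
  proof (rule finsum_cong', simp)
   fix i assume "i \<in> I'"
   then show "u i \<otimes> v' i = u i \<otimes> v i \<oplus> (\<ominus> v j) \<otimes> (u i \<otimes> e i)"
    unfolding v'_def using u e I v j scal_closed
    by (simp add: a_minus_def r_distr r_minus l_minus m_ac)
  qed (use u e I v j in auto)
  also have "\<dots> = (\<Oplus>i\<in>I'. u i \<otimes> v i) \<oplus> (\<Oplus>i\<in>I'. (\<ominus> v j) \<otimes> (u i \<otimes> e i))"
   by (rule finsum_addf) (use u e I v j in auto)
  also have "(\<Oplus>i\<in>I'. (\<ominus> v j) \<otimes> (u i \<otimes> e i)) = (\<ominus> v j) \<otimes> s"
   unfolding s_def by (rule finsum_rdistr[symmetric]) (use \<open>finite I'\<close> u e I v j in auto)
  also have "(\<Oplus>i\<in>I'. u i \<otimes> v i) = (\<Oplus>i\<in>I'. u' i \<otimes> v i)"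
   by (rule finsum_cong') (use u I v in "auto simp: u'_def")
  also have "(\<ominus> v j) \<otimes> s = u' j \<otimes> v j" unfolding u'_def using s v j by (simp add: l_minus r_minus m_comm)
  also have "(\<Oplus>i\<in>I'. u' i \<otimes> v i) \<oplus> u' j \<otimes> v j = (\<Oplus>i\<in>I. u' i \<otimes> v i)"
  proof -
   have "(\<Oplus>i\<in>I. u' i \<otimes> v i) = u' j \<otimes> v j \<oplus> (\<Oplus>i\<in>I'. u' i \<otimes> v i)"
    unfolding I(2) by (rule finsum_insert) (use \<open>finite I'\<close> I u s v j in "auto simp: u'_def")
   moreover have "u' j \<otimes> v j \<in> carrier R" "(\<Oplus>i\<in>I'. u' i \<otimes> v i) \<in> carrier R"
    using \<open>finite I'\<close> I u s v j by (auto simp: u'_def intro!: finsum_closed)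
   ultimately show ?thesis by (simp add: a_comm)
  qed
  finally have "(\<Oplus>i\<in>I. u' i \<otimes> v i) \<in> S" using u(3) by simp
  moreover have "\<forall>i\<in>I. u' i \<in> k" using u s I scal_ring unfolding u'_def by auto
  moreover have "\<exists>i\<in>I. u' i ~= \<zero>" using u(2) I unfolding u'_def by (metis)
  ultimately show ?thesis by blast
 qed
qed

text \<open>The form \<open>c\<^sub>0 z\<^sup>p + c\<^sub>1 g z\<^sup>p\<^sup>-\<^sup>1 + \<dots> + c\<^sub>p g\<^sup>p\<close>.\<close>

primrec hom_form :: "nat => (nat => 'a) => 'a => 'a => 'a" where
 "hom_form 0 c g z = c 0"
| "hom_form (Suc p) c g z = c 0 \<otimes> z [^] Suc p \<oplus> g \<otimes> hom_form p (%j. c (Suc j)) g z"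

lemma hom_form_closed [simp]:
 "g \<in> carrier R ==> z \<in> carrier R ==> (!!j. j <= p ==> c j \<in> carrier R) ==> hom_form p c g z \<in> carrier R"
 by (induction p arbitrary: c) auto

lemma hom_form_add:
 "g \<in> carrier R ==> z \<in> carrier R ==> (!!j. j <= p ==> c j \<in> carrier R) ==> (!!j. j <= p ==> b j \<in> carrier R) ==>
  hom_form p (%j. c j \<oplus> b j) g z = hom_form p c g z \<oplus> hom_form p b g z"
proof (induction p arbitrary: c b)
 case (Suc p)
 have "hom_form p (%j. c (Suc j)) g z \<in> carrier R" "hom_form p (%j. b (Suc j)) g z \<in> carrier R"
  "c 0 \<in> carrier R" "b 0 \<in> carrier R" "z [^] Suc p \<in> carrier R"
  using Suc.prems by auto
 note cl = this Suc.prems(1)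
 have *: "hom_form p (%j. c (Suc j) \<oplus> b (Suc j)) g z
   = hom_form p (%j. c (Suc j)) g z \<oplus> hom_form p (%j. b (Suc j)) g z"
  by (rule Suc.IH) (use Suc.prems in auto)
 show ?case unfolding hom_form.simps * by (rule ring_identities(2)) (rule cl)+
qed auto

lemma hom_form_smult:
 "g \<in> carrier R ==> z \<in> carrier R ==> (!!j. j <= p ==> c j \<in> carrier R) ==> l \<in> carrier R ==>
  hom_form p (%j. l \<otimes> c j) g z = l \<otimes> hom_form p c g z"
proof (induction p arbitrary: c)
 case (Suc p)
 have "hom_form p (%j. c (Suc j)) g z \<in> carrier R"
  "c 0 \<in> carrier R" "z [^] Suc p \<in> carrier R"
  using Suc.prems by auto
 note cl = this Suc.prems(1,4) zero_closed
 have *: "hom_form p (%j. l \<otimes> c (Suc j)) g z = l \<otimes> hom_form p (%j. c (Suc j)) g z"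
  by (rule Suc.IH) (use Suc.prems in auto)
 show ?case unfolding hom_form.simps * by (rule ring_identities(3)) (rule cl)+
qed auto

lemma hom_form_cong: "(!!j. j <= p ==> c j = b j) ==> hom_form p c g z = hom_form p b g z"
proof (induction p arbitrary: c b)
 case (Suc p)
 have "hom_form p (%j. c (Suc j)) g z = hom_form p (%j. b (Suc j)) g z"
  by (rule Suc.IH) (use Suc.prems in auto)
 then show ?case using Suc.prems[of 0] by simp
qed simp

text \<open>The root at infinity: a form without its pure power of \<open>g\<close> is divisible by
  \<open>z\<close>. Together with \<open>hom_form_division\<close> this gives a form of positive
  degree a linear factor over an algebraically closed field.\<close>

lemma hom_form_zero_top:
 "g \<in> carrier R ==> z \<in> carrier R ==> (!!j. j <= p ==> c j \<in> carrier R) ==> c (Suc p) = \<zero> ==>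
  hom_form (Suc p) c g z = z \<otimes> hom_form p c g z"
proof (induction p arbitrary: c)
 case 0 then show ?case by (simp add: m_comm)
next
 case (Suc p)
 have "hom_form p (%j. c (Suc j)) g z \<in> carrier R"
  "c 0 \<in> carrier R" "z [^] Suc p \<in> carrier R"
  using Suc.prems by auto
 note cl = this Suc.prems(1,2)
 have *: "hom_form (Suc p) (%j. c (Suc j)) g z = z \<otimes> hom_form p (%j. c (Suc j)) g z"
  by (rule Suc.IH) (use Suc.prems in auto)
 have "hom_form (Suc (Suc p)) c g z = c 0 \<otimes> (z [^] Suc p \<otimes> z) \<oplus> g \<otimes> (z \<otimes> hom_form p (%j. c (Suc j)) g z)"
  by (subst hom_form.simps(2)) (simp only: * nat_pow_Suc)
 also have "\<dots> = z \<otimes> (c 0 \<otimes> z [^] Suc p \<oplus> g \<otimes> hom_form p (%j. c (Suc j)) g z)"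
  by (rule ring_identities(4)) (rule cl zero_closed)+
 finally show ?case by (simp only: hom_form.simps(2))
qed

text \<open>Division by the linear form \<open>g \<ominus> l \<otimes> z\<close> by Horner's scheme;
  the remainder is the value at \<open>(l, 1)\<close> times a power of \<open>z\<close>, hence zero
  at a root \<open>l\<close>. The clause \<open>b p = c (Suc p)\<close> keeps the leading
  coefficient, so the quotient is nonzero when the top coefficient is.\<close>

lemma hom_form_division:
 assumes "g \<in> carrier R" "z \<in> carrier R" "l \<in> k"
 shows "(!!j. j <= Suc p ==> c j \<in> k) ==> \<exists>b. (\<forall>j\<le>p. b j \<in> k) & b p = c (Suc p) &
  hom_form (Suc p) c g z = (g \<ominus> l \<otimes> z) \<otimes> hom_form p b g z \<oplus> hom_form (Suc p) c l \<one> \<otimes> z [^] Suc p"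
proof (induction p arbitrary: c)
 case 0
 have "c 0 \<in> carrier R" "c 1 \<in> carrier R" "l \<in> carrier R" using 0 assms by auto
 then have "c 0 \<otimes> z \<oplus> g \<otimes> c 1 = (g \<ominus> l \<otimes> z) \<otimes> c 1 \<oplus> (c 0 \<oplus> l \<otimes> c 1) \<otimes> z"
  using assms by algebra
 then show ?case using 0 assms \<open>c 0 \<in> carrier R\<close> by (intro exI[of _ "%_. c 1"]) auto
next
 case (Suc p)
 obtain b where b: "\<forall>j\<le>p. b j \<in> k" "b p = c (Suc (Suc p))"
  "hom_form (Suc p) (%j. c (Suc j)) g z = (g \<ominus> l \<otimes> z) \<otimes> hom_form p b g z
   \<oplus> hom_form (Suc p) (%j. c (Suc j)) l \<one> \<otimes> z [^] Suc p"
  using Suc.IH[of "%j. c (Suc j)"] Suc.prems by auto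
 \<comment> \<open>Extended by zero, so that the old quotient can be read as a form of one degree
   more, which is a multiple of \<open>z\<close>.\<close>
 define b' where "b' j = (if j <= p then b j else \<zero>)" for j
 \<comment> \<open>Horner's recursion: these are the coefficients of the new quotient, namely the
   shifted \<open>c\<close> plus \<open>l\<close> times the old quotient.\<close>
 define e where "e j = c (Suc j) \<oplus> l \<otimes> b' j" for j
 have b': "b' j \<in> k" for j using b(1) scal_ring unfolding b'_def by auto
 have c: "c (Suc j) \<in> k" if "j <= Suc p" for j using Suc.prems that by auto
 have e: "e j \<in> k" if "j <= Suc p" for j unfolding e_def using b' c that scal_ring assms by auto
 have ep: "e (Suc p) = c (Suc (Suc p))" using c[of "Suc p"] assms unfolding e_def b'_def by simp
 let ?C = "hom_form (Suc p) (%j. c (Suc j)) g z" and ?B = "hom_form p b g z"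
  and ?E = "hom_form (Suc p) (%j. c (Suc j)) l \<one>" and ?Z = "z [^] Suc p"
 have cl: "?C \<in> carrier R" "?B \<in> carrier R" "?E \<in> carrier R" "?Z \<in> carrier R" "c 0 \<in> carrier R"
  "l \<in> carrier R"
  using assms b c Suc.prems by (auto simp del: hom_form.simps intro!: hom_form_closed)
 have "hom_form (Suc p) e g z = ?C \<oplus> hom_form (Suc p) (%j. l \<otimes> b' j) g z"
  unfolding e_def by (rule hom_form_add) (use assms b' c in auto)
 also have "hom_form (Suc p) (%j. l \<otimes> b' j) g z = l \<otimes> hom_form (Suc p) b' g z"
  by (rule hom_form_smult) (use assms b' in auto)
 also have "hom_form (Suc p) b' g z = z \<otimes> hom_form p b' g z"
  by (rule hom_form_zero_top) (use assms(1,2) scal_closed[OF b'] in \<open>simp_all add: b'_def[of "Suc p"]\<close>)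
 also have "hom_form p b' g z = ?B" by (rule hom_form_cong) (simp add: b'_def)
 finally have E: "hom_form (Suc p) e g z = ?C \<oplus> l \<otimes> (z \<otimes> ?B)" .
 have "hom_form (Suc (Suc p)) c g z = c 0 \<otimes> (?Z \<otimes> z) \<oplus> g \<otimes> ?C"
  "hom_form (Suc (Suc p)) c l \<one> = c 0 \<oplus> l \<otimes> ?E"
  using cl by (subst hom_form.simps(2), simp del: hom_form.simps)+
 moreover have "c 0 \<otimes> (?Z \<otimes> z) \<oplus> g \<otimes> ?C
  = (g \<ominus> l \<otimes> z) \<otimes> (?C \<oplus> l \<otimes> (z \<otimes> ?B)) \<oplus> (c 0 \<oplus> l \<otimes> ?E) \<otimes> (?Z \<otimes> z)"
 proof -
  have "c0 \<otimes> (Z \<otimes> z) \<oplus> g \<otimes> C = (g \<ominus> l \<otimes> z) \<otimes> (C \<oplus> l \<otimes> (z \<otimes> B)) \<oplus> (c0 \<oplus> l \<otimes> E) \<otimes> (Z \<otimes> z)"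
   if "C = (g \<ominus> l \<otimes> z) \<otimes> B \<oplus> E \<otimes> Z" "B \<in> carrier R" "E \<in> carrier R" "Z \<in> carrier R" "c0 \<in> carrier R"
    "l \<in> carrier R" for C B E Z c0
   using that(2-6) assms unfolding that(1) by algebra
  then show ?thesis using b(3) cl by blast
 qed
 moreover have "?Z \<otimes> z = z [^] Suc (Suc p)" by simp
 ultimately show ?case using e ep E by (metis)
qed

lemma hom_form_finsum:
 "g \<in> carrier R ==> z \<in> carrier R ==> (!!j. j <= p ==> c j \<in> carrier R) ==> w \<in> carrier R ==>
  hom_form p c g z \<otimes> w = (\<Oplus>j\<in>{..p}. c j \<otimes> (g [^] j \<otimes> (z [^] (p - j) \<otimes> w)))"
proof (induction p arbitrary: c)
 case (Suc p)
 let ?f = "%j. c j \<otimes> (g [^] j \<otimes> (z [^] (Suc p - j) \<otimes> w))"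
 have cl: "hom_form p (%j. c (Suc j)) g z \<in> carrier R" "c 0 \<in> carrier R" "z [^] Suc p \<in> carrier R"
  using Suc.prems by auto
 have "(\<Oplus>j\<in>{..Suc p}. ?f j) = (\<Oplus>j\<in>{..p}. ?f (Suc j)) \<oplus> ?f 0"
  by (rule finsum_Suc2) (use Suc.prems in auto)
 also have "(\<Oplus>j\<in>{..p}. ?f (Suc j)) = (\<Oplus>j\<in>{..p}. g \<otimes> (c (Suc j) \<otimes> (g [^] j \<otimes> (z [^] (p - j) \<otimes> w))))"
 proof (rule finsum_cong', simp)
  fix j assume "j \<in> {..p}"
  then have "c (Suc j) \<in> carrier R" "g [^] j \<in> carrier R" "z [^] (p - j) \<otimes> w \<in> carrier R" using Suc.prems by auto
  then have "c (Suc j) \<otimes> (g [^] j \<otimes> g \<otimes> (z [^] (p - j) \<otimes> w)) = g \<otimes> (c (Suc j) \<otimes> (g [^] j \<otimes> (z [^] (p - j) \<otimes> w)))"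
   using Suc.prems(1) by (intro ring_identities(5)[OF zero_closed zero_closed])
  then show "?f (Suc j) = g \<otimes> (c (Suc j) \<otimes> (g [^] j \<otimes> (z [^] (p - j) \<otimes> w)))" by simp
 qed (use Suc.prems in auto)
 also have "\<dots> = g \<otimes> (\<Oplus>j\<in>{..p}. (c (Suc j) \<otimes> (g [^] j \<otimes> (z [^] (p - j) \<otimes> w))))"
  by (rule finsum_rdistr[symmetric]) (use Suc.prems in auto)
 also have "(\<Oplus>j\<in>{..p}. (c (Suc j) \<otimes> (g [^] j \<otimes> (z [^] (p - j) \<otimes> w)))) = hom_form p (%j. c (Suc j)) g z \<otimes> w"
  by (rule Suc.IH[symmetric]) (use Suc.prems in auto)
 finally have "(\<Oplus>j\<in>{..Suc p}. ?f j) = g \<otimes> (hom_form p (%j. c (Suc j)) g z \<otimes> w) \<oplus> c 0 \<otimes> (z [^] Suc p \<otimes> w)"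
  using Suc.prems cl by simp
 moreover have "(c 0 \<otimes> z [^] Suc p \<oplus> g \<otimes> hom_form p (%j. c (Suc j)) g z) \<otimes> w = g \<otimes> (hom_form p (%j. c (Suc j)) g z \<otimes> w) \<oplus> c 0 \<otimes> (z [^] Suc p \<otimes> w)"
  by (rule ring_identities(6)[OF cl(2,3,1) _ zero_closed]) (rule Suc.prems)+
 ultimately show ?case unfolding hom_form.simps by (simp only:)
qed simp

end

section \<open>Pencils of linear maps over an algebraically closed field\<close>

text \<open>Setting \<open>z = \<one>\<close> turns a form into a polynomial in \<open>l\<close>
  with ascending coefficients; the assumption is a root for each polynomial of positive
  degree.\<close>

locale alg_closed_over = cring_over +
 assumes root: "!!p c. (!!j. j <= Suc p ==> c j \<in> k) ==> c (Suc p) ~= \<zero> ==> \<exists>l\<in>k. hom_form (Suc p) c l \<one> = \<zero>"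
begin

lemma hom_form_stable:
 assumes "g \<in> carrier R" "z \<in> carrier R" "!!n. lin_sub (S n)"
  "!!n s. s \<in> S n ==> g \<otimes> s \<in> S (Suc n)" "!!n s. s \<in> S n ==> z \<otimes> s \<in> S (Suc n)"
 shows "(!!j. j <= p ==> c j \<in> k) ==> s \<in> S n ==> hom_form p c g z \<otimes> s \<in> S (n + p)"
proof (induction p arbitrary: c n s)
 case 0 then show ?case using lin_subD(4)[OF assms(3)] by simp
next
 case (Suc p)
 have pw: "z [^] m \<otimes> t \<in> S (n + m)" if "t \<in> S n" for m t n
 proof (induction m)
  case 0 then show ?case using that lin_subD(5)[OF assms(3) that] by simp
 next
  case (Suc m)
  have "z [^] Suc m \<otimes> t = z \<otimes> (z [^] m \<otimes> t)"
   using assms(2) lin_subD(5)[OF assms(3) that] by (simp add: m_ac)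
  then show ?case using assms(5)[OF Suc] by simp
 qed
 have s: "s \<in> carrier R" using lin_subD(5)[OF assms(3) Suc.prems(2)] .
 have 1: "hom_form p (%j. c (Suc j)) g z \<otimes> s \<in> S (n + p)" by (rule Suc.IH) (use Suc.prems in auto)
 have "hom_form (Suc p) c g z \<otimes> s
   = c 0 \<otimes> (z [^] Suc p \<otimes> s) \<oplus> g \<otimes> (hom_form p (%j. c (Suc j)) g z \<otimes> s)"
 proof -
  have "hom_form p (%j. c (Suc j)) g z \<in> carrier R" "c 0 \<in> carrier R" "z [^] Suc p \<in> carrier R"
   using assms Suc.prems by auto
  then show ?thesis unfolding hom_form.simps using s assms(1)
   by (simp del: nat_pow_Suc add: l_distr m_assoc)
 qed
 moreover have "c 0 \<otimes> (z [^] Suc p \<otimes> s) \<in> S (n + Suc p)"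
  using pw[OF Suc.prems(2), of "Suc p"] Suc.prems(1)[of 0] lin_subD(4)[OF assms(3)] by blast
 moreover have "g \<otimes> (hom_form p (%j. c (Suc j)) g z \<otimes> s) \<in> S (n + Suc p)"
  using assms(4)[OF 1] by simp
 ultimately show ?case using lin_subD(3)[OF assms(3)] by simp
qed

text \<open>A nonzero form in \<open>g\<close> and \<open>z\<close> splits into linear factors; each factor is eventually
 surjective modulo \<open>S\<close> and can therefore be cancelled.\<close>

lemma hom_form_cancel:
 assumes gz: "g \<in> carrier R" "z \<in> carrier R" "M \<in> carrier R"
  and S: "!!n. lin_sub (S n)" "!!n s. s \<in> S n ==> g \<otimes> s \<in> S (Suc n)" "!!n s. s \<in> S n ==> z \<otimes> s \<in> S (Suc n)"
  and M: "!!n s. s \<in> S n ==> M \<otimes> s \<in> S (n + e)"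
  and Q: "!!n. Q n <= carrier R"
  and surj: "!!y. y = z \<or> (\<exists>l\<in>k. y = g \<ominus> l \<otimes> z) ==>
   \<exists>n0. \<forall>n\<ge>n0. Q (Suc n) <= {y \<otimes> q \<oplus> s | q s. q \<in> Q n & s \<in> S (Suc n)}"
 shows "(!!j. j <= p ==> c j \<in> k) ==> \<exists>j\<le>p. c j ~= \<zero> ==>
  \<forall>n\<ge>n0. \<forall>q\<in>Q n. M \<otimes> (hom_form p c g z \<otimes> q) \<in> S (n + p + e) ==>
  \<exists>n0. \<forall>n\<ge>n0. \<forall>q\<in>Q n. M \<otimes> q \<in> S (n + e)"
proof (induction p arbitrary: c n0)
 case 0
 have "M \<otimes> q \<in> S (n + e)" if "n \<ge> n0" "q \<in> Q n" for n q
 proof -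
  have c: "c 0 \<in> k" "c 0 ~= \<zero>" using 0 by auto
  have q: "q \<in> carrier R" using Q that by auto
  have "M \<otimes> (c 0 \<otimes> q) \<in> S (n + e)" using 0 that by auto
  then have "inv (c 0) \<otimes> (M \<otimes> (c 0 \<otimes> q)) \<in> S (n + e)" using lin_subD(4)[OF S(1)] scal_inv[OF c] by auto
  moreover have "inv (c 0) \<otimes> (M \<otimes> (c 0 \<otimes> q)) = (inv (c 0) \<otimes> c 0) \<otimes> (M \<otimes> q)"
   using scal_inv(1)[OF c] c q gz by (simp add: m_ac)
  ultimately show ?thesis using scal_inv(3)[OF c] q gz by simp
 qed
 then show ?case by blast
next
 case (Suc p)
 \<comment> \<open>The linear factor is \<open>z\<close> when the top coefficient vanishes, and
   \<open>g \<ominus> l \<otimes> z\<close> for a root \<open>l\<close> otherwise.\<close>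
 obtain y b where yb: "y = z \<or> (\<exists>l\<in>k. y = g \<ominus> l \<otimes> z)" "\<forall>j\<le>p. b j \<in> k" "\<exists>j\<le>p. b j ~= \<zero>"
  "hom_form (Suc p) c g z = y \<otimes> hom_form p b g z"
 proof (cases "c (Suc p) = \<zero>")
  case True
  have "hom_form (Suc p) c g z = z \<otimes> hom_form p c g z"
   by (rule hom_form_zero_top) (use gz Suc.prems True in auto)
  moreover have "\<exists>j\<le>p. c j ~= \<zero>" using Suc.prems(2) True le_Suc_eq by blast
  ultimately show ?thesis using that[of z c] Suc.prems by auto
 next
  case False
  obtain l where l: "l \<in> k" "hom_form (Suc p) c l \<one> = \<zero>" using root[of p c] Suc.prems(1) False by blast
  obtain b where "\<forall>j\<le>p. b j \<in> k" "b p = c (Suc p)"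
   "hom_form (Suc p) c g z = (g \<ominus> l \<otimes> z) \<otimes> hom_form p b g z \<oplus> hom_form (Suc p) c l \<one> \<otimes> z [^] Suc p"
   using hom_form_division[OF gz(1,2) l(1), of p c] Suc.prems(1) by blast
  moreover from this l have "hom_form (Suc p) c g z = (g \<ominus> l \<otimes> z) \<otimes> hom_form p b g z"
   using gz by (simp del: hom_form.simps)
  moreover from calculation have "\<exists>j\<le>p. b j ~= \<zero>" using False by auto
  ultimately show ?thesis using that[of "g \<ominus> l \<otimes> z" b] l(1) by blast
 qed
 have y: "y \<in> carrier R" using yb(1) gz by auto
 have hb: "hom_form p b g z \<in> carrier R" using gz yb by auto
 obtain n1 where n1: "\<forall>n\<ge>n1. Q (Suc n) <= {y \<otimes> q \<oplus> s | q s. q \<in> Q n & s \<in> S (Suc n)}" using surj[OF yb(1)] by blast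
 \<comment> \<open>Surjectivity writes \<open>q\<close> as \<open>y \<otimes> q' \<oplus> s\<close>.
   The factor \<open>y\<close> restores the full form on \<open>q'\<close>, which lies one step
   lower, and the term of \<open>s\<close> stays in \<open>S\<close>.\<close>
 have "M \<otimes> (hom_form p b g z \<otimes> q) \<in> S (n + p + e)" if n: "n \<ge> Suc (max n0 n1)" and q: "q \<in> Q n" for n q
 proof -
  obtain m where m: "n = Suc m" "m \<ge> n0" "m \<ge> n1" using n by (cases n) auto
  obtain q' s where qs: "q = y \<otimes> q' \<oplus> s" "q' \<in> Q m" "s \<in> S n" using n1 m q by blast
  have c: "q' \<in> carrier R" "s \<in> carrier R" using Q qs lin_subD(5)[OF S(1)] by auto
  have "M \<otimes> (hom_form p b g z \<otimes> (y \<otimes> q' \<oplus> s)) = M \<otimes> (y \<otimes> hom_form p b g z \<otimes> q') \<oplus> M \<otimes> (hom_form p b g z \<otimes> s)"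
   using c hb y gz by (simp add: r_distr m_ac)
  moreover have "M \<otimes> (y \<otimes> hom_form p b g z \<otimes> q') \<in> S (n + p + e)"
   using Suc.prems(3) m qs yb(4) by (metis add_Suc_right add_Suc)
  moreover have "M \<otimes> (hom_form p b g z \<otimes> s) \<in> S (n + p + e)"
   by (rule M, rule hom_form_stable) (use gz S yb qs in auto)
  ultimately show ?thesis using qs(1) lin_subD(3)[OF S(1)] by simp
 qed
 then show ?case using Suc.IH[of b "Suc (max n0 n1)"] yb by blast
qed

text \<open>Here \<open>g\<close> and \<open>z\<close> act as maps
  \<open>Q n / S n \<rightarrow> Q (n + 1) / S (n + 1)\<close>, and \<open>z\<close> is onto from
  \<open>n0\<close> on. What is sought is an eigenvalue of \<open>g\<close> relative to
  \<open>z\<close>, expressed by failure of surjectivity at arbitrarily large \<open>n\<close>. If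
  there were none, all linear factors would be eventually onto. A count of dimensions kills each
  generator by a form in \<open>g\<close> and \<open>z\<close>, the product of these forms kills
  everything, and cancelling it factor by factor leaves \<open>Q n \<subseteq> S n\<close>, against
  \<open>proper\<close>.\<close>

lemma exists_eigenvalue:
 assumes gz: "g \<in> carrier R" "z \<in> carrier R"
  and S: "!!n. lin_sub (S n)" "!!n s. s \<in> S n ==> g \<otimes> s \<in> S (Suc n)" "!!n s. s \<in> S n ==> z \<otimes> s \<in> S (Suc n)"
  and Q: "!!n. Q n <= carrier R" "!!n q. q \<in> Q n ==> g \<otimes> q \<in> Q (Suc n)" "!!n q. q \<in> Q n ==> z \<otimes> q \<in> Q (Suc n)"
  and W: "finite W" "W <= Q n0" "Q n0 <= lin_span (S n0 \<union> W)"
  and surj: "\<forall>n\<ge>n0. Q (Suc n) <= {z \<otimes> q \<oplus> s | q s. q \<in> Q n & s \<in> S (Suc n)}"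
  and proper: "!!n. \<not> Q n <= S n"
 shows "\<exists>l\<in>k. \<forall>n0. \<exists>n\<ge>n0. \<not> Q (Suc n) <= {(g \<ominus> l \<otimes> z) \<otimes> q \<oplus> s | q s. q \<in> Q n & s \<in> S (Suc n)}"
proof (rule ccontr)
 assume "\<not> ?thesis"
 then have sl: "\<exists>n0. \<forall>n\<ge>n0. Q (Suc n) <= {(g \<ominus> l \<otimes> z) \<otimes> q \<oplus> s | q s. q \<in> Q n & s \<in> S (Suc n)}"
  if "l \<in> k" for l
  using that by blast
 have sy: "\<exists>n0. \<forall>n\<ge>n0. Q (Suc n) <= {y \<otimes> q \<oplus> s | q s. q \<in> Q n & s \<in> S (Suc n)}"
  if "y = z \<or> (\<exists>l\<in>k. y = g \<ominus> l \<otimes> z)" for y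
  using that sl surj by blast
 have Sc: "s \<in> carrier R" if "s \<in> S n" for s n using lin_subD(5)[OF S(1) that] .
 have zS: "z [^] m \<otimes> t \<in> S (n + m)" if "t \<in> S n" for m t n
 proof (induction m)
  case 0 then show ?case using that Sc[OF that] by simp
 next
  case (Suc m)
  have "z [^] Suc m \<otimes> t = z \<otimes> (z [^] m \<otimes> t)" using gz Sc[OF that] by (simp add: m_ac)
  then show ?case using S(3)[OF Suc] by simp
 qed
 have zQ: "z [^] m \<otimes> t \<in> Q (n + m)" if "t \<in> Q n" for m t n
 proof (induction m)
  case 0 then show ?case using that subsetD[OF Q(1) that] by simp
 next
  case (Suc m)
  have "t \<in> carrier R" using that Q by auto
  then have "z [^] Suc m \<otimes> t = z \<otimes> (z [^] m \<otimes> t)" using gz by (simp add: m_ac)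
  then show ?case using Q(3)[OF Suc] by simp
 qed
 have gQ: "g [^] m \<otimes> t \<in> Q (n + m)" if "t \<in> Q n" for m t n
 proof (induction m)
  case 0 then show ?case using that subsetD[OF Q(1) that] by simp
 next
  case (Suc m)
  have "t \<in> carrier R" using that Q by auto
  then have "g [^] Suc m \<otimes> t = g \<otimes> (g [^] m \<otimes> t)" using gz by (simp add: m_ac)
  then show ?case using Q(2)[OF Suc] by simp
 qed
 have zsur: "\<exists>q0\<in>Q n0. \<exists>s\<in>S (n0 + m). q = z [^] m \<otimes> q0 \<oplus> s" if "q \<in> Q (n0 + m)" for m q
  using that
 proof (induction m arbitrary: q)
  case 0
  then have "q \<in> carrier R" using Q by auto
  then have "q = z [^] (0::nat) \<otimes> q \<oplus> \<zero>" by simp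
  then show ?case using 0 lin_subD(2)[OF S(1)] by (metis add.right_neutral)
 next
  case (Suc m)
  obtain q' s where "q = z \<otimes> q' \<oplus> s" "q' \<in> Q (n0 + m)" "s \<in> S (Suc (n0 + m))"
  proof -
   have "Q (Suc (n0 + m)) <= {z \<otimes> q \<oplus> s | q s. q \<in> Q (n0 + m) & s \<in> S (Suc (n0 + m))}" using surj by simp
   then show ?thesis using Suc.prems that by (simp only: add_Suc_right) blast
  qed
  moreover obtain q0 s' where "q0 \<in> Q n0" "s' \<in> S (n0 + m)" "q' = z [^] m \<otimes> q0 \<oplus> s'"
   using Suc.IH[OF calculation(2)] by blast
  moreover from calculation have "q0 \<in> carrier R" "s' \<in> carrier R" "s \<in> carrier R" using Q Sc by auto
  ultimately have "q = z [^] Suc m \<otimes> q0 \<oplus> (z \<otimes> s' \<oplus> s)" using gz by (simp add: r_distr m_ac a_assoc)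
  moreover have "z \<otimes> s' \<oplus> s \<in> S (n0 + Suc m)"
   using lin_subD(3)[OF S(1)] S(3) \<open>s' \<in> S (n0 + m)\<close> \<open>s \<in> S (Suc (n0 + m))\<close> by simp
  ultimately show ?case using \<open>q0 \<in> Q n0\<close> by blast
 qed
 \<comment> \<open>The \<open>p + 1\<close> monomials of degree \<open>p\<close> applied to a
   generator lie in a space spanned by at most \<open>p\<close> elements modulo
   \<open>S (n0 + p)\<close>, since \<open>z [^] p\<close> is onto there.\<close>
 define p where "p = card W"
 have Wc: "W <= carrier R" using W Q by blast
 have span: "Q (n0 + p) <= lin_span (S (n0 + p) \<union> (%x. z [^] p \<otimes> x) ` W)" (is "_ <= lin_span ?U")
 proof
  fix q assume "q \<in> Q (n0 + p)"
  then obtain q0 s where q: "q0 \<in> Q n0" "s \<in> S (n0 + p)" "q = z [^] p \<otimes> q0 \<oplus> s" using zsur by blast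
  have U: "?U <= carrier R" using Sc Wc gz by auto
  have "lin_span (S n0 \<union> W) <= {x \<in> carrier R. z [^] p \<otimes> x \<in> lin_span ?U}"
  proof (rule lin_span_least)
   show "lin_sub {x \<in> carrier R. z [^] p \<otimes> x \<in> lin_span ?U}" by (rule lin_sub_vimage[OF lin_sub_span[OF U]]) (use gz in auto)
   show "S n0 \<union> W <= {x \<in> carrier R. z [^] p \<otimes> x \<in> lin_span ?U}" using Sc Wc zS lin_span_base[of ?U] by auto
  qed
  then have "z [^] p \<otimes> q0 \<in> lin_span ?U" using q W(3) by blast
  moreover have "s \<in> lin_span ?U" using q lin_span_base[of ?U] by auto
  ultimately show "q \<in> lin_span ?U" unfolding q(3) using lin_subD(3)[OF lin_sub_span[OF U]] by blast
 qed
 have "\<exists>u. (\<forall>j\<le>p. u j \<in> k) & (\<exists>j\<le>p. u j ~= \<zero>) & hom_form p u g z \<otimes> w \<in> S (n0 + p)" if w: "w \<in> W" for w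
 proof -
  have wQ: "w \<in> Q n0" "w \<in> carrier R" using w W Q by auto
  have "\<exists>u. (\<forall>j\<in>{..p}. u j \<in> k) & (\<exists>j\<in>{..p}. u j ~= \<zero>) &
   (\<Oplus>j\<in>{..p}. u j \<otimes> (g [^] j \<otimes> (z [^] (p - j) \<otimes> w))) \<in> S (n0 + p)"
  proof (rule linear_dependence[where W = "(%x. z [^] p \<otimes> x) ` W"])
   show "card ((%x. z [^] p \<otimes> x) ` W) < card {..p}" using card_image_le[OF W(1), of "%x. z [^] p \<otimes> x"] unfolding p_def by (simp add: le_imp_less_Suc)
   fix j assume "j \<in> {..p}"
   then have "g [^] j \<otimes> (z [^] (p - j) \<otimes> w) \<in> Q (n0 + (p - j) + j)" "n0 + (p - j) + j = n0 + p"
    using gQ[OF zQ[OF wQ(1)], of j "p - j"] by auto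
   then show "g [^] j \<otimes> (z [^] (p - j) \<otimes> w) \<in> lin_span ?U" using span by auto
  qed (use W Wc gz S in auto)
  then obtain u where u: "\<forall>j\<le>p. u j \<in> k" "\<exists>j\<le>p. u j ~= \<zero>"
   "(\<Oplus>j\<in>{..p}. u j \<otimes> (g [^] j \<otimes> (z [^] (p - j) \<otimes> w))) \<in> S (n0 + p)" by auto
  moreover have "hom_form p u g z \<otimes> w = (\<Oplus>j\<in>{..p}. u j \<otimes> (g [^] j \<otimes> (z [^] (p - j) \<otimes> w)))"
   by (rule hom_form_finsum) (use gz wQ u in auto)
  ultimately show ?thesis by auto
 qed
 then obtain u where u: "!!w. w \<in> W ==> (\<forall>j\<le>p. u w j \<in> k) & (\<exists>j\<le>p. u w j ~= \<zero>) & hom_form p (u w) g z \<otimes> w \<in> S (n0 + p)"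
  by metis
 define h where "h w = hom_form p (u w) g z" for w
 have h: "h w \<in> carrier R" "s \<in> S n ==> h w \<otimes> s \<in> S (n + p)" if "w \<in> W" for w s n
  unfolding h_def using u[OF that] gz hom_form_stable[where S = S, OF gz S, where c = "u w" and p = p] by auto
 \<comment> \<open>The product of the annihilating forms of the generators in \<open>ws\<close>,
   each of degree \<open>p\<close>.\<close>
 define P where "P ws = foldr (%w a. h w \<otimes> a) ws \<one>" for ws
 have P: "P ws \<in> carrier R & (\<forall>n. \<forall>s\<in>S n. P ws \<otimes> s \<in> S (n + p * length ws))" if "set ws <= W" for ws
  using that
 proof (induction ws)
  case Nil then show ?case using Sc by (auto simp: P_def)
 next
  case (Cons w ws)
  have "P (w # ws) \<otimes> s \<in> S (n + p * length (w # ws))" if "s \<in> S n" for n s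
  proof -
   have "P (w # ws) \<otimes> s = h w \<otimes> (P ws \<otimes> s)" using Cons h Sc[OF that] by (simp add: P_def m_assoc)
   moreover have "h w \<otimes> (P ws \<otimes> s) \<in> S (n + p * length ws + p)" using h Cons that by auto
   ultimately show ?thesis by (simp add: algebra_simps)
  qed
  then show ?case using Cons h by (auto simp: P_def)
 qed
 have Pkill: "P ws \<otimes> w \<in> S (n0 + p * length ws)" if "set ws <= W" "w \<in> set ws" for ws w
  using that
 proof (induction ws)
  case (Cons v ws)
  have vw: "v \<in> W" "set ws <= W" "w \<in> carrier R" "w \<in> W" using Cons Wc by auto
  have e: "P (v # ws) = h v \<otimes> P ws" by (simp add: P_def)
  show ?case
  proof (cases "w \<in> set ws")
   case True
   then have "h v \<otimes> (P ws \<otimes> w) \<in> S (n0 + p * length ws + p)" using Cons h vw by auto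
   moreover have "h v \<otimes> (P ws \<otimes> w) = P (v # ws) \<otimes> w" unfolding e using P[OF vw(2)] h vw by (simp add: m_assoc)
   ultimately show ?thesis by (simp add: algebra_simps)
  next
   case False
   then have "w = v" using Cons by auto
   then have "P ws \<otimes> (h v \<otimes> w) \<in> S (n0 + p + p * length ws)" using P[OF vw(2)] u[OF vw(1)] unfolding h_def by blast
   moreover have "P ws \<otimes> (h v \<otimes> w) = P (v # ws) \<otimes> w" unfolding e using P[OF vw(2)] h vw by (simp add: m_ac)
   ultimately show ?thesis by (simp add: algebra_simps)
  qed
 qed simp
 have cancel: "\<exists>n1. \<forall>n\<ge>n1. Q n <= S n" if "set ws <= W" "\<exists>n1. \<forall>n\<ge>n1. \<forall>q\<in>Q n. P ws \<otimes> q \<in> S (n + p * length ws)" for ws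
  using that
 proof (induction ws)
  case Nil
  then obtain n1 where "\<forall>n\<ge>n1. \<forall>q\<in>Q n. \<one> \<otimes> q \<in> S n" by (auto simp: P_def)
  then have "\<forall>n\<ge>n1. Q n <= S n" using Q(1) by (metis l_one subset_iff)
  then show ?case by blast
 next
  case (Cons v ws)
  have vw: "v \<in> W" "set ws <= W" using Cons by auto
  obtain n1 where n1: "\<forall>n\<ge>n1. \<forall>q\<in>Q n. P (v # ws) \<otimes> q \<in> S (n + p * length (v # ws))" using Cons by blast
  have "\<exists>n0. \<forall>n\<ge>n0. \<forall>q\<in>Q n. P ws \<otimes> q \<in> S (n + p * length ws)"
  proof (rule hom_form_cancel[where p = p and c = "u v", OF gz _ S _ Q(1) sy])
   show "\<forall>n\<ge>n1. \<forall>q\<in>Q n. P ws \<otimes> (hom_form p (u v) g z \<otimes> q) \<in> S (n + p + p * length ws)"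
   proof (intro allI impI ballI)
    fix n q assume n: "n1 <= n" "q \<in> Q n"
    then have "P (v # ws) \<otimes> q \<in> S (n + p * length (v # ws))" using n1 by blast
    moreover have "P ws \<otimes> (h v \<otimes> q) = P (v # ws) \<otimes> q"
     using P[OF vw(2)] h(1)[OF vw(1)] subsetD[OF Q(1) n(2)] by (simp add: P_def m_ac)
    ultimately show "P ws \<otimes> (hom_form p (u v) g z \<otimes> q) \<in> S (n + p + p * length ws)"
     unfolding h_def by (simp add: algebra_simps)
   qed
  qed (use P[OF vw(2)] u[OF vw(1)] in auto)
  then show ?case using Cons vw by blast
 qed
 obtain ws where ws: "set ws = W" using finite_list[OF W(1)] by blast
 \<comment> \<open>Modulo \<open>S\<close>, every \<open>q\<close> is a power of \<open>z\<close>
   times an element of \<open>Q n0\<close>, so killing the generators kills all later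
   \<open>Q n\<close>.\<close>
 have "P ws \<otimes> q \<in> S (n + p * length ws)" if n: "n \<ge> n0" "q \<in> Q n" for n q
 proof -
  obtain m where m: "n = n0 + m" using n(1) le_Suc_ex by blast
  obtain q0 s where q: "q0 \<in> Q n0" "s \<in> S n" "q = z [^] m \<otimes> q0 \<oplus> s" using zsur n m by blast
  have Pc: "P ws \<in> carrier R" "!!n s. s \<in> S n ==> P ws \<otimes> s \<in> S (n + p * length ws)" using P[of ws] ws by auto
  have "lin_span (S n0 \<union> W) <= {x \<in> carrier R. P ws \<otimes> x \<in> S (n0 + p * length ws)}"
   by (rule lin_span_least[OF lin_sub_vimage[OF S(1) Pc(1)]]) (use Pc Sc Wc Pkill[of ws] ws in auto)
  then have "P ws \<otimes> q0 \<in> S (n0 + p * length ws)" using q W by blast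
  then have "z [^] m \<otimes> (P ws \<otimes> q0) \<in> S (n0 + p * length ws + m)" by (rule zS)
  moreover have "P ws \<otimes> s \<in> S (n + p * length ws)" using Pc q by blast
  moreover have "P ws \<otimes> q = z [^] m \<otimes> (P ws \<otimes> q0) \<oplus> P ws \<otimes> s"
   using q Q(1)[of n0] Sc[OF q(2)] gz Pc by (auto simp: r_distr m_ac)
  ultimately show ?thesis using lin_subD(3)[OF S(1)] m by (simp add: algebra_simps)
 qed
 then show False using cancel[of ws] ws proper by blast
qed

text \<open>The multipliers lead out of the span of \<open>W\<close>, so they act between the spans
  \<open>Q n\<close> of all products of \<open>n\<close> multipliers with \<open>W\<close>. The
  ideal \<open>Z\<close> is enlarged to a stable sequence \<open>S\<close> that contains no
  \<open>Q n\<close> entirely and modulo which each \<open>\<tau> j\<close> acts as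
  \<open>\<mu> j\<close> times a single multiplier \<open>z\<close>. If every \<open>w\<close> were
  solvable for this \<mu>, then \<open>z \<otimes> w\<close> would be congruent to the sum of the
  \<open>\<tau> j \<otimes> v j\<close>, hence to zero, and \<open>Q 1\<close> would lie in
  \<open>S 1\<close>.\<close>

theorem pencil_eigenvector:
 fixes \<tau> :: "nat => 'a" and N :: nat
 assumes Z: "ideal Z R" and W: "finite W" "W <= carrier R" "\<not> W <= Z"
  and t: "!!j. j <= N ==> \<tau> j \<in> carrier R" "\<tau> 0 = \<one>"
 shows "\<exists>\<mu>. (\<forall>j\<le>N. \<mu> j \<in> k) & (\<exists>j\<le>N. \<mu> j ~= \<zero>) &
  \<not> (\<forall>w\<in>W. \<exists>v. (\<forall>j\<le>N. v j \<in> lin_span W) & w \<ominus> (\<Oplus>j\<in>{..N}. \<mu> j \<otimes> v j) \<in> Z &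
    (\<Oplus>j\<in>{..N}. \<tau> j \<otimes> v j) \<in> Z)"
proof -
 define B where "B = rec_nat W (%_ B. \<Union>j\<in>{..N}. (%x. \<tau> j \<otimes> x) ` B)"
 have B: "B 0 = W" "B (Suc n) = (\<Union>j\<in>{..N}. (%x. \<tau> j \<otimes> x) ` B n)" for n unfolding B_def by auto
 have Bc: "B n <= carrier R & finite (B n)" for n using W t by (induction n) (auto simp: B)
 define Q where "Q n = lin_span (B n)" for n
 have Qs: "lin_sub (Q n)" for n unfolding Q_def using Bc by (intro lin_sub_span) auto
 have Qc: "Q n <= carrier R" for n using lin_subD(1)[OF Qs] .
 have Qt: "\<tau> j \<otimes> q \<in> Q (Suc n)" if "j <= N" "q \<in> Q n" for j q n
 proof -
  have "lin_span (B n) <= {x \<in> carrier R. \<tau> j \<otimes> x \<in> Q (Suc n)}"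
   by (rule lin_span_least[OF lin_sub_vimage[OF Qs t(1)[OF that(1)]]])
    (use Bc[of n] lin_span_base[of "B (Suc n)"] that in "auto simp: Q_def B")
  then show ?thesis using that Q_def by auto
 qed
 have Qleast: "Q (Suc n) <= T" if "lin_sub T" "!!j q. j <= N ==> q \<in> Q n ==> \<tau> j \<otimes> q \<in> T" for n T
  unfolding Q_def by (rule lin_span_least[OF that(1)]) (use that(2) lin_span_base[of "B n"] in "auto simp: B Q_def")
 have Q0: "W <= Q n" for n
 proof (induction n)
  case 0 then show ?case unfolding Q_def B using lin_span_base .
 next
  case (Suc n)
  show ?case
  proof
   fix w assume w: "w \<in> W"
   then have "\<tau> 0 \<otimes> w \<in> Q (Suc n)" using Suc Qt[of 0] by auto
   then show "w \<in> Q (Suc n)" using w W t(2) by auto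
  qed
 qed
 define stable where "stable S \<longleftrightarrow> (\<forall>n. lin_sub (S n)) & (\<forall>n j. j <= N --> (\<forall>s\<in>S n. \<tau> j \<otimes> s \<in> S (Suc n)))"
  for S :: "nat => 'a set"
 \<comment> \<open>Containment propagates, because \<open>Q (m + 1)\<close> is spanned by
   multipliers applied to \<open>Q m\<close> and \<open>S\<close> is stable. A stable sequence that
   is proper at arbitrarily large indices is therefore proper everywhere.\<close>
 have up: "Q m <= S m" if "stable S" "Q n <= S n" "n <= m" for S n m
  using that(3)
 proof (induction rule: dec_induct)
  case base then show ?case using that by simp
 next
  case (step m)
  then show ?case using that(1) Qleast[of "S (Suc m)" m] unfolding stable_def by blast
 qed
 \<comment> \<open>Adjoins the image of \<open>y\<close> to \<open>S\<close>. This image starts in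
   index one, so index zero is left unchanged.\<close>
 define ext where "ext S y n = (case n of 0 => S 0 | Suc m => {t \<oplus> s | t s. t \<in> (%x. y \<otimes> x) ` Q m & s \<in> S (Suc m)})"
  for S :: "nat => 'a set" and y n
 have ext_Suc: "ext S y (Suc m) = {y \<otimes> q \<oplus> s | q s. q \<in> Q m & s \<in> S (Suc m)}" for S y m
  unfolding ext_def by auto
 have ext_sup: "S n <= ext S y n" "!!q. q \<in> Q m ==> y \<otimes> q \<in> ext S y (Suc m)"
  if "stable S" "y \<in> carrier R" for S y n m
 proof -
  have S: "lin_sub (S n)" for n using that stable_def by auto
  show "S n <= ext S y n"
  proof (cases n)
   case (Suc m)
   have "s = y \<otimes> \<zero> \<oplus> s" if "s \<in> S n" for s using \<open>y \<in> carrier R\<close> lin_subD(5)[OF S that] by simp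
   then show ?thesis unfolding Suc ext_Suc using lin_subD(2)[OF Qs] by blast
  qed (simp add: ext_def)
  fix q assume q: "q \<in> Q m"
  then have "y \<otimes> q = y \<otimes> q \<oplus> \<zero>" using subsetD[OF Qc q] \<open>y \<in> carrier R\<close> by simp
  then show "y \<otimes> q \<in> ext S y (Suc m)" unfolding ext_Suc using q lin_subD(2)[OF S] by blast
 qed
 have ext_stable: "stable (ext S y)" if S: "stable S" "y \<in> carrier R" for S y
  unfolding stable_def
 proof (intro conjI allI impI ballI)
  have Sl: "lin_sub (S n)" for n using S stable_def by auto
  fix n show "lin_sub (ext S y n)"
   by (cases n) (use Sl S lin_sub_plus[OF lin_sub_mult[OF Qs S(2)] Sl] in "auto simp: ext_def")
  fix j s assume j: "j <= N" and s: "s \<in> ext S y n"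
  show "\<tau> j \<otimes> s \<in> ext S y (Suc n)"
  proof (cases n)
   case 0
   then show ?thesis using s S j ext_sup(1)[OF S, of "Suc 0"] unfolding stable_def by (auto simp: ext_def[of S y 0])
  next
   case (Suc m)
   then obtain q r where qr: "s = y \<otimes> q \<oplus> r" "q \<in> Q m" "r \<in> S n" using s ext_Suc by auto
   then have "\<tau> j \<otimes> s = y \<otimes> (\<tau> j \<otimes> q) \<oplus> \<tau> j \<otimes> r"
    using Qc[of m] lin_subD(5)[OF Sl] S(2) t(1)[OF j] by (auto simp: r_distr m_lcomm)
   moreover have "\<tau> j \<otimes> q \<in> Q n" "\<tau> j \<otimes> r \<in> S (Suc n)" using Qt[OF j qr(2)] Suc S j qr unfolding stable_def by auto
   ultimately show ?thesis unfolding ext_Suc by blast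
  qed
 qed
 \<comment> \<open>\<open>A i\<close> is \<open>Z\<close> together with the images of
   \<open>\<tau> 0\<close>, ..., \<open>\<tau> (i - 1)\<close>. It swallows no \<open>Q n\<close>
   for \<open>i = 0\<close>, and it swallows \<open>Q 1\<close> once all multipliers are
   included.\<close>
 define A where "A = rec_nat (%_. Z) (%i S. ext S (\<tau> i))"
 have A: "A 0 = (%_. Z)" "A (Suc i) = ext (A i) (\<tau> i)" for i unfolding A_def by auto
 have A_stable: "i <= Suc N ==> stable (A i)" for i
 proof (induction i)
  case 0
  show ?case unfolding A stable_def using ideal_lin_sub[OF Z] ideal.I_l_closed[OF Z] t by auto
 qed (auto simp: A intro!: ext_stable t)
 have A_mono: "A i n <= A j n" if "i <= j" "j <= Suc N" for i j n
  using that
 proof (induction rule: dec_induct)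
  case (step j)
  then show ?case using ext_sup(1)[OF A_stable t(1), of j j n] A by auto
 qed simp
 let ?np = "%i. \<exists>n. Q n <= A i n"
 have np: "?np (Suc N)"
 proof -
  have "Q (Suc 0) <= A (Suc N) (Suc 0)"
  proof (rule Qleast)
   show "lin_sub (A (Suc N) (Suc 0))" using A_stable stable_def by auto
   fix j q assume j: "j <= N" and q: "q \<in> Q 0"
   then have "\<tau> j \<otimes> q \<in> A (Suc j) (Suc 0)" unfolding A using ext_sup(2)[OF A_stable t(1)] by auto
   then show "\<tau> j \<otimes> q \<in> A (Suc N) (Suc 0)" using A_mono[of "Suc j" "Suc N"] j by auto
  qed
  then show ?thesis by blast
 qed
 have "\<not> ?np 0" using Q0 W(3) unfolding A by blast
 \<comment> \<open>At this first jump the multiplier \<open>\<tau> i\<close> is onto modulo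
   \<open>A i\<close> from some index on; it becomes the reference multiplier
   \<open>z\<close>.\<close>
 then obtain i where i: "i < Suc N" "\<forall>l\<le>i. \<not> ?np l" "?np (Suc i)"
  using ex_least_nat_less[of ?np, OF np] by blast
 define z where "z = \<tau> i"
 have zc: "z \<in> carrier R" using i t z_def by auto
 obtain n1 where n1: "Q n1 <= A (Suc i) n1" using i by blast
 have surj: "\<forall>n\<ge>n1. Q (Suc n) <= {z \<otimes> q \<oplus> s | q s. q \<in> Q n & s \<in> A i (Suc n)}"
 proof (intro allI impI)
  fix n assume "n1 <= n"
  then have "Q (Suc n) <= A (Suc i) (Suc n)" using up[OF A_stable n1, of "Suc n"] i by auto
  then show "Q (Suc n) <= {z \<otimes> q \<oplus> s | q s. q \<in> Q n & s \<in> A i (Suc n)}" unfolding A ext_Suc z_def .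
 qed
 \<comment> \<open>Invariant: the multipliers before \<open>m\<close> already act as scalar
   multiples of \<open>z\<close> modulo \<open>S\<close>, and \<open>S\<close> has not absorbed any
   whole \<open>Q n\<close>.\<close>
 have "m <= Suc N ==> \<exists>S \<mu>. stable S & (\<forall>n. \<not> Q n <= S n) & (\<forall>n. A i n <= S n) & (\<forall>j\<le>N. \<mu> j \<in> k) & \<mu> i = \<one> &
  (\<forall>j<m. \<forall>n. \<forall>q\<in>Q n. (\<tau> j \<ominus> \<mu> j \<otimes> z) \<otimes> q \<in> S (Suc n))" for m
 proof (induction m)
  case 0
  show ?case using A_stable[of i] i scal_ring
   by (intro exI[of _ "A i"] exI[of _ "%_. \<one>"]) auto
 next
  case (Suc m)
  then obtain S \<mu> where S': "stable S" "\<forall>n. \<not> Q n <= S n" "\<forall>n. A i n <= S n" "\<forall>j\<le>N. \<mu> j \<in> k" "\<mu> i = \<one>"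
   "\<forall>j<m. \<forall>n. \<forall>q\<in>Q n. (\<tau> j \<ominus> \<mu> j \<otimes> z) \<otimes> q \<in> S (Suc n)" by (meson Suc_leD)
  have S: "stable S" "!!n. \<not> Q n <= S n" "!!n. A i n <= S n" "!!j. j <= N ==> \<mu> j \<in> k" "\<mu> i = \<one>"
   "!!j n q. j < m ==> q \<in> Q n ==> (\<tau> j \<ominus> \<mu> j \<otimes> z) \<otimes> q \<in> S (Suc n)" using S' by blast+
  have Sl: "lin_sub (S n)" for n using S stable_def by auto
  have m: "m <= N" using Suc by simp
  consider "m < i" | "m = i" | "m > i" by linarith
  then show ?case
  proof cases
   case 1
   \<comment> \<open>The images of the multipliers before \<open>i\<close> are part of
     \<open>A i\<close>, so their eigenvalue is zero.\<close>
   define \<mu>' where "\<mu>' = \<mu>(m := \<zero>)"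
   have "(\<tau> m \<ominus> \<mu>' m \<otimes> z) \<otimes> q \<in> S (Suc n)" if q: "q \<in> Q n" for n q
   proof -
    have "\<tau> m \<otimes> q \<in> A (Suc m) (Suc n)" unfolding A using ext_sup(2)[OF A_stable t(1)] m q by auto
    then have "\<tau> m \<otimes> q \<in> S (Suc n)" using A_mono[of "Suc m" i] 1 i S(3) by (metis Suc_leI less_imp_le_nat subsetD)
    then show ?thesis using zc t(1)[OF m] by (simp add: \<mu>'_def a_minus_def)
   qed
   moreover have "(\<tau> j \<ominus> \<mu>' j \<otimes> z) \<otimes> q \<in> S (Suc n)" if "j < m" "q \<in> Q n" for j n q
    using S(6)[OF that] that by (simp add: \<mu>'_def)
   ultimately have "\<forall>j<Suc m. \<forall>n. \<forall>q\<in>Q n. (\<tau> j \<ominus> \<mu>' j \<otimes> z) \<otimes> q \<in> S (Suc n)" by (auto simp: less_Suc_eq)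
   moreover have "\<forall>j\<le>N. \<mu>' j \<in> k" "\<mu>' i = \<one>" using S 1 scal_ring by (auto simp: \<mu>'_def)
   ultimately show ?thesis using S(1-3) by blast
  next
   case 2
   have "(\<tau> m \<ominus> \<mu> m \<otimes> z) \<otimes> q \<in> S (Suc n)" if q: "q \<in> Q n" for n q
    using 2 S(5) zc subsetD[OF Qc q] lin_subD(2)[OF Sl] by (auto simp: z_def r_neg a_minus_def)
   then have "\<forall>j<Suc m. \<forall>n. \<forall>q\<in>Q n. (\<tau> j \<ominus> \<mu> j \<otimes> z) \<otimes> q \<in> S (Suc n)" using S(6) by (auto simp: less_Suc_eq)
   then show ?thesis using S(1-5) by blast
  next
   case 3
   \<comment> \<open>\<open>z\<close> remains onto modulo the larger \<open>S\<close>, so there is a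
     relative eigenvalue \<open>l\<close>, and the image of
     \<open>\<tau> m \<ominus> l \<otimes> z\<close> can be adjoined without exhausting any
     \<open>Q n\<close>.\<close>
   have "\<exists>l\<in>k. \<forall>n0. \<exists>n\<ge>n0. \<not> Q (Suc n) <= {(\<tau> m \<ominus> l \<otimes> z) \<otimes> q \<oplus> s | q s. q \<in> Q n & s \<in> S (Suc n)}"
   proof (rule exists_eigenvalue[where W = "B n1" and ?n0.0 = n1])
    show "\<forall>n\<ge>n1. Q (Suc n) <= {z \<otimes> q \<oplus> s | q s. q \<in> Q n & s \<in> S (Suc n)}"
     using surj S(3) by blast
    show "B n1 <= Q n1" "Q n1 <= lin_span (S n1 \<union> B n1)" unfolding Q_def using lin_span_base lin_span_mono by auto
   qed (use zc t m S(1,2) Qc Qt z_def i(1) Bc[of n1] in "auto simp: stable_def")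
   then obtain l where l: "l \<in> k" "!!n0. \<exists>n\<ge>n0. \<not> Q (Suc n) <= ext S (\<tau> m \<ominus> l \<otimes> z) (Suc n)"
    unfolding ext_Suc by blast
   define y where "y = \<tau> m \<ominus> l \<otimes> z"
   have y: "y \<in> carrier R" unfolding y_def using t m l zc by auto
   define \<mu>' where "\<mu>' = \<mu>(m := l)"
   have "\<not> Q n <= ext S y n" for n
    using up[OF ext_stable[OF S(1) y], of n] l(2)[of n] y_def by (metis le_SucI)
   moreover have "\<forall>j<Suc m. \<forall>n. \<forall>q\<in>Q n. (\<tau> j \<ominus> \<mu>' j \<otimes> z) \<otimes> q \<in> ext S y (Suc n)"
    using subsetD[OF ext_sup(1)[OF S(1) y] S(6)] ext_sup(2)[OF S(1) y] by (auto simp: less_Suc_eq \<mu>'_def y_def)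
   moreover have "\<forall>j\<le>N. \<mu>' j \<in> k" "\<mu>' i = \<one>" using S 3 l by (auto simp: \<mu>'_def)
   moreover have "\<forall>n. A i n <= ext S y n" using S(3) ext_sup(1)[OF S(1) y] by blast
   ultimately show ?thesis using ext_stable[OF S(1) y] by blast
  qed
 qed
 from this[OF order_refl] obtain S \<mu> where S': "stable S" "\<forall>n. \<not> Q n <= S n" "\<forall>n. A i n <= S n" "\<forall>j\<le>N. \<mu> j \<in> k" "\<mu> i = \<one>"
   "\<forall>j<Suc N. \<forall>n. \<forall>q\<in>Q n. (\<tau> j \<ominus> \<mu> j \<otimes> z) \<otimes> q \<in> S (Suc n)" by blast
 have S: "stable S" "!!n. \<not> Q n <= S n" "!!n. A i n <= S n" "!!j. j <= N ==> \<mu> j \<in> k" "\<mu> i = \<one>"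
   "!!j n q. j <= N ==> q \<in> Q n ==> (\<tau> j \<ominus> \<mu> j \<otimes> z) \<otimes> q \<in> S (Suc n)" using S' by (blast intro: le_imp_less_Suc)+
 have Sl: "lin_sub (S n)" for n using S stable_def by auto
 have ZS: "Z <= S n" for n using A_mono[of 0 i n] i S(3)[of n] A by auto
 have False if *: "\<forall>w\<in>W. \<exists>v. (\<forall>j\<le>N. v j \<in> lin_span W) & w \<ominus> (\<Oplus>j\<in>{..N}. \<mu> j \<otimes> v j) \<in> Z &
    (\<Oplus>j\<in>{..N}. \<tau> j \<otimes> v j) \<in> Z"
 proof -
  have zw: "z \<otimes> w \<in> S (Suc 0)" if w: "w \<in> W" for w
  proof -
   obtain v where v: "!!j. j <= N ==> v j \<in> Q 0" "w \<ominus> (\<Oplus>j\<in>{..N}. \<mu> j \<otimes> v j) \<in> Z" "(\<Oplus>j\<in>{..N}. \<tau> j \<otimes> v j) \<in> Z"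
    using * w unfolding Q_def B by blast
   have vc: "v j \<in> carrier R" "\<mu> j \<in> carrier R" "\<tau> j \<in> carrier R" if "j <= N" for j using v(1) Qc S(4) t that by auto
   let ?a = "\<Oplus>j\<in>{..N}. \<mu> j \<otimes> v j" and ?b = "\<Oplus>j\<in>{..N}. \<tau> j \<otimes> v j" and ?c = "\<Oplus>j\<in>{..N}. (\<tau> j \<ominus> \<mu> j \<otimes> z) \<otimes> v j"
   have c: "?a \<in> carrier R" "?b \<in> carrier R" "?c \<in> carrier R" using vc zc by (auto intro!: finsum_closed)
   have "?b = (\<Oplus>j\<in>{..N}. (\<tau> j \<ominus> \<mu> j \<otimes> z) \<otimes> v j \<oplus> z \<otimes> (\<mu> j \<otimes> v j))"
   proof (rule finsum_cong', simp)
    fix j assume "j \<in> {..N}"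
    then have "v j \<in> carrier R" "\<mu> j \<in> carrier R" "\<tau> j \<in> carrier R" using vc by auto
    moreover have "t' \<otimes> v' = (t' \<ominus> l \<otimes> z) \<otimes> v' \<oplus> z \<otimes> (l \<otimes> v')" if "t' \<in> carrier R" "l \<in> carrier R" "v' \<in> carrier R" for t' l v'
     using that zc by algebra
    ultimately show "\<tau> j \<otimes> v j = (\<tau> j \<ominus> \<mu> j \<otimes> z) \<otimes> v j \<oplus> z \<otimes> (\<mu> j \<otimes> v j)" by blast
   qed (use vc zc in auto)
   also have "\<dots> = ?c \<oplus> (\<Oplus>j\<in>{..N}. z \<otimes> (\<mu> j \<otimes> v j))" by (rule finsum_addf) (use vc zc in auto)
   also have "(\<Oplus>j\<in>{..N}. z \<otimes> (\<mu> j \<otimes> v j)) = z \<otimes> ?a" by (rule finsum_rdistr[symmetric]) (use vc zc in auto)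
   finally have b: "?b = ?c \<oplus> z \<otimes> ?a" .
   have "?c \<in> S (Suc 0)" by (rule lin_sub_finsum[OF Sl]) (use S(6) v(1) in auto)
   moreover have "?b \<in> S (Suc 0)" using v ZS by blast
   moreover have "z \<otimes> (w \<ominus> ?a) \<in> S (Suc 0)" using v ZS ideal.I_l_closed[OF Z] zc by blast
   ultimately have "z \<otimes> (w \<ominus> ?a) \<oplus> (?b \<ominus> ?c) \<in> S (Suc 0)" using lin_subD(3)[OF Sl] lin_sub_minus[OF Sl] by blast
   moreover have id: "z \<otimes> (w \<ominus> a) \<oplus> ((c \<oplus> z \<otimes> a) \<ominus> c) = z \<otimes> w" if "a \<in> carrier R" "c \<in> carrier R" for a c
    using that zc subsetD[OF W(2) w] by algebra
   moreover have "z \<otimes> (w \<ominus> ?a) \<oplus> (?b \<ominus> ?c) = z \<otimes> w" unfolding b by (rule id[OF c(1,3)])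
   ultimately show ?thesis by simp
  qed
  have "Q (Suc 0) <= S (Suc 0)"
  proof (unfold Q_def, rule lin_span_least[OF Sl])
   show "B (Suc 0) <= S (Suc 0)"
   proof
    fix x assume "x \<in> B (Suc 0)"
    then obtain j w where jw: "j <= N" "w \<in> W" "x = \<tau> j \<otimes> w" by (auto simp: B)
    have "(\<tau> j \<ominus> \<mu> j \<otimes> z) \<otimes> w \<in> S (Suc 0)" using S(6)[OF jw(1)] jw Q0 by auto
    moreover have "\<mu> j \<otimes> (z \<otimes> w) \<in> S (Suc 0)" using zw jw S(4) lin_subD(4)[OF Sl] by auto
    ultimately have "(\<tau> j \<ominus> \<mu> j \<otimes> z) \<otimes> w \<oplus> \<mu> j \<otimes> (z \<otimes> w) \<in> S (Suc 0)" using lin_subD(3)[OF Sl] by blast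
    moreover have "(t' \<ominus> l \<otimes> z) \<otimes> w \<oplus> l \<otimes> (z \<otimes> w) = t' \<otimes> w" if "t' \<in> carrier R" "l \<in> carrier R" for t' l
    proof -
     have "w \<in> carrier R" using jw W by auto
     then show ?thesis using that zc by algebra
    qed
    ultimately show "x \<in> S (Suc 0)" using jw t S(4) by auto
   qed
  qed
  then show False using S(2) by blast
 qed
 moreover have "\<mu> i ~= \<zero>" using S(5) subfieldE(6)[OF subfield] by auto
 moreover have "i <= N" using i by simp
 ultimately show ?thesis using S(4) by blast
qed

end

section \<open>Vanishing of local cohomology\<close>

lemma (in abelian_group) minus_eq_zeroD:
 assumes "a \<ominus> b = \<zero>" "a \<in> carrier G" "b \<in> carrier G" shows "a = b"
proof -
 have "a = (a \<ominus> b) \<oplus> b" using assms(2,3) by (simp add: a_minus_def a_assoc l_neg)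
 then show ?thesis using assms by simp
qed

lemma (in abelian_group) add_minus_cancel:
 assumes "a \<in> carrier G" "b \<in> carrier G"
 shows "(a \<oplus> b) \<ominus> a = b" "a \<oplus> (b \<ominus> a) = b"
 using assms by (simp_all add: a_minus_def a_comm[of a] a_assoc r_neg l_neg)

lemma (in abelian_group) minus_of_zero: "\<ominus> \<zero> = \<zero>"
 using add.inv_one by (simp add: a_inv_def)

section \<open>Module homomorphisms and extension from ideals into injective modules\<close>

lemma module_homD:
 assumes "h \<in> module_hom R M N"
 shows "!!x. x \<in> carrier M ==> h x \<in> carrier N"
  "!!x y. x \<in> carrier M ==> y \<in> carrier M ==> h (x \<oplus>\<^sub>M y) = h x \<oplus>\<^sub>N h y"
  "!!a x. a \<in> carrier R ==> x \<in> carrier M ==> h (a \<odot>\<^sub>M x) = a \<odot>\<^sub>N h x"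
 using assms unfolding module_hom_def by auto

lemma module_hom_zero:
 assumes "module R M" "module R N" "h \<in> module_hom R M N"
 shows "h \<zero>\<^sub>M = \<zero>\<^sub>N"
proof -
 interpret M: module R M by fact
 interpret N: module R N by fact
 have "h (\<zero>\<^sub>R \<odot>\<^sub>M \<zero>\<^sub>M) = \<zero>\<^sub>R \<odot>\<^sub>N h \<zero>\<^sub>M" by (rule module_homD(3)[OF assms(3)]) auto
 then show ?thesis using module_homD(1)[OF assms(3)] by simp
qed

lemma module_hom_minus:
 assumes "module R M" "module R N" "h \<in> module_hom R M N" "x \<in> carrier M" "y \<in> carrier M"
 shows "h (x \<ominus>\<^sub>M y) = h x \<ominus>\<^sub>N h y"
proof -
 interpret M: module R M by fact
 interpret N: module R N by fact
 have "h (\<ominus>\<^sub>M y) = \<ominus>\<^sub>N h y"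
 proof -
  have "h ((\<ominus>\<^sub>R \<one>\<^sub>R) \<odot>\<^sub>M y) = (\<ominus>\<^sub>R \<one>\<^sub>R) \<odot>\<^sub>N h y" using module_homD(3)[OF assms(3)] assms(5) by simp
  then show ?thesis using assms module_homD(1)[OF assms(3)] by (simp add: M.smult_l_minus N.smult_l_minus)
 qed
 then show ?thesis using module_homD[OF assms(3)] assms by (simp add: a_minus_def)
qed

text \<open>Baer's criterion in the direction needed here: the given type contains a copy of \<open>R\<close> and
 of its ideals.\<close>

lemma injective_module_extend:
 fixes R :: "('r, 'x) ring_scheme" and E :: "('r, ('r, 'm) resolution_elt) module"
 assumes "cring R" "injective_module R E" "ideal P R"
  and "!!a. a \<in> P ==> g a \<in> carrier E"
  and "!!a b. a \<in> P ==> b \<in> P ==> g (a \<oplus>\<^sub>R b) = g a \<oplus>\<^sub>E g b"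
  and "!!c a. c \<in> carrier R ==> a \<in> P ==> g (c \<otimes>\<^sub>R a) = c \<odot>\<^sub>E g a"
 shows "\<exists>e\<in>carrier E. \<forall>a\<in>P. g a = a \<odot>\<^sub>E e"
proof -
 interpret R: cring R by fact
 interpret P: ideal P R by fact
 interpret E: module R E using assms(2) unfolding injective_module_def by simp
 \<comment> \<open>Elements of \<open>R\<close> are coded by indicator functions in the type of the
   elements of \<open>E\<close>; \<open>Md C\<close> is the copy of the ideal \<open>C\<close> under
   this embedding.\<close>
 define j :: "'r => ('r, 'm) resolution_elt" where "j a = (%(s, _). (undefined, s = a))" for a
 have inj: "inj j"
 proof (rule injI)
  fix a b assume "j a = j b"
  then have "j a (a, 0) = j b (a, 0)" by simp
  then show "a = b" by (simp add: j_def)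
 qed
 define i where "i = inv_into UNIV j"
 have [simp]: "i (j a) = a" for a unfolding i_def using inj by simp
 define Md :: "'r set => ('r, ('r, 'm) resolution_elt) module" where
  "Md C = \<lparr>carrier = j ` C, monoid.mult = (%_ _. j \<zero>\<^sub>R), one = j \<zero>\<^sub>R, ring.zero = j \<zero>\<^sub>R,
   add = (%x y. j (i x \<oplus>\<^sub>R i y)), smult = (%c x. j (c \<otimes>\<^sub>R i x))\<rparr>" for C
 have mod: "module R (Md C)" if "ideal C R" for C
 proof -
  interpret C: ideal C R by fact
  note Cc = C.a_Hcarr
  have "abelian_group (Md C)"
  proof (rule abelian_groupI)
   fix x assume "x \<in> carrier (Md C)"
   then obtain a where a: "a \<in> C" "x = j a" by (auto simp: Md_def)
   then show "\<exists>y\<in>carrier (Md C). y \<oplus>\<^sub>(Md C) x = \<zero>\<^sub>(Md C)"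
    using Cc[OF a(1)] C.a_inv_closed[OF a(1)] by (auto simp: Md_def R.l_neg intro!: bexI[of _ "\<ominus>\<^sub>R a"])
  qed (auto simp: Md_def C.a_closed C.zero_closed Cc R.a_ac)
  moreover have "module_axioms R (Md C)"
   unfolding module_axioms_def by (auto simp: Md_def C.I_l_closed Cc R.l_distr R.r_distr R.m_assoc)
  ultimately show ?thesis unfolding module_def using R.cring_axioms by blast
 qed
 have "\<exists>h\<in>module_hom R (Md (carrier R)) E. \<forall>x\<in>carrier (Md P). h x = g (i x)"
 proof -
  have 1: "id \<in> module_hom R (Md P) (Md (carrier R))"
   unfolding module_hom_def by (auto simp: Md_def P.a_Hcarr)
  have 2: "(%x. g (i x)) \<in> module_hom R (Md P) E"
   unfolding module_hom_def using assms(4-6) by (auto simp: Md_def)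
  show ?thesis
   using assms(2) mod[OF P.is_ideal] mod[OF R.oneideal] 1 2 unfolding injective_module_def
   by (metis id_apply inj_on_id)
 qed
 then obtain h where h: "h \<in> module_hom R (Md (carrier R)) E" "!!x. x \<in> carrier (Md P) ==> h x = g (i x)" by blast
 have "g a = a \<odot>\<^sub>E h (j \<one>\<^sub>R)" if a: "a \<in> P" for a
 proof -
  have "a \<in> carrier R" using a P.a_Hcarr by auto
  then have "h (a \<odot>\<^sub>(Md (carrier R)) j \<one>\<^sub>R) = a \<odot>\<^sub>E h (j \<one>\<^sub>R)"
   by (intro module_homD(3)[OF h(1)]) (auto simp: Md_def)
  moreover have "a \<odot>\<^sub>(Md (carrier R)) j \<one>\<^sub>R = j a" using \<open>a \<in> carrier R\<close> by (simp add: Md_def)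
  moreover have "h (j a) = g a" using h(2)[of "j a"] a by (simp add: Md_def)
  ultimately show ?thesis by simp
 qed
 moreover have "h (j \<one>\<^sub>R) \<in> carrier E" by (rule module_homD(1)[OF h(1)]) (simp add: Md_def)
 ultimately show ?thesis by blast
qed

lemma (in cring) ideal_plus_principal:
 assumes b: "ideal b R" and y: "y \<in> carrier R"
 shows "ideal {y \<otimes> c \<oplus> v | c v. c \<in> carrier R & v \<in> b} R"
  and "b <= {y \<otimes> c \<oplus> v | c v. c \<in> carrier R & v \<in> b}" "y \<in> {y \<otimes> c \<oplus> v | c v. c \<in> carrier R & v \<in> b}"
proof -
 have "{y \<otimes> c \<oplus> v | c v. c \<in> carrier R & v \<in> b} = PIdl y <+> b"
  unfolding set_add_def' cgenideal_def using m_comm[OF _ y] by fastforce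
 then show "ideal {y \<otimes> c \<oplus> v | c v. c \<in> carrier R & v \<in> b} R"
  using add_ideals[OF cgenideal_ideal[OF y] b] by simp
 show "b <= {y \<otimes> c \<oplus> v | c v. c \<in> carrier R & v \<in> b}"
 proof
  fix v assume v: "v \<in> b"
  then have "v = y \<otimes> \<zero> \<oplus> v" using y ideal.Icarr[OF b v] by simp
  then show "v \<in> {y \<otimes> c \<oplus> v | c v. c \<in> carrier R & v \<in> b}" using v by blast
 qed
 have "y = y \<otimes> \<one> \<oplus> \<zero>" using y by simp
 then show "y \<in> {y \<otimes> c \<oplus> v | c v. c \<in> carrier R & v \<in> b}"
  using ideal_zero[OF b] by blast
qed

text \<open>\<open>bounded_torsion\<close> states that the ideals \<open>(J : x_i^n)\<close>, with
  \<open>J\<close> generated by the \<open>k\<close>-th powers of the earlier parameters, become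
  constant at some \<open>N\<close>. This is the form in which the Noetherian property acts on
  injective modules.\<close>

locale resolution = cring R for R :: "('r, 'x) ring_scheme" (structure) +
 fixes M :: "('r, 'm, 'y) module_scheme"
  and E :: "nat => ('r, ('r, 'm) resolution_elt) module" and \<epsilon> :: "'m => ('r, 'm) resolution_elt"
  and d :: "nat => ('r, 'm) resolution_elt => ('r, 'm) resolution_elt"
  and x :: "nat => 'r" and r :: nat
 assumes res: "injective_resolution R M E \<epsilon> d"
  and x_closed [simp]: "!!i. i < r ==> x i \<in> carrier R"
  and bounded_torsion: "!!i k. i < r ==> \<exists>N::nat. \<forall>n::nat. \<forall>c\<in>carrier R.
   x i [^] (N + n) \<otimes> c \<in> Idl ((%j. x j [^] (k::nat)) ` {..<i}) --> x i [^] N \<otimes> c \<in> Idl ((%j. x j [^] k) ` {..<i})"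
begin

lemma E_mod: "module R (E i)" and inj_E: "injective_module R (E i)"
 using res unfolding injective_resolution_def injective_module_def by auto

sublocale E: module R "E i" for i by (rule E_mod)

lemma d_hom: "d i \<in> module_hom R (E i) (E (Suc i))" and eps_hom: "\<epsilon> \<in> module_hom R M (E 0)"
 using res unfolding injective_resolution_def by auto

lemma d_closed [simp, intro]: "e \<in> carrier (E i) ==> d i e \<in> carrier (E (Suc i))"
 using module_homD(1)[OF d_hom] .

lemmas d_add = module_homD(2)[OF d_hom]
lemmas d_smult = module_homD(3)[OF d_hom]
lemmas d_zero = module_hom_zero[OF E_mod E_mod d_hom]
lemmas d_minus = module_hom_minus[OF E_mod E_mod d_hom]

lemma exact0: "{e \<in> carrier (E 0). d 0 e = \<zero>\<^sub>(E (Suc 0))} = \<epsilon> ` carrier M"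
 using res unfolding injective_resolution_def by simp

lemma exact: "{e \<in> carrier (E (Suc i)). d (Suc i) e = \<zero>\<^sub>(E (Suc (Suc i)))} = d i ` carrier (E i)"
 using res unfolding injective_resolution_def by simp

lemma d_d: "e \<in> carrier (E i) ==> d (Suc i) (d i e) = \<zero>\<^sub>(E (Suc (Suc i)))"
 using exact[of i] by auto

text \<open>Torsion for the first \<open>i\<close> parameters only. Adding one parameter at a time
  permits inductions from \<open>i = 0\<close>, where the resolution is exact, to
  \<open>i = r\<close>, where the torsion will be that of the maximal ideal.\<close>

definition tor :: "nat => nat => ('r, 'm) resolution_elt set" where
 "tor i n = {e \<in> carrier (E n). \<exists>t::nat. \<forall>j<i. x j [^] t \<odot>\<^sub>(E n) e = \<zero>\<^sub>(E n)}"

lemma pow_kill: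
 assumes "a \<in> carrier R" "e \<in> carrier (E n)" "a [^] (s::nat) \<odot>\<^sub>(E n) e = \<zero>\<^sub>(E n)" "s <= t"
 shows "a [^] t \<odot>\<^sub>(E n) e = \<zero>\<^sub>(E n)"
proof -
 have "a [^] t = a [^] (t - s) \<otimes> a [^] s" using assms by (simp add: nat_pow_mult)
 then show ?thesis using assms by (simp add: E.smult_assoc1)
qed

lemma tor_closed: "e \<in> tor i n ==> e \<in> carrier (E n)"
 unfolding tor_def by auto

lemma tor_0: "tor 0 n = carrier (E n)"
 unfolding tor_def by auto

lemma tor_SucD: "e \<in> tor (Suc i) n ==> e \<in> tor i n"
 unfolding tor_def by (auto simp: less_Suc_eq)

lemma tor_SucI:
 assumes "e \<in> tor i n" "x i [^] (t::nat) \<odot>\<^sub>(E n) e = \<zero>\<^sub>(E n)" "i < r"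
 shows "e \<in> tor (Suc i) n"
proof -
 obtain s :: nat where s: "\<forall>j<i. x j [^] s \<odot>\<^sub>(E n) e = \<zero>\<^sub>(E n)" "e \<in> carrier (E n)" using assms(1) unfolding tor_def by auto
 have "x j [^] (max s t) \<odot>\<^sub>(E n) e = \<zero>\<^sub>(E n)" if "j < Suc i" for j
  using that s assms(2,3) pow_kill[of "x j" e n s "max s t"] pow_kill[of "x j" e n t "max s t"] x_closed[of j]
  by (cases "j = i") auto
 then show ?thesis unfolding tor_def using s(2) by blast
qed

lemma tor_Suc_kill: "e \<in> tor (Suc i) n ==> \<exists>t::nat. x i [^] t \<odot>\<^sub>(E n) e = \<zero>\<^sub>(E n)"
 unfolding tor_def by auto

lemma tor_add: assumes "e \<in> tor i n" "e' \<in> tor i n" "i <= r" shows "e \<oplus>\<^sub>(E n) e' \<in> tor i n"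
proof -
 obtain s t :: nat where s: "\<forall>j<i. x j [^] s \<odot>\<^sub>(E n) e = \<zero>\<^sub>(E n)" "e \<in> carrier (E n)"
  and t: "\<forall>j<i. x j [^] t \<odot>\<^sub>(E n) e' = \<zero>\<^sub>(E n)" "e' \<in> carrier (E n)" using assms unfolding tor_def by auto
 have "x j [^] (max s t) \<odot>\<^sub>(E n) (e \<oplus>\<^sub>(E n) e') = \<zero>\<^sub>(E n)" if "j < i" for j
  using that s t assms(3) pow_kill[of "x j" e n s "max s t"] pow_kill[of "x j" e' n t "max s t"] x_closed[of j]
  by (simp add: E.smult_r_distr)
 then show ?thesis unfolding tor_def using s(2) t(2) by blast
qed

lemma tor_smult: assumes "e \<in> tor i n" "c \<in> carrier R" "i <= r" shows "c \<odot>\<^sub>(E n) e \<in> tor i n"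
proof -
 obtain s :: nat where s: "\<forall>j<i. x j [^] s \<odot>\<^sub>(E n) e = \<zero>\<^sub>(E n)" "e \<in> carrier (E n)" using assms unfolding tor_def by auto
 have "x j [^] s \<odot>\<^sub>(E n) (c \<odot>\<^sub>(E n) e) = \<zero>\<^sub>(E n)" if "j < i" for j
 proof -
  have "x j \<in> carrier R" using that assms(3) by auto
  then have "x j [^] s \<odot>\<^sub>(E n) (c \<odot>\<^sub>(E n) e) = c \<odot>\<^sub>(E n) (x j [^] s \<odot>\<^sub>(E n) e)"
   using s assms by (simp add: m_comm flip: E.smult_assoc1)
  then show ?thesis using s that assms by simp
 qed
 then show ?thesis unfolding tor_def using s(2) assms by blast
qed

lemma tor_minus: assumes "e \<in> tor i n" "e' \<in> tor i n" "i <= r" shows "e \<ominus>\<^sub>(E n) e' \<in> tor i n"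
proof -
 have "(\<ominus> \<one>) \<odot>\<^sub>(E n) e' \<in> tor i n" by (rule tor_smult) (use assms in auto)
 moreover have "(\<ominus> \<one>) \<odot>\<^sub>(E n) e' = \<ominus>\<^sub>(E n) e'" using tor_closed[OF assms(2)] by (simp add: E.smult_l_minus)
 ultimately show ?thesis unfolding a_minus_def using tor_add assms by metis
qed

lemma tor_d: assumes "e \<in> tor i n" "i <= r" shows "d n e \<in> tor i (Suc n)"
proof -
 obtain s :: nat where s: "\<forall>j<i. x j [^] s \<odot>\<^sub>(E n) e = \<zero>\<^sub>(E n)" "e \<in> carrier (E n)" using assms unfolding tor_def by auto
 have "x j [^] s \<odot>\<^sub>(E (Suc n)) d n e = \<zero>\<^sub>(E (Suc n))" if "j < i" for j
  using s that assms(2) d_smult[of "x j [^] s" e n] d_zero[of n] by simp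
 then show ?thesis unfolding tor_def using s(2) by blast
qed

lemma tor_zero: "\<zero>\<^sub>(E n) \<in> tor i n" if "i <= r"
 unfolding tor_def using that by auto

text \<open>Injectivity makes \<open>\<Gamma>(E)\<close> divisible by \<open>x\<^sub>i\<close> modulo \<open>x\<^sub>i\<close>-torsion.\<close>

lemma divisible:
 assumes e: "e \<in> tor i n" and i: "i < r"
 shows "\<exists>e'\<in>tor i n. e \<ominus>\<^sub>(E n) x i [^] (m::nat) \<odot>\<^sub>(E n) e' \<in> tor (Suc i) n"
proof -
 obtain s :: nat where s: "\<forall>j<i. x j [^] s \<odot>\<^sub>(E n) e = \<zero>\<^sub>(E n)" "e \<in> carrier (E n)" using e unfolding tor_def by auto
 define b where "b = Idl ((%j. x j [^] s) ` {..<i})"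
 have gen: "(%j. x j [^] s) ` {..<i} <= carrier R" using i by auto
 interpret b: ideal b R unfolding b_def by (rule genideal_ideal[OF gen])
 have b_kill: "v \<odot>\<^sub>(E n) e = \<zero>\<^sub>(E n)" if "v \<in> b" for v
 proof -
  have "b <= {v \<in> carrier R. v \<odot>\<^sub>(E n) e = \<zero>\<^sub>(E n)}"
   unfolding b_def by (rule genideal_minimal[OF E.annihilator_ideal[OF s(2)]]) (use s i in auto)
  then show ?thesis using that by auto
 qed
 \<comment> \<open>Beyond \<open>N\<close> the colon ideals of \<open>b\<close> no longer grow; this
   is what will make the map \<open>g\<close> well defined.\<close>
 obtain N :: nat where N': "\<forall>m::nat. \<forall>c\<in>carrier R. x i [^] (N + m) \<otimes> c \<in> b --> x i [^] N \<otimes> c \<in> b"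
  using bounded_torsion[OF i, of s] unfolding b_def by (elim exE)
 have N: "x i [^] N \<otimes> c \<in> b" if "c \<in> carrier R" "x i [^] (N + m) \<otimes> c \<in> b" for c
  using N' that by blast
 let ?y = "x i [^] (N + m)" and ?u = "x i [^] N"
 have yu: "?y \<in> carrier R" "?u \<in> carrier R" using i by auto
 define P where "P = {?y \<otimes> c \<oplus> v | c v. c \<in> carrier R & v \<in> b}"
 have P: "ideal P R" unfolding P_def by (rule ideal_plus_principal) (use i b.is_ideal in auto)
 \<comment> \<open>The homomorphism \<open>x_i^(N + m) c + v \<mapsto> x_i^N c e\<close> on the
   ideal \<open>P\<close>. Extended to \<open>R\<close> by injectivity it is multiplication into
   some \<open>e'\<close> with \<open>x_i^(N + m) e' = x_i^N e\<close>.\<close>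
 define g where "g a = (SOME z. \<exists>c\<in>carrier R. \<exists>v\<in>b. a = ?y \<otimes> c \<oplus> v & z = (?u \<otimes> c) \<odot>\<^sub>(E n) e)" for a
 have g: "g (?y \<otimes> c \<oplus> v) = (?u \<otimes> c) \<odot>\<^sub>(E n) e" if cv: "c \<in> carrier R" "v \<in> b" for c v
 proof -
  have "\<exists>z. \<exists>c'\<in>carrier R. \<exists>v'\<in>b. ?y \<otimes> c \<oplus> v = ?y \<otimes> c' \<oplus> v' & z = (?u \<otimes> c') \<odot>\<^sub>(E n) e" using cv by blast
  from someI_ex[OF this] obtain c' v' where c': "c' \<in> carrier R" "v' \<in> b" "?y \<otimes> c \<oplus> v = ?y \<otimes> c' \<oplus> v'"
   "g (?y \<otimes> c \<oplus> v) = (?u \<otimes> c') \<odot>\<^sub>(E n) e" unfolding g_def by blast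
  have vc: "v \<in> carrier R" "v' \<in> carrier R" using cv c' b.a_Hcarr by auto
  have "y \<otimes> (c \<ominus> c') = v' \<ominus> v" if "y \<in> carrier R" "y \<otimes> c \<oplus> v = y \<otimes> c' \<oplus> v'" for y
  proof -
   have "y \<otimes> (c \<ominus> c') = (y \<otimes> c \<oplus> v) \<ominus> (y \<otimes> c' \<oplus> v)" using that(1) cv(1) c'(1) vc by algebra
   also have "\<dots> = (y \<otimes> c' \<oplus> v') \<ominus> (y \<otimes> c' \<oplus> v)" using that by simp
   also have "\<dots> = v' \<ominus> v" using that(1) cv(1) c'(1) vc by algebra
   finally show ?thesis .
  qed
  then have "?y \<otimes> (c \<ominus> c') \<in> b" using c' yu(1) cv b.a_closed b.a_inv_closed by (simp add: a_minus_def)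
  then have "?u \<otimes> (c \<ominus> c') \<in> b" using N cv c' by auto
  then have "(?u \<otimes> (c \<ominus> c')) \<odot>\<^sub>(E n) e = \<zero>\<^sub>(E n)" by (rule b_kill)
  moreover have "(?u \<otimes> (c \<ominus> c')) = ?u \<otimes> c \<oplus> \<ominus> (?u \<otimes> c')" using yu cv c' by (simp add: a_minus_def r_distr r_minus)
  ultimately have "(?u \<otimes> c) \<odot>\<^sub>(E n) e \<ominus>\<^sub>(E n) (?u \<otimes> c') \<odot>\<^sub>(E n) e = \<zero>\<^sub>(E n)"
   using yu cv c' s(2) by (simp add: E.smult_l_distr E.smult_l_minus a_minus_def)
  then have "(?u \<otimes> c) \<odot>\<^sub>(E n) e = (?u \<otimes> c') \<odot>\<^sub>(E n) e"
   by (rule E.minus_eq_zeroD) (use c' yu cv s(2) in auto)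
  then show ?thesis using c' by simp
 qed
 have "\<exists>e'\<in>carrier (E n). \<forall>a\<in>P. g a = a \<odot>\<^sub>(E n) e'"
 proof (rule injective_module_extend[OF cring_axioms inj_E P])
  fix a assume "a \<in> P"
  then obtain c v where a: "a = ?y \<otimes> c \<oplus> v" "c \<in> carrier R" "v \<in> b" unfolding P_def by auto
  have vc: "v \<in> carrier R" using a b.a_Hcarr by auto
  show "g a \<in> carrier (E n)" using g[OF a(2,3)] a s(2) yu by simp
  {
   fix a' assume "a' \<in> P"
   then obtain c' v' where a': "a' = ?y \<otimes> c' \<oplus> v'" "c' \<in> carrier R" "v' \<in> b" unfolding P_def by auto
   have vc': "v' \<in> carrier R" using a' b.a_Hcarr by auto
   have "(y \<otimes> c \<oplus> v) \<oplus> (y \<otimes> c' \<oplus> v') = y \<otimes> (c \<oplus> c') \<oplus> (v \<oplus> v')" if "y \<in> carrier R" for y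
    using that a(2) a'(2) vc vc' by algebra
   then have "a \<oplus> a' = ?y \<otimes> (c \<oplus> c') \<oplus> (v \<oplus> v')" using a a' yu by simp
   then show "g (a \<oplus> a') = g a \<oplus>\<^sub>(E n) g a'"
    using g[of "c \<oplus> c'" "v \<oplus> v'"] g[OF a(2,3)] g[OF a'(2,3)] a a' b.a_closed s(2) yu
    by (simp add: r_distr E.smult_l_distr)
  }
  fix c' assume c': "c' \<in> carrier R"
  have "c' \<otimes> a = ?y \<otimes> (c' \<otimes> c) \<oplus> c' \<otimes> v" using a c' yu vc by (simp add: r_distr m_lcomm)
  then show "g (c' \<otimes> a) = c' \<odot>\<^sub>(E n) g a"
   using g[of "c' \<otimes> c" "c' \<otimes> v"] g[OF a(2,3)] a c' b.I_l_closed s(2) yu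
   by (simp add: m_lcomm flip: E.smult_assoc1)
 qed
 then obtain e' where e': "e' \<in> carrier (E n)" "!!a. a \<in> P ==> g a = a \<odot>\<^sub>(E n) e'" by blast
 have gP: "?y \<otimes> c \<oplus> v \<in> P" if "c \<in> carrier R" "v \<in> b" for c v using that unfolding P_def by blast
 \<comment> \<open>As \<open>g\<close> vanishes on \<open>b\<close>, the element \<open>e'\<close>
   is torsion for the earlier parameters as well.\<close>
 have "x j [^] s \<odot>\<^sub>(E n) e' = \<zero>\<^sub>(E n)" if j: "j < i" for j
 proof -
  have "x j [^] s \<in> b" unfolding b_def using genideal_self[OF gen] j by auto
  then have "?y \<otimes> \<zero> \<oplus> x j [^] s \<in> P" "g (?y \<otimes> \<zero> \<oplus> x j [^] s) = (?u \<otimes> \<zero>) \<odot>\<^sub>(E n) e"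
   using gP[of \<zero>] g[of \<zero>] by auto
  then show ?thesis using e'(2) yu s(2) i j by simp
 qed
 then have 1: "e' \<in> tor i n" unfolding tor_def using e' by blast
 have "?y \<otimes> \<one> \<oplus> \<zero> \<in> P" "g (?y \<otimes> \<one> \<oplus> \<zero>) = (?u \<otimes> \<one>) \<odot>\<^sub>(E n) e" using gP[of \<one>] g[of \<one>] b.zero_closed by auto
 then have eq: "?y \<odot>\<^sub>(E n) e' = ?u \<odot>\<^sub>(E n) e" using e'(2) yu by simp
 have "e \<ominus>\<^sub>(E n) x i [^] m \<odot>\<^sub>(E n) e' \<in> tor i n" using 1 e tor_minus tor_smult i by simp
 moreover have "?u \<odot>\<^sub>(E n) (e \<ominus>\<^sub>(E n) x i [^] m \<odot>\<^sub>(E n) e') = \<zero>\<^sub>(E n)"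
 proof -
  have "?u \<odot>\<^sub>(E n) (x i [^] m \<odot>\<^sub>(E n) e') = ?y \<odot>\<^sub>(E n) e'" using i e' by (simp add: nat_pow_mult flip: E.smult_assoc1)
  then show ?thesis using eq i e' s(2) by (simp add: a_minus_def E.smult_r_distr E.smult_r_minus E.r_neg)
 qed
 ultimately show ?thesis using tor_SucI[of _ i n N] 1 i by blast
qed

text \<open>Torsion in \<open>i\<close> elements has no cohomology above degree \<open>i\<close>. In
  the induction step \<open>z = d e\<close>, and a power of \<open>x_i\<close> times
  \<open>e\<close> is a cocycle, hence of the form \<open>d g\<close>. Dividing \<open>g\<close> by
  that power modulo torsion provides a coboundary that corrects \<open>e\<close> to an element
  killed by a power of \<open>x_i\<close>.\<close>

lemma vanish_above:
 "i <= r ==> i <= n ==> z \<in> tor i (Suc n) ==> d (Suc n) z = \<zero>\<^sub>(E (Suc (Suc n))) ==> \<exists>e\<in>tor i n. z = d n e"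
proof (induction i arbitrary: n z)
 case 0
 then show ?case using exact[of n] unfolding tor_0 by auto
next
 case (Suc i)
 obtain e where e: "e \<in> tor i n" "z = d n e" using Suc.IH[of n z] Suc.prems tor_SucD by auto
 obtain m where m: "n = Suc m" using Suc.prems by (cases n) auto
 obtain t :: nat where t: "x i [^] t \<odot>\<^sub>(E (Suc n)) z = \<zero>\<^sub>(E (Suc n))" using tor_Suc_kill Suc.prems by blast
 have i: "i < r" "i <= r" "x i \<in> carrier R" using Suc.prems by auto
 let ?z = "x i [^] t \<odot>\<^sub>(E n) e"
 have "?z \<in> tor i n" using e tor_smult i by simp
 moreover have "d n ?z = \<zero>\<^sub>(E (Suc n))" using d_smult[of "x i [^] t" e n] t e tor_closed i by simp
 ultimately obtain g where g: "g \<in> tor i m" "?z = d m g" using Suc.IH[of m ?z] Suc.prems i m by auto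
 \<comment> \<open>Subtracting \<open>d g'\<close> from \<open>e\<close> leaves \<open>z\<close>
   unchanged, since \<open>d\<close> composed with itself is zero.\<close>
 obtain g' where g': "g' \<in> tor i m" "g \<ominus>\<^sub>(E m) x i [^] t \<odot>\<^sub>(E m) g' \<in> tor (Suc i) m" using divisible[OF g(1) i(1)] by blast
 obtain N :: nat where N: "x i [^] N \<odot>\<^sub>(E m) (g \<ominus>\<^sub>(E m) x i [^] t \<odot>\<^sub>(E m) g') = \<zero>\<^sub>(E m)" using tor_Suc_kill[OF g'(2)] by blast
 note c = tor_closed[OF e(1)] tor_closed[OF g(1)] tor_closed[OF g'(1)]
 have dg': "d m g' \<in> tor i n" using tor_d[OF g'(1)] i m by simp
 have "x i [^] (N + t) \<odot>\<^sub>(E n) (e \<ominus>\<^sub>(E n) d m g') = x i [^] N \<odot>\<^sub>(E n) (x i [^] t \<odot>\<^sub>(E n) (e \<ominus>\<^sub>(E n) d m g'))"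
  using i c m by (simp flip: nat_pow_mult add: E.smult_assoc1)
 also have "x i [^] t \<odot>\<^sub>(E n) (e \<ominus>\<^sub>(E n) d m g') = d m (g \<ominus>\<^sub>(E m) x i [^] t \<odot>\<^sub>(E m) g')"
  using i c m g(2) d_minus[of g m "x i [^] t \<odot>\<^sub>(E m) g'"] d_smult[of "x i [^] t" g' m]
  by (simp add: a_minus_def E.smult_r_distr E.smult_r_minus)
 also have "x i [^] N \<odot>\<^sub>(E n) d m (g \<ominus>\<^sub>(E m) x i [^] t \<odot>\<^sub>(E m) g') = \<zero>\<^sub>(E n)"
  using N d_smult[of "x i [^] N" "g \<ominus>\<^sub>(E m) x i [^] t \<odot>\<^sub>(E m) g'" m] i c m d_zero[of m] by simp
 finally have "e \<ominus>\<^sub>(E n) d m g' \<in> tor (Suc i) n"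
  using tor_SucI[OF tor_minus[OF e(1) dg' i(2)]] i by blast
 moreover have "z = d n (e \<ominus>\<^sub>(E n) d m g')"
  using e(2) d_minus[of e n "d m g'"] d_d[of g' m] c m by (simp add: a_minus_def)
 ultimately show ?case by blast
qed

section \<open>The top cohomology as fractions\<close>

definition cocycles0 :: "('r, 'm) resolution_elt set" where
 "cocycles0 = {e \<in> carrier (E 0). d 0 e = \<zero>\<^sub>(E (Suc 0))}"

text \<open>\<open>represents i t z a\<close> says that the class of the cocycle \<open>z\<close> in degree \<open>i\<close> is, in the
 description by the Cech complex, that of \<open>a / (x\<^sub>0 \<cdots> x\<^sub>i\<^sub>-\<^sub>1)\<^sup>t\<close>.\<close>

primrec represents :: "nat => nat => ('r, 'm) resolution_elt => ('r, 'm) resolution_elt => bool" where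
 "represents 0 t z a \<longleftrightarrow> z = a & a \<in> cocycles0"
| "represents (Suc i) t z a \<longleftrightarrow> (\<exists>e\<in>tor i i. \<exists>z'. z = d i e & represents i t z' a &
   x i [^] t \<odot>\<^sub>(E i) e \<ominus>\<^sub>(E i) z' \<in> tor (Suc i) i)"

text \<open>Degree and number of parameters agree: in degree \<open>i\<close> the torsion is taken
  for the first \<open>i\<close> parameters, also in the source of the differential, which sits in
  degree \<open>i - 1\<close>.\<close>

primrec boundaries :: "nat => ('r, 'm) resolution_elt set" where
 "boundaries 0 = {\<zero>\<^sub>(E 0)}"
| "boundaries (Suc i) = d i ` tor (Suc i) i"

primrec xprod :: "nat => 'r" where
 "xprod 0 = \<one>"
| "xprod (Suc i) = x i \<otimes> xprod i"

lemma xprod_closed [simp]: "i <= r ==> xprod i \<in> carrier R"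
 by (induction i) auto

lemma represents_tor:
 "i <= r ==> represents i t z a ==> z \<in> tor i i & d i z = \<zero>\<^sub>(E (Suc i)) & a \<in> cocycles0"
proof (induction i arbitrary: z)
 case 0 then show ?case by (auto simp: tor_0 cocycles0_def)
next
 case (Suc i)
 then obtain e z' where e: "e \<in> tor i i" "z = d i e" "represents i t z' a" "x i [^] t \<odot>\<^sub>(E i) e \<ominus>\<^sub>(E i) z' \<in> tor (Suc i) i" by auto
 have i: "i <= r" "i < r" "x i \<in> carrier R" using Suc.prems by auto
 have z': "z' \<in> tor i i" "d i z' = \<zero>\<^sub>(E (Suc i))" "a \<in> cocycles0" using Suc.IH[OF i(1) e(3)] by auto
 note c = tor_closed[OF e(1)] tor_closed[OF z'(1)]
 obtain N :: nat where N: "x i [^] N \<odot>\<^sub>(E i) (x i [^] t \<odot>\<^sub>(E i) e \<ominus>\<^sub>(E i) z') = \<zero>\<^sub>(E i)" using tor_Suc_kill[OF e(4)] by blast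
 have "x i [^] (N + t) \<odot>\<^sub>(E (Suc i)) z = x i [^] N \<odot>\<^sub>(E (Suc i)) (x i [^] t \<odot>\<^sub>(E (Suc i)) z)"
  using i c e(2) by (simp flip: nat_pow_mult add: E.smult_assoc1)
 also have "x i [^] t \<odot>\<^sub>(E (Suc i)) z = d i (x i [^] t \<odot>\<^sub>(E i) e \<ominus>\<^sub>(E i) z')"
  using i c e(2) z'(2) d_minus[of "x i [^] t \<odot>\<^sub>(E i) e" i z'] d_smult[of "x i [^] t" e i] by (simp add: a_minus_def)
 also have "x i [^] N \<odot>\<^sub>(E (Suc i)) \<dots> = \<zero>\<^sub>(E (Suc i))"
  using N d_smult[of "x i [^] N" "x i [^] t \<odot>\<^sub>(E i) e \<ominus>\<^sub>(E i) z'" i] i c d_zero[of i] by simp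
 finally have "z \<in> tor (Suc i) (Suc i)" using tor_SucI[of z i "Suc i" "N + t"] tor_d[OF e(1)] e(2) i by auto
 then show ?case using e(2) d_d c z'(3) by auto
qed

lemma represents_minus:
 "i <= r ==> represents i t z a ==> represents i t w b ==> represents i t (z \<ominus>\<^sub>(E i) w) (a \<ominus>\<^sub>(E 0) b)"
proof (induction i arbitrary: z w)
 case 0 then show ?case using d_minus[of a 0 b] by (auto simp: cocycles0_def a_minus_def)
next
 case (Suc i)
 have i: "i <= r" "Suc i <= r" "i < r" "x i \<in> carrier R" using Suc.prems by auto
 obtain e z' where e: "e \<in> tor i i" "z = d i e" "represents i t z' a" "x i [^] t \<odot>\<^sub>(E i) e \<ominus>\<^sub>(E i) z' \<in> tor (Suc i) i" using Suc.prems by auto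
 obtain e' w' where e': "e' \<in> tor i i" "w = d i e'" "represents i t w' b" "x i [^] t \<odot>\<^sub>(E i) e' \<ominus>\<^sub>(E i) w' \<in> tor (Suc i) i" using Suc.prems by auto
 have z': "z' \<in> carrier (E i)" "w' \<in> carrier (E i)" using represents_tor[OF i(1)] e(3) e'(3) tor_closed by blast+
 note c = tor_closed[OF e(1)] tor_closed[OF e'(1)] z'
 have "x i [^] t \<odot>\<^sub>(E i) (e \<ominus>\<^sub>(E i) e') \<ominus>\<^sub>(E i) (z' \<ominus>\<^sub>(E i) w')
  = (x i [^] t \<odot>\<^sub>(E i) e \<ominus>\<^sub>(E i) z') \<ominus>\<^sub>(E i) (x i [^] t \<odot>\<^sub>(E i) e' \<ominus>\<^sub>(E i) w')"
  using c i by (simp add: a_minus_def E.smult_r_distr E.smult_r_minus E.minus_add E.a_ac)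
 also have "\<dots> \<in> tor (Suc i) i" by (rule tor_minus[OF e(4) e'(4) i(2)])
 finally show ?case
  unfolding represents.simps e(2) e'(2)
  using Suc.IH[OF i(1) e(3) e'(3)] tor_minus[OF e(1) e'(1) i(1)] d_minus[OF c(1,2), symmetric] by blast
qed

lemma represents_smult:
 "i <= r ==> represents i t z a ==> c \<in> carrier R ==> represents i t (c \<odot>\<^sub>(E i) z) (c \<odot>\<^sub>(E 0) a)"
proof (induction i arbitrary: z)
 case 0 then show ?case using d_smult[of c a 0] by (auto simp: cocycles0_def)
next
 case (Suc i)
 have i: "i <= r" "Suc i <= r" "i < r" "x i \<in> carrier R" using Suc.prems by auto
 obtain e z' where e: "e \<in> tor i i" "z = d i e" "represents i t z' a" "x i [^] t \<odot>\<^sub>(E i) e \<ominus>\<^sub>(E i) z' \<in> tor (Suc i) i" using Suc.prems by auto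
 have z': "z' \<in> carrier (E i)" using represents_tor[OF i(1)] e(3) tor_closed by blast+
 note c = tor_closed[OF e(1)] z' Suc.prems(3)
 have "c \<otimes> x i [^] t = x i [^] t \<otimes> c" using c i by (simp add: m_comm)
 then have "c \<odot>\<^sub>(E i) (x i [^] t \<odot>\<^sub>(E i) e) = x i [^] t \<odot>\<^sub>(E i) (c \<odot>\<^sub>(E i) e)"
  using c i by (metis E.smult_assoc1 nat_pow_closed)
 then have "x i [^] t \<odot>\<^sub>(E i) (c \<odot>\<^sub>(E i) e) \<ominus>\<^sub>(E i) (c \<odot>\<^sub>(E i) z')
  = c \<odot>\<^sub>(E i) (x i [^] t \<odot>\<^sub>(E i) e \<ominus>\<^sub>(E i) z')"
  using c i by (simp add: a_minus_def E.smult_r_distr E.smult_r_minus)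
 also have "\<dots> \<in> tor (Suc i) i" by (rule tor_smult[OF e(4) _ i(2)]) (use c in auto)
 finally show ?case
  unfolding represents.simps e(2)
  using Suc.IH[OF i(1) e(3) c(3)] tor_smult[OF e(1) c(3) i(1)] d_smult[OF c(3,1), symmetric] by blast
qed

text \<open>The fraction is expanded by \<open>x_0 ... x_(i-1)\<close>.\<close>

lemma represents_lift: "i <= r ==> represents i t z a ==> represents i (Suc t) z (xprod i \<odot>\<^sub>(E 0) a)"
proof (induction i arbitrary: z)
 case 0 then show ?case by (auto simp: cocycles0_def)
next
 case (Suc i)
 have i: "i <= r" "Suc i <= r" "i < r" "x i \<in> carrier R" using Suc.prems by auto
 obtain e z' where e: "e \<in> tor i i" "z = d i e" "represents i t z' a" "x i [^] t \<odot>\<^sub>(E i) e \<ominus>\<^sub>(E i) z' \<in> tor (Suc i) i" using Suc.prems by auto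
 have z': "z' \<in> carrier (E i)" "a \<in> carrier (E 0)" using represents_tor[OF i(1)] e(3) tor_closed cocycles0_def by blast+
 note c = tor_closed[OF e(1)] z'
 have "x i [^] Suc t \<odot>\<^sub>(E i) e \<ominus>\<^sub>(E i) (x i \<odot>\<^sub>(E i) z') = x i \<odot>\<^sub>(E i) (x i [^] t \<odot>\<^sub>(E i) e \<ominus>\<^sub>(E i) z')"
 proof -
  have "x i [^] Suc t = x i \<otimes> x i [^] t" using i by (simp add: m_comm)
  then show ?thesis using c i by (simp del: nat_pow_Suc add: E.smult_assoc1 a_minus_def E.smult_r_distr E.smult_r_minus)
 qed
 also have "\<dots> \<in> tor (Suc i) i" by (rule tor_smult[OF e(4) i(4,2)])
 finally have 1: "x i [^] Suc t \<odot>\<^sub>(E i) e \<ominus>\<^sub>(E i) (x i \<odot>\<^sub>(E i) z') \<in> tor (Suc i) i" .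
 have "represents i (Suc t) (x i \<odot>\<^sub>(E i) z') (x i \<odot>\<^sub>(E 0) (xprod i \<odot>\<^sub>(E 0) a))"
  by (rule represents_smult[OF i(1) Suc.IH[OF i(1) e(3)] i(4)])
 then have "represents i (Suc t) (x i \<odot>\<^sub>(E i) z') (xprod (Suc i) \<odot>\<^sub>(E 0) a)" using i c by (simp add: E.smult_assoc1)
 then show ?case unfolding represents.simps using 1 e(1,2) by blast
qed

lemma represents_lift_pow: "i <= r ==> represents i t z a ==> represents i (t + s) z (xprod i [^] s \<odot>\<^sub>(E 0) a)"
proof (induction s)
 case 0
 then have "a \<in> carrier (E 0)" using represents_tor[of i t z a] cocycles0_def by auto
 then show ?case using 0 by simp
next
 case (Suc s)
 then have "a \<in> carrier (E 0)" using represents_tor[of i t z a] cocycles0_def by auto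
 moreover have "xprod i [^] Suc s = xprod i \<otimes> xprod i [^] s" using Suc by (simp add: m_comm)
 ultimately show ?case using represents_lift[of i "t + s" z "xprod i [^] s \<odot>\<^sub>(E 0) a"] Suc by (simp del: nat_pow_Suc add: E.smult_assoc1)
qed

text \<open>A preimage \<open>e\<close> of \<open>z\<close> exists by \<open>vanish_above\<close>;
  multiplied by a power of the last parameter it becomes a cocycle of one degree less, which is a
  fraction by induction.\<close>

lemma represents_exists:
 "i <= r ==> z \<in> tor i i ==> d i z = \<zero>\<^sub>(E (Suc i)) ==> \<exists>t a. represents i t z a"
proof (induction i arbitrary: z)
 case 0 then show ?case by (auto simp: cocycles0_def tor_0)
next
 case (Suc i)
 have i: "i <= r" "Suc i <= r" "i < r" "x i \<in> carrier R" using Suc.prems by auto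
 obtain e where e: "e \<in> tor i i" "z = d i e" using vanish_above[of i i z] Suc.prems tor_SucD by auto
 obtain t :: nat where t: "x i [^] t \<odot>\<^sub>(E (Suc i)) z = \<zero>\<^sub>(E (Suc i))" using tor_Suc_kill Suc.prems by blast
 let ?z = "x i [^] t \<odot>\<^sub>(E i) e"
 note c = tor_closed[OF e(1)]
 have "?z \<in> tor i i" using e tor_smult i by simp
 moreover have "d i ?z = \<zero>\<^sub>(E (Suc i))" using d_smult[of "x i [^] t" e i] t e c i by simp
 ultimately obtain t' a where a: "represents i t' ?z a" using Suc.IH i by blast
 \<comment> \<open>Both exponents must become \<open>t' + t\<close>: the earlier parameters are
   expanded by \<open>t\<close>, and the last one by \<open>t'\<close>.\<close>
 have 1: "represents i (t' + t) (x i [^] t' \<odot>\<^sub>(E i) ?z) (x i [^] t' \<odot>\<^sub>(E 0) (xprod i [^] t \<odot>\<^sub>(E 0) a))"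
  by (rule represents_smult[OF i(1) represents_lift_pow[OF i(1) a]]) (use i in auto)
 have "x i [^] (t' + t) \<odot>\<^sub>(E i) e = x i [^] t' \<odot>\<^sub>(E i) ?z" using i c by (simp flip: nat_pow_mult add: E.smult_assoc1)
 then have "x i [^] (t' + t) \<odot>\<^sub>(E i) e \<ominus>\<^sub>(E i) (x i [^] t' \<odot>\<^sub>(E i) ?z) \<in> tor (Suc i) i"
  using tor_zero[OF i(2), of i] i c by (simp add: a_minus_def E.r_neg)
 then show ?case unfolding represents.simps using 1 e by blast
qed

text \<open>Divisibility modulo torsion allows division by \<open>x_0^t\<close>,
  \<open>x_1^t\<close> and so on in turn.\<close>

lemma represents_class: "i <= r ==> a \<in> cocycles0 ==> \<exists>z. represents i t z a"
proof (induction i)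
 case (Suc i)
 have i: "i <= r" "Suc i <= r" "i < r" "x i \<in> carrier R" using Suc.prems by auto
 obtain z where z: "represents i t z a" using Suc by auto
 have zt: "z \<in> tor i i" using represents_tor[OF i(1) z] by blast
 obtain e where e: "e \<in> tor i i" "z \<ominus>\<^sub>(E i) x i [^] t \<odot>\<^sub>(E i) e \<in> tor (Suc i) i" using divisible[OF zt i(3)] by blast
 have "\<zero>\<^sub>(E i) \<ominus>\<^sub>(E i) (z \<ominus>\<^sub>(E i) x i [^] t \<odot>\<^sub>(E i) e) \<in> tor (Suc i) i" by (rule tor_minus[OF tor_zero e(2)]) (use i in auto)
 moreover have "\<zero>\<^sub>(E i) \<ominus>\<^sub>(E i) (z \<ominus>\<^sub>(E i) x i [^] t \<odot>\<^sub>(E i) e) = x i [^] t \<odot>\<^sub>(E i) e \<ominus>\<^sub>(E i) z"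
  using tor_closed[OF e(1)] tor_closed[OF zt] i by (simp add: a_minus_def E.minus_add E.a_ac)
 ultimately have "represents (Suc i) t (d i e) a" unfolding represents.simps using e z by auto
 then show ?case by blast
qed simp

text \<open>The connecting map is well defined on classes. For \<open>i > 0\<close> a boundary
  \<open>z' = d g\<close> is removed by dividing \<open>g\<close> by \<open>x_i^t\<close> modulo
  torsion; then \<open>e\<close> may be replaced by an element killed by a power of
  \<open>x_i\<close> that has the same image.\<close>

lemma boundary_step:
 assumes i: "i < r" and e: "e \<in> tor i i" "z' \<in> boundaries i"
  "x i [^] (t::nat) \<odot>\<^sub>(E i) e \<ominus>\<^sub>(E i) z' \<in> tor (Suc i) i"
 shows "d i e \<in> boundaries (Suc i)"
proof -
 have key: "u \<in> tor (Suc i) i" if u: "u \<in> tor i i" "x i [^] t \<odot>\<^sub>(E i) u \<in> tor (Suc i) i" for u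
 proof -
  obtain N :: nat where N: "x i [^] N \<odot>\<^sub>(E i) (x i [^] t \<odot>\<^sub>(E i) u) = \<zero>\<^sub>(E i)" using tor_Suc_kill[OF u(2)] by blast
  then have "x i [^] (N + t) \<odot>\<^sub>(E i) u = \<zero>\<^sub>(E i)" using i tor_closed[OF u(1)] by (simp flip: nat_pow_mult add: E.smult_assoc1)
  then show ?thesis using tor_SucI[OF u(1) _ i] by blast
 qed
 note c = tor_closed[OF e(1)]
 show ?thesis
 proof (cases i)
  case 0
  then have "x i [^] t \<odot>\<^sub>(E i) e \<in> tor (Suc i) i" using e c x_closed[OF i] by (simp add: a_minus_def E.minus_of_zero)
  then show ?thesis using key e by auto
 next
  case (Suc m)
  then obtain g where g: "g \<in> tor i m" "z' = d m g" using e(2) by auto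
  obtain g' where g': "g' \<in> tor i m" "g \<ominus>\<^sub>(E m) x i [^] t \<odot>\<^sub>(E m) g' \<in> tor (Suc i) m" using divisible[OF g(1) i] by blast
  note c = c tor_closed[OF g(1)] tor_closed[OF g'(1)] x_closed[OF i]
  have 1: "e \<ominus>\<^sub>(E i) d m g' \<in> tor i i" using tor_minus[OF e(1)] tor_d[OF g'(1)] i Suc by auto
  have "d m (g \<ominus>\<^sub>(E m) x i [^] t \<odot>\<^sub>(E m) g') \<in> tor (Suc i) i" using tor_d[OF g'(2)] i Suc by auto
  moreover have "d m (g \<ominus>\<^sub>(E m) x i [^] t \<odot>\<^sub>(E m) g') = z' \<ominus>\<^sub>(E i) x i [^] t \<odot>\<^sub>(E i) d m g'"
   using d_minus[of g m "x i [^] t \<odot>\<^sub>(E m) g'"] d_smult[of "x i [^] t" g' m] c g Suc by simp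
  ultimately have "(x i [^] t \<odot>\<^sub>(E i) e \<ominus>\<^sub>(E i) z') \<oplus>\<^sub>(E i) (z' \<ominus>\<^sub>(E i) x i [^] t \<odot>\<^sub>(E i) d m g') \<in> tor (Suc i) i"
   using tor_add[OF e(3)] i by auto
  moreover have zc: "z' \<in> carrier (E i)" "d m g' \<in> carrier (E i)" using g c Suc by auto
  have "(x i [^] t \<odot>\<^sub>(E i) e \<ominus>\<^sub>(E i) z') \<oplus>\<^sub>(E i) (z' \<ominus>\<^sub>(E i) x i [^] t \<odot>\<^sub>(E i) d m g') = x i [^] t \<odot>\<^sub>(E i) (e \<ominus>\<^sub>(E i) d m g')"
   using c zc by (simp add: a_minus_def E.smult_r_distr E.smult_r_minus E.a_assoc E.r_neg1)
  ultimately have "e \<ominus>\<^sub>(E i) d m g' \<in> tor (Suc i) i" using key[OF 1] by simp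
  moreover have "d i (e \<ominus>\<^sub>(E i) d m g') = d i e"
   using d_minus[of e i "d m g'"] d_d[of g' m] c zc Suc by (simp add: a_minus_def)
  ultimately show ?thesis by (metis boundaries.simps(2) imageI)
 qed
qed

lemma represents_zero: "i <= r ==> represents i t z \<zero>\<^sub>(E 0) ==> z \<in> boundaries i"
proof (induction i arbitrary: z)
 case (Suc i)
 then obtain e z' where e: "e \<in> tor i i" "z = d i e" "represents i t z' \<zero>\<^sub>(E 0)" "x i [^] t \<odot>\<^sub>(E i) e \<ominus>\<^sub>(E i) z' \<in> tor (Suc i) i" by auto
 then show ?case using boundary_step[of i e z' t] Suc by auto
qed auto

text \<open>\<open>x_j\<close> cancels from the denominator of
  \<open>x_j^t b / (x_0 ... x_(i-1))^t\<close>, so the class comes from a localisation in the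
  remaining parameters and is zero.\<close>

lemma represents_multiple:
 "i <= r ==> j < i ==> b \<in> cocycles0 ==> represents i t z (x j [^] t \<odot>\<^sub>(E 0) b) ==> z \<in> boundaries i"
proof (induction i arbitrary: z)
 case (Suc i)
 have i: "i <= r" "Suc i <= r" "i < r" "x i \<in> carrier R" using Suc.prems by auto
 obtain e z' where e: "e \<in> tor i i" "z = d i e" "represents i t z' (x j [^] t \<odot>\<^sub>(E 0) b)" "x i [^] t \<odot>\<^sub>(E i) e \<ominus>\<^sub>(E i) z' \<in> tor (Suc i) i"
  using Suc.prems by auto
 show ?case
 proof (cases "j < i")
  case True
  then have "z' \<in> boundaries i" using Suc e i by auto
  then show ?thesis using boundary_step[OF i(3) e(1) _ e(4)] e by simp
 next
  case False
  then have j: "j = i" using Suc by simp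
  obtain w where w: "represents i t w b" using represents_class[OF i(1) Suc.prems(3)] by blast
  have wt: "w \<in> tor i i" "d i w = \<zero>\<^sub>(E (Suc i))" "z' \<in> tor i i" using represents_tor[OF i(1)] w e by auto
  have b: "b \<in> carrier (E 0)" using Suc.prems cocycles0_def by auto
  note c = tor_closed[OF wt(1)] tor_closed[OF wt(3)] tor_closed[OF e(1)] i(4)
  have "represents i t (z' \<ominus>\<^sub>(E i) x i [^] t \<odot>\<^sub>(E i) w) (x j [^] t \<odot>\<^sub>(E 0) b \<ominus>\<^sub>(E 0) x i [^] t \<odot>\<^sub>(E 0) b)"
   by (rule represents_minus[OF i(1) e(3) represents_smult[OF i(1) w]]) (use i in auto)
  then have 1: "z' \<ominus>\<^sub>(E i) x i [^] t \<odot>\<^sub>(E i) w \<in> boundaries i"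
   using represents_zero[OF i(1)] b i j by (simp add: a_minus_def E.r_neg)
  have "x i [^] t \<odot>\<^sub>(E i) (e \<ominus>\<^sub>(E i) w) \<ominus>\<^sub>(E i) (z' \<ominus>\<^sub>(E i) x i [^] t \<odot>\<^sub>(E i) w) = x i [^] t \<odot>\<^sub>(E i) e \<ominus>\<^sub>(E i) z'"
  proof -
   have "(p \<ominus>\<^sub>(E i) q) \<ominus>\<^sub>(E i) (s \<ominus>\<^sub>(E i) q) = p \<ominus>\<^sub>(E i) s" if "p \<in> carrier (E i)" "q \<in> carrier (E i)" "s \<in> carrier (E i)" for p q s
    using that by (simp add: a_minus_def E.minus_add E.a_ac E.r_neg1 E.r_neg2)
   moreover have "x i [^] t \<odot>\<^sub>(E i) (e \<ominus>\<^sub>(E i) w) = x i [^] t \<odot>\<^sub>(E i) e \<ominus>\<^sub>(E i) x i [^] t \<odot>\<^sub>(E i) w"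
    using c by (simp add: a_minus_def E.smult_r_distr E.smult_r_minus)
   ultimately show ?thesis using c by simp
  qed
  then have "d i (e \<ominus>\<^sub>(E i) w) \<in> boundaries (Suc i)"
   using boundary_step[OF i(3) tor_minus[OF e(1) wt(1) i(1)] 1, of t] e(4) by simp
  moreover have "d i (e \<ominus>\<^sub>(E i) w) = z" using d_minus[of e i w] c wt e by (simp add: a_minus_def)
  ultimately show ?thesis by simp
 qed
qed simp

lemma boundaries_add: "i <= r ==> z \<in> boundaries i ==> w \<in> boundaries i ==> z \<oplus>\<^sub>(E i) w \<in> boundaries i"
proof (cases i)
 case (Suc m)
 assume "i <= r" "z \<in> boundaries i" "w \<in> boundaries i"
 then obtain e e' where e: "e \<in> tor i m" "z = d m e" "e' \<in> tor i m" "w = d m e'" using Suc by auto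
 then have "d m (e \<oplus>\<^sub>(E m) e') = z \<oplus>\<^sub>(E i) w" using d_add tor_closed Suc by metis
 then show ?thesis using tor_add[OF e(1,3) \<open>i <= r\<close>] Suc by (metis boundaries.simps(2) imageI)
qed auto

text \<open>\<open>top\<close> says that \<open>(x_0 ... x_(r-1))^s a\<close> lies in the submodule
  generated by the multiples of the \<open>x_j^(t + s)\<close>, so that
  \<open>a / (x_0 ... x_(r-1))^t\<close> vanishes after expansion by \<open>s\<close>. The submodule
  is described through the additively closed sets \<open>T\<close> that contain these multiples,
  because \<open>T\<close> can then be taken to be a set of numerators.\<close>

lemma vanish_top:
 assumes M: "module R M"
  and top: "!!a t. a \<in> carrier M ==> \<exists>s. \<forall>T. \<zero>\<^sub>M \<in> T & (\<forall>u\<in>T. \<forall>v\<in>T. u \<oplus>\<^sub>M v \<in> T) &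
   (\<forall>j<r. \<forall>b\<in>carrier M. x j [^] (t + s :: nat) \<odot>\<^sub>M b \<in> T) --> xprod r [^] s \<odot>\<^sub>M a \<in> T"
  and z: "z \<in> tor r r" "d r z = \<zero>\<^sub>(E (Suc r))"
 shows "z \<in> boundaries r"
proof -
 interpret M: module R M by fact
 obtain t a' where a': "represents r t z a'" using represents_exists[OF order_refl z] by blast
 have coc: "cocycles0 = \<epsilon> ` carrier M" unfolding cocycles0_def by (rule exact0)
 have "a' \<in> cocycles0" using represents_tor[OF order_refl a'] by blast
 then obtain a where a: "a' = \<epsilon> a" "a \<in> carrier M" unfolding coc by blast
 have eps0: "\<epsilon> u \<in> cocycles0" if "u \<in> carrier M" for u using that unfolding coc by blast
 obtain s where s: "\<forall>T. \<zero>\<^sub>M \<in> T & (\<forall>u\<in>T. \<forall>v\<in>T. u \<oplus>\<^sub>M v \<in> T) &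
   (\<forall>j<r. \<forall>b\<in>carrier M. x j [^] (t + s :: nat) \<odot>\<^sub>M b \<in> T) --> xprod r [^] s \<odot>\<^sub>M a \<in> T"
  using top[OF a(2), of t] by (elim exE)
 \<comment> \<open>Numerators all of whose fractions with exponent \<open>t + s\<close> are
   boundaries. Closure under sums holds because each summand is itself the numerator of some
   class.\<close>
 define T where "T = {u \<in> carrier M. \<forall>w. represents r (t + s) w (\<epsilon> u) --> w \<in> boundaries r}"
 have "xprod r [^] s \<odot>\<^sub>M a \<in> T"
 proof (rule s[THEN spec, THEN mp], intro conjI)
  have "\<epsilon> \<zero>\<^sub>M = \<zero>\<^sub>(E 0)" using module_hom_zero[OF M E_mod eps_hom] .
  then show "\<zero>\<^sub>M \<in> T" unfolding T_def using represents_zero by auto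
  show "\<forall>u\<in>T. \<forall>v\<in>T. u \<oplus>\<^sub>M v \<in> T"
  proof (intro ballI)
   fix u v assume uv: "u \<in> T" "v \<in> T"
   have "w \<in> boundaries r" if w: "represents r (t + s) w (\<epsilon> (u \<oplus>\<^sub>M v))" for w
   proof -
    have uvc: "u \<in> carrier M" "v \<in> carrier M" "\<epsilon> u \<in> carrier (E 0)" "\<epsilon> v \<in> carrier (E 0)"
     using uv module_homD(1)[OF eps_hom] unfolding T_def by auto
    obtain w' where w': "represents r (t + s) w' (\<epsilon> u)" using represents_class eps0 uvc by blast
    have "represents r (t + s) (w \<ominus>\<^sub>(E r) w') (\<epsilon> (u \<oplus>\<^sub>M v) \<ominus>\<^sub>(E 0) \<epsilon> u)" by (rule represents_minus[OF order_refl w w'])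
    moreover have "\<epsilon> (u \<oplus>\<^sub>M v) \<ominus>\<^sub>(E 0) \<epsilon> u = \<epsilon> v"
     using module_homD(2)[OF eps_hom uvc(1,2)] uvc by (simp add: E.add_minus_cancel)
    ultimately have "w \<ominus>\<^sub>(E r) w' \<in> boundaries r" "w' \<in> boundaries r" using uv w' unfolding T_def by auto
    then have "w' \<oplus>\<^sub>(E r) (w \<ominus>\<^sub>(E r) w') \<in> boundaries r" by (intro boundaries_add) auto
    moreover have "w \<in> carrier (E r)" "w' \<in> carrier (E r)" using represents_tor[OF order_refl] w w' tor_closed by blast+
    ultimately show ?thesis by (simp add: E.add_minus_cancel)
   qed
   then show "u \<oplus>\<^sub>M v \<in> T" using uv unfolding T_def by auto
  qed
  show "\<forall>j<r. \<forall>b\<in>carrier M. x j [^] (t + s) \<odot>\<^sub>M b \<in> T"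
  proof (intro allI impI ballI)
   fix j b assume j: "j < r" and b: "b \<in> carrier M"
   have "\<epsilon> (x j [^] (t + s) \<odot>\<^sub>M b) = x j [^] (t + s) \<odot>\<^sub>(E 0) \<epsilon> b" by (rule module_homD(3)[OF eps_hom]) (use j b in auto)
   then show "x j [^] (t + s) \<odot>\<^sub>M b \<in> T" unfolding T_def using represents_multiple[of r j "\<epsilon> b"] j b eps0[OF b] by auto
  qed
 qed
 moreover have "\<epsilon> (xprod r [^] s \<odot>\<^sub>M a) = xprod r [^] s \<odot>\<^sub>(E 0) \<epsilon> a" by (rule module_homD(3)[OF eps_hom]) (use a in auto)
 ultimately show ?thesis using represents_lift_pow[OF order_refl a', of s] a unfolding T_def by auto
qed

lemma cohomology_trivial:
 assumes M: "module R M"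
  and top: "!!a t. a \<in> carrier M ==> \<exists>s. \<forall>T. \<zero>\<^sub>M \<in> T & (\<forall>u\<in>T. \<forall>v\<in>T. u \<oplus>\<^sub>M v \<in> T) &
   (\<forall>j<r. \<forall>b\<in>carrier M. x j [^] (t + s :: nat) \<odot>\<^sub>M b \<in> T) --> xprod r [^] s \<odot>\<^sub>M a \<in> T"
  and I: "!!n. \<Gamma> R I (E n) = tor r n" and n: "r <= n"
 shows "carrier (torsion_cohomology R I E d n) = {\<one>\<^sub>(torsion_cohomology R I E d n)}"
proof -
 define H where "H = (case n of 0 => {\<zero>\<^sub>(E 0)} | Suc j => d j ` tor r j)"
 define Z where "Z = {z \<in> tor r n. d n z = \<zero>\<^sub>(E (Suc n))}"
 let ?G = "(add_monoid (E n)) \<lparr>carrier := Z\<rparr>"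
 have co: "torsion_cohomology R I E d n = ?G Mod H"
  unfolding torsion_cohomology_def I Z_def H_def by simp
 \<comment> \<open>In degree \<open>r\<close> by the argument with fractions, above it because the
   degree exceeds the number of parameters.\<close>
 have HZ: "Z <= H"
 proof
  fix z assume z: "z \<in> Z"
  show "z \<in> H"
  proof (cases "n = r")
   case True
   then have "z \<in> boundaries r" using vanish_top[OF M top] z unfolding Z_def by blast
   then show ?thesis unfolding H_def using True by (cases r) auto
  next
   case False
   then obtain m where m: "n = Suc m" "r <= m" using n by (cases n) auto
   then show ?thesis using vanish_above[of r m z] z unfolding Z_def H_def by auto
  qed
 qed
 have Hc: "h \<in> carrier (E n)" if "h \<in> H" for h using that unfolding H_def by (auto split: nat.splits dest: tor_closed)
 have Hadd: "h \<oplus>\<^sub>(E n) h' \<in> H" if hh: "h \<in> H" "h' \<in> H" for h h'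
 proof (cases n)
  case (Suc m)
  then obtain e e' where "e \<in> tor r m" "h = d m e" "e' \<in> tor r m" "h' = d m e'" using hh unfolding H_def by auto
  then show ?thesis using d_add[of e m e'] tor_add[of e r m e'] tor_closed unfolding H_def Suc nat.case(2)
   by (intro image_eqI[where x = "e \<oplus>\<^sub>(E m) e'"]) auto
 qed (use hh in "auto simp: H_def")
 have Hneg: "\<ominus>\<^sub>(E n) h \<in> H" if hh: "h \<in> H" for h
 proof (cases n)
  case (Suc m)
  then obtain e where e: "e \<in> tor r m" "h = d m e" using hh unfolding H_def by auto
  then have "d m (\<zero>\<^sub>(E m) \<ominus>\<^sub>(E m) e) = \<ominus>\<^sub>(E n) h" using d_minus[of "\<zero>\<^sub>(E m)" m e] tor_closed[OF e(1)] d_zero Suc by (simp add: a_minus_def)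
  moreover have "\<zero>\<^sub>(E m) \<ominus>\<^sub>(E m) e \<in> tor r m" by (rule tor_minus[OF tor_zero e(1)]) auto
  ultimately show ?thesis unfolding H_def Suc nat.case(2) by (intro image_eqI[where x = "\<zero>\<^sub>(E m) \<ominus>\<^sub>(E m) e"]) (auto simp: Suc)
 qed (use hh in "auto simp: H_def")
 have coset: "H #>\<^bsub>?G\<^esub> z = H" if z: "z \<in> H" for z
 proof -
  have "H #>\<^bsub>?G\<^esub> z = (%h. h \<oplus>\<^sub>(E n) z) ` H" unfolding r_coset_def by auto
  also have "\<dots> = H"
  proof
   show "(%h. h \<oplus>\<^sub>(E n) z) ` H <= H" using Hadd z by auto
   show "H <= (%h. h \<oplus>\<^sub>(E n) z) ` H"
   proof
    fix h assume h: "h \<in> H"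
    then have "h = (h \<oplus>\<^sub>(E n) \<ominus>\<^sub>(E n) z) \<oplus>\<^sub>(E n) z" using Hc z by (simp add: E.a_assoc E.l_neg)
    then show "h \<in> (%h. h \<oplus>\<^sub>(E n) z) ` H" using Hadd[OF h Hneg[OF z]] by blast
   qed
  qed
  finally show ?thesis .
 qed
 have ne: "\<zero>\<^sub>(E n) \<in> Z" unfolding Z_def using tor_zero d_zero by auto
 have "carrier (?G Mod H) = (%z. H #>\<^bsub>?G\<^esub> z) ` Z" unfolding FactGroup_def RCOSETS_def by auto
 also have "\<dots> = {H}" using coset HZ ne by auto
 finally have "carrier (?G Mod H) = {H}" .
 moreover have "\<one>\<^sub>(?G Mod H) = H" unfolding FactGroup_def by simp
 ultimately show ?thesis unfolding co by simp
qed

end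

section \<open>The forcing algebra as a commutative algebra\<close>

lemma finite_submultisets: "finite {k. k \<subseteq># m}"
proof (induction m)
 case empty then show ?case by simp
next
 case (add x m)
 have "{k. k \<subseteq># add_mset x m} <= {k. k \<subseteq># m} \<union> add_mset x ` {k. k \<subseteq># m}"
 proof
  fix k assume "k \<in> {k. k \<subseteq># add_mset x m}"
  then have k: "k \<subseteq># add_mset x m" by simp
  show "k \<in> {k. k \<subseteq># m} \<union> add_mset x ` {k. k \<subseteq># m}"
  proof (cases "x \<in># k")
   case True
   then obtain k' where "k = add_mset x k'" by (metis insert_DiffM)
   then show ?thesis using k by auto
  next
   case False
   then have "k \<subseteq># m" using k by (metis add_mset_remove_trivial diff_single_trivial mset_subset_eq_add_mset_cancel
      subset_eq_diff_conv add_mset_add_single diff_subset_eq_self subset_mset.order_trans)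
   then show ?thesis by simp
  qed
 qed
 then show ?case using add by (auto intro: finite_subset)
qed

lemma submultiset_diff_diff: "k \<subseteq># m ==> m - (m - k) = k"
 by (simp add: multiset_eq_iff subseteq_mset_def)

context cring
begin

section \<open>Convolution of indexed polynomials\<close>

abbreviation mpolys :: "'v set => ('v multiset => 'a) set" where
 "mpolys I \<equiv> indexed_pset I (carrier R)"

text \<open>Closure and associativity come from induction on how \<open>mpolys\<close> arises from
  constants, sums and multiplication by a variable, since all three pass through the first argument
  of \<open>conv\<close>. Commutativity is the symmetry \<open>k \<mapsto> m - k\<close> of the
  submultisets of \<open>m\<close>.\<close>

definition conv :: "('v multiset => 'a) => ('v multiset => 'a) => ('v multiset => 'a)" where
 "conv P Q = (%m. \<Oplus>k\<in>{k. k \<subseteq># m}. P k \<otimes> Q (m - k))"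

lemma mpolys_coeff: "P \<in> mpolys I ==> P m \<in> carrier R"
 using indexed_pset_in_carrier[of "carrier R" P I] unfolding carrier_coeff_def by auto

lemma conv_comm:
 fixes P Q :: "'v multiset => 'a"
 assumes "!!m. P m \<in> carrier R" "!!m. Q m \<in> carrier R"
 shows "conv P Q = conv Q P"
proof
 fix m :: "'v multiset"
 have inj: "inj_on (%k. m - k) {k. k \<subseteq># m}"
  by (rule inj_onI) (metis mem_Collect_eq submultiset_diff_diff)
 have im: "(%k. m - k) ` {k. k \<subseteq># m} = {k. k \<subseteq># m}"
 proof
  show "{k. k \<subseteq># m} <= (%k. m - k) ` {k. k \<subseteq># m}"
  proof
   fix k assume "k \<in> {k. k \<subseteq># m}"
   then have "k = m - (m - k)" "m - k \<subseteq># m" by (auto simp: submultiset_diff_diff)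
   then show "k \<in> (%k. m - k) ` {k. k \<subseteq># m}" by blast
  qed
 qed auto
 have "(\<Oplus>k\<in>(%k. m - k) ` {k. k \<subseteq># m}. P k \<otimes> Q (m - k)) = (\<Oplus>k\<in>{k. k \<subseteq># m}. P (m - k) \<otimes> Q (m - (m - k)))"
  by (rule finsum_reindex) (use assms inj in auto)
 also have "\<dots> = (\<Oplus>k\<in>{k. k \<subseteq># m}. Q k \<otimes> P (m - k))"
  by (rule finsum_cong') (use assms in "auto simp: submultiset_diff_diff m_comm")
 finally show "conv P Q m = conv Q P m" unfolding conv_def im .
qed

lemma conv_const:
 assumes "c \<in> carrier R" "!!m. Q m \<in> carrier R"
 shows "conv (indexed_const c) Q = (%m. c \<otimes> Q m)"
proof
 fix m
 have "conv (indexed_const c) Q m = (\<Oplus>k\<in>{k. k \<subseteq># m}. if {#} = k then c \<otimes> Q (m - k) else \<zero>)"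
  unfolding conv_def by (rule finsum_cong') (use assms in "auto simp: indexed_const_def")
 also have "\<dots> = c \<otimes> Q (m - {#})" by (rule finsum_singleton) (use assms finite_submultisets in auto)
 finally show "conv (indexed_const c) Q m = c \<otimes> Q m" by simp
qed

lemma conv_padd:
 assumes "!!m. P m \<in> carrier R" "!!m. P' m \<in> carrier R" "!!m. Q m \<in> carrier R"
 shows "conv (indexed_padd P P') Q = indexed_padd (conv P Q) (conv P' Q)"
proof
 fix m
 have "conv (indexed_padd P P') Q m = (\<Oplus>k\<in>{k. k \<subseteq># m}. P k \<otimes> Q (m - k) \<oplus> P' k \<otimes> Q (m - k))"
  unfolding conv_def indexed_padd_def by (rule finsum_cong') (use assms in "auto simp: l_distr")
 also have "\<dots> = indexed_padd (conv P Q) (conv P' Q) m"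
  unfolding conv_def indexed_padd_def by (rule finsum_addf) (use assms in auto)
 finally show "conv (indexed_padd P P') Q m = indexed_padd (conv P Q) (conv P' Q) m" .
qed

lemma conv_pmult:
 assumes "!!m. P m \<in> carrier R" "!!m. Q m \<in> carrier R"
 shows "conv (indexed_pmult P i) Q = indexed_pmult (conv P Q) i"
proof
 fix m
 show "conv (indexed_pmult P i) Q m = indexed_pmult (conv P Q) i m"
 proof (cases "i \<in># m")
  case True
  let ?A = "{k. k \<subseteq># m - {#i#}}"
  have A: "add_mset i ` ?A <= {k. k \<subseteq># m}" using True by (auto simp: insert_subset_eq_iff)
  have "conv (indexed_pmult P i) Q m = (\<Oplus>k\<in>add_mset i ` ?A. P (k - {#i#}) \<otimes> Q (m - k))"
   unfolding conv_def
  proof (rule add.finprod_mono_neutral_cong_left[symmetric])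
   show "!!k. k \<in> {k. k \<subseteq># m} - add_mset i ` ?A ==> indexed_pmult P i k \<otimes> Q (m - k) = \<zero>"
   proof -
    fix k assume k: "k \<in> {k. k \<subseteq># m} - add_mset i ` ?A"
    have "i \<notin># k"
    proof
     assume "i \<in># k"
     then obtain k' where "k = add_mset i k'" by (metis insert_DiffM)
     then show False using k by (auto simp: insert_subset_eq_iff)
    qed
    then show "indexed_pmult P i k \<otimes> Q (m - k) = \<zero>" using assms by (simp add: indexed_pmult_def)
   qed
  qed (use assms A finite_submultisets in "auto simp: indexed_pmult_def")
  also have "\<dots> = (\<Oplus>k\<in>?A. P (add_mset i k - {#i#}) \<otimes> Q (m - add_mset i k))"
   by (rule finsum_reindex) (use assms in "auto simp: inj_on_def")
  also have "\<dots> = (\<Oplus>k\<in>?A. P k \<otimes> Q (m - {#i#} - k))"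
   by (rule finsum_cong') (use assms in auto)
  finally show ?thesis using True unfolding conv_def indexed_pmult_def by simp
 next
  case False
  have "conv (indexed_pmult P i) Q m = (\<Oplus>k\<in>{k. k \<subseteq># m}. \<zero>)"
   unfolding conv_def
   by (rule finsum_cong') (use assms False in "auto simp: indexed_pmult_def dest: mset_subset_eqD")
  then show ?thesis using False by (simp add: indexed_pmult_def)
 qed
qed

lemma conv_coeff: "(!!m. P m \<in> carrier R) ==> (!!m. Q m \<in> carrier R) ==> conv P Q m \<in> carrier R"
 unfolding conv_def by (rule finsum_closed) auto

lemma mpolys_smult:
 assumes "Q \<in> mpolys I" "c \<in> carrier R" shows "(%m. c \<otimes> Q m) \<in> mpolys I"
 using assms(1)
proof (induction rule: indexed_pset.induct)
 case (indexed_const a)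
 have *: "(%m. c \<otimes> indexed_const a m) = indexed_const (c \<otimes> a)" unfolding indexed_const_def using assms by auto
 show ?case unfolding * by (rule indexed_pset.indexed_const) (use indexed_const assms in auto)
next
 case (indexed_padd P Q)
 have "(%m. c \<otimes> indexed_padd P Q m) = indexed_padd (%m. c \<otimes> P m) (%m. c \<otimes> Q m)"
  unfolding indexed_padd_def using mpolys_coeff[OF indexed_padd.hyps(1)] mpolys_coeff[OF indexed_padd.hyps(2)] assms(2) by (simp add: r_distr)
 then show ?case using indexed_padd indexed_pset.indexed_padd by metis
next
 case (indexed_pmult P i)
 have "(%m. c \<otimes> indexed_pmult P i m) = indexed_pmult (%m. c \<otimes> P m) i"
  unfolding indexed_pmult_def using assms by auto
 then show ?case using indexed_pmult indexed_pset.indexed_pmult by metis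
qed

lemma mpolys_conv:
 assumes "P \<in> mpolys I" "Q \<in> mpolys I" shows "conv P Q \<in> mpolys I"
 using assms(1)
proof (induction rule: indexed_pset.induct)
 case (indexed_const a)
 then show ?case using conv_const[of a Q] mpolys_smult[OF assms(2)] mpolys_coeff[OF assms(2)] by simp
next
 case (indexed_padd P P')
 then show ?case using conv_padd[of P P' Q] mpolys_coeff assms(2) indexed_pset.indexed_padd by metis
next
 case (indexed_pmult P i)
 then show ?case using conv_pmult[of P Q i] mpolys_coeff assms(2) indexed_pset.indexed_pmult by metis
qed

lemma conv_assoc:
 assumes "P \<in> mpolys I" "Q \<in> mpolys I" "S \<in> mpolys I"
 shows "conv (conv P Q) S = conv P (conv Q S)"
 using assms(1)
proof (induction rule: indexed_pset.induct)
 case (indexed_const a)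
 note c = mpolys_coeff[OF assms(2)] mpolys_coeff[OF assms(3)]
 have "conv (%m. a \<otimes> Q m) S m = a \<otimes> conv Q S m" for m
 proof -
  have "conv (%m. a \<otimes> Q m) S m = (\<Oplus>k\<in>{k. k \<subseteq># m}. a \<otimes> (Q k \<otimes> S (m - k)))"
   unfolding conv_def by (rule finsum_cong') (use c indexed_const in "auto simp: m_assoc")
  also have "\<dots> = a \<otimes> conv Q S m"
   unfolding conv_def by (rule finsum_rdistr[symmetric]) (use c indexed_const finite_submultisets in auto)
  finally show ?thesis .
 qed
 moreover have "conv (indexed_const a) Q = (%m. a \<otimes> Q m)" by (rule conv_const) (use c indexed_const in auto)
 moreover have "conv (indexed_const a) (conv Q S) = (%m. a \<otimes> conv Q S m)"
  by (rule conv_const[OF indexed_const conv_coeff[OF c]])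
 ultimately show ?case by auto
next
 case (indexed_padd P P')
 note c = mpolys_coeff[OF assms(2)] mpolys_coeff[OF assms(3)] mpolys_coeff[OF indexed_padd.hyps(1)] mpolys_coeff[OF indexed_padd.hyps(2)]
 have "conv (conv (indexed_padd P P') Q) S = conv (indexed_padd (conv P Q) (conv P' Q)) S" using conv_padd[of P P' Q] c by simp
 also have "\<dots> = indexed_padd (conv (conv P Q) S) (conv (conv P' Q) S)" by (rule conv_padd) (use c in "auto intro!: conv_coeff")
 also have "\<dots> = indexed_padd (conv P (conv Q S)) (conv P' (conv Q S))" using indexed_padd by simp
 also have "\<dots> = conv (indexed_padd P P') (conv Q S)" by (rule conv_padd[symmetric]) (use c in "auto intro!: conv_coeff")
 finally show ?case .
next
 case (indexed_pmult P i)
 note c = mpolys_coeff[OF assms(2)] mpolys_coeff[OF assms(3)] mpolys_coeff[OF indexed_pmult.hyps(1)]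
 have "conv (conv (indexed_pmult P i) Q) S = conv (indexed_pmult (conv P Q) i) S" using conv_pmult[of P Q] c by simp
 also have "\<dots> = indexed_pmult (conv (conv P Q) S) i" by (rule conv_pmult) (use c in "auto intro!: conv_coeff")
 also have "\<dots> = indexed_pmult (conv P (conv Q S)) i" using indexed_pmult by simp
 also have "\<dots> = conv (indexed_pmult P i) (conv Q S)" by (rule conv_pmult[symmetric]) (use c in "auto intro!: conv_coeff")
 finally show ?case .
qed

lemma mpoly_ring_simps [simp]:
 "carrier (mpoly_ring R I) = mpolys I" "monoid.mult (mpoly_ring R I) = conv"
 "one (mpoly_ring R I) = indexed_const \<one>" "ring.zero (mpoly_ring R I) = indexed_const \<zero>"
 "add (mpoly_ring R I) = indexed_padd"
 unfolding mpoly_ring_def conv_def by auto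

lemma mpoly_ring_cring: "cring (mpoly_ring R I)"
proof (rule cringI)
 show "abelian_group (mpoly_ring R I)"
 proof (rule abelian_groupI)
  fix P assume P: "P \<in> carrier (mpoly_ring R I)"
  have "(%m. \<ominus> \<one> \<otimes> P m) \<in> mpolys I" by (rule mpolys_smult) (use P in auto)
  moreover have "indexed_padd (%m. \<ominus> \<one> \<otimes> P m) P = indexed_const \<zero>"
   unfolding indexed_padd_def indexed_zero_def using P mpolys_coeff[of P I] by (auto simp: l_minus l_neg)
  ultimately show "\<exists>y\<in>carrier (mpoly_ring R I). y \<oplus>\<^sub>(mpoly_ring R I) P = \<zero>\<^sub>(mpoly_ring R I)" by auto
 next
  fix P assume P: "P \<in> carrier (mpoly_ring R I)"
  show "\<zero>\<^sub>(mpoly_ring R I) \<oplus>\<^sub>(mpoly_ring R I) P = P"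
   using P mpolys_coeff[of P I] by (simp add: indexed_padd_def indexed_zero_def)
 next
  fix P Q S assume P: "P \<in> carrier (mpoly_ring R I)" "Q \<in> carrier (mpoly_ring R I)" "S \<in> carrier (mpoly_ring R I)"
  then show "P \<oplus>\<^sub>(mpoly_ring R I) Q \<oplus>\<^sub>(mpoly_ring R I) S = P \<oplus>\<^sub>(mpoly_ring R I) (Q \<oplus>\<^sub>(mpoly_ring R I) S)"
   using mpolys_coeff[of P I] mpolys_coeff[of Q I] mpolys_coeff[of S I] by (simp add: indexed_padd_def a_assoc)
 next
  fix P Q assume P: "P \<in> carrier (mpoly_ring R I)" "Q \<in> carrier (mpoly_ring R I)"
  then show "P \<oplus>\<^sub>(mpoly_ring R I) Q = Q \<oplus>\<^sub>(mpoly_ring R I) P"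
   using mpolys_coeff[of P I] mpolys_coeff[of Q I] by (simp add: indexed_padd_def a_comm)
 qed (auto intro: indexed_pset.intros)
 show "comm_monoid (mpoly_ring R I)"
 proof (rule comm_monoidI)
  fix P assume P: "P \<in> carrier (mpoly_ring R I)"
  show "\<one>\<^sub>(mpoly_ring R I) \<otimes>\<^sub>(mpoly_ring R I) P = P"
   using P mpolys_coeff[of P I] conv_const[of \<one> P] by simp
 next
  fix P Q assume P: "P \<in> carrier (mpoly_ring R I)" "Q \<in> carrier (mpoly_ring R I)"
  then show "P \<otimes>\<^sub>(mpoly_ring R I) Q = Q \<otimes>\<^sub>(mpoly_ring R I) P" using conv_comm[of P Q] mpolys_coeff[of P I] mpolys_coeff[of Q I] by simp
 qed (auto intro: indexed_pset.intros mpolys_conv conv_assoc)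
 fix P Q S assume "P \<in> carrier (mpoly_ring R I)" "Q \<in> carrier (mpoly_ring R I)" "S \<in> carrier (mpoly_ring R I)"
 then show "(P \<oplus>\<^sub>(mpoly_ring R I) Q) \<otimes>\<^sub>(mpoly_ring R I) S = P \<otimes>\<^sub>(mpoly_ring R I) S \<oplus>\<^sub>(mpoly_ring R I) Q \<otimes>\<^sub>(mpoly_ring R I) S"
  using conv_padd[of P Q S] mpolys_coeff[of P I] mpolys_coeff[of Q I] mpolys_coeff[of S I] by simp
qed

lemma indexed_const_hom:
 fixes I :: "'v set"
 shows "indexed_const \<in> ring_hom R (mpoly_ring R I)"
proof (rule ring_hom_memI)
 fix a b assume ab: "a \<in> carrier R" "b \<in> carrier R"
 show "indexed_const (a \<otimes> b) = indexed_const a \<otimes>\<^sub>(mpoly_ring R I) indexed_const b"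
 proof -
  have "conv (indexed_const a) (indexed_const b :: 'v multiset => 'a) = (%m. a \<otimes> indexed_const b m)"
   by (rule conv_const) (use ab in "auto simp: indexed_const_def")
  moreover have "(%m :: 'v multiset. a \<otimes> indexed_const b m) = indexed_const (a \<otimes> b)" using ab by (auto simp: indexed_const_def)
  ultimately show ?thesis by simp
 qed
 show "indexed_const (a \<oplus> b) = indexed_const a \<oplus>\<^sub>(mpoly_ring R I) indexed_const b"
  using ab by (auto simp: indexed_const_def indexed_padd_def)
qed (auto intro: indexed_pset.intros)

lemma indexed_var_mem: "i \<in> I ==> indexed_var i \<in> mpolys I"
 unfolding indexed_var_def by (auto intro: indexed_pset.intros)

text \<open>All later arguments about the forcing algebra rest on these data: the structure map
  \<psi>, through which scalars act, and the classes \<open>\<tau> i\<close> of the variables, which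
  solve the forcing equation.\<close>

theorem forcing_algebra_structure:
 fixes n f f0
 defines "A \<equiv> forcing_algebra R n f f0"
 assumes f: "!!i. i \<in> {1..n} ==> f i \<in> carrier R" "f0 \<in> carrier R"
 shows "\<exists>\<psi> \<tau>. cring A & \<psi> \<in> ring_hom R A & (\<forall>i\<in>{1..n}. \<tau> i \<in> carrier A) &
  (\<Oplus>\<^sub>A i\<in>{1..n}. \<psi> (f i) \<otimes>\<^sub>A \<tau> i) \<oplus>\<^sub>A \<psi> f0 = \<zero>\<^sub>A &
  (\<forall>a\<in>carrier R. \<forall>x\<in>carrier A. a \<odot>\<^sub>A x = \<psi> a \<otimes>\<^sub>A x) & module R A"
proof -
 define P where "P = mpoly_ring R {1..n}"
 interpret P: cring P unfolding P_def by (rule mpoly_ring_cring)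
 define F where "F = forcing_poly R n f f0"
 have Ps: "(\<Oplus>\<^sub>P i\<in>{1..n}. indexed_const (f i) \<otimes>\<^sub>P indexed_var i) \<oplus>\<^sub>P indexed_const f0 = F"
  unfolding F_def forcing_poly_def P_def Let_def by simp
 have cP: "indexed_const c \<in> carrier P" if "c \<in> carrier R" for c using that unfolding P_def by (auto intro: indexed_pset.intros)
 have vP: "indexed_var i \<in> carrier P" if "i \<in> {1..n}" for i using indexed_var_mem[OF that] unfolding P_def by simp
 have sumP: "(%i. indexed_const (f i) \<otimes>\<^sub>P indexed_var i) \<in> {1..n} \<rightarrow> carrier P" using cP vP f by auto
 have FP: "F \<in> carrier P" unfolding Ps[symmetric] using sumP cP f by (auto intro!: P.finsum_closed)
 define J where "J = PIdl\<^bsub>P\<^esub> F"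
 interpret J: ideal J P unfolding J_def by (rule P.cgenideal_ideal[OF FP])
 define Q where "Q = P Quot J"
 interpret Q: cring Q unfolding Q_def by (rule J.quotient_is_cring[OF P.is_cring])
 define \<pi> where "\<pi> p = J +>\<^sub>P p" for p
 have pi: "\<pi> \<in> ring_hom P Q" unfolding \<pi>_def Q_def using J.rcos_ring_hom by simp
 define \<psi> where "\<psi> c = \<pi> (indexed_const c)" for c
 have psi: "\<psi> \<in> ring_hom R Q" unfolding \<psi>_def
  using ring_hom_trans[OF indexed_const_hom[of "{1..n}"] pi[unfolded P_def]] by (simp add: comp_def)
 have A: "A = ring.extend Q (module.fields (%a x. \<psi> a \<otimes>\<^sub>Q x))"
  unfolding A_def forcing_algebra_def Let_def Q_def J_def F_def P_def \<psi>_def \<pi>_def by simp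
 have As [simp]: "carrier A = carrier Q" "monoid.mult A = monoid.mult Q" "one A = one Q" "ring.zero A = ring.zero Q" "add A = add Q"
  "smult A = (%a x. \<psi> a \<otimes>\<^sub>Q x)" unfolding A ring.defs module.defs by auto
 have Ac: "cring A"
 proof (rule cringI)
  show "abelian_group A"
   by (rule abelian_groupI) (auto simp: Q.a_ac intro: Q.l_neg Q.a_inv_closed exI bexI[of _ "\<ominus>\<^sub>Q x" for x])
  show "comm_monoid A" by (rule comm_monoidI) (auto simp: Q.m_ac)
 qed (auto simp: Q.l_distr)
 interpret A: cring A by fact
 have psiA: "\<psi> \<in> ring_hom R A" using psi unfolding ring_hom_def by simp
 note psiQ = ring_hom_closed[OF psi] ring_hom_mult[OF psi] ring_hom_add[OF psi] ring_hom_one[OF psi]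
 have M: "module R A"
  by (rule moduleI) (auto simp: cring_axioms A.abelian_group_axioms psiQ Q.l_distr Q.r_distr Q.m_assoc)
 define \<tau> where "\<tau> i = \<pi> (indexed_var i)" for i
 have tau: "\<tau> i \<in> carrier A" if "i \<in> {1..n}" for i using ring_hom_closed[OF pi vP[OF that]] by (simp add: \<tau>_def)
 interpret pi: ring_hom_cring P Q \<pi> by unfold_locales (rule pi)
 have "\<pi> F = \<zero>\<^sub>Q"
 proof -
  have "F \<in> J" unfolding J_def by (rule P.cgenideal_self[OF FP])
  then have "J +>\<^sub>P F = J" using J.a_rcos_const by simp
  then show ?thesis unfolding \<pi>_def Q_def FactRing_def by simp
 qed
 then have "\<pi> (\<Oplus>\<^sub>P i\<in>{1..n}. indexed_const (f i) \<otimes>\<^sub>P indexed_var i) \<oplus>\<^sub>Q \<psi> f0 = \<zero>\<^sub>Q"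
  unfolding Ps[symmetric] \<psi>_def using P.finsum_closed[OF sumP] cP f by simp
 moreover have "\<pi> (\<Oplus>\<^sub>P i\<in>{1..n}. indexed_const (f i) \<otimes>\<^sub>P indexed_var i) = (\<Oplus>\<^sub>A i\<in>{1..n}. \<psi> (f i) \<otimes>\<^sub>A \<tau> i)"
 proof -
  have "\<pi> (\<Oplus>\<^sub>P i\<in>{1..n}. indexed_const (f i) \<otimes>\<^sub>P indexed_var i) = (\<Oplus>\<^sub>Q i\<in>{1..n}. (\<pi> \<circ> (%i. indexed_const (f i) \<otimes>\<^sub>P indexed_var i)) i)"
   using pi.hom_finsum[OF sumP] by simp
  also have "\<dots> = (\<Oplus>\<^sub>Q i\<in>{1..n}. \<psi> (f i) \<otimes>\<^sub>Q \<tau> i)"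
   by (rule Q.finsum_cong') (use cP vP f tau psiQ in "auto simp: \<psi>_def \<tau>_def")
  \<comment> \<open>\<open>A\<close> extends the record of \<open>Q\<close> by a scalar
    multiplication, so finite sums agree by unfolding.\<close>
  also have "\<dots> = (\<Oplus>\<^sub>A i\<in>{1..n}. \<psi> (f i) \<otimes>\<^sub>A \<tau> i)"
   unfolding finsum_def by (simp add: finprod_def)
  finally show ?thesis .
 qed
 ultimately show ?thesis using Ac psiA tau M by (intro exI[of _ \<psi>] exI[of _ \<tau>]) auto
qed

end

section \<open>Noetherian rings\<close>

context cring
begin

definition submod :: "'a set => 'a set => bool" where
 "submod A T \<longleftrightarrow> T <= carrier R & \<zero> \<in> T & (\<forall>x\<in>T. \<forall>y\<in>T. x \<oplus> y \<in> T) & (\<forall>a\<in>A. \<forall>x\<in>T. a \<otimes> x \<in> T)"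

definition mod_span :: "'a set => 'a set => 'a set" where
 "mod_span A V = \<Inter>{T. submod A T & V <= T}"

text \<open>A finite generating set is required inside any given \<open>V\<close>, not merely inside
  its span. Subrings of \<open>R\<close> obtained by adjoining generators one by one take the part
  of polynomial rings.\<close>

definition noeth :: "'a set => bool" where
 "noeth A \<longleftrightarrow> subring A R & (\<forall>V\<subseteq>A. \<exists>V0\<subseteq>V. finite V0 & V <= mod_span A V0)"

lemma submodD:
 assumes "submod A T"
 shows "T <= carrier R" "\<zero> \<in> T" "!!x y. x \<in> T ==> y \<in> T ==> x \<oplus> y \<in> T"
  "!!a x. a \<in> A ==> x \<in> T ==> a \<otimes> x \<in> T" "!!x. x \<in> T ==> x \<in> carrier R"
 using assms unfolding submod_def by auto

lemma submod_minus:
 assumes "subring A R" "submod A T" "x \<in> T" "y \<in> T" shows "x \<ominus> y \<in> T"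
proof -
 have "\<ominus> \<one> \<in> A" using subringE(3,5)[OF assms(1)] by blast
 then have "(\<ominus> \<one>) \<otimes> y \<in> T" using submodD(4)[OF assms(2)] assms(4) by blast
 then have "\<ominus> y \<in> T" using submodD(5)[OF assms(2,4)] by (simp add: l_minus)
 then show ?thesis unfolding a_minus_def using submodD(3)[OF assms(2,3)] by blast
qed

lemma mod_span_least: "submod A T ==> V <= T ==> mod_span A V <= T"
 unfolding mod_span_def by auto

lemma mod_span_base: "V <= mod_span A V"
 unfolding mod_span_def by auto

lemma mod_span_mono: "V <= Y ==> mod_span A V <= mod_span A Y"
 unfolding mod_span_def by auto

lemma submod_span:
 assumes "A <= carrier R" "V <= carrier R" shows "submod A (mod_span A V)"
proof -
 have "submod A (carrier R)" unfolding submod_def using assms by auto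
 then have "mod_span A V <= carrier R" using assms mod_span_least by blast
 then show ?thesis unfolding submod_def mod_span_def by auto
qed

text \<open>The spans of the finite subsets of \<open>V\<close> form a directed family, so their
  union is already a submodule.\<close>

lemma mod_span_finite_subset:
 assumes A: "A <= carrier R" and V: "V <= carrier R" and F: "finite F" "F <= mod_span A V"
 shows "\<exists>V0\<subseteq>V. finite V0 & F <= mod_span A V0"
proof -
 define U where "U = (\<Union>V0\<in>{V0. V0 <= V & finite V0}. mod_span A V0)"
 have "submod A U" unfolding submod_def
 proof (intro conjI ballI)
  have s: "submod A (mod_span A V0)" if "V0 <= V" for V0 using submod_span[OF A] that V by auto
  show "U <= carrier R" unfolding U_def using submodD(1)[OF s] by blast
  have "{} <= V" "finite ({} :: 'a set)" by auto
  then show "\<zero> \<in> U" unfolding U_def using submodD(2)[OF s[of "{}"]] by blast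
  fix x y assume "x \<in> U" "y \<in> U"
  then obtain V1 V2 where *: "V1 <= V" "finite V1" "x \<in> mod_span A V1" "V2 <= V" "finite V2" "y \<in> mod_span A V2" unfolding U_def by auto
  then have "x \<in> mod_span A (V1 \<union> V2)" "y \<in> mod_span A (V1 \<union> V2)"
   using subsetD[OF mod_span_mono[OF Un_upper1]] subsetD[OF mod_span_mono[OF Un_upper2]] by blast+
  then have "x \<oplus> y \<in> mod_span A (V1 \<union> V2)" using submodD(3)[OF s[of "V1 \<union> V2"]] *(1,4) by simp
  then show "x \<oplus> y \<in> U" unfolding U_def using * by (intro UN_I[of "V1 \<union> V2"]) auto
 next
  have s: "submod A (mod_span A V0)" if "V0 <= V" for V0 using submod_span[OF A] that V by auto
  fix a x assume a: "a \<in> A" and "x \<in> U"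
  then obtain V1 where *: "V1 <= V" "finite V1" "x \<in> mod_span A V1" unfolding U_def by auto
  then have "a \<otimes> x \<in> mod_span A V1" using submodD(4)[OF s a] by blast
  then show "a \<otimes> x \<in> U" unfolding U_def using * by (intro UN_I[of V1]) auto
 qed
 moreover have "V <= U"
 proof
  fix x assume "x \<in> V"
  then have "{x} <= V" "finite {x}" "x \<in> mod_span A {x}" using mod_span_base by auto
  then show "x \<in> U" unfolding U_def by blast
 qed
 ultimately have "F <= U" using mod_span_least F by blast
 with F(1) show ?thesis
 proof (induction F rule: finite_induct)
  case empty then show ?case by (intro exI[of _ "{}"]) auto
 next
  case (insert f F)
  then obtain V1 where V1: "V1 <= V" "finite V1" "F <= mod_span A V1" by auto
  obtain V2 where V2: "V2 <= V" "finite V2" "f \<in> mod_span A V2" using insert U_def by auto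
  then show ?case using V1 mod_span_mono[of V1 "V1 \<union> V2" A] mod_span_mono[of V2 "V1 \<union> V2" A]
   by (intro exI[of _ "V1 \<union> V2"]) auto
 qed
qed

text \<open>Values at \<open>g\<close> of polynomials of degree less than \<open>d\<close>. As
  \<open>g\<close> may be algebraic over \<open>A\<close>, an element can have several such
  expressions, and the arguments quantify over expressions instead of assigning a degree to an
  element.\<close>

primrec polys_below :: "'a set => 'a => nat => 'a set" where
 "polys_below A g 0 = {\<zero>}"
| "polys_below A g (Suc d) = {b \<oplus> a \<otimes> g [^] d | a b. a \<in> A & b \<in> polys_below A g d}"

section \<open>Adjoining one element to a Noetherian subring\<close>

context
 fixes A g assumes A: "subring A R" and g: "g \<in> carrier R"
begin

lemma A_facts: "A <= carrier R" "\<zero> \<in> A" "\<one> \<in> A" "!!a b. a \<in> A ==> b \<in> A ==> a \<oplus> b \<in> A"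
 "!!a b. a \<in> A ==> b \<in> A ==> a \<otimes> b \<in> A" "!!a. a \<in> A ==> \<ominus> a \<in> A" "!!a. a \<in> A ==> a \<in> carrier R"
 using subringE[OF A] by auto

lemma polys_below_submod: "submod A (polys_below A g d)"
proof (induction d)
 case 0 then show ?case unfolding submod_def using A_facts by auto
next
 case (Suc d)
 note IH = submodD[OF Suc]
 show ?case unfolding submod_def
 proof (intro conjI ballI)
  show "polys_below A g (Suc d) <= carrier R" using IH A_facts g by auto
  have "\<zero> = \<zero> \<oplus> \<zero> \<otimes> g [^] d" using g by simp
  then show "\<zero> \<in> polys_below A g (Suc d)" using IH(2) A_facts(2) unfolding polys_below.simps by blast
 next
  fix x y assume "x \<in> polys_below A g (Suc d)" "y \<in> polys_below A g (Suc d)"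
  then obtain a b a' b' where *: "x = b \<oplus> a \<otimes> g [^] d" "y = b' \<oplus> a' \<otimes> g [^] d" "a \<in> A" "a' \<in> A" "b \<in> polys_below A g d" "b' \<in> polys_below A g d" by auto
  have "b \<oplus> a \<otimes> z \<oplus> (b' \<oplus> a' \<otimes> z) = (b \<oplus> b') \<oplus> (a \<oplus> a') \<otimes> z" if "z \<in> carrier R" for z
  proof -
   have "a \<in> carrier R" "a' \<in> carrier R" "b \<in> carrier R" "b' \<in> carrier R" using * IH(5) A_facts(7) by auto
   then show ?thesis using that by algebra
  qed
  then have "x \<oplus> y = (b \<oplus> b') \<oplus> (a \<oplus> a') \<otimes> g [^] d" using * g by simp
  then show "x \<oplus> y \<in> polys_below A g (Suc d)" using * IH(3) A_facts(4) unfolding polys_below.simps by blast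
 next
  fix c x assume "c \<in> A" "x \<in> polys_below A g (Suc d)"
  then obtain a b where *: "c \<in> A" "x = b \<oplus> a \<otimes> g [^] d" "a \<in> A" "b \<in> polys_below A g d" by auto
  then have "c \<otimes> x = c \<otimes> b \<oplus> (c \<otimes> a) \<otimes> g [^] d" using IH(5) A_facts(7) g by (simp add: r_distr m_assoc)
  then show "c \<otimes> x \<in> polys_below A g (Suc d)" using * IH(4) A_facts(5) unfolding polys_below.simps by blast
 qed
qed

lemmas pb = submodD[OF polys_below_submod]

lemma polys_below_Suc: "polys_below A g d <= polys_below A g (Suc d)"
proof
 fix b assume b: "b \<in> polys_below A g d"
 then have "b = b \<oplus> \<zero> \<otimes> g [^] d" using g pb(5) by simp
 then show "b \<in> polys_below A g (Suc d)" using b A_facts(2) unfolding polys_below.simps by blast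
qed

lemma polys_below_mono: "d <= e ==> b \<in> polys_below A g d ==> b \<in> polys_below A g e"
 by (induction rule: dec_induct) (use polys_below_Suc in auto)

lemma polys_below_shift: "b \<in> polys_below A g d ==> g [^] e \<otimes> b \<in> polys_below A g (e + d)"
proof (induction d arbitrary: b)
 case 0 then show ?case using g pb(2) by auto
next
 case (Suc d)
 then obtain a b' where *: "b = b' \<oplus> a \<otimes> g [^] d" "a \<in> A" "b' \<in> polys_below A g d" by auto
 have "g [^] e \<otimes> b = g [^] e \<otimes> b' \<oplus> a \<otimes> g [^] (e + d)"
  using * g pb(5)[OF *(3)] A_facts(7) by (simp add: r_distr m_lcomm nat_pow_mult)
 then show ?case using Suc.IH[OF *(3)] * by (simp, blast)
qed

definition polys :: "'a set" where "polys = (\<Union>d. polys_below A g d)"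

lemma polys_mult:
 "b \<in> polys_below A g d ==> c \<in> polys_below A g e ==> b \<otimes> c \<in> polys_below A g (d + e)"
proof (induction d arbitrary: b)
 case 0 then show ?case using pb(2,5) by auto
next
 case (Suc d)
 then obtain a b' where *: "b = b' \<oplus> a \<otimes> g [^] d" "a \<in> A" "b' \<in> polys_below A g d" by auto
 have "b \<otimes> c = b' \<otimes> c \<oplus> a \<otimes> (g [^] d \<otimes> c)"
  using * g pb(5)[OF *(3)] pb(5)[OF Suc.prems(2)] A_facts(7) by (simp add: l_distr m_assoc)
 moreover have "b' \<otimes> c \<in> polys_below A g (d + e)" using Suc * by auto
 moreover have "a \<otimes> (g [^] d \<otimes> c) \<in> polys_below A g (d + e)" using pb(4)[OF *(2) polys_below_shift[OF Suc.prems(2)]] .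
 ultimately have "b \<otimes> c \<in> polys_below A g (d + e)" using pb(3) by simp
 then show ?case using polys_below_Suc[of "d + e"] by auto
qed

lemma polys_facts: "A <= polys" "g \<in> polys" "polys <= carrier R" "subring polys R"
proof -
 show 1: "A <= polys"
 proof
  fix a assume a: "a \<in> A"
  then have "a = \<zero> \<oplus> a \<otimes> g [^] (0::nat)" using A_facts(7) by simp
  then have "a \<in> polys_below A g (Suc 0)" using a unfolding polys_below.simps by blast
  then show "a \<in> polys" unfolding polys_def by blast
 qed
 have "\<one> \<in> polys_below A g (Suc 0)"
 proof -
  have "\<one> = \<zero> \<oplus> \<one> \<otimes> g [^] (0::nat)" by simp
  then show ?thesis using A_facts(3) unfolding polys_below.simps by blast
 qed
 then have "g [^] (1::nat) \<otimes> \<one> \<in> polys_below A g (1 + Suc 0)" by (rule polys_below_shift)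
 then have "g \<in> polys_below A g (1 + Suc 0)" using g by (simp del: polys_below.simps)
 then show "g \<in> polys" unfolding polys_def by blast
 show 2: "polys <= carrier R" unfolding polys_def using pb(1) by blast
 show "subring polys R"
 proof (rule subringI[OF 2])
  show "\<one> \<in> polys" using 1 A_facts(3) by auto
  fix b assume "b \<in> polys"
  then obtain d where "b \<in> polys_below A g d" unfolding polys_def by auto
  then have "\<zero> \<ominus> b \<in> polys_below A g d" using submod_minus[OF A polys_below_submod] pb(2) by blast
  moreover have "\<zero> \<ominus> b = \<ominus> b" using 2 \<open>b \<in> polys\<close> by (auto simp: a_minus_def)
  ultimately show "\<ominus> b \<in> polys" unfolding polys_def by auto
 next
  fix b c assume "b \<in> polys" "c \<in> polys"
  then obtain d e where de: "b \<in> polys_below A g d" "c \<in> polys_below A g e" unfolding polys_def by auto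
  then show "b \<otimes> c \<in> polys" unfolding polys_def using polys_mult by blast
  have "b \<oplus> c \<in> polys_below A g (max d e)" using de polys_below_mono pb(3) by (metis max.cobounded1 max.cobounded2)
  then show "b \<oplus> c \<in> polys" unfolding polys_def by blast
 qed
qed

text \<open>Hilbert's argument: the leading coefficients of elements of the submodule
  \<open>J\<close> form an increasing sequence \<open>L d\<close> whose members all lie in the span
  of one \<open>L m\<close>. Lifts of finitely many generators of \<open>L 0\<close>, ...,
  \<open>L m\<close> generate \<open>J\<close> by descent on the degree.\<close>

theorem hilbert_basis_step:
 assumes N: "noeth A" shows "noeth polys"
 unfolding noeth_def
proof (intro conjI allI impI)
 show "subring polys R" by (rule polys_facts)
 fix V assume V: "V <= polys"
 have Vc: "V <= carrier R" using V polys_facts by auto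
 define J where "J = mod_span polys V"
 have J: "submod polys J" unfolding J_def by (rule submod_span) (use polys_facts Vc in auto)
 note Jf = submodD[OF J]
 have JA: "a \<otimes> x \<in> J" if "a \<in> A" "x \<in> J" for a x using Jf(4) that polys_facts by auto
 have gn: "g [^] (n::nat) \<in> polys" for n
  by (induction n) (use subringE(3,6)[OF polys_facts(4)] polys_facts(2) in auto)
 define L where "L d = {a \<in> A. \<exists>b\<in>polys_below A g d. b \<oplus> a \<otimes> g [^] d \<in> J}" for d
 have LA: "L d <= A" for d unfolding L_def by auto
 have L_mono: "L d <= L (d + e)" for d e
 proof
  fix a assume "a \<in> L d"
  then obtain b where b: "a \<in> A" "b \<in> polys_below A g d" "b \<oplus> a \<otimes> g [^] d \<in> J" unfolding L_def by auto
  have "g [^] e \<otimes> (b \<oplus> a \<otimes> g [^] d) = g [^] e \<otimes> b \<oplus> a \<otimes> g [^] (d + e)"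
   using b g pb(5)[OF b(2)] A_facts(7) by (simp add: r_distr m_lcomm nat_pow_mult add.commute)
  moreover have "g [^] e \<otimes> (b \<oplus> a \<otimes> g [^] d) \<in> J" using Jf(4)[OF gn] b by auto
  moreover have "g [^] e \<otimes> b \<in> polys_below A g (d + e)" using polys_below_shift[OF b(2), of e] by (simp add: add.commute)
  ultimately show "a \<in> L (d + e)" unfolding L_def using b(1) by auto
 qed
 have "\<exists>S\<subseteq>L d. finite S & L d <= mod_span A S" for d using N LA unfolding noeth_def by blast
 then obtain S where S: "!!d. S d <= L d" "!!d. finite (S d)" "!!d. L d <= mod_span A (S d)" by metis
 have "\<exists>S\<subseteq>(\<Union>d. L d). finite S & (\<Union>d. L d) <= mod_span A S" using N LA unfolding noeth_def by (metis UN_least)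
 then obtain S' where S': "S' <= (\<Union>d. L d)" "finite S'" "(\<Union>d. L d) <= mod_span A S'" by auto
 have "\<exists>m. S' <= L m" using S'(2,1)
 proof (induction S' rule: finite_induct)
  case (insert a F)
  then obtain m d where "F <= L m" "a \<in> L d" by auto
  then have "insert a F <= L (m + d)" using L_mono[of m d] L_mono[of d m] by (auto simp: add.commute)
  then show ?case by blast
 qed auto
 then obtain m where m: "S' <= L m" by blast
 \<comment> \<open>Leading coefficients in degrees above \<open>m\<close> are already generated in
   degree \<open>m\<close>.\<close>
 have Lm: "L d <= mod_span A (S (min d m))" for d
 proof (cases "d <= m")
  case False
  have "S' <= mod_span A (S m)" using m S(3) by blast
  then have "mod_span A S' <= mod_span A (S m)"
   by (rule mod_span_least[rotated, OF _ submod_span]) (use A_facts(1) S(1) LA in blast)+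
  then show ?thesis using S'(3) False by (auto simp: min_def)
 qed (use S(3) in "simp add: min_def")
 have "\<exists>f. \<exists>b\<in>polys_below A g d. f = b \<oplus> a \<otimes> g [^] d & f \<in> J" if "a \<in> S d" for a d using S(1) that unfolding L_def by blast
 note ex = this
 define l where "l d a = (SOME f. \<exists>b\<in>polys_below A g d. f = b \<oplus> a \<otimes> g [^] d & f \<in> J)" for d a
 have l: "\<exists>b\<in>polys_below A g d. l d a = b \<oplus> a \<otimes> g [^] d & l d a \<in> J" if "a \<in> S d" for a d
  unfolding l_def by (rule someI_ex[OF ex[OF that]])
 define F where "F = (\<Union>d\<in>{..m}. l d ` S d)"
 have F: "finite F" "F <= J" unfolding F_def using S(2) l by auto
 have Fc: "F <= carrier R" using F Jf(1) by auto
 have MF: "submod polys (mod_span polys F)" by (rule submod_span) (use polys_facts Fc in auto)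
 note MFf = submodD[OF MF]
 have MFJ: "mod_span polys F <= J" by (rule mod_span_least[OF J F(2)])
 have claim: "f \<in> mod_span polys F" if "f \<in> J" "f \<in> polys_below A g d" for f d
  using that
 proof (induction d arbitrary: f)
  case 0 then show ?case using MFf(2) by auto
 next
  case (Suc d)
  then obtain a b where ab: "f = b \<oplus> a \<otimes> g [^] d" "a \<in> A" "b \<in> polys_below A g d" by auto
  define d' where "d' = min d m"
  \<comment> \<open>The leading coefficients in degree \<open>d\<close> that are attained within the
    span of \<open>F\<close>. They form an \<open>A\<close>-submodule, so it is enough to find the
    generators \<open>S d'\<close> among them.\<close>
  let ?T = "{a \<in> A. \<exists>h\<in>mod_span polys F. h \<ominus> a \<otimes> g [^] d \<in> polys_below A g d}"
  have T: "submod A ?T" unfolding submod_def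
  proof (intro conjI ballI)
   show "?T <= carrier R" using A_facts by auto
   have "\<zero> \<ominus> \<zero> \<otimes> g [^] d = \<zero>" using g by (simp add: a_minus_def)
   then show "\<zero> \<in> ?T" using A_facts(2) MFf(2) pb(2) by (metis (mono_tags, lifting) mem_Collect_eq)
  next
   fix x y assume "x \<in> ?T" "y \<in> ?T"
   then obtain h h' where h: "x \<in> A" "y \<in> A" "h \<in> mod_span polys F" "h' \<in> mod_span polys F"
    "h \<ominus> x \<otimes> g [^] d \<in> polys_below A g d" "h' \<ominus> y \<otimes> g [^] d \<in> polys_below A g d" by auto
   have c: "h \<in> carrier R" "h' \<in> carrier R" "x \<in> carrier R" "y \<in> carrier R" using h MFf(5) A_facts(7) by auto
   have "(h \<oplus> h') \<ominus> (x \<oplus> y) \<otimes> z = (h \<ominus> x \<otimes> z) \<oplus> (h' \<ominus> y \<otimes> z)" if "z \<in> carrier R" for z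
    using that c by algebra
   then have "(h \<oplus> h') \<ominus> (x \<oplus> y) \<otimes> g [^] d \<in> polys_below A g d" using pb(3)[OF h(5,6)] g by simp
   then show "x \<oplus> y \<in> ?T" using h A_facts(4) MFf(3) by blast
  next
   fix c x assume c: "c \<in> A" and "x \<in> ?T"
   then obtain h where h: "x \<in> A" "h \<in> mod_span polys F" "h \<ominus> x \<otimes> g [^] d \<in> polys_below A g d" by auto
   have cc: "h \<in> carrier R" "c \<in> carrier R" "x \<in> carrier R" using h c MFf(5) A_facts(7) by auto
   have "c \<otimes> h \<ominus> (c \<otimes> x) \<otimes> z = c \<otimes> (h \<ominus> x \<otimes> z)" if "z \<in> carrier R" for z
    using that cc by algebra
   then have "c \<otimes> h \<ominus> (c \<otimes> x) \<otimes> g [^] d \<in> polys_below A g d" using pb(4)[OF c h(3)] g by simp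
   moreover have "c \<otimes> h \<in> mod_span polys F" using MFf(4) polys_facts(1) c h by blast
   ultimately show "c \<otimes> x \<in> ?T" using h c A_facts(5) by blast
  qed
  have "S d' <= ?T"
  proof
   fix s assume s: "s \<in> S d'"
   obtain b' where b': "b' \<in> polys_below A g d'" "l d' s = b' \<oplus> s \<otimes> g [^] d'" using l[OF s] by blast
   have sA: "s \<in> A" using S(1) LA s by blast
   have "l d' s \<in> F" unfolding F_def d'_def using s d'_def by auto
   then have h: "g [^] (d - d') \<otimes> l d' s \<in> mod_span polys F" using MFf(4)[OF gn] mod_span_base by blast
   have b'c: "b' \<in> carrier R" "s \<in> carrier R" using pb(5)[OF b'(1)] A_facts(7)[OF sA] by auto
   have "u \<otimes> (b' \<oplus> s \<otimes> v) \<ominus> s \<otimes> (u \<otimes> v) = u \<otimes> b'" if "u \<in> carrier R" "v \<in> carrier R" for u v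
    using that b'c by algebra
   then have "g [^] (d - d') \<otimes> l d' s \<ominus> s \<otimes> (g [^] (d - d') \<otimes> g [^] d') = g [^] (d - d') \<otimes> b'"
    unfolding b'(2) using g by simp
   moreover have e: "g [^] (d - d') \<otimes> g [^] d' = g [^] d" using g d'_def by (simp add: nat_pow_mult)
   moreover have "g [^] (d - d') \<otimes> b' \<in> polys_below A g d" using polys_below_shift[OF b'(1), of "d - d'"] d'_def by simp
   ultimately have "g [^] (d - d') \<otimes> l d' s \<ominus> s \<otimes> g [^] d \<in> polys_below A g d" by simp
   then show "s \<in> ?T" using sA h by blast
  qed
  then have "mod_span A (S d') <= ?T" by (rule mod_span_least[OF T])
  moreover have "a \<in> L d" unfolding L_def using ab Suc.prems by blast
  ultimately have "a \<in> ?T" using Lm[of d] d'_def by blast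
  then obtain h where h: "h \<in> mod_span polys F" "h \<ominus> a \<otimes> g [^] d \<in> polys_below A g d" by blast
  have c: "a \<in> carrier R" "b \<in> carrier R" "h \<in> carrier R" using ab A_facts(7) pb(5) h MFf(5) by auto
  have "(b \<oplus> a \<otimes> z) \<ominus> h = b \<ominus> (h \<ominus> a \<otimes> z)" if "z \<in> carrier R" for z using that c by algebra
  then have "f \<ominus> h \<in> polys_below A g d" using submod_minus[OF A polys_below_submod ab(3) h(2)] ab(1) g by simp
  moreover have "f \<ominus> h \<in> J" using submod_minus[OF polys_facts(4) J Suc.prems(1)] MFJ h by blast
  ultimately have "f \<ominus> h \<in> mod_span polys F" by (rule Suc.IH[rotated])
  then have "(f \<ominus> h) \<oplus> h \<in> mod_span polys F" using h MFf(3) by blast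
  moreover have "(f \<ominus> h) \<oplus> h = f"
  proof -
   have "f \<in> carrier R" using Jf(5) Suc.prems by blast
   then show ?thesis using c by algebra
  qed
  ultimately show ?case by simp
 qed
 obtain V0 where V0: "V0 <= V" "finite V0" "F <= mod_span polys V0"
  using mod_span_finite_subset[OF polys_facts(3) Vc F(1)] F(2) unfolding J_def by blast
 have "V <= mod_span polys F"
 proof
  fix x assume x: "x \<in> V"
  then obtain d where "x \<in> polys_below A g d" using V unfolding polys_def by blast
  then show "x \<in> mod_span polys F" using claim x mod_span_base[of V polys] unfolding J_def by blast
 qed
 moreover have "mod_span polys F <= mod_span polys V0"
  by (rule mod_span_least[OF submod_span V0(3)]) (use polys_facts V0(1) Vc in auto)
 ultimately show "\<exists>V0\<subseteq>V. finite V0 & V <= mod_span polys V0" using V0 by blast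
qed

end

lemma noeth_subfield: assumes "subfield k R" shows "noeth k"
 unfolding noeth_def
proof (intro conjI allI impI)
 show "subring k R" using subfieldE(1)[OF assms] .
 note s = subringE[OF subfieldE(1)[OF assms]]
 fix V assume V: "V <= k"
 show "\<exists>V0\<subseteq>V. finite V0 & V <= mod_span k V0"
 proof (cases "V <= {\<zero>}")
  case True
  have "submod k (mod_span k {})" by (rule submod_span) (use s in auto)
  then have "V <= mod_span k {}" using submodD(2) True by blast
  then show ?thesis by (intro exI[of _ "{}"]) auto
 next
  case False
  then obtain x where x: "x \<in> V" "x ~= \<zero>" by auto
  have xi: "inv x \<in> k" "inv x \<otimes> x = \<one>" using subfield_m_inv[OF assms, of x] x V by auto
  have M: "submod k (mod_span k {x})" by (rule submod_span) (use s V x in auto)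
  have xs: "x \<in> mod_span k {x}" using mod_span_base by blast
  have "y \<in> mod_span k {x}" if y: "y \<in> V" for y
  proof -
   have "y \<otimes> inv x \<in> k" using s(6) xi y V by auto
   then have "(y \<otimes> inv x) \<otimes> x \<in> mod_span k {x}" using submodD(4)[OF M _ xs] by blast
   moreover have "y \<in> carrier R" "inv x \<in> carrier R" "x \<in> carrier R" using s(1) V x y xi by auto
   ultimately show ?thesis using xi by (simp add: m_assoc)
  qed
  then show ?thesis using x by (intro exI[of _ "{x}"]) auto
 qed
qed

text \<open>Adjoining the elements of \<open>G\<close> to the Noetherian ring \<open>k\<close> one
  at a time reaches a subring that contains \<open>k\<close> and \<open>G\<close>, hence all of
  \<open>R\<close>.\<close>

theorem hilbert_basis:
 assumes k: "subfield k R" and G: "finite G" "G <= carrier R" "carrier R = generate_ring R (k \<union> G)"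
  and V: "V <= carrier R"
 shows "\<exists>V0\<subseteq>V. finite V0 & V <= Idl V0"
proof -
 have "\<exists>A. noeth A & k <= A & G <= A" using G(1,2)
 proof (induction G rule: finite_induct)
  case empty
  then show ?case using noeth_subfield[OF k] by auto
 next
  case (insert g F)
  then obtain A where A: "noeth A" "k <= A" "F <= A" by auto
  have s: "subring A R" "g \<in> carrier R" using A insert unfolding noeth_def by auto
  show ?case using hilbert_basis_step[OF s A(1)] polys_facts[OF s] A by (intro exI[of _ "polys A g"]) auto
 qed
 then obtain A where A: "noeth A" "k <= A" "G <= A" by auto
 have s: "subring A R" using A unfolding noeth_def by auto
 have "carrier R <= A"
 proof
  fix x assume "x \<in> carrier R"
  then have "x \<in> generate_ring R (k \<union> G)" using G(3) by simp
  then show "x \<in> A"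
   by (induction rule: generate_ring.induct) (use A subringE[OF s] in auto)
 qed
 then have "A = carrier R" using subringE(1)[OF s] by auto
 then obtain V0 where V0: "V0 <= V" "finite V0" "V <= mod_span (carrier R) V0" using A V unfolding noeth_def by blast
 have V0c: "V0 <= carrier R" using V0 V by auto
 have I: "ideal (Idl V0) R" by (rule genideal_ideal[OF V0c])
 have "submod (carrier R) (Idl V0)" unfolding submod_def
  using additive_subgroup.a_subset[OF ideal.axioms(1)[OF I]] ideal_zero[OF I]
   ideal_sum[OF I] ideal.I_l_closed[OF I] by auto
 then have "mod_span (carrier R) V0 <= Idl V0" by (rule mod_span_least) (rule genideal_self[OF V0c])
 then show ?thesis using V0 by blast
qed

end

section \<open>Standard graded domains\<close>

locale std_graded = cring_over R k + domain R for R (structure) and k +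
 fixes gr :: "nat => 'a set" and G :: "'a set"
 assumes graded: "graded_ring R gr" and gr_0: "gr 0 = k"
  and G: "finite G" "G <= gr 1" "carrier R = generate_ring R (k \<union> G)"
begin

lemma gr_subgroup: "additive_subgroup (gr n) R"
 using graded unfolding graded_ring_def by blast

lemma gr_closed [simp]: "x \<in> gr n ==> x \<in> carrier R"
 using additive_subgroup.a_Hcarr[OF gr_subgroup] .

lemma gr_mult: "x \<in> gr i ==> y \<in> gr j ==> x \<otimes> y \<in> gr (i + j)"
 using graded unfolding graded_ring_def by blast

lemma gr_zero [simp]: "\<zero> \<in> gr n"
 and gr_add: "x \<in> gr n ==> y \<in> gr n ==> x \<oplus> y \<in> gr n"
 and gr_neg: "x \<in> gr n ==> \<ominus> x \<in> gr n"
 using additive_subgroup.zero_closed[OF gr_subgroup] additive_subgroup.a_closed[OF gr_subgroup]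
  additive_subgroup.a_inv_closed[OF gr_subgroup] by auto

lemma gr_lin_sub: "lin_sub (gr n)"
 unfolding lin_sub_def using gr_add gr_mult[of _ 0 _ n] gr_0 by auto

section \<open>Homogeneous components\<close>

definition is_decomp :: "'a => (nat => 'a) => bool" where
 "is_decomp x c \<longleftrightarrow> (\<forall>k. c k \<in> gr k) & finite {k. c k ~= \<zero>} & x = (\<Oplus>k\<in>{k. c k ~= \<zero>}. c k)"

definition hcomp :: "'a => nat => 'a" where
 "hcomp x = (THE c. is_decomp x c)"

lemma ex1_decomp: "x \<in> carrier R ==> \<exists>!c. is_decomp x c"
 using graded unfolding graded_ring_def is_decomp_def by blast

lemma decomp_comp: "x \<in> carrier R ==> is_decomp x (hcomp x)"
 unfolding hcomp_def by (rule theI'[OF ex1_decomp])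

lemma comp_unique: "x \<in> carrier R ==> is_decomp x c ==> hcomp x = c"
 using ex1_decomp decomp_comp by blast

lemma comp_gr [simp]: "x \<in> carrier R ==> hcomp x n \<in> gr n"
 using decomp_comp unfolding is_decomp_def by auto

lemma comp_closed [simp]: "x \<in> carrier R ==> hcomp x n \<in> carrier R"
 using comp_gr gr_closed by blast

lemma finite_comp: "x \<in> carrier R ==> finite {n. hcomp x n ~= \<zero>}"
 using decomp_comp unfolding is_decomp_def by auto

lemma decompI:
 assumes "finite F" "!!n. c n \<in> gr n" "!!n. n \<notin> F ==> c n = \<zero>"
 shows "is_decomp (\<Oplus>n\<in>F. c n) c"
proof -
 have s: "{k. c k ~= \<zero>} <= F" using assms by auto
 have "(\<Oplus>n\<in>F. c n) = (\<Oplus>k\<in>{k. c k ~= \<zero>}. c k)"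
  by (rule add.finprod_mono_neutral_cong_right) (use assms(1,3) gr_closed[OF assms(2)] s in auto)
 then show ?thesis unfolding is_decomp_def using assms s finite_subset by auto
qed

lemma comp_sum:
 assumes "finite F" "!!n. c n \<in> gr n" "!!n. n \<notin> F ==> c n = \<zero>"
 shows "hcomp (\<Oplus>n\<in>F. c n) = c"
 by (rule comp_unique[OF _ decompI[OF assms]]) (use gr_closed[OF assms(2)] in "auto intro!: finsum_closed")

lemma sum_comp:
 assumes "x \<in> carrier R" "finite F" "{n. hcomp x n ~= \<zero>} <= F"
 shows "x = (\<Oplus>n\<in>F. hcomp x n)"
proof -
 have "(\<Oplus>n\<in>F. hcomp x n) = (\<Oplus>k\<in>{k. hcomp x k ~= \<zero>}. hcomp x k)"
  by (rule add.finprod_mono_neutral_cong_right) (use assms in auto)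
 then show ?thesis using decomp_comp[OF assms(1)] unfolding is_decomp_def by simp
qed

lemma comp_homogeneous: assumes "x \<in> gr n" shows "hcomp x m = (if m = n then x else \<zero>)"
proof -
 have "hcomp (\<Oplus>i\<in>{n}. if i = n then x else \<zero>) = (%i. if i = n then x else \<zero>)"
  by (rule comp_sum) (use assms in auto)
 moreover have "(\<Oplus>i\<in>{n}. if i = n then x else \<zero>) = x" using assms by (simp add: finsum_insert)
 ultimately show ?thesis by simp
qed

lemma comp_add:
 assumes "x \<in> carrier R" "y \<in> carrier R" shows "hcomp (x \<oplus> y) n = hcomp x n \<oplus> hcomp y n"
proof -
 let ?F = "{n. hcomp x n ~= \<zero>} \<union> {n. hcomp y n ~= \<zero>}"
 have F: "finite ?F" using finite_comp assms by auto
 have "x \<oplus> y = (\<Oplus>n\<in>?F. hcomp x n) \<oplus> (\<Oplus>n\<in>?F. hcomp y n)"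
  using sum_comp[OF assms(1) F] sum_comp[OF assms(2) F] by auto
 also have "\<dots> = (\<Oplus>n\<in>?F. hcomp x n \<oplus> hcomp y n)" by (rule finsum_addf[symmetric]) (use assms in auto)
 finally have e: "x \<oplus> y = (\<Oplus>n\<in>?F. hcomp x n \<oplus> hcomp y n)" .
 have "hcomp (x \<oplus> y) = (%n. hcomp x n \<oplus> hcomp y n)"
  unfolding e by (rule comp_sum) (use F assms gr_add in auto)
 then show ?thesis by simp
qed

lemma comp_zero [simp]: "hcomp \<zero> n = \<zero>"
 using comp_homogeneous[of \<zero> 0 n] by auto

lemma comp_neg: assumes "x \<in> carrier R" shows "hcomp (\<ominus> x) n = \<ominus> hcomp x n"
proof -
 have "hcomp (x \<oplus> \<ominus> x) n = hcomp x n \<oplus> hcomp (\<ominus> x) n" by (rule comp_add) (use assms in auto)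
 then have "hcomp (\<ominus> x) n \<oplus> hcomp x n = \<zero>" using assms by (simp add: r_neg a_comm)
 then show ?thesis by (intro minus_equality[symmetric]) (use assms in auto)
qed

lemma comp_minus: "x \<in> carrier R ==> y \<in> carrier R ==> hcomp (x \<ominus> y) n = hcomp x n \<ominus> hcomp y n"
 unfolding a_minus_def by (simp add: comp_add comp_neg)

lemma comp_finsum:
 "finite I ==> (!!i. i \<in> I ==> f i \<in> carrier R) ==> hcomp (\<Oplus>i\<in>I. f i) n = (\<Oplus>i\<in>I. hcomp (f i) n)"
proof (induction I rule: finite_induct)
 case (insert i I)
 have "(\<Oplus>i\<in>insert i I. f i) = f i \<oplus> (\<Oplus>i\<in>I. f i)" by (rule finsum_insert) (use insert in auto)
 moreover have "(\<Oplus>i\<in>insert i I. hcomp (f i) n) = hcomp (f i) n \<oplus> (\<Oplus>i\<in>I. hcomp (f i) n)"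
  by (rule finsum_insert) (use insert in auto)
 moreover have "(\<Oplus>i\<in>I. f i) \<in> carrier R" using insert by (auto intro!: finsum_closed)
 ultimately show ?case using insert comp_add by simp
qed simp

lemma comp_mult_homogeneous:
 assumes "a \<in> gr d" "x \<in> carrier R"
 shows "hcomp (a \<otimes> x) n = (if n < d then \<zero> else a \<otimes> hcomp x (n - d))"
proof -
 let ?F = "{n. hcomp x n ~= \<zero>}" and ?c = "%n. if n < d then \<zero> else a \<otimes> hcomp x (n - d)"
 have a: "a \<in> carrier R" using assms by auto
 have F: "finite ?F" using finite_comp assms by auto
 have "a \<otimes> x = a \<otimes> (\<Oplus>n\<in>?F. hcomp x n)" using sum_comp[OF assms(2) F] by simp
 also have "\<dots> = (\<Oplus>n\<in>?F. a \<otimes> hcomp x n)" by (rule finsum_rdistr) (use F assms in auto)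
 also have "\<dots> = (\<Oplus>n\<in>?F. ?c (d + n))" by simp
 also have "\<dots> = (\<Oplus>n\<in>(%n. d + n) ` ?F. ?c n)" by (rule finsum_reindex[symmetric]) (use assms in auto)
 finally have e: "a \<otimes> x = (\<Oplus>n\<in>(%n. d + n) ` ?F. ?c n)" .
 have "hcomp (\<Oplus>n\<in>(%n. d + n) ` ?F. ?c n) = ?c"
 proof (rule comp_sum)
  show "?c n \<in> gr n" for n using gr_mult[OF assms(1) comp_gr[OF assms(2)], of "n - d"] by auto
  fix n assume "n \<notin> (%n. d + n) ` ?F"
  then have "n < d \<or> hcomp x (n - d) = \<zero>" using image_eqI[of n "%n. d + n" "n - d" "{n. hcomp x n ~= \<zero>}"] by fastforce
  then show "?c n = \<zero>" using a by auto
 qed (use F in auto)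
 then show ?thesis using e by simp
qed

text \<open>Elements of order at least \<open>N\<close>. As \<open>R\<close> is generated in degree
  one, this is the \<open>N\<close>-th power of the irrelevant ideal; the localised statement is
  \<open>local_power\<close>.\<close>

definition tail :: "nat => 'a set" where
 "tail N = {x \<in> carrier R. \<forall>n<N. hcomp x n = \<zero>}"

lemma tail_0 [simp]: "tail 0 = carrier R"
 unfolding tail_def by auto

lemma tail_closed: "x \<in> tail N ==> x \<in> carrier R"
 unfolding tail_def by auto

lemma tail_antimono: "M <= N ==> x \<in> tail N ==> x \<in> tail M"
 unfolding tail_def by auto

lemma tail_add: "x \<in> tail N ==> y \<in> tail N ==> x \<oplus> y \<in> tail N"
 unfolding tail_def by (auto simp: comp_add)

lemma tail_neg: "x \<in> tail N ==> \<ominus> x \<in> tail N"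
 unfolding tail_def by (auto simp: comp_neg)

lemma tail_zero [simp]: "\<zero> \<in> tail N"
 unfolding tail_def by auto

lemma gr_tail: "x \<in> gr n ==> N <= n ==> x \<in> tail N"
 unfolding tail_def by (auto simp: comp_homogeneous)

lemma gr_tail_zero: "x \<in> gr n ==> x \<in> tail N ==> n < N ==> x = \<zero>"
 unfolding tail_def using comp_homogeneous by auto

lemma tail_finsum: "(!!i. i \<in> I ==> f i \<in> tail N) ==> finsum R f I \<in> tail N"
proof (induction I rule: infinite_finite_induct)
 case (insert i I)
 then have "finsum R f (insert i I) = f i \<oplus> finsum R f I" by (intro finsum_insert) (auto dest: tail_closed)
 then show ?case using insert tail_add by auto
qed auto

lemma tail_gr_mult: "a \<in> gr d ==> x \<in> tail N ==> a \<otimes> x \<in> tail (d + N)"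
 unfolding tail_def using comp_mult_homogeneous[of a d x] by (auto dest: gr_closed)

lemma tail_mult: assumes "x \<in> tail M" "y \<in> tail N" shows "x \<otimes> y \<in> tail (M + N)"
proof -
 let ?F = "{n. hcomp x n ~= \<zero>}"
 have c: "x \<in> carrier R" "y \<in> carrier R" using assms tail_closed by auto
 have F: "finite ?F" using finite_comp c by auto
 have "x \<otimes> y = (\<Oplus>n\<in>?F. hcomp x n) \<otimes> y" using sum_comp[OF c(1) F] by simp
 also have "\<dots> = (\<Oplus>n\<in>?F. hcomp x n \<otimes> y)" by (rule finsum_ldistr) (use F c in auto)
 also have "\<dots> \<in> tail (M + N)"
 proof (rule tail_finsum)
  fix n assume "n \<in> ?F"
  then have "\<not> n < M" using assms(1) unfolding tail_def by blast
  then have "M <= n" by simp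
  then show "hcomp x n \<otimes> y \<in> tail (M + N)"
   using tail_gr_mult[OF comp_gr[OF c(1)] assms(2)] tail_antimono[of "M + N" "n + N"] by auto
 qed
 finally show ?thesis .
qed

lemma tail_ideal: "ideal (tail N) R"
proof (rule idealI[OF ring_axioms])
 show "subgroup (tail N) (add_monoid R)"
 proof (rule add.subgroupI)
  show "tail N ~= {}" using tail_zero by blast
 qed (use tail_closed tail_neg tail_add in auto)
 show "x \<otimes> a \<in> tail N" "a \<otimes> x \<in> tail N" if "a \<in> tail N" "x \<in> carrier R" for a x
  using tail_mult[of x 0 a N] tail_mult[of a N x 0] that by auto
qed

lemma tail_head: assumes "x \<in> tail N" shows "x \<ominus> hcomp x N \<in> tail (Suc N)"
 unfolding tail_def
proof (intro CollectI conjI allI impI)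
 have x: "x \<in> carrier R" using tail_closed assms by auto
 then show "x \<ominus> hcomp x N \<in> carrier R" by auto
 fix n assume "n < Suc N"
 then show "hcomp (x \<ominus> hcomp x N) n = \<zero>"
 proof -
  have "hcomp (x \<ominus> hcomp x N) n = hcomp x n \<ominus> hcomp (hcomp x N) n" using x by (simp add: comp_minus)
  also have "\<dots> = \<zero>"
   using x assms \<open>n < Suc N\<close> comp_homogeneous[OF comp_gr[OF x], of N n] by (auto simp: tail_def a_minus_def r_neg less_Suc_eq)
  finally show ?thesis .
 qed
qed

lemma tail_comp_zero: "x \<in> tail N ==> hcomp x N = \<zero> ==> x \<in> tail (Suc N)"
 unfolding tail_def by (auto simp: less_Suc_eq)

text \<open>Leading forms multiply, because every other product of components has higher
  degree.\<close>

lemma comp_mult_lowest: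
 assumes "x \<in> tail M" "y \<in> tail N" shows "hcomp (x \<otimes> y) (M + N) = hcomp x M \<otimes> hcomp y N"
proof -
 have c: "x \<in> carrier R" "y \<in> carrier R" using assms tail_closed by auto
 define x' y' where "x' = x \<ominus> hcomp x M" and "y' = y \<ominus> hcomp y N"
 have t: "x' \<in> tail (Suc M)" "y' \<in> tail (Suc N)" unfolding x'_def y'_def using tail_head assms by auto
 have cc: "hcomp x M \<in> carrier R" "hcomp y N \<in> carrier R" "x' \<in> carrier R" "y' \<in> carrier R" using c tail_closed t by auto
 have "x \<otimes> y = u \<otimes> v \<oplus> (u \<otimes> (y \<ominus> v) \<oplus> (x \<ominus> u) \<otimes> y)" if "u \<in> carrier R" "v \<in> carrier R" for u v
  using that c by algebra
 from this[OF cc(1,2)] have e: "x \<otimes> y = hcomp x M \<otimes> hcomp y N \<oplus> (hcomp x M \<otimes> y' \<oplus> x' \<otimes> y)"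
  unfolding x'_def y'_def .
 have "hcomp x M \<otimes> y' \<in> tail (M + Suc N)" "x' \<otimes> y \<in> tail (Suc M + N)"
  using tail_gr_mult[OF comp_gr[OF c(1)] t(2)] tail_mult[OF t(1) assms(2)] by auto
 then have "hcomp x M \<otimes> y' \<oplus> x' \<otimes> y \<in> tail (Suc (M + N))" using tail_add by simp
 then have "hcomp (hcomp x M \<otimes> y' \<oplus> x' \<otimes> y) (M + N) = \<zero>" unfolding tail_def by auto
 moreover have "hcomp (hcomp x M \<otimes> hcomp y N) (M + N) = hcomp x M \<otimes> hcomp y N"
  using comp_homogeneous[OF gr_mult[OF comp_gr[OF c(1)] comp_gr[OF c(2)]]] by simp
 ultimately show ?thesis unfolding e using cc c by (subst comp_add) auto
qed

section \<open>Monomials in the generators\<close>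

definition mons :: "nat => 'a set" where
 "mons n = rec_nat {\<one>} (%_ B. (%(g, m). g \<otimes> m) ` (G \<times> B)) n"

lemma mons_simps: "mons 0 = {\<one>}" "mons (Suc n) = (%(g, m). g \<otimes> m) ` (G \<times> mons n)"
 unfolding mons_def by auto

lemma finite_mons: "finite (mons n)"
 using G by (induction n) (auto simp: mons_simps)

lemma mons_gr: "m \<in> mons n ==> m \<in> gr n"
proof (induction n arbitrary: m)
 case 0 then show ?case using scal_ring gr_0 by (simp add: mons_simps)
next
 case (Suc n)
 then show ?case using gr_mult[of _ 1 _ n] G by (auto simp: mons_simps)
qed

lemma mons_mult: "m \<in> mons i ==> m' \<in> mons j ==> m \<otimes> m' \<in> mons (i + j)"
proof (induction i arbitrary: m)
 case 0
 then have "m' \<in> carrier R" using mons_gr gr_closed by blast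
 then show ?case using 0 by (simp add: mons_simps)
next
 case (Suc i)
 then obtain g m1 where g: "g \<in> G" "m1 \<in> mons i" "m = g \<otimes> m1" by (auto simp: mons_simps)
 have "g \<in> carrier R" "m1 \<in> carrier R" "m' \<in> carrier R" using g Suc.prems mons_gr gr_closed G by blast+
 then have "m \<otimes> m' = g \<otimes> (m1 \<otimes> m')" using g by (simp add: m_assoc)
 then show ?case using Suc.IH[OF g(2) Suc.prems(2)] g by (auto simp: mons_simps)
qed

text \<open>The span of all monomials is closed under products and contains \<open>k\<close> and
  \<open>G\<close>, so it is all of \<open>R\<close>. Taking the component of degree
  \<open>n\<close> discards the monomials of other degrees.\<close>

lemma gr_span: "gr n = lin_span (mons n)"
proof
 show "lin_span (mons n) <= gr n" by (rule lin_span_least[OF gr_lin_sub]) (use mons_gr in auto)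
 define A where "A = (\<Union>n. mons n)"
 have Ac: "A <= carrier R" unfolding A_def using mons_gr gr_closed by blast
 define T where "T = lin_span A"
 have T: "lin_sub T" unfolding T_def by (rule lin_sub_span[OF Ac])
 have AT: "A <= T" unfolding T_def by (rule lin_span_base)
 have m1: "a \<otimes> y \<in> T" if a: "a \<in> A" and y: "y \<in> T" for a y
 proof -
  have "lin_span A <= {x \<in> carrier R. a \<otimes> x \<in> T}"
  proof (rule lin_span_least[OF lin_sub_vimage[OF T]])
   show "A <= {x \<in> carrier R. a \<otimes> x \<in> T}" using mons_mult a AT Ac unfolding A_def by blast
  qed (use a Ac in auto)
  then show ?thesis using y T_def by auto
 qed
 have mT: "x \<otimes> y \<in> T" if x: "x \<in> T" and y: "y \<in> T" for x y
 proof -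
  have yc: "y \<in> carrier R" using y lin_subD(5)[OF T] by auto
  have "lin_span A <= {x \<in> carrier R. y \<otimes> x \<in> T}"
   by (rule lin_span_least[OF lin_sub_vimage[OF T yc]]) (use m1[OF _ y] Ac yc in "auto simp: m_comm")
  then show ?thesis using x yc lin_subD(5)[OF T x] T_def by (auto simp: m_comm)
 qed
 have "\<one> \<in> mons 0" by (simp add: mons_simps)
 then have one: "\<one> \<in> T" using AT unfolding A_def by blast
 have "generate_ring R (k \<union> G) <= T"
 proof
  fix x assume "x \<in> generate_ring R (k \<union> G)"
  then show "x \<in> T"
  proof (induction rule: generate_ring.induct)
   case (incl h)
   then show ?case
   proof
    assume "h \<in> k"
    then show ?thesis using lin_subD(4)[OF T _ one, of h] by simp
   next
    assume "h \<in> G"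
    then have "h \<otimes> \<one> \<in> mons (Suc 0)" "h \<in> carrier R" using G gr_closed by (auto simp: mons_simps)
    then have "h \<in> A" unfolding A_def by auto
    then show ?thesis using AT by blast
   qed
  next
   case (a_inv h) then show ?case using lin_sub_neg[OF T] by blast
  qed (use one mT lin_subD(3)[OF T] in auto)
 qed
 then have cT: "carrier R <= T" using G by simp
 have "lin_sub {x \<in> carrier R. hcomp x n \<in> lin_span (mons n)}"
 proof -
  have L: "lin_sub (lin_span (mons n))" by (rule lin_sub_span) (use mons_gr gr_closed in blast)
  show ?thesis unfolding lin_sub_def
  proof (intro conjI ballI)
   fix c x assume c: "c \<in> k" and x: "x \<in> {x \<in> carrier R. hcomp x n \<in> lin_span (mons n)}"
   then have "hcomp (c \<otimes> x) n = c \<otimes> hcomp x n" using comp_mult_homogeneous[of c 0 x n] gr_0 by simp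
   then show "c \<otimes> x \<in> {x \<in> carrier R. hcomp x n \<in> lin_span (mons n)}" using c x lin_subD(4)[OF L] by auto
  qed (use lin_subD[OF L] comp_add in auto)
 qed
 moreover have "A <= {x \<in> carrier R. hcomp x n \<in> lin_span (mons n)}"
 proof
  fix m assume "m \<in> A"
  then obtain i where i: "m \<in> mons i" unfolding A_def by auto
  then have "hcomp m n = (if n = i then m else \<zero>)" using comp_homogeneous mons_gr by blast
  moreover have "\<zero> \<in> lin_span (mons n)" using lin_subD(2)[OF lin_sub_span] mons_gr gr_closed by blast
  ultimately show "m \<in> {x \<in> carrier R. hcomp x n \<in> lin_span (mons n)}"
   using i Ac \<open>m \<in> A\<close> lin_span_base[of "mons i"] by auto
 qed
 ultimately have "T <= {x \<in> carrier R. hcomp x n \<in> lin_span (mons n)}" unfolding T_def by (rule lin_span_least)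
 then have *: "hcomp x n \<in> lin_span (mons n)" if "x \<in> carrier R" for x using cT that by blast
 show "gr n <= lin_span (mons n)"
 proof
  fix x assume x: "x \<in> gr n"
  then show "x \<in> lin_span (mons n)" using *[OF gr_closed[OF x]] comp_homogeneous[OF x, of n] by simp
 qed
qed

text \<open>A monomial of degree \<open>n + 1\<close> is a generator times a monomial of degree
  \<open>n\<close>.\<close>

lemma gr_Suc_induct:
 assumes "lin_sub T" "!!g b. g \<in> gr 1 ==> b \<in> gr n ==> g \<otimes> b \<in> T"
 shows "gr (Suc n) <= T"
 unfolding gr_span[of "Suc n"]
 by (rule lin_span_least[OF assms(1)]) (use assms(2) G mons_gr in "auto simp: mons_simps")

text \<open>An element with nonzero constant term has its leading form in degree zero, so in a
  domain multiplication by it cannot raise the order. This identifies the order of a fraction with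
  that of its numerator.\<close>

lemma tail_unit: assumes "x \<in> carrier R" "s \<in> carrier R" "hcomp s 0 ~= \<zero>" "s \<otimes> x \<in> tail N" shows "x \<in> tail N"
proof -
 have "M <= N ==> x \<in> tail M" for M
 proof (induction M)
  case (Suc M)
  then have xM: "x \<in> tail M" by simp
  have "hcomp (s \<otimes> x) (0 + M) = hcomp s 0 \<otimes> hcomp x M" by (rule comp_mult_lowest[OF _ xM]) (use assms in auto)
  moreover have "hcomp (s \<otimes> x) M = \<zero>" using assms(4) Suc.prems unfolding tail_def by auto
  ultimately have "hcomp x M = \<zero>" using integral[of "hcomp s 0" "hcomp x M"] assms by auto
  then show ?case using tail_comp_zero[OF xM] by blast
 qed (use assms in auto)
 then show ?thesis by blast
qed

lemma tail_1_iff: "x \<in> tail 1 \<longleftrightarrow> x \<in> carrier R & hcomp x 0 = \<zero>"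
 unfolding tail_def by auto

lemma tail_1_prime: "primeideal (tail 1) R"
proof (rule primeidealI[OF tail_ideal is_cring])
 have "hcomp \<one> 0 = \<one>" using comp_homogeneous[of \<one> 0 0] scal_ring gr_0 by auto
 then show "carrier R ~= tail 1" using one_not_zero tail_1_iff by (metis one_closed)
 fix a b assume ab: "a \<in> carrier R" "b \<in> carrier R" "a \<otimes> b \<in> tail 1"
 then have "hcomp a 0 \<otimes> hcomp b 0 = \<zero>" using comp_mult_lowest[of a 0 b 0] ab(3)[unfolded tail_1_iff] by simp
 then have "hcomp a 0 = \<zero> \<or> hcomp b 0 = \<zero>" by (rule integral) (use ab in auto)
 then show "a \<in> tail 1 \<or> b \<in> tail 1" using ab tail_1_iff by auto
qed

lemma tail_1_maximal: "maximalideal (tail 1) R"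
proof (rule maximalidealI[OF tail_ideal])
 interpret p: primeideal "tail 1" R by (rule tail_1_prime)
 show "carrier R ~= tail 1" using p.I_notcarr .
 fix J assume J: "ideal J R" "tail 1 <= J" "J <= carrier R"
 show "J = tail 1 \<or> J = carrier R"
 proof (cases "J <= tail 1")
  case False
  then obtain s where s: "s \<in> J" "s \<notin> tail 1" by auto
  then have sc: "s \<in> carrier R" "hcomp s 0 ~= \<zero>" using subsetD[OF J(3)] tail_1_iff[of s] by blast+
  have "s \<ominus> hcomp s 0 \<in> tail 1" using tail_head[of s 0] sc by simp
  then have "s \<ominus> (s \<ominus> hcomp s 0) \<in> J"
   using lin_sub_minus[OF ideal_lin_sub[OF J(1)] s(1)] J(2) by blast
  moreover have "s \<ominus> (s \<ominus> u) = u" if "u \<in> carrier R" for u using that sc by algebra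
  ultimately have c: "hcomp s 0 \<in> J" using sc by simp
  have "hcomp s 0 \<in> k" using comp_gr[OF sc(1), of 0] gr_0 by auto
  then have "inv (hcomp s 0) \<otimes> hcomp s 0 = \<one>" "inv (hcomp s 0) \<in> carrier R" using scal_inv sc by auto
  then have "\<one> \<in> J" using ideal.I_l_closed[OF J(1) c] by metis
  then show ?thesis using ideal.one_imp_carrier[OF J(1)] by blast
 qed (use J in auto)
qed

text \<open>The coefficients are replaced by their components of complementary degree. The clause
  for \<open>n < \<delta> i\<close> repairs the truncated difference \<open>n - \<delta> i\<close>,
  which would otherwise admit constants.\<close>

lemma comp_combination:
 assumes I: "finite I" "!!i. i \<in> I ==> x i \<in> gr (\<delta> i)" and a: "a \<in> Idl (x ` I)"
 shows "\<exists>t. (\<forall>i\<in>I. t i \<in> gr (n - \<delta> i) & (n < \<delta> i --> t i = \<zero>)) & hcomp a n = (\<Oplus>i\<in>I. t i \<otimes> x i)"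
proof -
 have xc: "x i \<in> carrier R" if "i \<in> I" for i using gr_closed[OF I(2)[OF that]] .
 obtain t where t: "\<forall>i\<in>I. t i \<in> carrier R" "a = (\<Oplus>i\<in>I. t i \<otimes> x i)"
  using genideal_combination[OF I(1) xc a] by blast
 define t' where "t' i = (if n < \<delta> i then \<zero> else hcomp (t i) (n - \<delta> i))" for i
 have t': "t' i \<in> gr (n - \<delta> i)" "t' i \<in> carrier R" if "i \<in> I" for i using t that unfolding t'_def by auto
 have "hcomp a n = (\<Oplus>i\<in>I. hcomp (t i \<otimes> x i) n)" unfolding t(2) by (rule comp_finsum) (use t xc I in auto)
 also have "\<dots> = (\<Oplus>i\<in>I. t' i \<otimes> x i)"
 proof (rule finsum_cong', simp)
  fix i assume i: "i \<in> I"
  then have c: "t i \<in> carrier R" "x i \<in> carrier R" "x i \<in> gr (\<delta> i)" using t xc I by auto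
  have "hcomp (t i \<otimes> x i) n = hcomp (x i \<otimes> t i) n" using c by (simp add: m_comm)
  also have "\<dots> = t' i \<otimes> x i" unfolding comp_mult_homogeneous[OF c(3,1)] t'_def using c by (simp add: m_comm)
  finally show "hcomp (t i \<otimes> x i) n = t' i \<otimes> x i" .
 qed (use t' xc in auto)
 finally show ?thesis using t' by (intro exI[of _ t']) (auto simp: t'_def)
qed

lemma comp_in_homogeneous_ideal:
 assumes I: "finite I" "!!i. i \<in> I ==> x i \<in> gr (\<delta> i)" and a: "a \<in> Idl (x ` I)"
 shows "hcomp a n \<in> Idl (x ` I)"
proof -
 have xs: "x ` I <= carrier R" using I(2) gr_closed by blast
 obtain t where t: "\<forall>i\<in>I. t i \<in> gr (n - \<delta> i) & (n < \<delta> i --> t i = \<zero>)" "hcomp a n = (\<Oplus>i\<in>I. t i \<otimes> x i)"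
  using comp_combination[OF I a] by blast
 show ?thesis unfolding t(2)
  by (rule ideal_finsum[OF genideal_ideal[OF xs]])
   (use t(1) genideal_self[OF xs] in "auto intro!: ideal.I_l_closed[OF genideal_ideal[OF xs]]")
qed

end

section \<open>Completions of standard graded domains\<close>

text \<open>The completion is described by its relation to \<open>R\<close>: the image of
  \<open>R\<close> is dense, the filtration restricts to the filtration by order, and series of
  forms of increasing degree converge. The axioms are to hold both for the completion and for its
  quotient by the zero ideal, which is the ring that solid closure refers to.\<close>

locale graded_completion = std_graded R k gr G + B: cring B
 for R (structure) and k gr G and B (structure) +
 fixes \<phi> :: "'a => 'c" and fil :: "nat => 'c set"
 assumes phi_hom: "\<phi> \<in> ring_hom R B"
  and phi_fil: "!!a N. a \<in> carrier R ==> \<phi> a \<in> fil N \<longleftrightarrow> a \<in> tail N"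
  and fil_ideal: "!!N. ideal (fil N) B"
  and fil_Suc: "!!N. fil (Suc N) <= fil N"
  and dense: "!!b N. b \<in> carrier B ==> \<exists>a\<in>carrier R. b \<ominus>\<^sub>B \<phi> a \<in> fil N"
  and separated: "!!b. (!!N. b \<in> fil N) ==> b = \<zero>\<^sub>B"
  and complete: "!!c. (!!n. c n \<in> gr n) ==> \<exists>b\<in>carrier B. \<forall>N. b \<ominus>\<^sub>B (\<Oplus>\<^sub>B n\<in>{..<N}. \<phi> (c n)) \<in> fil N"
begin

section \<open>The filtration and leading forms\<close>

sublocale phi: ring_hom_cring R B \<phi>
 by unfold_locales (rule phi_hom)

lemma phi_minus: "a \<in> carrier R ==> b \<in> carrier R ==> \<phi> (a \<ominus> b) = \<phi> a \<ominus>\<^sub>B \<phi> b"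
 by (simp add: a_minus_def)

lemma fil_closed: "b \<in> fil N ==> b \<in> carrier B"
 using ideal_mem[OF fil_ideal] .

lemma fil_antimono: "M <= N ==> b \<in> fil N ==> b \<in> fil M"
 by (induction rule: dec_induct) (use fil_Suc in auto)

lemma fil_add: "b \<in> fil N ==> c \<in> fil N ==> b \<oplus>\<^sub>B c \<in> fil N"
 using ideal_sum[OF fil_ideal] .

lemma fil_neg: "b \<in> fil N ==> \<ominus>\<^sub>B b \<in> fil N"
 using ideal_neg[OF fil_ideal] .

lemma fil_minus: "b \<in> fil N ==> c \<in> fil N ==> b \<ominus>\<^sub>B c \<in> fil N"
 unfolding a_minus_def using fil_add fil_neg by blast

lemma fil_zero [simp]: "\<zero>\<^sub>B \<in> fil N"
 using ideal_zero[OF fil_ideal] .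

lemma fil_l_mult: "b \<in> fil N ==> x \<in> carrier B ==> x \<otimes>\<^sub>B b \<in> fil N"
 using ideal.I_l_closed[OF fil_ideal] .

lemma fil_finsum: "(!!i. i \<in> I ==> f i \<in> fil N) ==> finsum B f I \<in> fil N"
proof (induction I rule: infinite_finite_induct)
 case (insert i I)
 then have "finsum B f (insert i I) = f i \<oplus>\<^sub>B finsum B f I" by (intro B.finsum_insert) (auto dest: fil_closed)
 then show ?case using insert fil_add by auto
qed auto

lemma minus_triv:
 assumes "a \<in> carrier B" "b \<in> carrier B" "c \<in> carrier B" "d \<in> carrier B"
 shows "a \<ominus>\<^sub>B (a \<ominus>\<^sub>B b) = b" "(a \<ominus>\<^sub>B b) \<oplus>\<^sub>B b = a" "b \<oplus>\<^sub>B (a \<ominus>\<^sub>B b) = a"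
  "(a \<ominus>\<^sub>B b) \<oplus>\<^sub>B (b \<ominus>\<^sub>B c) = a \<ominus>\<^sub>B c"
  "(a \<oplus>\<^sub>B b) \<otimes>\<^sub>B (c \<oplus>\<^sub>B d) = a \<otimes>\<^sub>B c \<oplus>\<^sub>B (a \<otimes>\<^sub>B d \<oplus>\<^sub>B b \<otimes>\<^sub>B (c \<oplus>\<^sub>B d))"
  "(a \<ominus>\<^sub>B b) \<ominus>\<^sub>B (c \<ominus>\<^sub>B d) = (a \<ominus>\<^sub>B c) \<oplus>\<^sub>B (d \<ominus>\<^sub>B b)"
 using assms by (algebra)+

text \<open>The associated graded ring of the filtration is \<open>R\<close>: an approximation from
  \<open>R\<close> has order at least \<open>N\<close>, and its component of degree \<open>N\<close>
  is the leading form.\<close>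

lemma fil_head: assumes "b \<in> fil N" shows "\<exists>a\<in>gr N. b \<ominus>\<^sub>B \<phi> a \<in> fil (Suc N)"
proof -
 have b: "b \<in> carrier B" using assms fil_closed by auto
 obtain a where a: "a \<in> carrier R" "b \<ominus>\<^sub>B \<phi> a \<in> fil (Suc N)" using dense[OF b] by blast
 then have "b \<ominus>\<^sub>B (b \<ominus>\<^sub>B \<phi> a) \<in> fil N" using assms fil_minus fil_Suc by blast
 then have "\<phi> a \<in> fil N" using minus_triv(1)[OF b phi.hom_closed[OF a(1)] b b] by simp
 then have at: "a \<in> tail N" using phi_fil a by auto
 then have "a \<ominus> hcomp a N \<in> tail (Suc N)" by (rule tail_head)
 then have "\<phi> (a \<ominus> hcomp a N) \<in> fil (Suc N)" by (rule iffD2[OF phi_fil, rotated]) (use a in auto)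
 then have "\<phi> a \<ominus>\<^sub>B \<phi> (hcomp a N) \<in> fil (Suc N)"
  unfolding phi_minus[OF a(1) comp_closed[OF a(1)]] .
 then have "(b \<ominus>\<^sub>B \<phi> a) \<oplus>\<^sub>B (\<phi> a \<ominus>\<^sub>B \<phi> (hcomp a N)) \<in> fil (Suc N)" using fil_add a by blast
 then have "b \<ominus>\<^sub>B \<phi> (hcomp a N) \<in> fil (Suc N)"
  using minus_triv(4)[OF b phi.hom_closed[OF a(1)] phi.hom_closed b] a by simp
 then show ?thesis using a by auto
qed

lemma fil_approx: assumes "b \<in> fil M" shows "\<exists>a\<in>tail M. b \<ominus>\<^sub>B \<phi> a \<in> fil N"
proof -
 have b: "b \<in> carrier B" using assms fil_closed by auto
 obtain a where a: "a \<in> carrier R" "b \<ominus>\<^sub>B \<phi> a \<in> fil (max M N)" using dense[OF b] by blast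
 then have "b \<ominus>\<^sub>B (b \<ominus>\<^sub>B \<phi> a) \<in> fil M" using assms fil_minus fil_antimono[of M "max M N"] by auto
 then have "\<phi> a \<in> fil M" using minus_triv(1)[OF b phi.hom_closed[OF a(1)] b b] by simp
 then show ?thesis using a phi_fil fil_antimono[of N "max M N"] by auto
qed

text \<open>Orders add for elements of \<open>R\<close>, and both factors agree with such elements
  up to order \<open>M + N\<close>.\<close>

lemma fil_mult: assumes "b \<in> fil M" "c \<in> fil N" shows "b \<otimes>\<^sub>B c \<in> fil (M + N)"
proof -
 obtain a where a: "a \<in> tail M" "b \<ominus>\<^sub>B \<phi> a \<in> fil (M + N)" using fil_approx[OF assms(1)] by blast
 obtain a' where a': "a' \<in> tail N" "c \<ominus>\<^sub>B \<phi> a' \<in> fil (M + N)" using fil_approx[OF assms(2)] by blast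
 have cl: "b \<in> carrier B" "c \<in> carrier B" "a \<in> carrier R" "a' \<in> carrier R" "\<phi> a \<in> carrier B" "\<phi> a' \<in> carrier B"
  using assms fil_closed a a' tail_closed by auto
 have "(\<phi> a \<oplus>\<^sub>B (b \<ominus>\<^sub>B \<phi> a)) \<otimes>\<^sub>B (\<phi> a' \<oplus>\<^sub>B (c \<ominus>\<^sub>B \<phi> a'))
  = \<phi> a \<otimes>\<^sub>B \<phi> a' \<oplus>\<^sub>B (\<phi> a \<otimes>\<^sub>B (c \<ominus>\<^sub>B \<phi> a') \<oplus>\<^sub>B (b \<ominus>\<^sub>B \<phi> a) \<otimes>\<^sub>B (\<phi> a' \<oplus>\<^sub>B (c \<ominus>\<^sub>B \<phi> a')))"
  by (rule minus_triv(5)) (use cl in auto)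
 moreover have "\<phi> a \<otimes>\<^sub>B \<phi> a' \<in> fil (M + N)"
  using phi_fil[of "a \<otimes> a'" "M + N"] tail_mult[OF a(1) a'(1)] cl by simp
 moreover have "\<phi> a \<otimes>\<^sub>B (c \<ominus>\<^sub>B \<phi> a') \<in> fil (M + N)" using fil_l_mult a' cl by blast
 moreover have "(b \<ominus>\<^sub>B \<phi> a) \<otimes>\<^sub>B (\<phi> a' \<oplus>\<^sub>B (c \<ominus>\<^sub>B \<phi> a')) \<in> fil (M + N)"
  by (rule ideal.I_r_closed[OF fil_ideal a(2)]) (use cl in auto)
 ultimately have "(\<phi> a \<oplus>\<^sub>B (b \<ominus>\<^sub>B \<phi> a)) \<otimes>\<^sub>B (\<phi> a' \<oplus>\<^sub>B (c \<ominus>\<^sub>B \<phi> a')) \<in> fil (M + N)"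
  using fil_add by simp
 then show ?thesis using minus_triv(3)[OF cl(1,5) cl(1,1)] minus_triv(3)[OF cl(2,6) cl(1,1)] by simp
qed

lemma fil_0: "fil 0 = carrier B"
proof
 show "carrier B <= fil 0"
 proof
  fix b assume b: "b \<in> carrier B"
  obtain a where a: "a \<in> carrier R" "b \<ominus>\<^sub>B \<phi> a \<in> fil 0" using dense[OF b] by blast
  then have "(b \<ominus>\<^sub>B \<phi> a) \<oplus>\<^sub>B \<phi> a \<in> fil 0" using phi_fil[of a 0] fil_add by auto
  then show "b \<in> fil 0" using minus_triv(2)[OF b phi.hom_closed[OF a(1)] b b] by simp
 qed
qed (use fil_closed in auto)

text \<open>Successive approximation: solving modulo one more step of the filtration suffices.\<close>

lemma approximation:
 fixes h :: "'i => 'c" and \<delta> :: "'i => nat"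
 assumes I: "finite I" "!!i. i \<in> I ==> h i \<in> fil (\<delta> i)"
  and step: "!!n b. b \<in> J ==> b \<in> fil n ==> \<exists>r. (\<forall>i\<in>I. r i \<in> gr (n - \<delta> i) & (n < \<delta> i --> r i = \<zero>)) &
   b \<ominus>\<^sub>B (\<Oplus>\<^sub>B i\<in>I. \<phi> (r i) \<otimes>\<^sub>B h i) \<in> J \<inter> fil (Suc n)"
  and b: "b \<in> J" "b \<in> fil N"
 shows "\<exists>a. (\<forall>i\<in>I. a i \<in> fil (N - \<delta> i)) & b = (\<Oplus>\<^sub>B i\<in>I. a i \<otimes>\<^sub>B h i)"
proof -
 have hc: "h i \<in> carrier B" if "i \<in> I" for i using I(2)[OF that] fil_closed by auto
 define st where "st n v = (SOME r. (\<forall>i\<in>I. r i \<in> gr (n - \<delta> i) & (n < \<delta> i --> r i = \<zero>)) &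
   v \<ominus>\<^sub>B (\<Oplus>\<^sub>B i\<in>I. \<phi> (r i) \<otimes>\<^sub>B h i) \<in> J \<inter> fil (Suc n))" for n v
 have st: "(\<forall>i\<in>I. st n v i \<in> gr (n - \<delta> i) & (n < \<delta> i --> st n v i = \<zero>)) &
   v \<ominus>\<^sub>B (\<Oplus>\<^sub>B i\<in>I. \<phi> (st n v i) \<otimes>\<^sub>B h i) \<in> J \<inter> fil (Suc n)" if "v \<in> J" "v \<in> fil n" for n v
  unfolding st_def by (rule someI_ex[OF step[OF that]])
 \<comment> \<open>The successive remainders; the \<open>n\<close>-th of them has order at least
   \<open>N + n\<close>.\<close>
 define w where "w = rec_nat b (%n v. v \<ominus>\<^sub>B (\<Oplus>\<^sub>B i\<in>I. \<phi> (st (N + n) v i) \<otimes>\<^sub>B h i))"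
 define r where "r n = st (N + n) (w n)" for n
 have w_simps: "w 0 = b" "w (Suc n) = w n \<ominus>\<^sub>B (\<Oplus>\<^sub>B i\<in>I. \<phi> (r n i) \<otimes>\<^sub>B h i)" for n
  unfolding w_def r_def by auto
 have w: "w n \<in> J & w n \<in> fil (N + n)" for n
 proof (induction n)
  case (Suc n)
  then show ?case using st[of "w n" "N + n"] unfolding w_simps r_def by auto
 qed (use b w_simps in auto)
 have r: "r n i \<in> gr (N + n - \<delta> i)" "N + n < \<delta> i ==> r n i = \<zero>" if "i \<in> I" for n i
  using st[of "w n" "N + n"] w[of n] that unfolding r_def by auto
 have rc: "r n i \<in> carrier R" if "i \<in> I" for n i using r(1)[OF that] gr_closed by blast
 \<comment> \<open>Step \<open>M\<close> contributes a form of degree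
   \<open>N + M - \<delta> i\<close> to the \<open>i\<close>-th coefficient, so its degree
   \<open>m\<close> is filled by step \<open>m + \<delta> i - N\<close>.\<close>
 define c where "c i m = (if N <= m + \<delta> i then r (m + \<delta> i - N) i else \<zero>)" for i m
 have c: "c i m \<in> gr m" if "i \<in> I" for i m
  using r(1)[OF that, of "m + \<delta> i - N"] unfolding c_def by auto
 have cc: "c i m \<in> carrier R" if "i \<in> I" for i m using c[OF that] gr_closed by blast
 have "\<exists>a\<in>carrier B. \<forall>M. a \<ominus>\<^sub>B (\<Oplus>\<^sub>B m\<in>{..<M}. \<phi> (c i m)) \<in> fil M" if "i \<in> I" for i
  by (rule complete) (rule c[OF that])
 then obtain a where a: "!!i. i \<in> I ==> a i \<in> carrier B" "!!i M. i \<in> I ==> a i \<ominus>\<^sub>B (\<Oplus>\<^sub>B m\<in>{..<M}. \<phi> (c i m)) \<in> fil M"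
  by metis
 have afil: "a i \<in> fil (N - \<delta> i)" if i: "i \<in> I" for i
 proof -
  have "(\<Oplus>\<^sub>B m\<in>{..<N - \<delta> i}. \<phi> (c i m)) = (\<Oplus>\<^sub>B m\<in>{..<N - \<delta> i}. \<zero>\<^sub>B)"
   by (rule B.finsum_cong') (auto simp: c_def)
  then show ?thesis using a(2)[OF i, of "N - \<delta> i"] a(1)[OF i] by (simp add: a_minus_def)
 qed
 \<comment> \<open>The part of the \<open>i\<close>-th coefficient that has been collected in the
   first \<open>M\<close> steps.\<close>
 define S where "S i M = (\<Oplus>\<^sub>B m\<in>{..<N + M - \<delta> i}. \<phi> (c i m))" for i M
 have Sc: "S i M \<in> carrier B" if "i \<in> I" for i M unfolding S_def using cc[OF that] by (auto intro!: B.finsum_closed)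
 have S_0: "S i 0 = \<zero>\<^sub>B" if "i \<in> I" for i
 proof -
  have "S i 0 = (\<Oplus>\<^sub>B m\<in>{..<N + 0 - \<delta> i}. \<zero>\<^sub>B)" unfolding S_def
   by (rule B.finsum_cong') (auto simp: c_def)
  then show ?thesis by simp
 qed
 have S_Suc: "S i (Suc M) = \<phi> (r M i) \<oplus>\<^sub>B S i M" if i: "i \<in> I" for i M
 proof (cases "\<delta> i <= N + M")
  case True
  then have e: "{..<N + Suc M - \<delta> i} = insert (N + M - \<delta> i) {..<N + M - \<delta> i}" by auto
  have "c i (N + M - \<delta> i) = r M i" using True unfolding c_def by simp
  then show ?thesis unfolding S_def e using cc[OF i] rc[OF i] by (subst B.finsum_insert) auto
 next
  case False
  then have "S i (Suc M) = S i M" unfolding S_def by (intro arg_cong[where f = "finsum B _"]) auto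
  then show ?thesis using r(2)[OF i, of M] False Sc[OF i] by simp
 qed
 have wS: "w M = b \<ominus>\<^sub>B (\<Oplus>\<^sub>B i\<in>I. S i M \<otimes>\<^sub>B h i)" for M
 proof (induction M)
  case 0
  have "(\<Oplus>\<^sub>B i\<in>I. S i 0 \<otimes>\<^sub>B h i) = (\<Oplus>\<^sub>B i\<in>I. \<zero>\<^sub>B)"
   by (rule B.finsum_cong') (use S_0 hc in auto)
  then show ?case using w_simps b fil_closed by (simp add: a_minus_def)
 next
  case (Suc M)
  have "(\<Oplus>\<^sub>B i\<in>I. S i (Suc M) \<otimes>\<^sub>B h i) = (\<Oplus>\<^sub>B i\<in>I. \<phi> (r M i) \<otimes>\<^sub>B h i \<oplus>\<^sub>B S i M \<otimes>\<^sub>B h i)"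
   by (rule B.finsum_cong') (use S_Suc hc Sc rc in "auto simp: B.l_distr")
  also have "\<dots> = (\<Oplus>\<^sub>B i\<in>I. \<phi> (r M i) \<otimes>\<^sub>B h i) \<oplus>\<^sub>B (\<Oplus>\<^sub>B i\<in>I. S i M \<otimes>\<^sub>B h i)"
   by (rule B.finsum_addf) (use hc Sc rc in auto)
  finally have e: "(\<Oplus>\<^sub>B i\<in>I. S i (Suc M) \<otimes>\<^sub>B h i) = (\<Oplus>\<^sub>B i\<in>I. \<phi> (r M i) \<otimes>\<^sub>B h i) \<oplus>\<^sub>B (\<Oplus>\<^sub>B i\<in>I. S i M \<otimes>\<^sub>B h i)" .
  have "(b \<ominus>\<^sub>B u) \<ominus>\<^sub>B v = b \<ominus>\<^sub>B (v \<oplus>\<^sub>B u)" if "u \<in> carrier B" "v \<in> carrier B" for u v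
  proof -
   have "b \<in> carrier B" using b fil_closed by auto
   then show ?thesis using that by algebra
  qed
  then show ?case unfolding w_simps Suc e using hc Sc rc by (auto intro!: B.finsum_closed)
 qed
 have "b \<ominus>\<^sub>B (\<Oplus>\<^sub>B i\<in>I. a i \<otimes>\<^sub>B h i) \<in> fil M" for M
 proof -
  have X: "(\<Oplus>\<^sub>B i\<in>I. (a i \<ominus>\<^sub>B S i M) \<otimes>\<^sub>B h i) \<in> fil (N + M)"
  proof (rule fil_finsum)
   fix i assume i: "i \<in> I"
   have "(a i \<ominus>\<^sub>B S i M) \<otimes>\<^sub>B h i \<in> fil ((N + M - \<delta> i) + \<delta> i)"
    unfolding S_def by (rule fil_mult) (use a(2)[OF i] I(2)[OF i] in auto)
   then show "(a i \<ominus>\<^sub>B S i M) \<otimes>\<^sub>B h i \<in> fil (N + M)" by (rule fil_antimono[rotated]) auto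
  qed
  have XY: "(\<Oplus>\<^sub>B i\<in>I. (a i \<ominus>\<^sub>B S i M) \<otimes>\<^sub>B h i) \<oplus>\<^sub>B (\<Oplus>\<^sub>B i\<in>I. S i M \<otimes>\<^sub>B h i) = (\<Oplus>\<^sub>B i\<in>I. a i \<otimes>\<^sub>B h i)"
  proof -
   have "(\<Oplus>\<^sub>B i\<in>I. (a i \<ominus>\<^sub>B S i M) \<otimes>\<^sub>B h i) \<oplus>\<^sub>B (\<Oplus>\<^sub>B i\<in>I. S i M \<otimes>\<^sub>B h i)
    = (\<Oplus>\<^sub>B i\<in>I. (a i \<ominus>\<^sub>B S i M) \<otimes>\<^sub>B h i \<oplus>\<^sub>B S i M \<otimes>\<^sub>B h i)"
    by (rule B.finsum_addf[symmetric]) (use hc Sc a in auto)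
   also have "\<dots> = (\<Oplus>\<^sub>B i\<in>I. a i \<otimes>\<^sub>B h i)"
   proof (rule B.finsum_cong', simp)
    fix i assume i: "i \<in> I"
    have "(u \<ominus>\<^sub>B v) \<otimes>\<^sub>B z \<oplus>\<^sub>B v \<otimes>\<^sub>B z = u \<otimes>\<^sub>B z" if "u \<in> carrier B" "v \<in> carrier B" "z \<in> carrier B" for u v z
     using that by algebra
    then show "(a i \<ominus>\<^sub>B S i M) \<otimes>\<^sub>B h i \<oplus>\<^sub>B S i M \<otimes>\<^sub>B h i = a i \<otimes>\<^sub>B h i" using a(1)[OF i] Sc[OF i] hc[OF i] by blast
   qed (use hc a in auto)
   finally show ?thesis .
  qed
  have wM: "b \<ominus>\<^sub>B (\<Oplus>\<^sub>B i\<in>I. S i M \<otimes>\<^sub>B h i) \<in> fil (N + M)" using w[of M] wS[of M] by simp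
  have id: "b \<ominus>\<^sub>B (u \<oplus>\<^sub>B v) = (b \<ominus>\<^sub>B v) \<ominus>\<^sub>B u" if "u \<in> carrier B" "v \<in> carrier B" for u v
  proof -
   have "b \<in> carrier B" using b fil_closed by auto
   then show ?thesis using that by algebra
  qed
  have Y: "(\<Oplus>\<^sub>B i\<in>I. S i M \<otimes>\<^sub>B h i) \<in> carrier B" using hc Sc by (auto intro!: B.finsum_closed)
  have "b \<ominus>\<^sub>B (\<Oplus>\<^sub>B i\<in>I. a i \<otimes>\<^sub>B h i) \<in> fil (N + M)"
   unfolding XY[symmetric] id[OF fil_closed[OF X] Y] by (rule fil_minus[OF wM X])
  then show ?thesis by (rule fil_antimono[rotated]) auto
 qed
 then have z: "b \<ominus>\<^sub>B (\<Oplus>\<^sub>B i\<in>I. a i \<otimes>\<^sub>B h i) = \<zero>\<^sub>B" by (rule separated)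
 have "b \<in> carrier B" "(\<Oplus>\<^sub>B i\<in>I. a i \<otimes>\<^sub>B h i) \<in> carrier B" using b fil_closed hc a by (auto intro!: B.finsum_closed)
 then have "b = (\<Oplus>\<^sub>B i\<in>I. a i \<otimes>\<^sub>B h i)" using z by simp
 then show ?thesis using afil by blast
qed

section \<open>Units, the maximal ideal and the domain property\<close>

lemma one_not_fil: "\<one>\<^sub>B \<notin> fil 1"
proof -
 have "\<one> \<notin> tail 1" using ideal.one_imp_carrier[OF tail_ideal] maximalideal.I_notcarr[OF tail_1_maximal] by auto
 then show ?thesis using phi_fil[of \<one> 1] by simp
qed

text \<open>An element of order zero has a nonzero constant as leading form. Dividing leading forms
  by this constant solves \<open>\<one> = a b\<close> for \<open>a\<close> by successive
  approximation, with a one-element index set.\<close>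

lemma unit_iff: assumes "b \<in> carrier B" shows "b \<in> Units B \<longleftrightarrow> b \<notin> fil 1"
proof
 assume "b \<in> Units B"
 then obtain c where "c \<in> carrier B" "c \<otimes>\<^sub>B b = \<one>\<^sub>B" unfolding Units_def by auto
 then show "b \<notin> fil 1" using fil_l_mult[of b 1 c] one_not_fil by auto
next
 assume nb: "b \<notin> fil 1"
 obtain s where s: "s \<in> gr 0" "b \<ominus>\<^sub>B \<phi> s \<in> fil 1" using fil_head[of b 0] assms fil_0 by auto
 have "s ~= \<zero>" using s nb assms by (auto simp: a_minus_def)
 then have si: "inv s \<in> k" "s \<otimes> inv s = \<one>" "inv s \<otimes> s = \<one>" using scal_inv[of s] s gr_0 by auto
 have sc: "s \<in> carrier R" "inv s \<in> carrier R" using s si by auto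
 have "\<exists>a. (\<forall>i\<in>{0::nat}. a i \<in> fil (0 - 0)) & \<one>\<^sub>B = (\<Oplus>\<^sub>B i\<in>{0::nat}. a i \<otimes>\<^sub>B b)"
 proof (rule approximation[where J = "carrier B" and \<delta> = "%_. 0"])
  fix n c assume c: "c \<in> carrier B" "c \<in> fil n"
  obtain a where a: "a \<in> gr n" "c \<ominus>\<^sub>B \<phi> a \<in> fil (Suc n)" using fil_head[OF c(2)] by blast
  have ac: "a \<in> carrier R" using a by auto
  define r where "r = inv s \<otimes> a"
  have r: "r \<in> gr n" "r \<in> carrier R" using gr_mult[of "inv s" 0 a n] si a gr_0 unfolding r_def by auto
  have rb: "\<phi> r \<otimes>\<^sub>B \<phi> s = \<phi> a"
  proof -
   have "r \<otimes> s = (inv s \<otimes> s) \<otimes> a" unfolding r_def using sc ac by (simp add: m_ac)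
   then have "\<phi> (r \<otimes> s) = \<phi> a" using si ac by simp
   then show ?thesis using r sc by simp
  qed
  have id: "u \<ominus>\<^sub>B p \<otimes>\<^sub>B b = (u \<ominus>\<^sub>B p \<otimes>\<^sub>B v) \<ominus>\<^sub>B p \<otimes>\<^sub>B (b \<ominus>\<^sub>B v)"
   if "u \<in> carrier B" "p \<in> carrier B" "v \<in> carrier B" for u p v
   using that assms by algebra
  have "c \<ominus>\<^sub>B \<phi> r \<otimes>\<^sub>B b = (c \<ominus>\<^sub>B \<phi> a) \<ominus>\<^sub>B \<phi> r \<otimes>\<^sub>B (b \<ominus>\<^sub>B \<phi> s)"
   using id[OF c(1) phi.hom_closed[OF r(2)] phi.hom_closed[OF sc(1)]] unfolding rb .
  moreover have "\<phi> r \<otimes>\<^sub>B (b \<ominus>\<^sub>B \<phi> s) \<in> fil (n + 1)"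
   by (rule fil_mult) (use r s phi_fil gr_tail in auto)
  ultimately have "c \<ominus>\<^sub>B \<phi> r \<otimes>\<^sub>B b \<in> fil (Suc n)" using a fil_minus by simp
  moreover have "(\<Oplus>\<^sub>B i\<in>{0::nat}. \<phi> r \<otimes>\<^sub>B b) = \<phi> r \<otimes>\<^sub>B b" using r assms by (simp add: B.finsum_insert)
  ultimately show "\<exists>r. (\<forall>i\<in>{0::nat}. r i \<in> gr (n - 0) & (n < 0 --> r i = \<zero>)) &
   c \<ominus>\<^sub>B (\<Oplus>\<^sub>B i\<in>{0::nat}. \<phi> (r i) \<otimes>\<^sub>B b) \<in> carrier B \<inter> fil (Suc n)"
   using r fil_closed by (intro exI[of _ "%_. r"]) auto
 qed (use assms fil_0 in auto)
 then obtain a where "a \<in> carrier B" "\<one>\<^sub>B = (\<Oplus>\<^sub>B i\<in>{0::nat}. a \<otimes>\<^sub>B b)" using fil_0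
  by (auto simp: B.finsum_insert assms)
 then have a: "a \<in> carrier B" "a \<otimes>\<^sub>B b = \<one>\<^sub>B" using assms by (auto simp: B.finsum_insert)
 then show "b \<in> Units B" unfolding Units_def using assms B.m_comm[OF a(1) assms] by auto
qed

lemma proper_ideal_fil: assumes "ideal J B" "J ~= carrier B" shows "J <= fil 1"
proof (rule ccontr)
 assume "\<not> J <= fil 1"
 then obtain b where b: "b \<in> J" "b \<notin> fil 1" by auto
 have bc: "b \<in> carrier B" using ideal_mem[OF assms(1) b(1)] .
 then obtain c where "c \<in> carrier B" "c \<otimes>\<^sub>B b = \<one>\<^sub>B" using unit_iff b unfolding Units_def by auto
 then have "\<one>\<^sub>B \<in> J" using ideal.I_l_closed[OF assms(1) b(1)] by metis
 then show False using ideal.one_imp_carrier[OF assms(1)] assms(2) by simp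
qed

lemma fil_1_maximal: "maximalideal (fil 1) B"
proof (rule maximalidealI[OF fil_ideal])
 show "carrier B ~= fil 1" using one_not_fil by auto
 fix J assume "ideal J B" "fil 1 <= J" "J <= carrier B"
 then show "J = fil 1 \<or> J = carrier B" using proper_ideal_fil by blast
qed

lemma max_ideal: "max_ideal_of B = fil 1"
 unfolding max_ideal_of_def
proof (rule the_equality)
 show "maximalideal (fil 1) B" by (rule fil_1_maximal)
 fix m assume m: "maximalideal m B"
 then have "m <= fil 1"
  using proper_ideal_fil[OF maximalideal.axioms(1)[OF m]] maximalideal.I_notcarr[OF m] by simp
 moreover have "fil 1 <= carrier B" using fil_closed by blast
 ultimately have "fil 1 = m \<or> fil 1 = carrier B" by (intro maximalideal.I_maximal[OF m fil_ideal])
 then show "m = fil 1" using one_not_fil by auto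
qed

lemma fil_order: assumes "b \<in> carrier B" "b ~= \<zero>\<^sub>B" shows "\<exists>n. b \<in> fil n & b \<notin> fil (Suc n)"
proof (rule ccontr)
 assume "\<not> ?thesis"
 then have "b \<in> fil n" for n using assms fil_0 by (induction n) auto
 then show False using separated assms by blast
qed

text \<open>The product of the leading forms of two nonzero elements is nonzero because
  \<open>R\<close> is a domain, and a vanishing product would force it to have larger order than its
  degree.\<close>

lemma B_domain: "domain B"
proof (unfold_locales)
 show "\<one>\<^sub>B ~= \<zero>\<^sub>B" using one_not_fil fil_zero by metis
 fix b c assume bc: "b \<otimes>\<^sub>B c = \<zero>\<^sub>B" "b \<in> carrier B" "c \<in> carrier B"
 show "b = \<zero>\<^sub>B \<or> c = \<zero>\<^sub>B"
 proof (rule ccontr)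
  assume n: "\<not> ?thesis"
  obtain i where i: "b \<in> fil i" "b \<notin> fil (Suc i)" using fil_order n bc by blast
  obtain j where j: "c \<in> fil j" "c \<notin> fil (Suc j)" using fil_order n bc by blast
  obtain u where u: "u \<in> gr i" "b \<ominus>\<^sub>B \<phi> u \<in> fil (Suc i)" using fil_head i by blast
  obtain v where v: "v \<in> gr j" "c \<ominus>\<^sub>B \<phi> v \<in> fil (Suc j)" using fil_head j by blast
  have uv: "u ~= \<zero>" "v ~= \<zero>" "u \<in> carrier R" "v \<in> carrier R" using u v i j bc by (auto simp: a_minus_def)
  let ?U = "\<phi> u" and ?V = "\<phi> v"
  have "U \<otimes>\<^sub>B V = b \<otimes>\<^sub>B c \<ominus>\<^sub>B (b \<otimes>\<^sub>B (c \<ominus>\<^sub>B V) \<oplus>\<^sub>B (b \<ominus>\<^sub>B U) \<otimes>\<^sub>B V)"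
   if "U \<in> carrier B" "V \<in> carrier B" for U V using that bc(2,3) by algebra
  then have e: "\<phi> (u \<otimes> v) = \<zero>\<^sub>B \<ominus>\<^sub>B (b \<otimes>\<^sub>B (c \<ominus>\<^sub>B ?V) \<oplus>\<^sub>B (b \<ominus>\<^sub>B ?U) \<otimes>\<^sub>B ?V)"
   using uv bc(1) by simp
  have "b \<otimes>\<^sub>B (c \<ominus>\<^sub>B ?V) \<in> fil (i + Suc j)" by (rule fil_mult[OF i(1) v(2)])
  moreover have "(b \<ominus>\<^sub>B ?U) \<otimes>\<^sub>B ?V \<in> fil (Suc i + j)"
   by (rule fil_mult[OF u(2)]) (use phi_fil[of v j] gr_tail[OF v(1)] uv in auto)
  ultimately have "\<phi> (u \<otimes> v) \<in> fil (Suc (i + j))" unfolding e using fil_minus fil_add fil_zero by simp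
  then have "u \<otimes> v \<in> tail (Suc (i + j))" by (rule iffD1[OF phi_fil, rotated]) (use uv in auto)
  then have "u \<otimes> v = \<zero>" using gr_tail_zero[OF gr_mult[OF u(1) v(1)]] by simp
  then show False using integral[of u v] uv by blast
 qed
qed

end

section \<open>Finiteness of the dimension\<close>

lemma (in cring) ideal_minus: "ideal J R ==> x \<in> J ==> y \<in> J ==> x \<ominus> y \<in> J"
 unfolding a_minus_def
 using additive_subgroup.a_closed[OF ideal.axioms(1)] additive_subgroup.a_inv_closed[OF ideal.axioms(1)] by metis

lemma (in cring) ideal_Hcarr: "ideal J R ==> x \<in> J ==> x \<in> carrier R"
 using additive_subgroup.a_Hcarr[OF ideal.axioms(1)] .

lemma (in cring) ideal_add: "ideal J R ==> x \<in> J ==> y \<in> J ==> x \<oplus> y \<in> J"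
 using additive_subgroup.a_closed[OF ideal.axioms(1)] .

context graded_completion
begin

text \<open>The \<open>h i\<close> are elements of \<open>J\<close> whose leading forms generate the
  ideal spanned by all leading forms of \<open>J\<close>; finitely many suffice by Hilbert's basis
  theorem in \<open>R\<close>. Removing leading forms one degree at a time expresses each element of
  \<open>J\<close> with control over the orders of the coefficients. This yields both the Noetherian
  property and a version of the Artin-Rees lemma.\<close>

lemma standard_basis:
 assumes J: "ideal J B"
 shows "\<exists>(s::nat) h \<delta>. (\<forall>i<s. h i \<in> J & h i \<in> fil (\<delta> i)) &
  (\<forall>N. \<forall>b\<in>J \<inter> fil N. \<exists>a. (\<forall>i<s. a i \<in> fil (N - \<delta> i)) & b = (\<Oplus>\<^sub>B i\<in>{..<s}. a i \<otimes>\<^sub>B h i))"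
proof -
 \<comment> \<open>The leading forms of degree \<open>n\<close> of elements of \<open>J\<close>,
   zero included.\<close>
 define V where "V n = {r \<in> gr n. \<exists>b\<in>J \<inter> fil n. b \<ominus>\<^sub>B \<phi> r \<in> fil (Suc n)}" for n
 have Vc: "(\<Union>n. V n) <= carrier R" unfolding V_def using gr_closed by blast
 have Gc: "G <= carrier R" using G(2) gr_closed by blast
 obtain V0 where V0: "V0 <= (\<Union>n. V n)" "finite V0" "(\<Union>n. V n) <= Idl V0"
  using hilbert_basis[OF subfield G(1) Gc G(3) Vc] by blast
 obtain s :: nat and \<rho> where rho: "V0 = \<rho> ` {..<s}"
  using finite_imp_nat_seg_image_inj_on[OF V0(2)] by (auto simp: lessThan_def)
 have "\<forall>i. \<exists>nb. i < s --> \<rho> i \<in> gr (fst nb) & snd nb \<in> J \<inter> fil (fst nb) & snd nb \<ominus>\<^sub>B \<phi> (\<rho> i) \<in> fil (Suc (fst nb))"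
 proof
  fix i
  show "\<exists>nb. i < s --> \<rho> i \<in> gr (fst nb) & snd nb \<in> J \<inter> fil (fst nb) & snd nb \<ominus>\<^sub>B \<phi> (\<rho> i) \<in> fil (Suc (fst nb))"
  proof (cases "i < s")
   case True
   then have "\<rho> i \<in> (\<Union>n. V n)" using V0 rho by auto
   then obtain n b where "\<rho> i \<in> gr n" "b \<in> J \<inter> fil n" "b \<ominus>\<^sub>B \<phi> (\<rho> i) \<in> fil (Suc n)" unfolding V_def by auto
   then show ?thesis by (intro exI[of _ "(n, b)"]) auto
  qed simp
 qed
 from choice[OF this] obtain nb where nb: "\<forall>i. i < s --> \<rho> i \<in> gr (fst (nb i)) & snd (nb i) \<in> J \<inter> fil (fst (nb i)) &
  snd (nb i) \<ominus>\<^sub>B \<phi> (\<rho> i) \<in> fil (Suc (fst (nb i)))" by blast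
 define h \<delta> where "h i = snd (nb i)" and "\<delta> i = fst (nb i)" for i
 have h: "\<rho> i \<in> gr (\<delta> i)" "h i \<in> J" "h i \<in> fil (\<delta> i)" "h i \<ominus>\<^sub>B \<phi> (\<rho> i) \<in> fil (Suc (\<delta> i))" if "i < s" for i
  using nb that unfolding h_def \<delta>_def by auto
 have hc: "h i \<in> carrier B" "\<rho> i \<in> carrier R" if "i < s" for i using h[OF that] fil_closed by auto
 have "\<exists>a. (\<forall>i\<in>{..<s}. a i \<in> fil (N - \<delta> i)) & b = (\<Oplus>\<^sub>B i\<in>{..<s}. a i \<otimes>\<^sub>B h i)" if b: "b \<in> J \<inter> fil N" for N b
 proof (rule approximation)
  fix n b assume b: "b \<in> J" "b \<in> fil n"
  obtain r where r: "r \<in> gr n" "b \<ominus>\<^sub>B \<phi> r \<in> fil (Suc n)" using fil_head[OF b(2)] by blast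
  have bc: "b \<in> carrier B" "r \<in> carrier R" using b fil_closed r by auto
  have "r \<in> (\<Union>n. V n)" unfolding V_def using r b by blast
  then have "r \<in> Idl (\<rho> ` {..<s})" using V0(3) rho by blast
  then obtain r' where R: "\<forall>i\<in>{..<s}. r' i \<in> gr (n - \<delta> i) & (n < \<delta> i --> r' i = \<zero>)" "hcomp r n = (\<Oplus>i\<in>{..<s}. r' i \<otimes> \<rho> i)"
   using comp_combination[of "{..<s}" \<rho> \<delta> r n] h by auto
  have R1: "r' i \<in> gr (n - \<delta> i)" "n < \<delta> i ==> r' i = \<zero>" if "i < s" for i using R(1) that by auto
  have r': "r' i \<in> gr (n - \<delta> i)" "n < \<delta> i ==> r' i = \<zero>" "r' i \<in> carrier R" if "i < s" for i
   using R1[OF that] gr_closed[OF R1(1)[OF that]] by simp_all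
  have rr: "r = (\<Oplus>i\<in>{..<s}. r' i \<otimes> \<rho> i)" using comp_homogeneous[OF r(1), of n] R(2) by simp
  have pr: "\<phi> r = (\<Oplus>\<^sub>B i\<in>{..<s}. \<phi> (r' i) \<otimes>\<^sub>B \<phi> (\<rho> i))"
   unfolding rr by (rule phi.hom_finsum_mult) (use r' hc in auto)
  let ?H = "\<Oplus>\<^sub>B i\<in>{..<s}. \<phi> (r' i) \<otimes>\<^sub>B h i" and ?D = "\<Oplus>\<^sub>B i\<in>{..<s}. \<phi> (r' i) \<otimes>\<^sub>B (h i \<ominus>\<^sub>B \<phi> (\<rho> i))"
  have D: "?D \<in> fil (Suc n)"
  proof (rule fil_finsum)
   fix i assume "i \<in> {..<s}"
   then have i: "i < s" by simp
   show "\<phi> (r' i) \<otimes>\<^sub>B (h i \<ominus>\<^sub>B \<phi> (\<rho> i)) \<in> fil (Suc n)"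
   proof (cases "n < \<delta> i")
    case True
    then have "\<phi> (r' i) = \<zero>\<^sub>B" using r'(2)[OF i] by simp
    then show ?thesis using hc[OF i] by simp
   next
    case False
    have "\<phi> (r' i) \<in> fil (n - \<delta> i)" using phi_fil[OF r'(3)[OF i]] gr_tail[OF r'(1)[OF i]] by simp
    then have "\<phi> (r' i) \<otimes>\<^sub>B (h i \<ominus>\<^sub>B \<phi> (\<rho> i)) \<in> fil ((n - \<delta> i) + Suc (\<delta> i))" by (rule fil_mult) (rule h(4)[OF i])
    then show ?thesis using False by simp
   qed
  qed
  have "?H = (\<Oplus>\<^sub>B i\<in>{..<s}. \<phi> (r' i) \<otimes>\<^sub>B \<phi> (\<rho> i) \<oplus>\<^sub>B \<phi> (r' i) \<otimes>\<^sub>B (h i \<ominus>\<^sub>B \<phi> (\<rho> i)))"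
  proof (rule B.finsum_cong', simp)
   fix i assume "i \<in> {..<s}"
   then have c: "\<phi> (r' i) \<in> carrier B" "h i \<in> carrier B" "\<phi> (\<rho> i) \<in> carrier B" using r' hc by auto
   have "p \<otimes>\<^sub>B u = p \<otimes>\<^sub>B v \<oplus>\<^sub>B p \<otimes>\<^sub>B (u \<ominus>\<^sub>B v)" if "p \<in> carrier B" "u \<in> carrier B" "v \<in> carrier B" for p u v
    using that by algebra
   then show "\<phi> (r' i) \<otimes>\<^sub>B h i = \<phi> (r' i) \<otimes>\<^sub>B \<phi> (\<rho> i) \<oplus>\<^sub>B \<phi> (r' i) \<otimes>\<^sub>B (h i \<ominus>\<^sub>B \<phi> (\<rho> i))" using c by blast
  qed (use r' hc in auto)
  also have "\<dots> = \<phi> r \<oplus>\<^sub>B ?D" unfolding pr by (rule B.finsum_addf) (use r' hc in auto)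
  finally have H: "?H = \<phi> r \<oplus>\<^sub>B ?D" .
  have "u \<ominus>\<^sub>B (v \<oplus>\<^sub>B w) = (u \<ominus>\<^sub>B v) \<ominus>\<^sub>B w" if "u \<in> carrier B" "v \<in> carrier B" "w \<in> carrier B" for u v w
   using that by algebra
  from this[OF bc(1) phi.hom_closed[OF bc(2)] fil_closed[OF D]]
  have "b \<ominus>\<^sub>B ?H \<in> fil (Suc n)" unfolding H using fil_minus[OF r(2) D] by simp
  moreover have "b \<ominus>\<^sub>B ?H \<in> J"
   by (rule B.ideal_minus[OF J b(1)], rule B.ideal_finsum[OF J]) (use h r' in "auto intro!: ideal.I_l_closed[OF J]")
  ultimately show "\<exists>r. (\<forall>i\<in>{..<s}. r i \<in> gr (n - \<delta> i) & (n < \<delta> i --> r i = \<zero>)) &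
   b \<ominus>\<^sub>B (\<Oplus>\<^sub>B i\<in>{..<s}. \<phi> (r i) \<otimes>\<^sub>B h i) \<in> J \<inter> fil (Suc n)"
   using r' by (intro exI[of _ r']) auto
 qed (use h b in auto)
 then show ?thesis using h(2,3) by (intro exI[of _ s] exI[of _ h] exI[of _ \<delta>]) (simp add: Ball_def)
qed

lemma B_noetherian: "noetherian_ring B"
proof (unfold_locales)
 fix J assume J: "ideal J B"
 from standard_basis[OF J] obtain s :: nat and h \<delta> where h: "\<forall>i<s. h i \<in> J & h i \<in> fil (\<delta> i)"
  "\<forall>N. \<forall>b\<in>J \<inter> fil N. \<exists>a. (\<forall>i<s. a i \<in> fil (N - \<delta> i)) & b = (\<Oplus>\<^sub>B i\<in>{..<s}. a i \<otimes>\<^sub>B h i)" by blast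
 let ?A = "h ` {..<s}"
 have A: "?A <= J" "?A <= carrier B" using h B.ideal_Hcarr[OF J] by auto
 have I: "ideal (Idl\<^bsub>B\<^esub> ?A) B" by (rule B.genideal_ideal[OF A(2)])
 have "J <= Idl\<^bsub>B\<^esub> ?A"
 proof
  fix b assume b: "b \<in> J"
  then have "b \<in> J \<inter> fil 0" using fil_0 B.ideal_Hcarr[OF J] by auto
  then obtain a where a: "\<forall>i<s. a i \<in> fil (0 - \<delta> i)" "b = (\<Oplus>\<^sub>B i\<in>{..<s}. a i \<otimes>\<^sub>B h i)" using h(2) by blast
  show "b \<in> Idl\<^bsub>B\<^esub> ?A" unfolding a(2)
   by (rule B.ideal_finsum[OF I]) (use a fil_closed B.genideal_self[OF A(2)] in "auto intro!: ideal.I_l_closed[OF I]")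
 qed
 moreover have "Idl\<^bsub>B\<^esub> ?A <= J" by (rule B.genideal_minimal[OF J A(1)])
 ultimately show "\<exists>A\<subseteq>carrier B. finite A & J = Idl\<^bsub>B\<^esub> A" using A by (intro exI[of _ ?A]) auto
qed

text \<open>A standard basis of \<open>P + (g)\<close>, with elements \<open>g c i + v i\<close> and
  \<open>v i\<close> in \<open>P\<close>, writes \<open>g x - p\<close> with coefficients
  \<open>a i\<close> of controlled order. Then \<open>g (x - \<Sum> a i c i)\<close> lies in
  \<open>P\<close>, and as \<open>P\<close> is prime, \<open>x\<close> agrees with
  \<open>\<Sum> a i c i\<close> up to an element of \<open>P\<close>.\<close>

lemma artin_rees_prime:
 assumes P: "primeideal P B" and g: "g \<in> carrier B" "g \<notin> P"
 shows "\<exists>c. \<forall>N x p. x \<in> carrier B & p \<in> P & g \<otimes>\<^sub>B x \<ominus>\<^sub>B p \<in> fil N --> (\<exists>p'\<in>P. x \<ominus>\<^sub>B p' \<in> fil (N - c))"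
proof -
 have PI: "ideal P B" using P primeideal.axioms(1) by auto
 define J where "J = {g \<otimes>\<^sub>B c \<oplus>\<^sub>B v | c v. c \<in> carrier B & v \<in> P}"
 have J: "ideal J B"
  unfolding J_def by (rule B.ideal_plus_principal[OF PI g(1)])
 from standard_basis[OF J] obtain s :: nat and h \<delta> where h: "\<forall>i<s. h i \<in> J & h i \<in> fil (\<delta> i)"
  "\<forall>N. \<forall>b\<in>J \<inter> fil N. \<exists>a. (\<forall>i<s. a i \<in> fil (N - \<delta> i)) & b = (\<Oplus>\<^sub>B i\<in>{..<s}. a i \<otimes>\<^sub>B h i)" by blast
 have "\<forall>i. \<exists>cv. i < s --> h i = g \<otimes>\<^sub>B fst cv \<oplus>\<^sub>B snd cv & fst cv \<in> carrier B & snd cv \<in> P"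
 proof
  fix i show "\<exists>cv. i < s --> h i = g \<otimes>\<^sub>B fst cv \<oplus>\<^sub>B snd cv & fst cv \<in> carrier B & snd cv \<in> P"
  proof (cases "i < s")
   case True
   then obtain c v where "h i = g \<otimes>\<^sub>B c \<oplus>\<^sub>B v" "c \<in> carrier B" "v \<in> P" using h unfolding J_def by auto
   then show ?thesis by (intro exI[of _ "(c, v)"]) auto
  qed simp
 qed
 from choice[OF this] obtain cv where cv: "\<forall>i. i < s --> h i = g \<otimes>\<^sub>B fst (cv i) \<oplus>\<^sub>B snd (cv i) & fst (cv i) \<in> carrier B & snd (cv i) \<in> P" by blast
 define c v where "c i = fst (cv i)" and "v i = snd (cv i)" for i
 have cv: "h i = g \<otimes>\<^sub>B c i \<oplus>\<^sub>B v i" "c i \<in> carrier B" "v i \<in> P" if "i < s" for i using cv that unfolding c_def v_def by auto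
 \<comment> \<open>Any common bound of the orders \<open>\<delta> i\<close> can serve as the
   loss.\<close>
 define C where "C = (\<Sum>i<s. \<delta> i)"
 have dC: "\<delta> i <= C" if "i < s" for i unfolding C_def using that by (intro member_le_sum) auto
 have "\<exists>p'\<in>P. x \<ominus>\<^sub>B p' \<in> fil (N - C)" if x: "x \<in> carrier B" "p \<in> P" "g \<otimes>\<^sub>B x \<ominus>\<^sub>B p \<in> fil N" for N x p
 proof -
  have pc: "p \<in> carrier B" using B.ideal_Hcarr[OF PI x(2)] .
  have "\<ominus>\<^sub>B p \<in> P" using ideal_neg[OF PI x(2)] .
  then have "g \<otimes>\<^sub>B x \<ominus>\<^sub>B p \<in> J" unfolding J_def a_minus_def using x(1) by blast
  then obtain a where a: "\<forall>i<s. a i \<in> fil (N - \<delta> i)" "g \<otimes>\<^sub>B x \<ominus>\<^sub>B p = (\<Oplus>\<^sub>B i\<in>{..<s}. a i \<otimes>\<^sub>B h i)" using h(2) x(3) by blast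
  have ac: "a i \<in> carrier B" "c i \<in> carrier B" "v i \<in> carrier B" if "i < s" for i using a fil_closed cv[OF that] that B.ideal_Hcarr[OF PI] by auto
  let ?a = "\<Oplus>\<^sub>B i\<in>{..<s}. a i \<otimes>\<^sub>B c i" and ?v = "\<Oplus>\<^sub>B i\<in>{..<s}. a i \<otimes>\<^sub>B v i"
  have af: "?a \<in> fil (N - C)"
  proof (rule fil_finsum)
   fix i assume i: "i \<in> {..<s}"
   then have "a i \<in> fil (N - C)" using a(1) fil_antimono[of "N - C" "N - \<delta> i" "a i"] dC[of i] by auto
   then show "a i \<otimes>\<^sub>B c i \<in> fil (N - C)" using ideal.I_r_closed[OF fil_ideal] ac i by auto
  qed
  have vP: "?v \<in> P" by (rule B.ideal_finsum[OF PI]) (use ac cv in "auto intro!: ideal.I_l_closed[OF PI]")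
  have "(\<Oplus>\<^sub>B i\<in>{..<s}. a i \<otimes>\<^sub>B h i) = (\<Oplus>\<^sub>B i\<in>{..<s}. g \<otimes>\<^sub>B (a i \<otimes>\<^sub>B c i) \<oplus>\<^sub>B a i \<otimes>\<^sub>B v i)"
   by (rule B.finsum_cong') (use ac cv g in "auto simp: B.r_distr B.m_lcomm")
  also have "\<dots> = (\<Oplus>\<^sub>B i\<in>{..<s}. g \<otimes>\<^sub>B (a i \<otimes>\<^sub>B c i)) \<oplus>\<^sub>B ?v" by (rule B.finsum_addf) (use ac g in auto)
  also have "(\<Oplus>\<^sub>B i\<in>{..<s}. g \<otimes>\<^sub>B (a i \<otimes>\<^sub>B c i)) = g \<otimes>\<^sub>B ?a" by (rule B.finsum_rdistr[symmetric]) (use ac g in auto)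
  finally have e: "g \<otimes>\<^sub>B x \<ominus>\<^sub>B p = g \<otimes>\<^sub>B ?a \<oplus>\<^sub>B ?v" using a(2) by simp
  have id: "g \<otimes>\<^sub>B (x \<ominus>\<^sub>B u) = ((g \<otimes>\<^sub>B x \<ominus>\<^sub>B p) \<ominus>\<^sub>B g \<otimes>\<^sub>B u) \<oplus>\<^sub>B p" if "u \<in> carrier B" for u
   using that x(1) g(1) pc by algebra
  have id2: "(g \<otimes>\<^sub>B u \<oplus>\<^sub>B w) \<ominus>\<^sub>B g \<otimes>\<^sub>B u = w" if "u \<in> carrier B" "w \<in> carrier B" for u w
   using that g(1) by algebra
  have "g \<otimes>\<^sub>B (x \<ominus>\<^sub>B ?a) = ?v \<oplus>\<^sub>B p"
   unfolding id[OF fil_closed[OF af]] e id2[OF fil_closed[OF af] B.ideal_Hcarr[OF PI vP]] ..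
  then have "g \<otimes>\<^sub>B (x \<ominus>\<^sub>B ?a) \<in> P" using B.ideal_add[OF PI vP x(2)] by simp
  then have xa: "x \<ominus>\<^sub>B ?a \<in> P" using primeideal.I_prime[OF P g(1), of "x \<ominus>\<^sub>B ?a"] g(2) x(1) fil_closed[OF af] by auto
  have "x \<ominus>\<^sub>B (x \<ominus>\<^sub>B ?a) = ?a" by (rule minus_triv(1)) (use x fil_closed[OF af] in auto)
  then show ?thesis using xa af by (intro bexI[of _ "x \<ominus>\<^sub>B ?a"]) auto
 qed
 then show ?thesis by blast
qed

text \<open>The loss \<open>c\<close> is incurred once for each factor \<open>g\<close>.\<close>

lemma artin_rees_power:
 assumes P: "primeideal P B" and g: "g \<in> carrier B"
  and c: "\<forall>N x p. x \<in> carrier B & p \<in> P & g \<otimes>\<^sub>B x \<ominus>\<^sub>B p \<in> fil N --> (\<exists>p'\<in>P. x \<ominus>\<^sub>B p' \<in> fil (N - c))"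
 shows "x \<in> carrier B ==> p \<in> P ==> g [^]\<^sub>B (m::nat) \<otimes>\<^sub>B x \<ominus>\<^sub>B p \<in> fil N ==> \<exists>p'\<in>P. x \<ominus>\<^sub>B p' \<in> fil (N - m * c)"
proof (induction m arbitrary: x p N)
 case (Suc m)
 have "g [^]\<^sub>B Suc m \<otimes>\<^sub>B x = g [^]\<^sub>B m \<otimes>\<^sub>B (g \<otimes>\<^sub>B x)" using g Suc.prems by (simp add: B.m_assoc)
 then obtain p' where p': "p' \<in> P" "g \<otimes>\<^sub>B x \<ominus>\<^sub>B p' \<in> fil (N - m * c)" using Suc.IH[of "g \<otimes>\<^sub>B x" p N] Suc.prems g by auto
 then obtain p'' where "p'' \<in> P" "x \<ominus>\<^sub>B p'' \<in> fil (N - m * c - c)" using c Suc.prems(1) by blast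
 moreover have "N - m * c - c = N - Suc m * c" by simp
 ultimately show ?case by auto
qed auto

text \<open>A monomial of degree below \<open>N\<close> has all exponents below \<open>N\<close>.
  The bound is polynomial in \<open>N\<close> of degree \<open>card G\<close>, which is what limits
  the length of chains of primes.\<close>

lemma monomials_card: "card (\<Union>n\<in>{..<N}. mons n) <= N ^ card G"
proof -
 define mg where "mg \<beta> = (\<Otimes>g\<in>G. g [^] (\<beta> g :: nat))" for \<beta>
 have Gc: "g \<in> carrier R" if "g \<in> G" for g using that G(2) gr_closed by blast
 have "\<exists>\<beta>\<in>G \<rightarrow>\<^sub>E {..n}. m = mg \<beta>" if "m \<in> mons n" for m n
  using that
 proof (induction n arbitrary: m)
  case 0
  have "mg (\<lambda>g\<in>G. 0) = (\<Otimes>g\<in>G. \<one>)" unfolding mg_def by (rule finprod_cong') (use Gc in auto)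
  moreover have "m = \<one>" using 0 by (simp add: mons_simps)
  ultimately have "m = mg (\<lambda>g\<in>G. 0)" by simp
  moreover have "(\<lambda>g\<in>G. 0) \<in> G \<rightarrow>\<^sub>E {..0::nat}" by auto
  ultimately show ?case by blast
 next
  case (Suc n)
  then obtain g m' where g: "g \<in> G" "m' \<in> mons n" "m = g \<otimes> m'" by (auto simp: mons_simps)
  obtain \<beta> where b: "\<beta> \<in> G \<rightarrow>\<^sub>E {..n}" "m' = mg \<beta>" using Suc.IH[OF g(2)] by blast
  define \<beta>' where "\<beta>' = \<beta>(g := Suc (\<beta> g))"
  have Gi: "G = insert g (G - {g})" using g by auto
  have fin: "finite (G - {g})" using G(1) by auto
  have "mg \<beta>' = (\<Otimes>h\<in>insert g (G - {g}). h [^] \<beta>' h)" unfolding mg_def using Gi by simp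
  also have "\<dots> = g [^] \<beta>' g \<otimes> (\<Otimes>h\<in>G - {g}. h [^] \<beta>' h)"
   by (rule finprod_insert) (use fin Gc g in auto)
  also have "(\<Otimes>h\<in>G - {g}. h [^] \<beta>' h) = (\<Otimes>h\<in>G - {g}. h [^] \<beta> h)"
   by (rule finprod_cong') (use Gc in "auto simp: \<beta>'_def")
  also have "g [^] \<beta>' g \<otimes> (\<Otimes>h\<in>G - {g}. h [^] \<beta> h) = g \<otimes> (g [^] \<beta> g \<otimes> (\<Otimes>h\<in>G - {g}. h [^] \<beta> h))"
  proof -
   have "g \<in> carrier R" "(\<Otimes>h\<in>G - {g}. h [^] \<beta> h) \<in> carrier R" using Gc g by (auto intro!: finprod_closed)
   moreover from this have "g [^] \<beta> g \<otimes> g = g \<otimes> g [^] \<beta> g" by (simp add: m_comm)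
   ultimately show ?thesis by (simp add: \<beta>'_def m_assoc)
  qed
  also have "g [^] \<beta> g \<otimes> (\<Otimes>h\<in>G - {g}. h [^] \<beta> h) = (\<Otimes>h\<in>insert g (G - {g}). h [^] \<beta> h)"
   by (rule finprod_insert[symmetric]) (use fin Gc g in auto)
  also have "\<dots> = m'" unfolding b(2) mg_def using Gi by simp
  finally have "m = mg \<beta>'" using g(3) by simp
  moreover have "\<beta>' \<in> G \<rightarrow>\<^sub>E {..Suc n}" using b(1) g(1) unfolding \<beta>'_def
   by (auto simp: PiE_def extensional_def Pi_def intro: le_SucI)
  ultimately show ?case by blast
 qed
 then have "(\<Union>n\<in>{..<N}. mons n) <= mg ` (G \<rightarrow>\<^sub>E {..<N})"
 proof (intro subsetI)
  fix m assume *: "!!m n. m \<in> mons n ==> \<exists>\<beta>\<in>G \<rightarrow>\<^sub>E {..n}. m = mg \<beta>" "m \<in> (\<Union>n\<in>{..<N}. mons n)"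
  then obtain n where n: "n < N" "m \<in> mons n" by auto
  then obtain \<beta> where "\<beta> \<in> G \<rightarrow>\<^sub>E {..n}" "m = mg \<beta>" using *(1) by blast
  moreover have "G \<rightarrow>\<^sub>E {..n} <= G \<rightarrow>\<^sub>E {..<N}" by (rule PiE_mono) (use n in auto)
  ultimately show "m \<in> mg ` (G \<rightarrow>\<^sub>E {..<N})" by auto
 qed
 then have "card (\<Union>n\<in>{..<N}. mons n) <= card (G \<rightarrow>\<^sub>E {..<N})"
  by (rule surj_card_le[rotated]) (use G(1) in "auto intro: finite_PiE")
 also have "\<dots> = N ^ card G" using G(1) by (simp add: card_PiE)
 finally show ?thesis .
qed

section \<open>Bounding chains of primes by counting\<close>

lemma phi_subfield: "subfield (\<phi> ` k) B"
proof -
 have "ring_hom_ring R B \<phi>" by (rule phi.ring.ring_hom_ring_axioms)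
 moreover have "\<one>\<^sub>B ~= \<zero>\<^sub>B" using one_not_fil fil_zero by metis
 ultimately show ?thesis using ring_hom_ring.img_is_subfield(2)[OF _ subfield] by blast
qed

sublocale Bk: cring_over B "\<phi> ` k"
 by (intro cring_over.intro B.cring_axioms cring_over_axioms.intro phi_subfield)

text \<open>With \<open>monomials_card\<close> this bounds the dimension of the quotient by
  \<open>fil N\<close> by \<open>N^(card G)\<close>.\<close>

lemma span_mod_fil:
 assumes "b \<in> carrier B" shows "b \<in> Bk.lin_span (fil N \<union> \<phi> ` (\<Union>n\<in>{..<N}. mons n))"
proof -
 let ?T = "Bk.lin_span (fil N \<union> \<phi> ` (\<Union>n\<in>{..<N}. mons n))"
 have sub: "fil N \<union> \<phi> ` (\<Union>n\<in>{..<N}. mons n) <= carrier B" using fil_closed mons_gr gr_closed by blast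
 have T: "Bk.lin_sub ?T" by (rule Bk.lin_sub_span[OF sub])
 have base: "fil N \<union> \<phi> ` (\<Union>n\<in>{..<N}. mons n) <= ?T" by (rule Bk.lin_span_base)
 obtain a where a: "a \<in> carrier R" "b \<ominus>\<^sub>B \<phi> a \<in> fil N" using dense[OF assms] by blast
 have TR: "lin_sub {x \<in> carrier R. \<phi> x \<in> ?T}"
  unfolding lin_sub_def using Bk.lin_subD[OF T] by auto
 have gr: "gr n <= {x \<in> carrier R. \<phi> x \<in> ?T}" for n
 proof (cases "n < N")
  case True
  show ?thesis unfolding gr_span
   by (rule lin_span_least[OF TR]) (use True base mons_gr gr_closed in blast)
 next
  case False
  show ?thesis
  proof
   fix x assume x: "x \<in> gr n"
   then have "\<phi> x \<in> fil N" using phi_fil[OF gr_closed[OF x]] gr_tail[OF x] False by simp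
   then show "x \<in> {x \<in> carrier R. \<phi> x \<in> ?T}" using base x by auto
  qed
 qed
 have "a = (\<Oplus>n\<in>{n. hcomp a n ~= \<zero>}. hcomp a n)" using sum_comp[OF a(1) finite_comp[OF a(1)]] by simp
 also have "\<dots> \<in> {x \<in> carrier R. \<phi> x \<in> ?T}"
  by (rule lin_sub_finsum[OF TR]) (use gr comp_gr[OF a(1)] in blast)
 finally have "\<phi> a \<in> ?T" by simp
 then have "(b \<ominus>\<^sub>B \<phi> a) \<oplus>\<^sub>B \<phi> a \<in> ?T" using Bk.lin_subD(3)[OF T] a(2) base by blast
 then show ?thesis using minus_triv(2)[OF assms phi.hom_closed[OF a(1)] assms assms] by simp
qed

text \<open>With \<open>y i\<close> in \<open>P (i + 1)\<close> but not in \<open>P i\<close>, a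
  chain of length \<open>L = card G + 1\<close> supplies \<open>q^L\<close> power products with
  exponents below \<open>q\<close>, more than the dimension modulo \<open>fil N\<close>. The
  resulting relation is peeled variable by variable: dividing by the least power of
  \<open>y j\<close> costs a bounded order by Artin-Rees, and terms with a larger exponent fall into
  \<open>P (j + 1)\<close>. In the end a single nonzero scalar would lie in
  \<open>fil 1\<close>.\<close>

theorem prime_chain_bound:
 assumes P: "!!i. i <= l ==> primeideal (P i) B" "!!i. i < l ==> P i \<subset> P (Suc i)"
 shows "l <= card G"
proof (rule ccontr)
 assume "\<not> l <= card G"
 define e L where "e = card G" and "L = Suc e"
 have L: "L <= l" using \<open>\<not> l <= card G\<close> unfolding L_def e_def by simp
 have PI: "ideal (P i) B" if "i <= L" for i using P(1)[of i] primeideal.axioms(1) that L by auto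
 have "\<forall>i. \<exists>y. i < L --> y \<in> P (Suc i) & y \<notin> P i" using P(2) L by (metis order_less_le_trans psubset_imp_ex_mem Diff_iff)
 from choice[OF this] obtain y where y': "\<forall>i. i < L --> y i \<in> P (Suc i) & y i \<notin> P i" by blast
 have y: "y i \<in> P (Suc i)" "y i \<notin> P i" "y i \<in> carrier B" if "i < L" for i
  using y' that B.ideal_Hcarr[OF PI[of "Suc i"]] by auto
 have "\<forall>i. \<exists>c. i < L --> (\<forall>N x p. x \<in> carrier B & p \<in> P i & y i \<otimes>\<^sub>B x \<ominus>\<^sub>B p \<in> fil N --> (\<exists>p'\<in>P i. x \<ominus>\<^sub>B p' \<in> fil (N - c)))"
 proof
  fix i show "\<exists>c. i < L --> (\<forall>N x p. x \<in> carrier B & p \<in> P i & y i \<otimes>\<^sub>B x \<ominus>\<^sub>B p \<in> fil N --> (\<exists>p'\<in>P i. x \<ominus>\<^sub>B p' \<in> fil (N - c)))"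
  proof (cases "i < L")
   case True
   then show ?thesis using artin_rees_prime[of "P i" "y i"] P(1)[of i] y[of i] L by auto
  qed simp
 qed
 from choice[OF this] obtain c where c: "\<forall>i. i < L --> (\<forall>N x p. x \<in> carrier B & p \<in> P i & y i \<otimes>\<^sub>B x \<ominus>\<^sub>B p \<in> fil N --> (\<exists>p'\<in>P i. x \<ominus>\<^sub>B p' \<in> fil (N - c i)))" by blast
 \<comment> \<open>A division by \<open>y i\<close> loses \<open>c i\<close>, so
   \<open>q * C\<close> bounds the total loss, and \<open>N\<close> exceeds it by one. The choice of
   \<open>q\<close> gives \<open>N^e \<le> (q (C + 1))^e < q^(e + 1)\<close>.\<close>
 define C q N where "C = (\<Sum>i<L. c i)" and "q = Suc ((C + 1) ^ e)" and "N = Suc (q * C)"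
 define D where "D j = q * (\<Sum>i<j. c i)" for j
 have DN: "D j < N" if "j <= L" for j
 proof -
  have "(\<Sum>i<j. c i) <= C" unfolding C_def by (rule sum_mono2) (use that in auto)
  then show ?thesis unfolding D_def N_def by (simp add: le_imp_less_Suc)
 qed
 define Bx where "Bx = ({..<L} \<rightarrow>\<^sub>E {..<q})"
 define sv where "sv j \<alpha> = (\<Otimes>\<^sub>B i\<in>{j..<L}. y i [^]\<^sub>B (\<alpha> i :: nat))" for j \<alpha>
 have svc: "sv j \<alpha> \<in> carrier B" for j \<alpha> unfolding sv_def using y by (auto intro!: B.finprod_closed)
 have sv_step: "sv j \<alpha> = y j [^]\<^sub>B \<alpha> j \<otimes>\<^sub>B sv (Suc j) \<alpha>" if "j < L" for j \<alpha>
 proof -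
  have "{j..<L} = insert j {Suc j..<L}" using that by auto
  then show ?thesis unfolding sv_def using y that by (simp add: B.finprod_insert)
 qed
 have fB: "finite Bx" unfolding Bx_def by (auto intro: finite_PiE)
 have "N <= q * (C + 1)" unfolding N_def q_def by simp
 then have "N ^ e <= (q * (C + 1)) ^ e" by (rule power_mono) simp
 also have "\<dots> = q ^ e * (C + 1) ^ e" by (simp only: power_mult_distrib)
 also have "\<dots> < q ^ e * q" unfolding q_def by simp
 also have "\<dots> = card Bx" unfolding Bx_def L_def by (simp add: card_PiE)
 finally have big: "N ^ e < card Bx" .
 let ?M = "\<Union>n\<in>{..<N}. mons n"
 have fM: "finite ?M" using finite_mons by auto
 have "card (\<phi> ` ?M) <= N ^ e" using card_image_le[OF fM, of \<phi>] monomials_card[of N] unfolding e_def by simp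
 have "\<exists>u. (\<forall>\<alpha>\<in>Bx. u \<alpha> \<in> \<phi> ` k) & (\<exists>\<alpha>\<in>Bx. u \<alpha> ~= \<zero>\<^sub>B) & (\<Oplus>\<^sub>B \<alpha>\<in>Bx. u \<alpha> \<otimes>\<^sub>B sv 0 \<alpha>) \<in> fil N"
 proof (rule Bk.linear_dependence[where W = "\<phi> ` ?M"])
  show "card (\<phi> ` ?M) < card Bx" using \<open>card (\<phi> ` ?M) <= N ^ e\<close> big by simp
  show "Bk.lin_sub (fil N)" by (rule Bk.ideal_lin_sub[OF fil_ideal])
  show "\<phi> ` ?M <= carrier B" using mons_gr gr_closed by blast
  show "sv 0 i \<in> Bk.lin_span (fil N \<union> \<phi> ` ?M)" for i by (rule span_mod_fil[OF svc])
 qed (use fM fB in auto)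
 then obtain u where u: "!!\<alpha>. \<alpha> \<in> Bx ==> u \<alpha> \<in> \<phi> ` k" "\<exists>\<alpha>\<in>Bx. u \<alpha> ~= \<zero>\<^sub>B" "(\<Oplus>\<^sub>B \<alpha>\<in>Bx. u \<alpha> \<otimes>\<^sub>B sv 0 \<alpha>) \<in> fil N" by blast
 have uc: "u \<alpha> \<in> carrier B" if "\<alpha> \<in> Bx" for \<alpha> using u(1)[OF that] Bk.scal_closed by blast
 \<comment> \<open>\<open>A\<close> holds exponents with nonzero coefficient that agree in all
   places before \<open>j\<close>, and \<open>D j\<close> bounds the order lost so far.\<close>
 have main: "j <= L ==> \<exists>A\<subseteq>Bx. A ~= {} & (\<forall>\<alpha>\<in>A. u \<alpha> ~= \<zero>\<^sub>B) & (\<forall>\<alpha>\<in>A. \<forall>\<beta>\<in>A. \<forall>i<j. \<alpha> i = \<beta> i) &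
  (\<exists>p\<in>P j. (\<Oplus>\<^sub>B \<alpha>\<in>A. u \<alpha> \<otimes>\<^sub>B sv j \<alpha>) \<ominus>\<^sub>B p \<in> fil (N - D j))" for j
 proof (induction j)
  case 0
  let ?A = "{\<alpha> \<in> Bx. u \<alpha> ~= \<zero>\<^sub>B}"
  have "(\<Oplus>\<^sub>B \<alpha>\<in>?A. u \<alpha> \<otimes>\<^sub>B sv 0 \<alpha>) = (\<Oplus>\<^sub>B \<alpha>\<in>Bx. u \<alpha> \<otimes>\<^sub>B sv 0 \<alpha>)"
   by (rule B.add.finprod_mono_neutral_cong_left) (use fB uc svc in auto)
  then have "(\<Oplus>\<^sub>B \<alpha>\<in>?A. u \<alpha> \<otimes>\<^sub>B sv 0 \<alpha>) \<ominus>\<^sub>B \<zero>\<^sub>B \<in> fil (N - D 0)"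
   using u(3) fil_minus[OF u(3) fil_zero] unfolding D_def by simp
  moreover have "\<zero>\<^sub>B \<in> P 0" using ideal_zero[OF PI[of 0]] by simp
  ultimately show ?case using u(2) by (intro exI[of _ ?A]) auto
 next
  case (Suc j)
  then have j: "j < L" "j <= L" by auto
  obtain A p where A: "A <= Bx" "A ~= {}" "\<forall>\<alpha>\<in>A. u \<alpha> ~= \<zero>\<^sub>B" "\<forall>\<alpha>\<in>A. \<forall>\<beta>\<in>A. \<forall>i<j. \<alpha> i = \<beta> i"
   "p \<in> P j" "(\<Oplus>\<^sub>B \<alpha>\<in>A. u \<alpha> \<otimes>\<^sub>B sv j \<alpha>) \<ominus>\<^sub>B p \<in> fil (N - D j)" using Suc.IH[OF j(2)] by blast
  have fA: "finite A" by (rule finite_subset[OF A(1) fB])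
  \<comment> \<open>The least exponent of \<open>y j\<close>; after division by this power, only the
    terms that attain it survive modulo \<open>P (j + 1)\<close>.\<close>
  define m where "m = Min ((%\<alpha>. \<alpha> j) ` A)"
  have m: "m <= \<alpha> j" if "\<alpha> \<in> A" for \<alpha> unfolding m_def using fA that by auto
  have "m \<in> (%\<alpha>. \<alpha> j) ` A" unfolding m_def by (rule Min_in) (use fA A in auto)
  then obtain \<alpha>0 where a0: "\<alpha>0 \<in> A" "\<alpha>0 j = m" by auto
  have mq: "m < q" using a0 A(1) j unfolding Bx_def by auto
  define A1 where "A1 = {\<alpha> \<in> A. \<alpha> j = m}"
  define A2 where "A2 = {\<alpha> \<in> A. \<alpha> j ~= m}"
  have A12: "A = A1 \<union> A2" "A1 \<inter> A2 = {}" "finite A1" "finite A2" unfolding A1_def A2_def using fA by auto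
  have yc: "y j \<in> carrier B" using y j by auto
  define t where "t \<alpha> = u \<alpha> \<otimes>\<^sub>B (y j [^]\<^sub>B (\<alpha> j - m) \<otimes>\<^sub>B sv (Suc j) \<alpha>)" for \<alpha>
  have ucA: "u \<alpha> \<in> carrier B" if "\<alpha> \<in> A" for \<alpha> using that A uc by auto
  have tc: "t \<alpha> \<in> carrier B" if "\<alpha> \<in> A" for \<alpha> unfolding t_def using ucA[OF that] yc svc by auto
  have "(\<Oplus>\<^sub>B \<alpha>\<in>A. u \<alpha> \<otimes>\<^sub>B sv j \<alpha>) = (\<Oplus>\<^sub>B \<alpha>\<in>A. y j [^]\<^sub>B m \<otimes>\<^sub>B t \<alpha>)"
  proof (rule B.finsum_cong', simp)
   fix \<alpha> assume a: "\<alpha> \<in> A"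
   have "y j [^]\<^sub>B \<alpha> j = y j [^]\<^sub>B m \<otimes>\<^sub>B y j [^]\<^sub>B (\<alpha> j - m)" using m[OF a] yc by (simp add: B.nat_pow_mult)
   then show "u \<alpha> \<otimes>\<^sub>B sv j \<alpha> = y j [^]\<^sub>B m \<otimes>\<^sub>B t \<alpha>"
    unfolding t_def sv_step[OF j(1), of \<alpha>] using ucA[OF a] yc svc[of "Suc j" \<alpha>] by (simp add: B.m_assoc B.m_lcomm)
  qed (use tc yc in auto)
  also have "\<dots> = y j [^]\<^sub>B m \<otimes>\<^sub>B (\<Oplus>\<^sub>B \<alpha>\<in>A. t \<alpha>)" by (rule B.finsum_rdistr[symmetric]) (use fA tc yc in auto)
  finally have e: "(\<Oplus>\<^sub>B \<alpha>\<in>A. u \<alpha> \<otimes>\<^sub>B sv j \<alpha>) = y j [^]\<^sub>B m \<otimes>\<^sub>B (\<Oplus>\<^sub>B \<alpha>\<in>A. t \<alpha>)" .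
  have sumc: "(\<Oplus>\<^sub>B \<alpha>\<in>A. t \<alpha>) \<in> carrier B" "(\<Oplus>\<^sub>B \<alpha>\<in>A1. t \<alpha>) \<in> carrier B" using tc A12 by (auto intro!: B.finsum_closed)
  have "\<exists>p'\<in>P j. (\<Oplus>\<^sub>B \<alpha>\<in>A. t \<alpha>) \<ominus>\<^sub>B p' \<in> fil (N - D j - m * c j)"
  proof (rule artin_rees_power[OF _ yc])
   show "primeideal (P j) B" using P(1) j L by auto
   show "\<forall>N x p. x \<in> carrier B & p \<in> P j & y j \<otimes>\<^sub>B x \<ominus>\<^sub>B p \<in> fil N --> (\<exists>p'\<in>P j. x \<ominus>\<^sub>B p' \<in> fil (N - c j))" using c j by blast
  qed (use sumc A(5,6) e in auto)
  then obtain p' where p': "p' \<in> P j" "(\<Oplus>\<^sub>B \<alpha>\<in>A. t \<alpha>) \<ominus>\<^sub>B p' \<in> fil (N - D j - m * c j)" by blast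
  have pP: "p' \<in> P (Suc j)" using p'(1) P(2)[of j] j L by auto
  have PS: "ideal (P (Suc j)) B" using PI j by auto
  have T2: "(\<Oplus>\<^sub>B \<alpha>\<in>A2. t \<alpha>) \<in> P (Suc j)"
  proof (rule B.ideal_finsum[OF PS])
   fix \<alpha> assume a: "\<alpha> \<in> A2"
   then have aA: "\<alpha> \<in> A" "\<alpha> j ~= m" unfolding A2_def by auto
   then obtain r where r: "\<alpha> j - m = Suc r" using m[OF aA(1)] by (metis Suc_diff_Suc le_neq_implies_less)
   have "y j [^]\<^sub>B (\<alpha> j - m) \<in> P (Suc j)" unfolding r using ideal.I_l_closed[OF PS y(1)[OF j(1)], of "y j [^]\<^sub>B r"] yc by simp
   then have "y j [^]\<^sub>B (\<alpha> j - m) \<otimes>\<^sub>B sv (Suc j) \<alpha> \<in> P (Suc j)" by (rule ideal.I_r_closed[OF PS _ svc])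
   then show "t \<alpha> \<in> P (Suc j)" unfolding t_def by (rule ideal.I_l_closed[OF PS _ ucA[OF aA(1)]])
  qed
  have T12: "(\<Oplus>\<^sub>B \<alpha>\<in>A. t \<alpha>) = (\<Oplus>\<^sub>B \<alpha>\<in>A1. t \<alpha>) \<oplus>\<^sub>B (\<Oplus>\<^sub>B \<alpha>\<in>A2. t \<alpha>)"
   unfolding A12(1) by (rule B.finsum_Un_disjoint) (use A12 tc in auto)
  have T1: "(\<Oplus>\<^sub>B \<alpha>\<in>A1. t \<alpha>) = (\<Oplus>\<^sub>B \<alpha>\<in>A1. u \<alpha> \<otimes>\<^sub>B sv (Suc j) \<alpha>)"
   by (rule B.finsum_cong') (use ucA svc in "auto simp: A1_def t_def")
  have id: "(a \<oplus>\<^sub>B b) \<ominus>\<^sub>B z = a \<ominus>\<^sub>B (z \<ominus>\<^sub>B b)" if "a \<in> carrier B" "b \<in> carrier B" "z \<in> carrier B" for a b z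
   using that by algebra
  have "(\<Oplus>\<^sub>B \<alpha>\<in>A1. t \<alpha>) \<ominus>\<^sub>B (p' \<ominus>\<^sub>B (\<Oplus>\<^sub>B \<alpha>\<in>A2. t \<alpha>)) \<in> fil (N - D j - m * c j)"
   using p'(2) unfolding T12 id[OF sumc(2) B.ideal_Hcarr[OF PS T2] B.ideal_Hcarr[OF PS pP]] .
  then have "(\<Oplus>\<^sub>B \<alpha>\<in>A1. u \<alpha> \<otimes>\<^sub>B sv (Suc j) \<alpha>) \<ominus>\<^sub>B (p' \<ominus>\<^sub>B (\<Oplus>\<^sub>B \<alpha>\<in>A2. t \<alpha>)) \<in> fil (N - D (Suc j))"
   unfolding T1
  proof (rule fil_antimono[rotated])
   have "m * c j <= q * c j" by (rule mult_le_mono1) (use mq in simp)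
   then have "D j + m * c j <= D (Suc j)" unfolding D_def by (simp add: algebra_simps)
   then show "N - D (Suc j) <= N - D j - m * c j" by linarith
  qed
  moreover have "p' \<ominus>\<^sub>B (\<Oplus>\<^sub>B \<alpha>\<in>A2. t \<alpha>) \<in> P (Suc j)" by (rule B.ideal_minus[OF PS pP T2])
  moreover have "\<forall>\<alpha>\<in>A1. \<forall>\<beta>\<in>A1. \<forall>i<Suc j. \<alpha> i = \<beta> i" using A(4) unfolding A1_def by (auto simp: less_Suc_eq)
  moreover have "A1 <= Bx" "A1 ~= {}" "\<forall>\<alpha>\<in>A1. u \<alpha> ~= \<zero>\<^sub>B" using A a0 unfolding A1_def by auto
  ultimately show ?case by blast
 qed
 obtain A p where A: "A <= Bx" "A ~= {}" "\<forall>\<alpha>\<in>A. u \<alpha> ~= \<zero>\<^sub>B" "\<forall>\<alpha>\<in>A. \<forall>\<beta>\<in>A. \<forall>i<L. \<alpha> i = \<beta> i"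
   "p \<in> P L" "(\<Oplus>\<^sub>B \<alpha>\<in>A. u \<alpha> \<otimes>\<^sub>B sv L \<alpha>) \<ominus>\<^sub>B p \<in> fil (N - D L)" using main[OF order_refl] by blast
 obtain \<alpha> where a: "\<alpha> \<in> A" using A(2) by blast
 have aB: "\<alpha> \<in> Bx" using a A(1) by blast
 have "\<beta> = \<alpha>" if b: "\<beta> \<in> A" for \<beta>
 proof (rule PiE_ext[of \<beta> "{..<L}" "%_. {..<q}" \<alpha>])
  show "\<beta> \<in> {..<L} \<rightarrow>\<^sub>E {..<q}" using b A(1) unfolding Bx_def by blast
  show "\<alpha> \<in> {..<L} \<rightarrow>\<^sub>E {..<q}" using aB unfolding Bx_def .
  show "\<beta> i = \<alpha> i" if "i \<in> {..<L}" for i using A(4) a b that by simp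
 qed
 then have sing: "A = {\<alpha>}" using a by blast
 have "sv L \<alpha> = \<one>\<^sub>B" unfolding sv_def by simp
 then have "(\<Oplus>\<^sub>B \<beta>\<in>{\<alpha>}. u \<beta> \<otimes>\<^sub>B sv L \<beta>) = u \<alpha>" using uc[OF aB] svc by (simp add: B.finsum_insert)
 then have "u \<alpha> \<ominus>\<^sub>B p \<in> fil (N - D L)" using A(6) unfolding sing by simp
 then have "u \<alpha> \<ominus>\<^sub>B p \<in> fil 1" by (rule fil_antimono[rotated]) (use DN[of L] in simp)
 moreover have "P L <= fil 1"
  by (rule proper_ideal_fil[OF PI]) (use primeideal.I_notcarr[OF P(1)[OF L]] in auto)
 ultimately have "(u \<alpha> \<ominus>\<^sub>B p) \<oplus>\<^sub>B p \<in> fil 1" using A(5) fil_add by blast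
 then have uf: "u \<alpha> \<in> fil 1" using minus_triv(2)[of "u \<alpha>" p p p] uc[OF aB] B.ideal_Hcarr[OF PI A(5)] by simp
 obtain w where w: "w \<in> k" "u \<alpha> = \<phi> w" using u(1)[OF aB] by blast
 then have "w \<in> tail 1" using uf phi_fil[of w 1] by auto
 then have "w = \<zero>" using gr_tail_zero[of w 0 1] w gr_0 by simp
 then show False using w A(3) a by auto
qed

end

section \<open>Systems of parameters\<close>

context cring
begin

definition colon :: "'a set => 'a => 'a set" where
 "colon J x = {y \<in> carrier R. x \<otimes> y \<in> J}"

lemma colon_ideal: assumes "ideal J R" "x \<in> carrier R" shows "ideal (colon J x) R"
proof (rule idealI_comm)
 note J = ideal_add[OF assms(1)] ideal_zero[OF assms(1)]
 show "colon J x <= carrier R" "\<zero> \<in> colon J x" unfolding colon_def using J assms by auto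
 show "a \<oplus> b \<in> colon J x" if "a \<in> colon J x" "b \<in> colon J x" for a b
  using that J assms unfolding colon_def by (auto simp: r_distr)
 fix a y assume a: "a \<in> colon J x" and y: "y \<in> carrier R"
 then have "x \<otimes> (y \<otimes> a) = y \<otimes> (x \<otimes> a)" using assms unfolding colon_def by (auto simp: m_lcomm)
 then show "y \<otimes> a \<in> colon J x" using a y ideal.I_l_closed[OF assms(1)] unfolding colon_def by auto
qed

text \<open>\<open>prod_in Qs J\<close> says that the product of the ideals in \<open>Qs\<close> is contained in \<open>J\<close>.\<close>

primrec prod_in :: "'a set list => 'a set => bool" where
 "prod_in [] J \<longleftrightarrow> \<one> \<in> J"
| "prod_in (Q # Qs) J \<longleftrightarrow> (\<forall>x\<in>Q. prod_in Qs (colon J x))"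

lemma prod_in_mono: "prod_in Qs J ==> J <= J' ==> prod_in Qs J'"
proof (induction Qs arbitrary: J J')
 case (Cons Q Qs)
 have "prod_in Qs (colon J' x)" if "x \<in> Q" for x
  by (rule Cons.IH[of "colon J x"]) (use Cons.prems that in "auto simp: colon_def")
 then show ?case by simp
qed auto

lemma prod_in_append:
 "prod_in Qs1 J1 ==> prod_in Qs2 J2 ==> J2 <= carrier R ==> (!!a b. a \<in> J1 ==> b \<in> J2 ==> a \<otimes> b \<in> J) ==>
  (!!Q. Q \<in> set Qs1 ==> Q <= carrier R) ==> prod_in (Qs1 @ Qs2) J"
proof (induction Qs1 arbitrary: J1 J)
 case Nil
 have "J2 <= J"
 proof
  fix b assume b: "b \<in> J2"
  then have "\<one> \<otimes> b \<in> J" using Nil by auto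
  moreover have "b \<in> carrier R" using b Nil by blast
  ultimately show "b \<in> J" by simp
 qed
 then show ?case using prod_in_mono Nil by simp
next
 case (Cons Q Qs)
 have "prod_in (Qs @ Qs2) (colon J x)" if x: "x \<in> Q" for x
 proof (rule Cons.IH[of "colon J1 x"])
  have xc: "x \<in> carrier R" using x Cons.prems(5)[of Q] by auto
  show "prod_in Qs (colon J1 x)" using Cons.prems(1) x by simp
  fix a b assume "a \<in> colon J1 x" "b \<in> J2"
  then have "a \<in> carrier R" "b \<in> carrier R" "x \<otimes> a \<in> J1" using Cons.prems(3) unfolding colon_def by auto
  then show "a \<otimes> b \<in> colon J x" using Cons.prems(4)[of "x \<otimes> a" b] \<open>b \<in> J2\<close> xc unfolding colon_def by (simp add: m_assoc)
 qed (use Cons.prems in auto)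
 then show ?case by simp
qed

text \<open>If some \<open>x\<close> in \<open>Q\<close> is outside \<open>P\<close>, the colon
  ideal of \<open>J\<close> by \<open>x\<close> is still contained in \<open>P\<close>, and the
  induction continues with the remaining factors.\<close>

lemma prod_in_prime:
 "prod_in Qs J ==> primeideal P R ==> J <= P ==> (!!Q. Q \<in> set Qs ==> Q <= carrier R) ==> \<exists>Q\<in>set Qs. Q <= P"
proof (induction Qs arbitrary: J)
 case Nil
 then have "\<one> \<in> P" by auto
 then show ?case using ideal.one_imp_carrier[OF primeideal.axioms(1)[OF Nil(2)]] primeideal.I_notcarr[OF Nil(2)] by simp
next
 case (Cons Q Qs)
 show ?case
 proof (cases "Q <= P")
  case False
  then obtain x where x: "x \<in> Q" "x \<notin> P" by auto
  have xc: "x \<in> carrier R" using x Cons.prems(4)[of Q] by auto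
  have "colon J x <= P" using primeideal.I_prime[OF Cons.prems(2) xc] Cons.prems(3) x(2) unfolding colon_def by blast
  then have "\<exists>Q\<in>set Qs. Q <= P" using Cons.IH[of "colon J x"] Cons.prems x by auto
  then show ?thesis by auto
 qed auto
qed

text \<open>Noetherian induction with a maximal counterexample \<open>M\<close>. It is neither prime
  nor the whole ring, so it contains a product \<open>a b\<close> of elements outside it, and the
  lists for \<open>M + (a)\<close> and \<open>M + (b)\<close> concatenate to one for
  \<open>M\<close>. The result stands in for the finiteness of the set of minimal primes over
  \<open>J\<close>.\<close>

lemma prime_product:
 assumes N: "noetherian_ring R" and J: "ideal J R"
 shows "\<exists>Qs. (\<forall>Q\<in>set Qs. primeideal Q R & J <= Q) & prod_in Qs J"
proof (rule ccontr)
 interpret noetherian_ring R by fact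
 assume bad: "\<not> ?thesis"
 let ?good = "%J. \<exists>Qs. (\<forall>Q\<in>set Qs. primeideal Q R & J <= Q) & prod_in Qs J"
 let ?A = "{J. ideal J R & \<not> ?good J}"
 have "\<exists>M\<in>?A. \<forall>J\<in>?A. M <= J --> J = M"
 proof (rule subset_Zorn_nonempty)
  show "?A ~= {}" using J bad by blast
  fix C assume C: "C ~= {}" "subset.chain ?A C"
  then have "subset.chain {I. ideal I R} C" unfolding subset.chain_def by auto
  then have "\<Union>C \<in> C" by (rule ideal_chain_is_trivial[OF C(1)])
  then show "\<Union>C \<in> ?A" using C(2) unfolding subset.chain_def by blast
 qed
 then obtain M where M: "ideal M R" "\<not> ?good M" "!!J. ideal J R ==> \<not> ?good J ==> M <= J ==> J = M" by blast
 have "\<not> primeideal M R"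
 proof
  assume P: "primeideal M R"
  have "prod_in [M] M" using ideal_Hcarr[OF M(1)] by (auto simp: colon_def)
  then show False using M(2) P by (auto dest!: spec[of _ "[M]"])
 qed
 moreover have "carrier R ~= M"
 proof
  assume "carrier R = M"
  \<comment> \<open>The empty product is the unit ideal.\<close>
  then have "prod_in [] M" by (simp flip: \<open>carrier R = M\<close>)
  then show False using M(2) by (auto dest!: spec[of _ "[]"])
 qed
 ultimately obtain a b where ab: "a \<in> carrier R" "b \<in> carrier R" "a \<otimes> b \<in> M" "a \<notin> M" "b \<notin> M"
  using primeidealI[OF M(1) is_cring] by blast
 define J where "J y = {y \<otimes> c \<oplus> v | c v. c \<in> carrier R & v \<in> M}" for y
 have JI: "ideal (J y) R" "M <= J y" "y \<in> J y" if y: "y \<in> carrier R" for y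
 proof -
  show "ideal (J y) R" "M <= J y" "y \<in> J y" unfolding J_def by (rule ideal_plus_principal[OF M(1) y])+
 qed
 have "?good (J a)" "?good (J b)" using M(3)[of "J a"] M(3)[of "J b"] JI ab by blast+
 then obtain Qs Qs' where Q: "\<forall>Q\<in>set Qs. primeideal Q R & J a <= Q" "prod_in Qs (J a)"
  "\<forall>Q\<in>set Qs'. primeideal Q R & J b <= Q" "prod_in Qs' (J b)" by blast
 have "prod_in (Qs @ Qs') M"
 proof (rule prod_in_append[OF Q(2,4)])
  show "J b <= carrier R" using ideal_Hcarr[OF JI(1)[OF ab(2)]] by auto
  show "!!Q. Q \<in> set Qs ==> Q <= carrier R" using Q(1) ideal_Hcarr[OF primeideal.axioms(1)] by blast
  fix y z assume "y \<in> J a" "z \<in> J b"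
  then obtain c v c' v' where *: "y = a \<otimes> c \<oplus> v" "z = b \<otimes> c' \<oplus> v'" "c \<in> carrier R" "c' \<in> carrier R" "v \<in> M" "v' \<in> M"
   unfolding J_def by auto
  have vc: "v \<in> carrier R" "v' \<in> carrier R" using * ideal_Hcarr[OF M(1)] by auto
  have "y \<otimes> z = (c \<otimes> c') \<otimes> (a \<otimes> b) \<oplus> ((a \<otimes> c) \<otimes> v' \<oplus> (b \<otimes> c' \<oplus> v') \<otimes> v)"
   using * vc ab by algebra
  moreover have "(c \<otimes> c') \<otimes> (a \<otimes> b) \<in> M" "(a \<otimes> c) \<otimes> v' \<in> M" "(b \<otimes> c' \<oplus> v') \<otimes> v \<in> M"
   using * ab vc by (auto intro!: ideal.I_l_closed[OF M(1)])
  ultimately show "y \<otimes> z \<in> M" using ideal_add[OF M(1)] by simp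
 qed
 moreover have "primeideal Q R & M <= Q" if "Q \<in> set (Qs @ Qs')" for Q
 proof (cases "Q \<in> set Qs")
  case True
  then have "primeideal Q R" "J a <= Q" using Q(1) by simp_all
  then show ?thesis using order_trans[OF JI(2)[OF ab(1)]] by simp
 next
  case False
  then have "primeideal Q R" "J b <= Q" using Q(3) that by simp_all
  then show ?thesis using order_trans[OF JI(2)[OF ab(2)]] by simp
 qed
 ultimately show False using M(2) by blast
qed

end

context graded_completion
begin

text \<open>Successive approximation with the \<open>\<phi> (x i)\<close> as basis: a leading form
  of degree at least \<open>N\<close> is a combination of the \<open>x i\<close> with homogeneous
  coefficients.\<close>

lemma fil_generated:
 assumes I: "finite I" "!!i. i \<in> I ==> x i \<in> gr (\<delta> i)"
  and gen: "!!n. N <= n ==> gr n <= Idl (x ` I)"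
 shows "fil N <= Idl\<^bsub>B\<^esub> ((%i. \<phi> (x i)) ` I)"
proof
 fix b assume b: "b \<in> fil N"
 have xc: "x i \<in> carrier R" if "i \<in> I" for i using I(2)[OF that] gr_closed by auto
 have "\<exists>a. (\<forall>i\<in>I. a i \<in> fil (N - \<delta> i)) & b = (\<Oplus>\<^sub>B i\<in>I. a i \<otimes>\<^sub>B \<phi> (x i))"
 proof (rule approximation[where J = "fil N"])
  show "\<phi> (x i) \<in> fil (\<delta> i)" if "i \<in> I" for i using phi_fil[OF xc[OF that]] gr_tail[OF I(2)[OF that]] by simp
  fix n0 b assume b: "b \<in> fil N" "b \<in> fil n0"
  have "\<exists>r. (\<forall>i\<in>I. r i \<in> gr (n0 - \<delta> i) & (n0 < \<delta> i --> r i = \<zero>)) &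
   b \<ominus>\<^sub>B (\<Oplus>\<^sub>B i\<in>I. \<phi> (r i) \<otimes>\<^sub>B \<phi> (x i)) \<in> fil (max N (Suc n0))"
  proof (cases "n0 < N")
   \<comment> \<open>Nothing has to be removed below order \<open>N\<close>, because
     \<open>b\<close> lies in \<open>fil N\<close> anyway.\<close>
   case True
   have "(\<Oplus>\<^sub>B i\<in>I. \<phi> \<zero> \<otimes>\<^sub>B \<phi> (x i)) = (\<Oplus>\<^sub>B i\<in>I. \<zero>\<^sub>B)" by (rule B.finsum_cong') (use xc in auto)
   then have "b \<ominus>\<^sub>B (\<Oplus>\<^sub>B i\<in>I. \<phi> \<zero> \<otimes>\<^sub>B \<phi> (x i)) = b" using b fil_closed by (simp add: a_minus_def)
   then show ?thesis using b True by (intro exI[of _ "%_. \<zero>"]) (simp add: max_absorb1)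
  next
   case False
   obtain r where r: "r \<in> gr n0" "b \<ominus>\<^sub>B \<phi> r \<in> fil (Suc n0)" using fil_head[OF b(2)] by blast
   have "r \<in> Idl (x ` I)" using gen[of n0] r False by auto
   then obtain r' where r': "\<forall>i\<in>I. r' i \<in> gr (n0 - \<delta> i) & (n0 < \<delta> i --> r' i = \<zero>)" "hcomp r n0 = (\<Oplus>i\<in>I. r' i \<otimes> x i)"
    using comp_combination[of I x \<delta> r n0, OF I(1) I(2)] by blast
   have rr: "r = (\<Oplus>i\<in>I. r' i \<otimes> x i)" using comp_homogeneous[OF r(1), of n0] r'(2) by simp
   have "\<phi> r = (\<Oplus>\<^sub>B i\<in>I. \<phi> (r' i) \<otimes>\<^sub>B \<phi> (x i))"
    unfolding rr by (rule phi.hom_finsum_mult) (use r'(1) xc in auto)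
   then have "b \<ominus>\<^sub>B (\<Oplus>\<^sub>B i\<in>I. \<phi> (r' i) \<otimes>\<^sub>B \<phi> (x i)) \<in> fil (max N (Suc n0))"
    using r(2) False by (simp add: max_def)
   then show ?thesis using r'(1) by (intro exI[of _ r']) auto
  qed
  then show "\<exists>r. (\<forall>i\<in>I. r i \<in> gr (n0 - \<delta> i) & (n0 < \<delta> i --> r i = \<zero>)) &
   b \<ominus>\<^sub>B (\<Oplus>\<^sub>B i\<in>I. \<phi> (r i) \<otimes>\<^sub>B \<phi> (x i)) \<in> fil N \<inter> fil (Suc n0)"
   using fil_antimono[of N "max N (Suc n0)"] fil_antimono[of "Suc n0" "max N (Suc n0)"] by (meson IntI max.cobounded1 max.cobounded2)
 qed (use I b in auto)
 then obtain a where a: "\<forall>i\<in>I. a i \<in> fil (N - \<delta> i)" "b = (\<Oplus>\<^sub>B i\<in>I. a i \<otimes>\<^sub>B \<phi> (x i))" by blast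
 have sub: "(%i. \<phi> (x i)) ` I <= carrier B" using xc by auto
 have ID: "ideal (Idl\<^bsub>B\<^esub> ((%i. \<phi> (x i)) ` I)) B" by (rule B.genideal_ideal[OF sub])
 show "b \<in> Idl\<^bsub>B\<^esub> ((%i. \<phi> (x i)) ` I)" unfolding a(2)
  by (rule B.ideal_finsum[OF ID]) (use a fil_closed B.genideal_self[OF sub] in "auto intro!: ideal.I_l_closed[OF ID]")
qed

section \<open>Avoiding primes by elements of degree one\<close>

lemma gr_in_ideal:
 assumes J: "ideal J R" "gr N <= J" "N <= n" shows "gr n <= J"
 using assms(3)
proof (induction rule: dec_induct)
 case (step n)
 show ?case by (rule gr_Suc_induct[OF ideal_lin_sub[OF J(1)]]) (use step J ideal.I_l_closed[OF J(1)] gr_closed in blast)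
qed (use J in auto)

text \<open>\<open>fil 1\<close> is generated by the image of degree one, and it is the largest
  proper ideal.\<close>

lemma gr1_not_in_prime: assumes "primeideal Q B" "Q ~= fil 1" shows "\<not> \<phi> ` gr 1 <= Q"
proof
 assume *: "\<phi> ` gr 1 <= Q"
 have QI: "ideal Q B" using assms primeideal.axioms(1) by auto
 have Gc: "G <= carrier R" using G(2) gr_closed by blast
 have ID: "ideal (Idl (id ` G)) R" by (rule genideal_ideal) (use Gc in auto)
 have sub: "id ` G <= Idl (id ` G)" by (rule genideal_self) (use Gc in auto)
 have "gr 1 <= Idl (id ` G)"
 proof -
  have "mons 1 <= Idl (id ` G)"
  proof
   fix m assume "m \<in> mons 1"
   then obtain g where g: "g \<in> G" "m = g \<otimes> \<one>" by (auto simp: mons_simps One_nat_def)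
   then have "m = g" using Gc by auto
   then show "m \<in> Idl (id ` G)" using sub g(1) by auto
  qed
  then show ?thesis unfolding gr_span[of 1] by (rule lin_span_least[OF ideal_lin_sub[OF ID]])
 qed
 then have "fil 1 <= Idl\<^bsub>B\<^esub> ((%i. \<phi> (id i)) ` G)"
  by (intro fil_generated[where \<delta> = "%_. 1"]) (use G gr_in_ideal[OF ID] in auto)
 also have "\<dots> <= Q" by (rule B.genideal_minimal[OF QI]) (use * G in auto)
 finally have "fil 1 <= Q" .
 moreover have "Q <= fil 1" by (rule proper_ideal_fil[OF QI]) (use primeideal.I_notcarr[OF assms(1)] in auto)
 ultimately show False using assms(2) by blast
qed

text \<open>Suppose \<open>u\<close> avoids all primes of the list but lies in the new prime
  \<open>Q\<close>, and \<open>v\<close> is outside \<open>Q\<close>. The line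
  \<open>v + l u\<close> then avoids \<open>Q\<close> for every \<open>l\<close> and meets each
  other prime for at most one \<open>l\<close>, so an infinite field leaves a good choice.\<close>

lemma prime_avoidance:
 assumes inf: "infinite k" and Qs: "!!Q. Q \<in> set Qs ==> primeideal Q B & Q ~= fil 1"
 shows "\<exists>x\<in>gr 1. \<forall>Q\<in>set Qs. \<phi> x \<notin> Q"
 using Qs
proof (induction Qs)
 case Nil
 show ?case using gr_zero[of 1] by (intro bexI[of _ \<zero>]) simp_all
next
 case (Cons Q Qs)
 then obtain u where u: "u \<in> gr 1" "\<forall>Q\<in>set Qs. \<phi> u \<notin> Q" by auto
 have QI: "ideal Q B" "primeideal Q B" "Q ~= fil 1" using Cons.prems[of Q] primeideal.axioms(1) by auto
 show ?case
 proof (cases "\<phi> u \<in> Q")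
  case True
  obtain v where v: "v \<in> gr 1" "\<phi> v \<notin> Q" using gr1_not_in_prime[OF QI(2,3)] by auto
  define w where "w l = v \<oplus> l \<otimes> u" for l
  have c: "u \<in> carrier R" "v \<in> carrier R" using u v by auto
  have wgr: "w l \<in> gr 1" if "l \<in> k" for l unfolding w_def using v u gr_add lin_subD(4)[OF gr_lin_sub that] by auto
  have wQ: "\<phi> (w l) \<notin> Q" if "l \<in> k" for l
  proof
   assume "\<phi> (w l) \<in> Q"
   moreover have "\<phi> (l \<otimes> u) \<in> Q" using ideal.I_l_closed[OF QI(1) True, of "\<phi> l"] that c by simp
   ultimately have "\<phi> (w l) \<ominus>\<^sub>B \<phi> (l \<otimes> u) \<in> Q" by (rule B.ideal_minus[OF QI(1)])
   moreover have "w l \<ominus> l \<otimes> u = v"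
   proof -
    have lc: "l \<in> carrier R" using that by auto
    show ?thesis unfolding w_def using lc c by algebra
   qed
   moreover have "\<phi> (w l \<ominus> l \<otimes> u) = \<phi> (w l) \<ominus>\<^sub>B \<phi> (l \<otimes> u)"
    by (rule phi_minus) (use gr_closed[OF wgr[OF that]] that c in auto)
   ultimately have "\<phi> v \<in> Q" by simp
   then show False using v by simp
  qed
  have fin: "finite {l \<in> k. \<phi> (w l) \<in> P}" if P: "P \<in> set Qs" for P
  proof -
   have PI: "ideal P B" "primeideal P B" using Cons.prems[of P] P primeideal.axioms(1) by auto
   \<comment> \<open>Two such values would put \<open>(l - l') u\<close>, and hence
     \<open>u\<close>, into the prime.\<close>
   have "l = l'" if l: "l \<in> k" "l' \<in> k" "\<phi> (w l) \<in> P" "\<phi> (w l') \<in> P" for l l'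
   proof (rule ccontr)
    assume ne: "l ~= l'"
    have lc: "l \<in> carrier R" "l' \<in> carrier R" using l by auto
    define s where "s = l \<ominus> l'"
    have s: "s \<in> k" unfolding s_def a_minus_def by (rule scal_ring(3)[OF l(1) scal_ring(5)[OF l(2)]])
    have s0: "s ~= \<zero>" unfolding s_def using ne lc r_right_minus_eq by blast
    have "w l \<ominus> w l' = s \<otimes> u" unfolding w_def s_def using lc c by algebra
    moreover have "\<phi> (w l \<ominus> w l') = \<phi> (w l) \<ominus>\<^sub>B \<phi> (w l')"
     by (rule phi_minus) (use gr_closed[OF wgr] l in auto)
    ultimately have suP: "\<phi> (s \<otimes> u) \<in> P" using B.ideal_minus[OF PI(1) l(3,4)] by simp
    have ic: "inv s \<in> carrier R" "s \<in> carrier R" using scal_inv(1)[OF s s0] s by auto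
    have "\<phi> (inv s) \<otimes>\<^sub>B \<phi> (s \<otimes> u) \<in> P" by (rule ideal.I_l_closed[OF PI(1) suP]) (use ic in auto)
    then have "\<phi> (inv s \<otimes> (s \<otimes> u)) \<in> P" using ic c by simp
    moreover have "inv s \<otimes> (s \<otimes> u) = u" using scal_inv(3)[OF s s0] ic c by (simp flip: m_assoc)
    ultimately have "\<phi> u \<in> P" by simp
    then show False using u P by auto
   qed
   then have "{l \<in> k. \<phi> (w l) \<in> P} = {} \<or> (\<exists>l. {l \<in> k. \<phi> (w l) \<in> P} = {l})" by blast
   then show ?thesis by (elim disjE exE) (simp_all only: finite.emptyI finite.insertI)
  qed
  have "finite (\<Union>P\<in>set Qs. {l \<in> k. \<phi> (w l) \<in> P})" using fin by auto
  then obtain l where "l \<in> k" "l \<notin> (\<Union>P\<in>set Qs. {l \<in> k. \<phi> (w l) \<in> P})" using inf by (meson finite_subset subsetI)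
  then show ?thesis using wgr wQ by (intro bexI[of _ "w l"]) auto
 next
  case False
  then show ?thesis using u by (intro bexI[of _ u]) auto
 qed
qed

section \<open>Heights and the number of parameters\<close>

definition height_ge :: "'c set => nat => bool" where
 "height_ge P i \<longleftrightarrow> (\<exists>C. C i = P & (\<forall>j\<le>i. primeideal (C j) B) & (\<forall>j<i. C j \<subset> C (Suc j)))"

lemma height_ge_Suc: assumes "height_ge Q i" "primeideal P B" "Q \<subset> P" shows "height_ge P (Suc i)"
proof -
 obtain C where C: "C i = Q" "\<forall>j\<le>i. primeideal (C j) B" "\<forall>j<i. C j \<subset> C (Suc j)" using assms(1) unfolding height_ge_def by blast
 show ?thesis unfolding height_ge_def
  by (rule exI[of _ "C(Suc i := P)"]) (use C assms(2,3) in "auto simp: less_Suc_eq le_Suc_eq")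
qed

text \<open>A prime over \<open>i + 1\<close> chosen elements contains some prime \<open>Q\<close>
  from a product of primes inside the ideal of the first \<open>i\<close>. The new element avoids
  all those \<open>Q\<close> other than the maximal ideal, so the inclusion is strict and the height
  grows by one.\<close>

lemma parameters_step:
 assumes inf: "infinite k"
 shows "\<exists>x. (\<forall>j<i. x j \<in> gr 1) & (\<forall>P. primeideal P B & (\<forall>j<i. \<phi> (x j) \<in> P) --> P = fil 1 \<or> height_ge P i)"
proof (induction i)
 case 0
 have "height_ge P 0" if "primeideal P B" for P unfolding height_ge_def using that by (intro exI[of _ "%_. P"]) auto
 then show ?case by auto
next
 case (Suc i)
 then obtain x where x: "\<forall>j<i. x j \<in> gr 1" "!!P. primeideal P B ==> (\<forall>j<i. \<phi> (x j) \<in> P) ==> P = fil 1 \<or> height_ge P i" by blast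
 let ?A = "(%j. \<phi> (x j)) ` {..<i}"
 have A: "?A <= carrier B" using x(1) by auto
 have ID: "ideal (Idl\<^bsub>B\<^esub> ?A) B" by (rule B.genideal_ideal[OF A])
 obtain Qs where Qs: "\<forall>Q\<in>set Qs. primeideal Q B & Idl\<^bsub>B\<^esub> ?A <= Q" "B.prod_in Qs (Idl\<^bsub>B\<^esub> ?A)"
  using B.prime_product[OF B_noetherian ID] by blast
 obtain y where y: "y \<in> gr 1" "\<forall>Q\<in>set (filter (%Q. Q ~= fil 1) Qs). \<phi> y \<notin> Q"
  using prime_avoidance[OF inf, of "filter (%Q. Q ~= fil 1) Qs"] Qs by auto
 define x' where "x' = x(i := y)"
 have "P = fil 1 \<or> height_ge P (Suc i)" if P: "primeideal P B" "\<forall>j<Suc i. \<phi> (x' j) \<in> P" for P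
 proof (rule disjCI)
  assume nh: "\<not> height_ge P (Suc i)"
  show "P = fil 1"
  proof (rule ccontr)
   assume ne: "P ~= fil 1"
   have PI: "ideal P B" using P primeideal.axioms(1) by auto
   have "\<forall>j<i. \<phi> (x j) \<in> P" "\<phi> y \<in> P" using P(2) unfolding x'_def by (auto simp: less_Suc_eq)
   then have "Idl\<^bsub>B\<^esub> ?A <= P" by (intro B.genideal_minimal[OF PI]) auto
   then obtain Q where Q: "Q \<in> set Qs" "Q <= P"
    using B.prod_in_prime[OF Qs(2) P(1)] Qs(1) B.ideal_Hcarr[OF primeideal.axioms(1)] by blast
   have Qne: "Q ~= fil 1"
   proof
    assume "Q = fil 1"
    moreover have "P <= fil 1" by (rule proper_ideal_fil[OF PI]) (use primeideal.I_notcarr[OF P(1)] in auto)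
    ultimately show False using Q ne by blast
   qed
   then have "\<phi> y \<notin> Q" using y(2) Q by auto
   then have "Q \<subset> P" using Q \<open>\<phi> y \<in> P\<close> by blast
   moreover have "height_ge Q i"
   proof -
    have "\<forall>j<i. \<phi> (x j) \<in> Q" using Qs(1) Q(1) B.genideal_self[OF A] by blast
    then show ?thesis using x(2)[of Q] Qs(1) Q(1) Qne by blast
   qed
   ultimately show False using height_ge_Suc[of Q i P] P(1) nh by blast
  qed
 qed
 then have "\<forall>P. primeideal P B & (\<forall>j<Suc i. \<phi> (x' j) \<in> P) --> P = fil 1 \<or> height_ge P (Suc i)" by blast
 moreover have "\<forall>j<Suc i. x' j \<in> gr 1" using x(1) y(1) unfolding x'_def by (auto simp: less_Suc_eq)
 ultimately show ?case by (intro exI[of _ x'] conjI)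
qed

lemma height_bound: "height_ge P i ==> i <= card G"
proof -
 assume "height_ge P i"
 then obtain C where C: "!!j. j <= i ==> primeideal (C j) B" "!!j. j < i ==> C j \<subset> C (Suc j)"
  unfolding height_ge_def by blast
 show "i <= card G" by (rule prime_chain_bound[of i C]) (use C in auto)
qed

lemma krull_dim_ge: "height_ge P i ==> enat i <= krull_dim B"
 unfolding height_ge_def krull_dim_def by (rule Sup_upper) blast

lemma krull_dim_finite: "krull_dim B <= enat (card G)"
 unfolding krull_dim_def
proof (rule Sup_least)
 fix z assume "z \<in> {enat l | l. \<exists>P. (\<forall>i\<le>l. primeideal (P i) B) & (\<forall>i<l. P i \<subset> P (Suc i))}"
 then obtain l P where "z = enat l" "!!i. i <= l ==> primeideal (P i) B" "!!i. i < l ==> P i \<subset> P (Suc i)" by blast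
 then show "z <= enat (card G)" using prime_chain_bound[of l P] by simp
qed

text \<open>A form of degree \<open>length Qs\<close> is a sum of products with one factor of degree
  one for each ideal in the list.\<close>

lemma prod_in_gr:
 "B.prod_in Qs J ==> ideal J B ==> (!!Q. Q \<in> set Qs ==> \<phi> ` gr 1 <= Q) ==> \<phi> ` gr (length Qs) <= J"
proof (induction Qs arbitrary: J)
 case Nil
 then have "J = carrier B" using ideal.one_imp_carrier[OF Nil(2)] by simp
 then show ?case by auto
next
 case (Cons Q Qs)
 have "lin_sub {a \<in> carrier R. \<phi> a \<in> J}" unfolding lin_sub_def
  using B.ideal_add[OF Cons.prems(2)] ideal.I_l_closed[OF Cons.prems(2)]
   ideal_zero[OF Cons.prems(2)] by auto
 then have "gr (Suc (length Qs)) <= {a \<in> carrier R. \<phi> a \<in> J}"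
 proof (rule gr_Suc_induct)
  fix g b assume g: "g \<in> gr 1" and b: "b \<in> gr (length Qs)"
  have c: "g \<in> carrier R" "b \<in> carrier R" using g b by auto
  have "\<phi> ` gr (length Qs) <= B.colon J (\<phi> g)"
   by (rule Cons.IH) (use Cons.prems g c B.colon_ideal in auto)
  then have "\<phi> g \<otimes>\<^sub>B \<phi> b \<in> J" using b unfolding B.colon_def by auto
  then show "g \<otimes> b \<in> {a \<in> carrier R. \<phi> a \<in> J}" using c by simp
 qed
 then show ?case by auto
qed

text \<open>\<open>r\<close> is minimal such that some \<open>r\<close> elements of degree one lie
  in no common prime but the maximal ideal. If \<open>r > 0\<close>, then \<open>r - 1\<close>
  elements chosen by \<open>parameters_step\<close> lie in a further prime, which has height at
  least \<open>r - 1\<close> and is strictly below the maximal ideal; so the dimension is at least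
  \<open>r\<close>.\<close>

theorem parameters:
 assumes inf: "infinite k"
 shows "\<exists>r x. (\<forall>j<r. x j \<in> gr 1) & (\<exists>N. gr N <= Idl (x ` {..<r})) & enat r <= krull_dim B"
proof -
 let ?S = "%(i::nat) x. (\<forall>j<i. x j \<in> gr 1) & (\<forall>P. primeideal P B & (\<forall>j<i. \<phi> (x j) \<in> P) --> P = fil 1)"
 \<comment> \<open>No prime has height above \<open>card G\<close>, so with one element more only
   the maximal ideal is left.\<close>
 have "\<exists>x. ?S (Suc (card G)) x"
 proof -
  obtain x where x: "\<forall>j<Suc (card G). x j \<in> gr 1" "\<forall>P. primeideal P B & (\<forall>j<Suc (card G). \<phi> (x j) \<in> P) --> P = fil 1 \<or> height_ge P (Suc (card G))"
   using parameters_step[OF inf, of "Suc (card G)"] by blast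
  have "\<not> height_ge P (Suc (card G))" for P using height_bound[of P "Suc (card G)"] by auto
  then show ?thesis using x by blast
 qed
 define T where "T i \<longleftrightarrow> (\<exists>x. ?S i x)" for i
 have "T (Suc (card G))" unfolding T_def by fact
 define r where "r = (LEAST i. T i)"
 have Tr: "T r" unfolding r_def by (rule LeastI) fact
 have Tl: "\<not> T i" if "i < r" for i using not_less_Least[of i T] that unfolding r_def .
 from Tr obtain x where x: "\<forall>j<r. x j \<in> gr 1" "!!P. primeideal P B ==> (\<forall>j<r. \<phi> (x j) \<in> P) ==> P = fil 1" unfolding T_def by blast
 have m_prime: "primeideal (fil 1) B" by (rule B.maximalideal_prime[OF fil_1_maximal])
 have "\<exists>P. height_ge P r"
 proof (cases r)
  case 0
  then show ?thesis using m_prime unfolding height_ge_def by (intro exI[of _ "fil 1"] exI[of _ "%_. fil 1"]) auto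
 next
  case (Suc i)
  obtain y where y: "\<forall>j<i. y j \<in> gr 1" "\<forall>P. primeideal P B & (\<forall>j<i. \<phi> (y j) \<in> P) --> P = fil 1 \<or> height_ge P i"
   using parameters_step[OF inf, of i] by blast
  have "\<not> ?S i y" using Tl[of i] Suc unfolding T_def by (simp only: lessI not_ex not_False_eq_True simp_thms)
  then obtain P where P: "primeideal P B" "P ~= fil 1" "height_ge P i" using y by blast
  have "P <= fil 1" by (rule proper_ideal_fil[OF primeideal.axioms(1)[OF P(1)]]) (use primeideal.I_notcarr[OF P(1)] in auto)
  then have "P \<subset> fil 1" using P(2) by blast
  then show ?thesis using height_ge_Suc[OF P(3) m_prime] Suc by auto
 qed
 then have dim: "enat r <= krull_dim B" using krull_dim_ge by blast
 let ?A = "(%j. \<phi> (x j)) ` {..<r}"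
 have xc: "x j \<in> carrier R" if "j < r" for j using x(1) that gr_closed by blast
 have A: "?A <= carrier B" using xc by auto
 have ID: "ideal (Idl\<^bsub>B\<^esub> ?A) B" by (rule B.genideal_ideal[OF A])
 obtain Qs where Qs: "\<forall>Q\<in>set Qs. primeideal Q B & Idl\<^bsub>B\<^esub> ?A <= Q" "B.prod_in Qs (Idl\<^bsub>B\<^esub> ?A)"
  using B.prime_product[OF B_noetherian ID] by blast
 define N where "N = length Qs"
 have "\<phi> ` gr N <= Idl\<^bsub>B\<^esub> ?A" unfolding N_def
 proof (rule prod_in_gr[OF Qs(2) ID])
  fix Q assume Q: "Q \<in> set Qs"
  then have "Q = fil 1" using x(2)[of Q] Qs(1) B.genideal_self[OF A] by blast
  then show "\<phi> ` gr 1 <= Q" using phi_fil gr_tail by auto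
 qed
 have xI: "x ` {..<r} <= carrier R" using xc by auto
 have IR: "ideal (Idl (x ` {..<r})) R" by (rule genideal_ideal[OF xI])
 have "gr N <= Idl (x ` {..<r})"
 proof
  fix a assume a: "a \<in> gr N"
  have ac: "a \<in> carrier R" using a by auto
  have "\<phi> a \<in> Idl\<^bsub>B\<^esub> ?A" using a \<open>\<phi> ` gr N <= Idl\<^bsub>B\<^esub> ?A\<close> by auto
  then obtain b where b: "\<forall>j\<in>{..<r}. b j \<in> carrier B" "\<phi> a = (\<Oplus>\<^sub>B j\<in>{..<r}. b j \<otimes>\<^sub>B \<phi> (x j))"
   using B.genideal_combination[of "{..<r}" "%j. \<phi> (x j)" "\<phi> a"] xc by auto
  \<comment> \<open>Membership descends from the completion to \<open>R\<close>: replacing the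
    \<open>b j\<close> by elements of \<open>R\<close> that agree with them up to order
    \<open>N + 1\<close> changes nothing in degree \<open>N\<close>.\<close>
  have "\<forall>j. \<exists>c. j < r --> c \<in> carrier R & b j \<ominus>\<^sub>B \<phi> c \<in> fil (Suc N)" using dense b(1) by (meson lessThan_iff)
  from choice[OF this] obtain c where c: "\<forall>j. j < r --> c j \<in> carrier R & b j \<ominus>\<^sub>B \<phi> (c j) \<in> fil (Suc N)" by blast
  let ?s = "\<Oplus>j\<in>{..<r}. c j \<otimes> x j"
  have sc: "?s \<in> carrier R" using c xc by (auto intro!: finsum_closed)
  have ps: "\<phi> ?s = (\<Oplus>\<^sub>B j\<in>{..<r}. \<phi> (c j) \<otimes>\<^sub>B \<phi> (x j))"
   by (rule phi.hom_finsum_mult) (use c xc in auto)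
  have "\<phi> a = (\<Oplus>\<^sub>B j\<in>{..<r}. \<phi> (c j) \<otimes>\<^sub>B \<phi> (x j) \<oplus>\<^sub>B (b j \<ominus>\<^sub>B \<phi> (c j)) \<otimes>\<^sub>B \<phi> (x j))"
   unfolding b(2)
  proof (rule B.finsum_cong', simp)
   fix j assume "j \<in> {..<r}"
   then have cl: "b j \<in> carrier B" "\<phi> (c j) \<in> carrier B" "\<phi> (x j) \<in> carrier B" using b c xc by auto
   have "p \<otimes>\<^sub>B z = q \<otimes>\<^sub>B z \<oplus>\<^sub>B (p \<ominus>\<^sub>B q) \<otimes>\<^sub>B z" if "p \<in> carrier B" "q \<in> carrier B" "z \<in> carrier B" for p q z
    using that by algebra
   then show "b j \<otimes>\<^sub>B \<phi> (x j) = \<phi> (c j) \<otimes>\<^sub>B \<phi> (x j) \<oplus>\<^sub>B (b j \<ominus>\<^sub>B \<phi> (c j)) \<otimes>\<^sub>B \<phi> (x j)" using cl by blast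
  qed (use b c xc in auto)
  also have "\<dots> = \<phi> ?s \<oplus>\<^sub>B (\<Oplus>\<^sub>B j\<in>{..<r}. (b j \<ominus>\<^sub>B \<phi> (c j)) \<otimes>\<^sub>B \<phi> (x j))"
   unfolding ps by (rule B.finsum_addf) (use b c xc in auto)
  finally have e: "\<phi> a = \<phi> ?s \<oplus>\<^sub>B (\<Oplus>\<^sub>B j\<in>{..<r}. (b j \<ominus>\<^sub>B \<phi> (c j)) \<otimes>\<^sub>B \<phi> (x j))" .
  have f: "(\<Oplus>\<^sub>B j\<in>{..<r}. (b j \<ominus>\<^sub>B \<phi> (c j)) \<otimes>\<^sub>B \<phi> (x j)) \<in> fil (Suc N)"
   by (rule fil_finsum) (use c xc in "auto intro!: ideal.I_r_closed[OF fil_ideal]")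
  have "(p \<oplus>\<^sub>B z) \<ominus>\<^sub>B p = z" if "p \<in> carrier B" "z \<in> carrier B" for p z using that by algebra
  from this[OF phi.hom_closed[OF sc] fil_closed[OF f]] have "\<phi> a \<ominus>\<^sub>B \<phi> ?s \<in> fil (Suc N)" unfolding e using f by simp
  then have "\<phi> (a \<ominus> ?s) \<in> fil (Suc N)" using phi_minus[OF ac sc] by simp
  then have "a \<ominus> ?s \<in> tail (Suc N)" by (rule iffD1[OF phi_fil, rotated]) (use ac sc in auto)
  then have "hcomp (a \<ominus> ?s) N = \<zero>" unfolding tail_def by blast
  then have "hcomp a N = hcomp ?s N" using comp_minus[OF ac sc, of N] ac sc by simp
  then have "a = hcomp ?s N" using comp_homogeneous[OF a, of N] by simp
  also have "\<dots> \<in> Idl (x ` {..<r})"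
  proof (rule comp_in_homogeneous_ideal[where \<delta> = "%_. 1"])
   show "?s \<in> Idl (x ` {..<r})"
    by (rule ideal_finsum[OF IR]) (use c genideal_self[OF xI] in "auto intro!: ideal.I_l_closed[OF IR]")
  qed (use x(1) in auto)
  finally show "a \<in> Idl (x ` {..<r})" .
 qed
 then show ?thesis using x(1) dim by blast
qed

end

section \<open>Monomials in a system of parameters\<close>

lemma digits_less:
 fixes a :: "nat => nat"
 shows "(!!i. i < r ==> a i < q) ==> (\<Sum>i<r. a i * q ^ i) < q ^ r"
proof (induction r)
 case (Suc r)
 have "(\<Sum>i<Suc r. a i * q ^ i) < q ^ r + a r * q ^ r" using Suc by simp
 also have "\<dots> = Suc (a r) * q ^ r" by simp
 also have "\<dots> <= q * q ^ r" using Suc.prems[of r] by (intro mult_le_mono1) simp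
 finally show ?case by simp
qed simp

text \<open>Uniqueness of the expansion in base \<open>q\<close>; the digits will be the exponents
  of a monomial.\<close>

lemma digits_inj:
 fixes a b :: "nat => nat"
 shows "(!!i. i < r ==> a i < q) ==> (!!i. i < r ==> b i < q) ==>
  (\<Sum>i<r. a i * q ^ i) = (\<Sum>i<r. b i * q ^ i) ==> i < r ==> a i = b i"
proof (induction r)
 case (Suc r)
 have l: "(\<Sum>i<r. a i * q ^ i) < q ^ r" "(\<Sum>i<r. b i * q ^ i) < q ^ r" using Suc.prems by (auto intro: digits_less)
 have "((\<Sum>i<r. a i * q ^ i) + a r * q ^ r) div q ^ r = a r" "((\<Sum>i<r. b i * q ^ i) + b r * q ^ r) div q ^ r = b r"
  using l Suc.prems(1)[of r] by (simp_all add: div_add1_eq)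
 then have r: "a r = b r" using Suc.prems(3) by simp
 then have "(\<Sum>i<r. a i * q ^ i) = (\<Sum>i<r. b i * q ^ i)" using Suc.prems(3) by simp
 then show ?case using Suc.IH Suc.prems(1,2,4) r by (cases "i = r") auto
qed simp

text \<open>\<open>N\<close> is positive so that a degree of at least \<open>N\<close> can be
  lowered by one.\<close>

locale graded_parameters = std_graded +
 fixes x :: "nat => 'a" and r N :: nat
 assumes x_gr: "!!i. i < r ==> x i \<in> gr 1"
  and N_pos: "0 < N" and parameters: "gr N <= Idl (x ` {..<r})"
begin

lemma x_closed [simp]: "i < r ==> x i \<in> carrier R"
 by (rule gr_closed[OF x_gr])

definition mon :: "(nat => nat) => 'a" where
 "mon \<gamma> = (\<Otimes>i\<in>{..<r}. x i [^] \<gamma> i)"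

lemma mon_closed [simp]: "mon \<gamma> \<in> carrier R"
 unfolding mon_def by (auto intro!: finprod_closed)

lemma mon_cong: "(!!i. i < r ==> \<gamma> i = \<delta> i) ==> mon \<gamma> = mon \<delta>"
 unfolding mon_def by (rule finprod_cong') auto

lemma mon_mult: "mon \<gamma> \<otimes> mon \<delta> = mon (%i. \<gamma> i + \<delta> i)"
proof -
 have "mon (%i. \<gamma> i + \<delta> i) = (\<Otimes>i\<in>{..<r}. x i [^] \<gamma> i \<otimes> x i [^] \<delta> i)"
  unfolding mon_def by (rule finprod_cong') (auto simp: nat_pow_mult)
 then show ?thesis unfolding mon_def by (subst (asm) finprod_multf) auto
qed

lemma mon_zero [simp]: "mon (%i. 0) = \<one>"
 unfolding mon_def by simp

lemma mon_pow: "mon \<gamma> [^] (u::nat) = mon (%i. u * \<gamma> i)"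
 by (induction u) (simp_all add: mon_mult add.commute)

lemma pow_gr: "a \<in> gr d ==> a [^] (j::nat) \<in> gr (j * d)"
proof (induction j)
 case 0
 then show ?case using gr_0 scal_ring(2) by simp
next
 case (Suc j)
 then show ?case using gr_mult[of "a [^] j" "j * d" a d] by (simp add: add.commute)
qed

lemma mon_gr: "mon \<gamma> \<in> gr (\<Sum>i<r. \<gamma> i)"
proof -
 have "(\<Otimes>i\<in>{..<j}. x i [^] \<gamma> i) \<in> gr (\<Sum>i<j. \<gamma> i)" if "j <= r" for j
  using that
 proof (induction j)
  case 0
  then show ?case using gr_0 scal_ring(2) by simp
 next
  case (Suc j)
  have "(\<Otimes>i\<in>{..<Suc j}. x i [^] \<gamma> i) = x j [^] \<gamma> j \<otimes> (\<Otimes>i\<in>{..<j}. x i [^] \<gamma> i)"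
   using Suc.prems by (simp add: lessThan_Suc finprod_insert Pi_def)
  then show ?case using gr_mult[OF pow_gr[OF x_gr[of j], of "\<gamma> j"] Suc.IH] Suc.prems by (simp add: add.commute)
 qed
 then show ?thesis unfolding mon_def by simp
qed

lemma mon_split: "i < r ==> mon \<gamma> = x i [^] \<gamma> i \<otimes> (\<Otimes>j\<in>{..<r} - {i}. x j [^] \<gamma> j)"
proof -
 assume i: "i < r"
 then have "{..<r} = insert i ({..<r} - {i})" by auto
 then have "mon \<gamma> = (\<Otimes>j\<in>insert i ({..<r} - {i}). x j [^] \<gamma> j)" unfolding mon_def by simp
 also have "\<dots> = x i [^] \<gamma> i \<otimes> (\<Otimes>j\<in>{..<r} - {i}. x j [^] \<gamma> j)" by (rule finprod_insert) (use i in auto)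
 finally show ?thesis .
qed

lemma mon_Suc: assumes i: "i < r" shows "x i \<otimes> mon \<gamma> = mon (\<gamma>(i := Suc (\<gamma> i)))"
proof -
 have c: "(\<Otimes>j\<in>{..<r} - {i}. x j [^] \<gamma> j) \<in> carrier R" by (auto intro!: finprod_closed)
 have "(\<Otimes>j\<in>{..<r} - {i}. x j [^] (\<gamma>(i := Suc (\<gamma> i))) j) = (\<Otimes>j\<in>{..<r} - {i}. x j [^] \<gamma> j)"
  by (rule finprod_cong') auto
 then show ?thesis unfolding mon_split[OF i] using i c by (simp add: m_ac)
qed

lemma mons_closed: "b \<in> mons n ==> b \<in> carrier R"
 by (rule gr_closed[OF mons_gr])

abbreviation powers :: "nat => 'a set" where
 "powers t \<equiv> (%i. x i [^] t) ` {..<r}"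

lemma mon_in_ideal:
 assumes J: "ideal J R" "powers t <= J" and i: "i < r" "t <= \<gamma> i" shows "mon \<gamma> \<in> J"
proof -
 have c: "(\<Otimes>j\<in>{..<r} - {i}. x j [^] \<gamma> j) \<in> carrier R" by (auto intro!: finprod_closed)
 have "x i [^] \<gamma> i = x i [^] (\<gamma> i - t) \<otimes> x i [^] t" using i by (simp add: nat_pow_mult)
 moreover have "x i [^] t \<in> J" using J(2) i by auto
 ultimately have "x i [^] \<gamma> i \<in> J" using ideal.I_l_closed[OF J(1)] i by simp
 then show ?thesis unfolding mon_split[OF i(1)] using ideal.I_r_closed[OF J(1) _ c] by simp
qed

text \<open>From degree \<open>N\<close> on, a form is a combination of the \<open>x i\<close> with
  coefficients of one degree less.\<close>

lemma gr_parameters_induct: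
 assumes m: "N <= m" and T: "lin_sub T" "!!i b. i < r ==> b \<in> gr (m - 1) ==> x i \<otimes> b \<in> T"
 shows "gr m <= T"
proof
 fix a assume a: "a \<in> gr m"
 have xs: "x ` {..<r} <= carrier R" by auto
 have J: "ideal (Idl (x ` {..<r})) R" by (rule genideal_ideal[OF xs])
 have "gr n <= Idl (x ` {..<r})" if "N <= n" for n
  using that
 proof (induction rule: dec_induct)
  case (step n)
  show ?case by (rule gr_Suc_induct[OF ideal_lin_sub[OF J]]) (use step ideal.I_l_closed[OF J] gr_closed in blast)
 qed (rule parameters)
 then have "a \<in> Idl (x ` {..<r})" using a m by blast
 then obtain t where t: "\<forall>i\<in>{..<r}. t i \<in> gr (m - 1) & (m < 1 --> t i = \<zero>)" "hcomp a m = (\<Oplus>i\<in>{..<r}. t i \<otimes> x i)"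
  using comp_combination[of "{..<r}" x "%_. 1" a m] x_gr by blast
 have "a = (\<Oplus>i\<in>{..<r}. t i \<otimes> x i)" using comp_homogeneous[OF a, of m] t(2) by simp
 also have "\<dots> \<in> T"
 proof (rule lin_sub_finsum[OF T(1)])
  fix i assume "i \<in> {..<r}"
  then have i: "i < r" "t i \<in> gr (m - 1)" using t(1) by auto
  then show "t i \<otimes> x i \<in> T" using T(2)[OF i] m_comm[of "t i" "x i"] by simp
 qed
 finally show "a \<in> T" .
qed

section \<open>Finiteness over the parameters\<close>

definition spanning :: "nat => 'a set" where
 "spanning m = {mon \<gamma> \<otimes> b | \<gamma> b n. b \<in> mons n & n < N & (\<Sum>i<r. \<gamma> i) + n = m}"

lemma spanning_closed: "spanning m <= carrier R"
 unfolding spanning_def using mons_closed by auto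

text \<open>Degrees below \<open>N\<close> are covered by the zero exponent, and from degree
  \<open>N\<close> on a factor \<open>x i\<close> can be split off. Thus the finitely many monomials
  of degree below \<open>N\<close> generate \<open>R\<close> over polynomials in the
  parameters.\<close>

lemma gr_spanning: "gr m <= lin_span (spanning m)"
proof (induction m rule: less_induct)
 case (less m)
 show ?case
 proof (cases "m < N")
  case True
  have "mons m <= spanning m"
  proof
   fix b assume b: "b \<in> mons m"
   then have "b = mon (%i. 0) \<otimes> b" using mons_closed by simp
   then show "b \<in> spanning m" unfolding spanning_def using b True by (intro CollectI exI[of _ "%i. 0"] exI[of _ b] exI[of _ m]) auto
  qed
  then show ?thesis unfolding gr_span[of m] by (rule lin_span_mono)
 next
  case False
  note S = lin_sub_span[OF spanning_closed[of m]]
  show ?thesis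
  proof (rule gr_parameters_induct[OF _ S])
   fix i b assume i: "i < r" and b: "b \<in> gr (m - 1)"
   have "lin_span (spanning (m - 1)) <= {y \<in> carrier R. x i \<otimes> y \<in> lin_span (spanning m)}"
   proof (rule lin_span_least[OF lin_sub_vimage[OF S]], use i in simp)
    show "spanning (m - 1) <= {y \<in> carrier R. x i \<otimes> y \<in> lin_span (spanning m)}"
    proof
     fix y assume y: "y \<in> spanning (m - 1)"
     then obtain \<gamma> b n where g: "y = mon \<gamma> \<otimes> b" "b \<in> mons n" "n < N" "(\<Sum>i<r. \<gamma> i) + n = m - 1"
      unfolding spanning_def by blast
     have "x i \<otimes> y = mon (\<gamma>(i := Suc (\<gamma> i))) \<otimes> b"
      unfolding g(1) mon_Suc[OF i, symmetric] using i g(2) mons_closed by (simp add: m_assoc)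
     moreover have "(\<Sum>j<r. (\<gamma>(i := Suc (\<gamma> i))) j) = Suc (\<Sum>j<r. \<gamma> j)"
      using i by (simp add: sum.remove[of "{..<r}" i])
     then have "(\<Sum>j<r. (\<gamma>(i := Suc (\<gamma> i))) j) + n = m" using g(4) False N_pos by linarith
     ultimately have "x i \<otimes> y \<in> spanning m" unfolding spanning_def using g(2,3) by blast
     then show "y \<in> {y \<in> carrier R. x i \<otimes> y \<in> lin_span (spanning m)}"
      using lin_span_base y spanning_closed by blast
    qed
   qed
   then show "x i \<otimes> b \<in> lin_span (spanning m)" using less.IH[of "m - 1"] b False N_pos by auto
  qed (use False in simp)
 qed
qed

text \<open>Pigeonhole: the cofactor of the power product has degree below \<open>N\<close>, so some
  parameter occurs with exponent at least \<open>t\<close>.\<close>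

lemma gr_large_subset:
 assumes J: "ideal J R" "powers t <= J" and m: "r * t + N <= m" shows "gr m <= J"
proof -
 have "spanning m <= J"
 proof
  fix y assume "y \<in> spanning m"
  then obtain \<gamma> b n where g: "y = mon \<gamma> \<otimes> b" "b \<in> mons n" "n < N" "(\<Sum>i<r. \<gamma> i) + n = m"
   unfolding spanning_def by blast
  have "\<exists>i<r. t <= \<gamma> i"
  proof (rule ccontr)
   assume "\<not> ?thesis"
   then have "(\<Sum>i<r. \<gamma> i) <= (\<Sum>i<r. t)" by (intro sum_mono) (auto simp: not_le)
   then show False using g m by simp
  qed
  then obtain i where "i < r" "t <= \<gamma> i" by blast
  then have "mon \<gamma> \<in> J" by (rule mon_in_ideal[OF J])
  then show "y \<in> J" unfolding g(1) using ideal.I_r_closed[OF J(1)] mons_closed[OF g(2)] by simp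
 qed
 then show ?thesis using gr_spanning[of m] lin_span_least[OF ideal_lin_sub[OF J(1)]] by blast
qed

definition relation_count :: nat where
 "relation_count = card (\<Union>n<N. mons n) * 2 ^ r + 1"

definition box :: "nat => (nat => nat) set" where
 "box q = {..<r} \<rightarrow>\<^sub>E {..<q}"

lemma finite_box [simp]: "finite (box q)"
 unfolding box_def by (auto intro: finite_PiE)

lemma card_box [simp]: "card (box q) = q ^ r"
 unfolding box_def by (simp add: card_PiE)

lemma box_less: "\<alpha> \<in> box q ==> i < r ==> \<alpha> i < q"
 unfolding box_def using PiE_mem by fastforce

lemma box_eqI: "\<alpha> \<in> box q ==> \<beta> \<in> box q ==> (!!i. i < r ==> \<alpha> i = \<beta> i) ==> \<alpha> = \<beta>"
 unfolding box_def using PiE_ext[of \<alpha> "{..<r}" "%_. {..<q}" \<beta>] by simp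

lemma restrict_box: "(!!i. i < r ==> \<alpha> i < q) ==> restrict \<alpha> {..<r} \<in> box q"
 unfolding box_def restrict_PiE_iff by simp

text \<open>\<open>R\<close> is finite over the polynomials in the parameters, so the powers of \<open>f\<close> satisfy an algebraic relation
 over them whose coefficients can be bounded in terms of the degree of \<open>f\<close>; its constant term is
 divisible by \<open>f\<close>.\<close>

lemma parameter_relation:
 assumes f: "f \<in> gr d" "f ~= \<zero>" and q: "relation_count * d <= q" "0 < q"
 shows "\<exists>c. (\<forall>\<alpha>\<in>box q. c \<alpha> \<in> k) & (\<exists>\<alpha>\<in>box q. c \<alpha> ~= \<zero>) & (\<Oplus>\<alpha>\<in>box q. c \<alpha> \<otimes> mon \<alpha>) \<in> PIdl f"
proof -
 define J where "J = relation_count"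
 define bs where "bs = (\<Union>n<N. mons n)"
 \<comment> \<open>Exponents below \<open>2 q\<close> suffice: those of \<alpha> are below
   \<open>q\<close>, and the expansion of \<open>f^j\<close> contributes at most
   \<open>j d \<le> q\<close>.\<close>
 define W where "W = (%(\<beta>, b). mon \<beta> \<otimes> b) ` (box (2 * q) \<times> bs)"
 have fc: "f \<in> carrier R" using f by simp
 have fb: "finite bs" "bs <= carrier R" unfolding bs_def using finite_mons mons_closed by auto
 have Wc: "finite W" "W <= carrier R" unfolding W_def using fb by auto
 have "card W <= card (box (2 * q) \<times> bs)" unfolding W_def by (rule card_image_le) (use fb in auto)
 also have "\<dots> = q ^ r * (card bs * 2 ^ r)" by (simp add: card_cartesian_product power_mult_distrib)
 also have "\<dots> < q ^ r * J" unfolding J_def relation_count_def bs_def using q by simp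
 also have "\<dots> = card (box q \<times> {..<J})" by (simp add: card_cartesian_product)
 finally have cW: "card W < card (box q \<times> {..<J})" .
 define v where "v i = mon (fst i) \<otimes> f [^] snd i" for i :: "(nat => nat) \<times> nat"
 have vc: "v i \<in> carrier R" for i unfolding v_def using fc by simp
 have "v i \<in> lin_span ({\<zero>} \<union> W)" if i: "i \<in> box q \<times> {..<J}" for i
 proof -
  obtain \<alpha> j where ij: "i = (\<alpha>, j)" "\<alpha> \<in> box q" "j < J" using i by auto
  have S: "lin_sub (lin_span W)" by (rule lin_sub_span[OF Wc(2)])
  have "lin_span (spanning (j * d)) <= {y \<in> carrier R. mon \<alpha> \<otimes> y \<in> lin_span W}"
  proof (rule lin_span_least[OF lin_sub_vimage[OF S mon_closed]], rule)
   fix y assume y: "y \<in> spanning (j * d)"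
   then obtain \<gamma> b n where g: "y = mon \<gamma> \<otimes> b" "b \<in> mons n" "n < N" "(\<Sum>i<r. \<gamma> i) + n = j * d"
    unfolding spanning_def by blast
   have bc: "b \<in> carrier R" using g(2) mons_closed by blast
   define \<beta> where "\<beta> = restrict (%i. \<alpha> i + \<gamma> i) {..<r}"
   have "j * d <= q" using mult_le_mono1[of j J d] ij q unfolding J_def by linarith
   have "\<beta> \<in> box (2 * q)" unfolding \<beta>_def
   proof (rule restrict_box)
    fix i assume i: "i < r"
    have "\<gamma> i <= (\<Sum>i<r. \<gamma> i)" by (rule member_le_sum) (use i in auto)
    then have "\<gamma> i <= q" using g(4) \<open>j * d <= q\<close> by linarith
    then show "\<alpha> i + \<gamma> i < 2 * q" using box_less[OF ij(2) i] by simp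
   qed
   moreover have "mon \<alpha> \<otimes> y = mon \<beta> \<otimes> b"
   proof -
    have "mon \<beta> = mon \<alpha> \<otimes> mon \<gamma>" unfolding mon_mult \<beta>_def by (rule mon_cong) simp
    then show ?thesis unfolding g(1) using bc by (simp add: m_assoc)
   qed
   moreover have "b \<in> bs" unfolding bs_def using g by auto
   ultimately have "mon \<alpha> \<otimes> y \<in> W" unfolding W_def by force
   then show "y \<in> {y \<in> carrier R. mon \<alpha> \<otimes> y \<in> lin_span W}" using lin_span_base y spanning_closed by blast
  qed
  then have "mon \<alpha> \<otimes> f [^] j \<in> lin_span W" using gr_spanning pow_gr[OF f(1), of j] by blast
  then show ?thesis unfolding v_def ij using lin_span_mono[of W "{\<zero>} \<union> W"] by auto
 qed
 moreover have "lin_sub {\<zero>}" unfolding lin_sub_def by auto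
 moreover have "finite (box q \<times> {..<J})" by simp
 ultimately have "\<exists>u. (\<forall>i\<in>box q \<times> {..<J}. u i \<in> k) & (\<exists>i\<in>box q \<times> {..<J}. u i ~= \<zero>) &
   (\<Oplus>i\<in>box q \<times> {..<J}. u i \<otimes> v i) \<in> {\<zero>}"
  by (intro linear_dependence[OF Wc _ _ cW])
 then obtain u where u': "\<forall>i\<in>box q \<times> {..<J}. u i \<in> k" "\<exists>i\<in>box q \<times> {..<J}. u i ~= \<zero>"
   "(\<Oplus>i\<in>box q \<times> {..<J}. u i \<otimes> v i) \<in> {\<zero>}" by (elim exE conjE)
 note u = bspec[OF u'(1)] u'(2) singletonD[OF u'(3)]
 define T where "T j \<longleftrightarrow> j < J & (\<exists>\<alpha>\<in>box q. u (\<alpha>, j) ~= \<zero>)" for j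
 have "\<exists>j. T j"
 proof -
  obtain i where "i \<in> box q \<times> {..<J}" "u i ~= \<zero>" using u(2) by (elim bexE)
  then have "T (snd i)" unfolding T_def by (cases i) auto
  then show ?thesis ..
 qed
 \<comment> \<open>The lowest power of \<open>f\<close> with a nonzero coefficient. In a domain
   \<open>f^j0\<close> can be cancelled, after which the terms free of \<open>f\<close> still have a
   nonzero coefficient and add up to a multiple of \<open>f\<close>.\<close>
 define j0 where "j0 = (LEAST j. T j)"
 have j0: "T j0" unfolding j0_def by (rule LeastI_ex) fact
 have jl: "\<not> T j" if "j < j0" for j using not_less_Least[of j T] that unfolding j0_def .
 define I0 I1 where "I0 = box q \<times> {j0}" and "I1 = box q \<times> {Suc j0..<J}"
 have j0J: "j0 < J" using j0 unfolding T_def by (elim conjE)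
 have "finite I0" unfolding I0_def by (rule finite_cartesian_product[OF finite_box]) simp
 moreover have "finite I1" unfolding I1_def by (rule finite_cartesian_product[OF finite_box]) simp
 moreover have "I0 \<inter> I1 = {}" unfolding I0_def I1_def Times_Int_Times by simp
 ultimately have I01: "finite I0" "finite I1" "I0 \<inter> I1 = {}" by simp_all
 have I01_sub: "I0 \<union> I1 <= box q \<times> {..<J}"
 proof -
  have "{j0} <= {..<J}" "{Suc j0..<J} <= {..<J}" using j0J by (simp_all add: subset_eq)
  then show ?thesis unfolding I0_def I1_def by (rule Un_least[OF Sigma_mono[OF order_refl] Sigma_mono[OF order_refl]])
 qed
 have uc: "u i \<in> carrier R" if "i \<in> I0 \<union> I1" for i by (rule scal_closed[OF u(1)[OF subsetD[OF I01_sub that]]])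
 define w where "w i = mon (fst i) \<otimes> f [^] (snd i - j0)" for i :: "(nat => nat) \<times> nat"
 have wc: "w i \<in> carrier R" for i unfolding w_def using fc by simp
 have vw: "v i = f [^] j0 \<otimes> w i" if "i \<in> I0 \<union> I1" for i
 proof -
  have "j0 <= snd i" using that unfolding I0_def I1_def by auto
  then have "f [^] snd i = f [^] j0 \<otimes> f [^] (snd i - j0)" using fc by (simp add: nat_pow_mult)
  then show ?thesis unfolding v_def w_def using fc by (simp add: m_lcomm)
 qed
 have "(\<Oplus>i\<in>I0 \<union> I1. u i \<otimes> v i) = (\<Oplus>i\<in>box q \<times> {..<J}. u i \<otimes> v i)"
 proof (rule add.finprod_mono_neutral_cong_left)
  show "u i \<otimes> v i = \<zero>" if "i \<in> box q \<times> {..<J} - (I0 \<union> I1)" for i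
  proof -
   have "snd i < j0" "i \<in> box q \<times> {..<J}" using that unfolding I0_def I1_def by (auto simp: not_less_eq_eq)
   then have "u i = \<zero>" using jl[of "snd i"] unfolding T_def by (cases i) auto
   then show ?thesis using vc by simp
  qed
  show "finite (box q \<times> {..<J})" by simp
  show "(%i. u i \<otimes> v i) \<in> box q \<times> {..<J} \<rightarrow> carrier R"
   by (rule funcsetI) (rule m_closed[OF scal_closed[OF u(1)] vc])
 qed (rule I01_sub, rule refl)
 then have "\<zero> = (\<Oplus>i\<in>I0 \<union> I1. f [^] j0 \<otimes> (u i \<otimes> w i))"
 proof -
  assume *: "(\<Oplus>i\<in>I0 \<union> I1. u i \<otimes> v i) = (\<Oplus>i\<in>box q \<times> {..<J}. u i \<otimes> v i)"
  have "(\<Oplus>i\<in>I0 \<union> I1. u i \<otimes> v i) = (\<Oplus>i\<in>I0 \<union> I1. f [^] j0 \<otimes> (u i \<otimes> w i))"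
  proof (rule finsum_cong', simp)
   fix i assume i: "i \<in> I0 \<union> I1"
   show "u i \<otimes> v i = f [^] j0 \<otimes> (u i \<otimes> w i)" unfolding vw[OF i] using uc[OF i] wc fc by (simp add: m_lcomm)
  qed (use uc wc fc in auto)
  then show ?thesis using * u(3) by simp
 qed
 also have "\<dots> = f [^] j0 \<otimes> (\<Oplus>i\<in>I0 \<union> I1. u i \<otimes> w i)"
  by (rule finsum_rdistr[symmetric]) (use I01 uc wc fc in auto)
 finally have z: "f [^] j0 \<otimes> (\<Oplus>i\<in>I0 \<union> I1. u i \<otimes> w i) = \<zero>" by simp
 have sc: "(\<Oplus>i\<in>A. u i \<otimes> w i) \<in> carrier R" if "A <= I0 \<union> I1" for A using that uc wc by (auto intro!: finsum_closed)
 have f0: "f [^] j0 ~= \<zero>" by (induction j0) (use f(2) fc integral in auto)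
 have "(\<Oplus>i\<in>I0 \<union> I1. u i \<otimes> w i) = \<zero>" using integral[OF z] fc sc[OF order_refl] f0 by auto
 moreover have "(\<Oplus>i\<in>I0 \<union> I1. u i \<otimes> w i) = (\<Oplus>i\<in>I0. u i \<otimes> w i) \<oplus> (\<Oplus>i\<in>I1. u i \<otimes> w i)"
  by (rule finsum_Un_disjoint) (use I01 uc wc in auto)
 ultimately have s: "(\<Oplus>i\<in>I0. u i \<otimes> w i) = \<ominus> (\<Oplus>i\<in>I1. u i \<otimes> w i)"
  using sc[of I0] sc[of I1] by (simp add: minus_equality)
 have P: "ideal (PIdl f) R" by (rule cgenideal_ideal[OF fc])
 have "(\<Oplus>i\<in>I1. u i \<otimes> w i) \<in> PIdl f"
 proof (rule ideal_finsum[OF P])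
  fix i assume i: "i \<in> I1"
  then obtain m where m: "snd i - j0 = Suc m" unfolding I1_def by (cases "snd i - j0") auto
  have "u i \<otimes> w i = (u i \<otimes> (mon (fst i) \<otimes> f [^] m)) \<otimes> f"
   unfolding w_def m using uc[of i] i fc by (simp add: m_assoc)
  moreover have "u i \<otimes> (mon (fst i) \<otimes> f [^] m) \<in> carrier R" using uc[of i] i fc by simp
  ultimately show "u i \<otimes> w i \<in> PIdl f" unfolding cgenideal_def by blast
 qed
 then have "(\<Oplus>i\<in>I0. u i \<otimes> w i) \<in> PIdl f" unfolding s by (rule ideal_neg[OF P])
 moreover have "(\<Oplus>i\<in>I0. u i \<otimes> w i) = (\<Oplus>\<alpha>\<in>box q. u (\<alpha>, j0) \<otimes> mon \<alpha>)"
 proof -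
  have e: "I0 = (%\<alpha>. (\<alpha>, j0)) ` box q" unfolding I0_def by auto
  have "(\<Oplus>i\<in>I0. u i \<otimes> w i) = (\<Oplus>\<alpha>\<in>box q. u (\<alpha>, j0) \<otimes> w (\<alpha>, j0))"
   unfolding e by (rule add.finprod_reindex) (use uc wc e in "auto simp: inj_on_def")
  also have "\<dots> = (\<Oplus>\<alpha>\<in>box q. u (\<alpha>, j0) \<otimes> mon \<alpha>)"
   by (rule finsum_cong') (use uc e in "auto simp: w_def")
  finally show ?thesis .
 qed
 ultimately show ?thesis
  by (intro exI[of _ "%\<alpha>. u (\<alpha>, j0)"]) (use u(1) j0 in "auto simp: T_def")
qed

text \<open>In a nonzero polynomial in the parameters the exponent of least weight \<open>\<omega>\<close> is unique, since the digits
 of \<open>\<omega>\<close> in base \<open>q\<close> are the exponents. The corresponding monomial is therefore a combination of \<open>f\<close> and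
 monomials that are of greater weight.\<close>

lemma parameter_powers:
 assumes q: "relation_count * d <= q" "0 < q" and f: "f \<in> gr d" "f ~= \<zero>"
  and J: "ideal J R" "f \<in> J" "powers t <= J"
 shows "(\<Sum>i<r. \<gamma> i * q ^ i) + q <= t ==> mon (%i. t - \<gamma> i) \<in> J"
proof -
 define \<omega> where "\<omega> \<alpha> = (\<Sum>i<r. \<alpha> i * q ^ i)" for \<alpha> :: "nat => nat"
 obtain c where c: "!!\<alpha>. \<alpha> \<in> box q ==> c \<alpha> \<in> k" "\<exists>\<alpha>\<in>box q. c \<alpha> ~= \<zero>" "(\<Oplus>\<alpha>\<in>box q. c \<alpha> \<otimes> mon \<alpha>) \<in> PIdl f"
  using parameter_relation[OF f q] by blast
 have "PIdl f <= J" using cgenideal_minimal[OF J(1,2)] .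
 then have cJ: "(\<Oplus>\<alpha>\<in>box q. c \<alpha> \<otimes> mon \<alpha>) \<in> J" using c(3) by blast
 obtain \<alpha>0 where a0: "\<alpha>0 \<in> box q" "c \<alpha>0 ~= \<zero>" "!!\<alpha>. \<alpha> \<in> box q ==> c \<alpha> ~= \<zero> ==> \<omega> \<alpha>0 <= \<omega> \<alpha>"
  using c(2) ex_has_least_nat[of "%\<alpha>. \<alpha> \<in> box q & c \<alpha> ~= \<zero>" _ \<omega>] by (elim bexE) meson
 have a0_less: "\<omega> \<alpha>0 < \<omega> \<alpha>" if a: "\<alpha> \<in> box q" "c \<alpha> ~= \<zero>" "\<alpha> ~= \<alpha>0" for \<alpha>
 proof (rule ccontr)
  assume "\<not> \<omega> \<alpha>0 < \<omega> \<alpha>"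
  then have e: "\<omega> \<alpha> = \<omega> \<alpha>0" using a0(3)[OF a(1,2)] by simp
  have "\<alpha> = \<alpha>0"
  proof (rule box_eqI[OF a(1) a0(1)])
   fix i assume i: "i < r"
   show "\<alpha> i = \<alpha>0 i"
    by (rule digits_inj[of r \<alpha> q \<alpha>0]) (use box_less[OF a(1)] box_less[OF a0(1)] e i in "auto simp: \<omega>_def")
  qed
  then show False using a by simp
 qed
 have "\<omega> \<gamma> + q <= t ==> mon (%i. t - \<gamma> i) \<in> J" for \<gamma>
 \<comment> \<open>Descent on the weight: each other term of the relation either contains a
   \<open>t\<close>-th power or leads to an exponent vector of smaller weight.\<close>
 proof (induction "\<omega> \<gamma>" arbitrary: \<gamma> rule: less_induct)
  case less
  have g_le: "\<gamma> i <= \<omega> \<gamma>" if "i < r" for i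
  proof -
   have "\<gamma> i <= \<gamma> i * q ^ i" using q by simp
   also have "\<dots> <= \<omega> \<gamma>" unfolding \<omega>_def by (rule member_le_sum) (use that in auto)
   finally show ?thesis .
  qed
  \<comment> \<open>The bound on the weight prevents truncation in the exponents
    \<open>t - \<gamma> i - \<alpha>0 i\<close>.\<close>
  have le: "\<gamma> i + \<alpha> i < t" if "i < r" "\<alpha> \<in> box q" for i \<alpha>
  proof -
   have "\<alpha> i < q" using that box_less by simp
   then show ?thesis using g_le[OF that(1)] less.prems by linarith
  qed
  \<comment> \<open>Multiplication by this factor turns the term of \<open>\<alpha>0\<close> into a
    scalar multiple of the monomial in question.\<close>
  define m where "m = mon (%i. t - \<gamma> i - \<alpha>0 i)"
  have mm: "m \<otimes> mon \<alpha> = mon (%i. t - \<gamma> i - \<alpha>0 i + \<alpha> i)" for \<alpha> unfolding m_def mon_mult by simp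
  have mc: "m \<in> carrier R" unfolding m_def by simp
  have cc: "c \<alpha> \<in> carrier R" if "\<alpha> \<in> box q" for \<alpha> using c(1)[OF that] by auto
  have rest: "c \<alpha> \<otimes> (m \<otimes> mon \<alpha>) \<in> J" if a: "\<alpha> \<in> box q - {\<alpha>0}" for \<alpha>
  proof (cases "c \<alpha> = \<zero>")
   case True
   then show ?thesis using ideal_zero[OF J(1)] mc by simp
  next
   case False
   have aB: "\<alpha> \<in> box q" "\<alpha> ~= \<alpha>0" using a by auto
   have "m \<otimes> mon \<alpha> \<in> J"
   proof (cases "\<exists>i<r. \<gamma> i + \<alpha>0 i <= \<alpha> i")
    case True
    then obtain i where "i < r" "\<gamma> i + \<alpha>0 i <= \<alpha> i" by blast
    then show ?thesis unfolding mm by (intro mon_in_ideal[OF J(1,3)]) auto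
   next
    case f: False
    \<comment> \<open>The term of \<alpha> becomes the monomial with exponents
      \<open>t - \<delta> i\<close>. Since \<alpha> is heavier than \<open>\<alpha>0\<close>, this
      \<delta> is lighter than \<gamma>.\<close>
    define \<delta> where "\<delta> i = \<gamma> i + \<alpha>0 i - \<alpha> i" for i
    have d: "\<delta> i + \<alpha> i = \<gamma> i + \<alpha>0 i" if "i < r" for i using f that unfolding \<delta>_def by auto
    have "\<omega> \<delta> + \<omega> \<alpha> = (\<Sum>i<r. (\<delta> i + \<alpha> i) * q ^ i)" unfolding \<omega>_def by (simp add: sum.distrib algebra_simps)
    also have "\<dots> = (\<Sum>i<r. (\<gamma> i + \<alpha>0 i) * q ^ i)" using d by simp
    also have "\<dots> = \<omega> \<gamma> + \<omega> \<alpha>0" unfolding \<omega>_def by (simp add: sum.distrib algebra_simps)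
    finally have w: "\<omega> \<delta> < \<omega> \<gamma>" using a0_less[OF aB(1) False aB(2)] by linarith
    have "mon (%i. t - \<delta> i) \<in> J" by (rule less.hyps[OF w]) (use w less.prems in simp)
    moreover have "mon (%i. t - \<gamma> i - \<alpha>0 i + \<alpha> i) = mon (%i. t - \<delta> i)"
    proof (rule mon_cong)
     fix i assume i: "i < r"
     show "t - \<gamma> i - \<alpha>0 i + \<alpha> i = t - \<delta> i" using d[OF i] le[OF i a0(1)] by linarith
    qed
    ultimately show ?thesis unfolding mm by simp
   qed
   then show ?thesis by (rule ideal.I_l_closed[OF J(1) _ cc[OF aB(1)]])
  qed
  have "m \<otimes> (\<Oplus>\<alpha>\<in>box q. c \<alpha> \<otimes> mon \<alpha>) = (\<Oplus>\<alpha>\<in>box q. m \<otimes> (c \<alpha> \<otimes> mon \<alpha>))"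
   by (rule finsum_rdistr) (use cc mc in auto)
  also have "\<dots> = (\<Oplus>\<alpha>\<in>box q. c \<alpha> \<otimes> (m \<otimes> mon \<alpha>))"
   by (rule finsum_cong') (use cc mc in "auto simp: m_lcomm")
  also have "\<dots> = (\<Oplus>\<alpha>\<in>insert \<alpha>0 (box q - {\<alpha>0}). c \<alpha> \<otimes> (m \<otimes> mon \<alpha>))" using a0(1) by (simp add: insert_absorb)
  also have "\<dots> = c \<alpha>0 \<otimes> (m \<otimes> mon \<alpha>0) \<oplus> (\<Oplus>\<alpha>\<in>box q - {\<alpha>0}. c \<alpha> \<otimes> (m \<otimes> mon \<alpha>))"
   by (rule finsum_insert) (use cc mc a0 in auto)
  finally have e: "m \<otimes> (\<Oplus>\<alpha>\<in>box q. c \<alpha> \<otimes> mon \<alpha>) = c \<alpha>0 \<otimes> (m \<otimes> mon \<alpha>0) \<oplus> (\<Oplus>\<alpha>\<in>box q - {\<alpha>0}. c \<alpha> \<otimes> (m \<otimes> mon \<alpha>))" .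
  have sJ: "(\<Oplus>\<alpha>\<in>box q - {\<alpha>0}. c \<alpha> \<otimes> (m \<otimes> mon \<alpha>)) \<in> J" by (rule ideal_finsum[OF J(1)]) (rule rest)
  have tJ: "c \<alpha>0 \<otimes> (m \<otimes> mon \<alpha>0) \<oplus> (\<Oplus>\<alpha>\<in>box q - {\<alpha>0}. c \<alpha> \<otimes> (m \<otimes> mon \<alpha>)) \<in> J"
   unfolding e[symmetric] by (rule ideal.I_l_closed[OF J(1) cJ mc])
  have "(y \<oplus> s) \<ominus> s = y" if "y \<in> carrier R" "s \<in> carrier R" for y s using that by algebra
  from this[of "c \<alpha>0 \<otimes> (m \<otimes> mon \<alpha>0)", OF _ ideal_Hcarr[OF J(1) sJ]]
  have cm: "c \<alpha>0 \<otimes> (m \<otimes> mon \<alpha>0) \<in> J" using ideal_minus[OF J(1) tJ sJ] cc[OF a0(1)] mc by simp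
  have ic: "inv (c \<alpha>0) \<in> carrier R" "inv (c \<alpha>0) \<otimes> c \<alpha>0 = \<one>" using scal_inv[OF c(1)[OF a0(1)] a0(2)] by auto
  have "inv (c \<alpha>0) \<otimes> (c \<alpha>0 \<otimes> (m \<otimes> mon \<alpha>0)) \<in> J" by (rule ideal.I_l_closed[OF J(1) cm ic(1)])
  then have "m \<otimes> mon \<alpha>0 \<in> J" using ic cc[OF a0(1)] mc by (simp flip: m_assoc)
  moreover have "mon (%i. t - \<gamma> i - \<alpha>0 i + \<alpha>0 i) = mon (%i. t - \<gamma> i)"
  proof (rule mon_cong)
   fix i assume i: "i < r"
   show "t - \<gamma> i - \<alpha>0 i + \<alpha>0 i = t - \<gamma> i" using le[OF i a0(1)] by linarith
  qed
  ultimately show ?case unfolding mm by simp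
 qed
 then show "(\<Sum>i<r. \<gamma> i * q ^ i) + q <= t ==> mon (%i. t - \<gamma> i) \<in> J" unfolding \<omega>_def .
qed

end

section \<open>Forcing equations and parameters\<close>

text \<open>Splits off one term and renumbers the others, so that a relation with one generator
  fewer again runs over an initial segment.\<close>

lemma (in cring) finsum_skip:
 fixes p j0 :: nat
 assumes "j0 <= Suc p" "!!j. j <= Suc p ==> T j \<in> carrier R"
 shows "(\<Oplus>j\<in>{..Suc p}. T j) = T j0 \<oplus> (\<Oplus>j\<in>{..p}. T (if j < j0 then j else Suc j))"
proof -
 let ?s = "%j. if j < j0 then j else Suc j"
 have s: "{..Suc p} - {j0} = ?s ` {..p}"
 proof
  show "{..Suc p} - {j0} <= ?s ` {..p}"
  proof
   fix j assume "j \<in> {..Suc p} - {j0}"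
   then have "j = ?s (if j < j0 then j else j - 1)" "(if j < j0 then j else j - 1) \<in> {..p}" using assms(1) by auto
   then show "j \<in> ?s ` {..p}" by (rule image_eqI)
  qed
 qed (use assms(1) in auto)
 have "(\<Oplus>j\<in>{..Suc p}. T j) = (\<Oplus>j\<in>insert j0 ({..Suc p} - {j0}). T j)" using assms(1) by (simp add: insert_absorb)
 also have "\<dots> = T j0 \<oplus> (\<Oplus>j\<in>{..Suc p} - {j0}. T j)" by (rule finsum_insert) (use assms in auto)
 also have "(\<Oplus>j\<in>{..Suc p} - {j0}. T j) = (\<Oplus>j\<in>{..p}. T (?s j))" unfolding s
  by (rule add.finprod_reindex) (use assms(2) in "auto simp: inj_on_def split: if_splits")
 finally show ?thesis .
qed

locale parameter_algebra = graded_parameters + alg_closed_over + psi: ring_hom_cring R A \<psi>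
 for A (structure) and \<psi>
begin

lemma psi_ring_hom: "ring_hom_ring R A \<psi>"
 by (rule ring_hom_ringI2[OF ring_axioms psi.S.ring_axioms psi.homh])

lemma psi_pow: "a \<in> carrier R ==> \<psi> (a [^] (n::nat)) = \<psi> a [^]\<^sub>A n"
 by (induction n) auto

abbreviation power_ideal :: "nat => 'c set" where
 "power_ideal t \<equiv> Idl\<^bsub>A\<^esub> ((%i. \<psi> (x i) [^]\<^sub>A t) ` {..<r})"

abbreviation xprods :: "nat => 'c" where
 "xprods u \<equiv> \<psi> (mon (%i. u))"

text \<open>The elements \<open>a\<close> for which \<open>a / (x_0 ... x_(r-1))^t\<close> is zero
  in the direct limit of the quotients of \<open>A\<close> by the ideals of \<open>t\<close>-th
  powers, with multiplication by power products as transition maps.\<close>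

definition limit_ideal :: "nat => 'c set" where
 "limit_ideal t = {a \<in> carrier A. \<exists>u. xprods u \<otimes>\<^sub>A a \<in> power_ideal (t + u)}"

lemma gens_closed: "(%i. \<psi> (x i) [^]\<^sub>A (t::nat)) ` {..<r} <= carrier A"
 by auto

lemma power_ideal: "ideal (power_ideal t) A"
 by (rule psi.S.genideal_ideal[OF gens_closed])

lemma power_ideal_gen: "i < r ==> \<psi> (x i) [^]\<^sub>A (t::nat) \<in> power_ideal t"
 using psi.S.genideal_self[OF gens_closed[of t]] by auto

lemma power_ideal_gen': assumes i: "i < r" "t <= s" shows "\<psi> (x i [^] s) \<in> power_ideal t"
proof -
 have "\<psi> (x i [^] s) = \<psi> (x i) [^]\<^sub>A (s - t) \<otimes>\<^sub>A \<psi> (x i) [^]\<^sub>A t"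
  using i by (simp add: psi_pow psi.S.nat_pow_mult)
 then show ?thesis using ideal.I_l_closed[OF power_ideal power_ideal_gen[OF i(1), of t]] i by simp
qed

lemma xprods_add: "xprods u \<otimes>\<^sub>A xprods v = xprods (u + v)"
 by (simp add: mon_mult flip: psi.hom_mult)

lemma xprods_power_ideal: assumes a: "a \<in> power_ideal t" shows "xprods u \<otimes>\<^sub>A a \<in> power_ideal (t + u)"
proof -
 have "power_ideal t <= psi.S.colon (power_ideal (t + u)) (xprods u)"
 proof (rule psi.S.genideal_minimal[OF psi.S.colon_ideal[OF power_ideal]])
  show "(%i. \<psi> (x i) [^]\<^sub>A t) ` {..<r} <= psi.S.colon (power_ideal (t + u)) (xprods u)"
  proof
   fix y assume "y \<in> (%i. \<psi> (x i) [^]\<^sub>A t) ` {..<r}"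
   then obtain i where i: "i < r" "y = \<psi> (x i) [^]\<^sub>A t" by auto
   let ?z = "\<Otimes>j\<in>{..<r} - {i}. x j [^] u"
   have z: "?z \<in> carrier R" by (auto intro!: finprod_closed)
   have "mon (%i. u) \<otimes> x i [^] t = ?z \<otimes> x i [^] (t + u)"
    unfolding mon_split[OF i(1)] using z i by (simp add: m_ac flip: nat_pow_mult)
   then have "xprods u \<otimes>\<^sub>A y = \<psi> ?z \<otimes>\<^sub>A \<psi> (x i [^] (t + u))"
    using psi.hom_mult[OF mon_closed, of "x i [^] t" "%i. u"] psi.hom_mult[OF z, of "x i [^] (t + u)"] i z by (simp add: psi_pow)
   then have "xprods u \<otimes>\<^sub>A y \<in> power_ideal (t + u)"
    using ideal.I_l_closed[OF power_ideal power_ideal_gen'[OF i(1) order_refl, of "t + u"]] z by simp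
   then show "y \<in> psi.S.colon (power_ideal (t + u)) (xprods u)" unfolding psi.S.colon_def using i by simp
  qed
 qed simp
 then show ?thesis using a unfolding psi.S.colon_def by blast
qed

lemma limit_ideal_mono:
 assumes "a \<in> carrier A" "xprods u \<otimes>\<^sub>A a \<in> power_ideal (t + u)" "u <= v"
 shows "xprods v \<otimes>\<^sub>A a \<in> power_ideal (t + v)"
proof -
 have "xprods v \<otimes>\<^sub>A a = xprods (v - u) \<otimes>\<^sub>A (xprods u \<otimes>\<^sub>A a)"
  using assms by (simp add: xprods_add flip: psi.S.m_assoc)
 then show ?thesis using xprods_power_ideal[OF assms(2), of "v - u"] assms(3) by simp
qed

lemma limit_ideal: "ideal (limit_ideal t) A"
proof (rule psi.S.idealI_comm)
 show "limit_ideal t <= carrier A" unfolding limit_ideal_def by auto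
 show "\<zero>\<^sub>A \<in> limit_ideal t" unfolding limit_ideal_def
  using ideal_zero[OF power_ideal] by simp
 fix a assume "a \<in> limit_ideal t"
 then obtain u where a: "a \<in> carrier A" "xprods u \<otimes>\<^sub>A a \<in> power_ideal (t + u)" unfolding limit_ideal_def by blast
 {
  fix b assume "b \<in> limit_ideal t"
  then obtain v where b: "b \<in> carrier A" "xprods v \<otimes>\<^sub>A b \<in> power_ideal (t + v)" unfolding limit_ideal_def by blast
  have "xprods (u + v) \<otimes>\<^sub>A a \<oplus>\<^sub>A xprods (u + v) \<otimes>\<^sub>A b \<in> power_ideal (t + (u + v))"
   by (intro psi.S.ideal_add[OF power_ideal] limit_ideal_mono[OF a] limit_ideal_mono[OF b]) auto
  then show "a \<oplus>\<^sub>A b \<in> limit_ideal t" unfolding limit_ideal_def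
   using a b by (auto simp: psi.S.r_distr intro: exI[of _ "u + v"])
 next
  fix y assume y: "y \<in> carrier A"
  have "xprods u \<otimes>\<^sub>A (y \<otimes>\<^sub>A a) = y \<otimes>\<^sub>A (xprods u \<otimes>\<^sub>A a)" using a y by (simp add: psi.S.m_lcomm)
  then have "xprods u \<otimes>\<^sub>A (y \<otimes>\<^sub>A a) \<in> power_ideal (t + u)" using ideal.I_l_closed[OF power_ideal a(2) y] by simp
  then show "y \<otimes>\<^sub>A a \<in> limit_ideal t" unfolding limit_ideal_def using a y by auto
 }
qed

text \<open>Expanding a fraction by a power product does not change its class.\<close>

lemma limit_ideal_shift:
 assumes a: "a \<in> carrier A" "xprods v \<otimes>\<^sub>A a \<in> limit_ideal (t + v)" shows "a \<in> limit_ideal t"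
proof -
 obtain u where "xprods u \<otimes>\<^sub>A (xprods v \<otimes>\<^sub>A a) \<in> power_ideal (t + v + u)" using a(2) unfolding limit_ideal_def by blast
 then have "xprods (u + v) \<otimes>\<^sub>A a \<in> power_ideal (t + (u + v))" using a(1) by (simp add: xprods_add ac_simps flip: psi.S.m_assoc)
 then show ?thesis unfolding limit_ideal_def using a(1) by blast
qed

definition kernel_ideal :: "nat => 'a set" where
 "kernel_ideal t = {a \<in> carrier R. \<psi> a \<in> limit_ideal t}"

lemma kernel_ideal: "ideal (kernel_ideal t) R"
 unfolding kernel_ideal_def by (rule ring_hom_ring.ideal_vimage[OF psi_ring_hom limit_ideal])

lemma power_in_kernel: "powers t <= kernel_ideal t"
proof
 fix y assume "y \<in> powers t"
 then obtain i where i: "i < r" "y = x i [^] t" by auto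
 have "xprods 0 \<otimes>\<^sub>A \<psi> y \<in> power_ideal (t + 0)" using power_ideal_gen'[OF i(1) order_refl, of t] i by simp
 then have "\<psi> y \<in> limit_ideal t" unfolding limit_ideal_def by (intro CollectI conjI exI[of _ 0]) (use i in simp_all)
 then show "y \<in> kernel_ideal t" unfolding kernel_ideal_def using i by simp
qed

lemmas gr_large_in_kernel = gr_large_subset[OF kernel_ideal power_in_kernel]

text \<open>The equation for \<open>m\<close> keeps it within \<open>r * t0\<close> of
  \<open>r * t\<close>. A power product in a spanning element of degree \<open>m\<close> therefore
  either contains a \<open>t\<close>-th power or is complementary to one of degree at most
  \<open>r * t0 + N\<close>; for \<open>t\<close> as large as required,
  \<open>parameter_powers\<close> puts it into the ideal of \<open>f\<close> and the
  \<open>t\<close>-th powers. Taking components of degree \<open>m\<close> yields \<open>h\<close>.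
  As \<open>h\<close> has degree \<open>m - d0\<close>, forms of degree above \<open>d0\<close>
  carry it past \<open>m\<close>, into the kernel.\<close>

lemma top_degree_surjective:
 assumes f: "f \<in> gr d0" "f ~= \<zero>" and q: "q = relation_count * d0 + 1"
  and V: "(\<Sum>i<r. (r * t0 + N) * q ^ i) + q <= t"
  and m: "m + r * t0 = c + r * t" and a: "a \<in> gr m"
  and top: "!!m'. m < m' ==> gr m' <= kernel_ideal t"
 shows "\<exists>h\<in>carrier R. (\<forall>g\<in>gr d0. g \<otimes> h \<in> gr m) & (\<forall>j>d0. \<forall>g\<in>gr j. g \<otimes> h \<in> kernel_ideal t) &
  a \<ominus> f \<otimes> h \<in> kernel_ideal t"
proof -
 have pc: "powers t <= carrier R" by auto
 have I: "ideal (Idl (powers t)) R" by (rule genideal_ideal[OF pc])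
 have fc: "f \<in> carrier R" using f by simp
 define J where "J = {f \<otimes> c \<oplus> v | c v. c \<in> carrier R & v \<in> Idl (powers t)}"
 have J: "ideal J R" unfolding J_def by (rule ideal_plus_principal(1)[OF I fc])
 have IJ: "Idl (powers t) <= J" and fJ: "f \<in> J" unfolding J_def by (rule ideal_plus_principal(2,3)[OF I fc])+
 have pJ: "powers t <= J" using IJ genideal_self[OF pc] by blast
 have "spanning m <= J"
 proof
  fix y assume "y \<in> spanning m"
  then obtain \<gamma> b n where g: "y = mon \<gamma> \<otimes> b" "b \<in> mons n" "n < N" "(\<Sum>i<r. \<gamma> i) + n = m"
   unfolding spanning_def by blast
  have "mon \<gamma> \<in> J"
  proof (cases "\<exists>i<r. t <= \<gamma> i")
   case True
   then obtain i where "i < r" "t <= \<gamma> i" by blast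
   then show ?thesis by (rule mon_in_ideal[OF J pJ])
  next
   case False
   define \<delta> where "\<delta> i = t - \<gamma> i" for i
   have dg: "\<delta> i + \<gamma> i = t" if "i < r" for i using False that unfolding \<delta>_def by auto
   have "(\<Sum>i<r. \<delta> i) + (\<Sum>i<r. \<gamma> i) = (\<Sum>i<r. t)" using dg by (simp flip: sum.distrib)
   then have s: "(\<Sum>i<r. \<delta> i) <= r * t0 + N" using g(3,4) m by simp
   have "\<delta> i <= r * t0 + N" if "i < r" for i
   proof -
    have "\<delta> i <= (\<Sum>i<r. \<delta> i)" by (rule member_le_sum) (use that in auto)
    then show ?thesis using s by simp
   qed
   then have "(\<Sum>i<r. \<delta> i * q ^ i) <= (\<Sum>i<r. (r * t0 + N) * q ^ i)" by (intro sum_mono mult_le_mono1) auto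
   then have "mon (%i. t - \<delta> i) \<in> J" by (intro parameter_powers[OF _ _ f J fJ pJ, of q]) (use V q in auto)
   moreover have "mon (%i. t - \<delta> i) = mon \<gamma>" by (rule mon_cong) (simp flip: dg)
   ultimately show ?thesis by simp
  qed
  then show "y \<in> J" unfolding g(1) using ideal.I_r_closed[OF J] mons_closed[OF g(2)] by simp
 qed
 then have "a \<in> J" using a gr_spanning[of m] lin_span_least[OF ideal_lin_sub[OF J]] by blast
 then obtain y z where yz: "a = f \<otimes> y \<oplus> z" "y \<in> carrier R" "z \<in> Idl (powers t)" unfolding J_def by blast
 have zc: "z \<in> carrier R" by (rule ideal_Hcarr[OF I yz(3)])
 have "hcomp z m \<in> Idl (powers t)"
  by (rule comp_in_homogeneous_ideal[OF _ _ yz(3)]) (use pow_gr[OF x_gr, of _ t] in auto)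
 then have "hcomp z m \<in> kernel_ideal t" using genideal_minimal[OF kernel_ideal power_in_kernel] by blast
 note zK = this
 \<comment> \<open>The case \<open>m < d0\<close> guards against the truncated difference; there
   \<open>f \<otimes> y\<close> has no component of degree \<open>m\<close>.\<close>
 define h where "h = (if m < d0 then \<zero> else hcomp y (m - d0))"
 have hc: "h \<in> carrier R" unfolding h_def using yz by simp
 have "a = hcomp a m" using comp_homogeneous[OF a, of m] by simp
 also have "\<dots> = hcomp (f \<otimes> y) m \<oplus> hcomp z m" unfolding yz(1) by (rule comp_add) (use fc yz zc in auto)
 also have "hcomp (f \<otimes> y) m = f \<otimes> h" unfolding comp_mult_homogeneous[OF f(1) yz(2)] h_def using fc by simp
 finally have ah: "a = f \<otimes> h \<oplus> hcomp z m" .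
 have "(p \<oplus> s) \<ominus> p = s" if "p \<in> carrier R" "s \<in> carrier R" for p s using that by algebra
 from this[of "f \<otimes> h" "hcomp z m"] have "a \<ominus> f \<otimes> h = hcomp z m" using ah fc hc zc by simp
 then have "a \<ominus> f \<otimes> h \<in> kernel_ideal t" using zK by simp
 moreover have "g \<otimes> h \<in> gr m" if "g \<in> gr d0" for g
  using gr_mult[OF that comp_gr[OF yz(2)], of "m - d0"] that unfolding h_def by auto
 moreover have "g \<otimes> h \<in> kernel_ideal t" if "d0 < j" "g \<in> gr j" for g j
 proof (cases "m < d0")
  case True
  then show ?thesis unfolding h_def using that(2) ideal_zero[OF kernel_ideal] by simp
 next
  case False
  then have "g \<otimes> h \<in> gr (j + (m - d0))" unfolding h_def using gr_mult[OF that(2) comp_gr[OF yz(2)]] by (simp only: if_False)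
  moreover have "m < j + (m - d0)" using that(1) False by linarith
  ultimately show ?thesis using top by blast
 qed
 ultimately show ?thesis using hc by (intro bexI[of _ h] conjI ballI allI impI)
qed

section \<open>The image of the field in the forcing algebra\<close>

lemma hom_form_image:
 assumes "l \<in> carrier R" "z \<in> carrier R" and one: "\<one>\<^sub>A ~= \<zero>\<^sub>A"
 shows "(!!j. j <= p ==> b j \<in> carrier R) ==> (!!j. j <= p ==> c j = \<psi> (b j)) ==>
  cring_over.hom_form A p c (\<psi> l) (\<psi> z) = \<psi> (hom_form p b l z)"
proof (induction p arbitrary: b c)
 interpret Ak: cring_over A "\<psi> ` k"
  by (intro cring_over.intro cring_over_axioms.intro psi.S.cring_axioms ring_hom_ring.img_is_subfield(2)[OF psi_ring_hom subfield one])
 {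
  case 0
  then show ?case by simp
 next
  case (Suc p)
  have "Ak.hom_form p (%j. c (Suc j)) (\<psi> l) (\<psi> z) = \<psi> (hom_form p (%j. b (Suc j)) l z)"
   by (rule Suc.IH) (use Suc.prems in auto)
  moreover have "hom_form p (%j. b (Suc j)) l z \<in> carrier R" by (rule hom_form_closed) (use assms Suc.prems in auto)
  ultimately show ?case using Suc.prems[of 0] assms by (simp del: nat_pow_Suc add: psi_pow)
 }
qed

text \<open>Roots are carried over from \<open>k\<close> by the ring map. The pencil theorem will be
  applied inside the forcing algebra, over the image of \<open>k\<close>.\<close>

lemma image_alg_closed: assumes one: "\<one>\<^sub>A ~= \<zero>\<^sub>A" shows "alg_closed_over A (\<psi> ` k)"
proof -
 interpret Ak: cring_over A "\<psi> ` k"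
  by (intro cring_over.intro cring_over_axioms.intro psi.S.cring_axioms ring_hom_ring.img_is_subfield(2)[OF psi_ring_hom subfield one])
 show ?thesis
 proof unfold_locales
  fix p and c :: "nat => 'c" assume c: "!!j. j <= Suc p ==> c j \<in> \<psi> ` k" "c (Suc p) ~= \<zero>\<^sub>A"
  have "\<forall>j. \<exists>b. j <= Suc p --> b \<in> k & c j = \<psi> b" using c(1) by blast
  from choice[OF this] obtain b where b: "!!j. j <= Suc p ==> b j \<in> k & c j = \<psi> (b j)" by blast
  have "b (Suc p) ~= \<zero>" using b[of "Suc p"] c(2) by auto
  then obtain l where l: "l \<in> k" "hom_form (Suc p) b l \<one> = \<zero>" using root[of p b] b by blast
  have "Ak.hom_form (Suc p) c (\<psi> l) (\<psi> \<one>) = \<psi> (hom_form (Suc p) b l \<one>)"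
   by (rule hom_form_image) (use l b one in auto)
  then have "Ak.hom_form (Suc p) c (\<psi> l) \<one>\<^sub>A = \<zero>\<^sub>A" unfolding l(2) by simp
  then show "\<exists>l\<in>\<psi> ` k. Ak.hom_form (Suc p) c l \<one>\<^sub>A = \<zero>\<^sub>A" using l(1) by blast
 qed
qed

text \<open>A forcing relation among forms of degree \<open>d0\<close> only: the multiplier of
  \<open>f0\<close> is normalised to one, the other forms lie in \<open>I\<close>, and the relation
  is demanded on those \<open>h\<close> that all forms of degree above \<open>d0\<close> annihilate.
  Minimising \<open>p\<close> will make the forms linearly independent over
  \<open>k\<close>.\<close>

definition forced :: "nat => nat => 'a set => 'a => nat => bool" where
 "forced d0 t I f0 p \<longleftrightarrow> (\<exists>g \<tau>. g 0 = f0 & \<tau> 0 = \<one>\<^sub>A & (\<forall>j\<le>p. \<tau> j \<in> carrier A & g j \<in> gr d0) &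
  (\<forall>j\<le>p. 0 < j --> g j \<in> I) &
  (\<forall>h\<in>carrier R. (\<forall>j>d0. \<forall>g\<in>gr j. g \<otimes> h \<in> kernel_ideal t) -->
   (\<Oplus>\<^sub>A j\<in>{..p}. \<tau> j \<otimes>\<^sub>A \<psi> (g j)) \<otimes>\<^sub>A \<psi> h \<in> limit_ideal t))"

text \<open>A linear relation without \<open>f0\<close> expresses some \<open>g j0\<close> by the
  other forms. Substitution changes the multipliers by scalar multiples of \<open>\<tau> j0\<close>,
  but because of \<open>l 0 = \<zero>\<close> the multiplier of \<open>f0\<close> stays equal to
  one.\<close>

lemma forced_eliminate:
 assumes g: "g 0 = f0" "\<tau> 0 = \<one>\<^sub>A" "\<forall>j\<le>Suc p. \<tau> j \<in> carrier A & g j \<in> gr d0" "\<forall>j\<le>Suc p. 0 < j --> g j \<in> I"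
   "\<forall>h\<in>carrier R. (\<forall>j>d0. \<forall>g\<in>gr j. g \<otimes> h \<in> kernel_ideal t) -->
   (\<Oplus>\<^sub>A j\<in>{..Suc p}. \<tau> j \<otimes>\<^sub>A \<psi> (g j)) \<otimes>\<^sub>A \<psi> h \<in> limit_ideal t"
  and l: "\<forall>j\<le>Suc p. l j \<in> k" "l 0 = \<zero>" "j0 <= Suc p" "l j0 ~= \<zero>" "(\<Oplus>j\<in>{..Suc p}. l j \<otimes> g j) = \<zero>"
 shows "forced d0 t I f0 p"
proof -
 have j0: "0 < j0" using l by (cases j0) auto
 let ?s = "%j. if j < j0 then j else Suc j"
 define v where "v j = inv (l j0) \<otimes> l (?s j)" for j
 have ik: "inv (l j0) \<in> k" "inv (l j0) \<otimes> l j0 = \<one>" using scal_inv[of "l j0"] l by auto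
 have vk: "v j \<in> k" if "j <= p" for j unfolding v_def using ik l that by (auto intro!: scal_ring)
 have gc: "g j \<in> carrier R" "\<tau> j \<in> carrier A" "l j \<in> carrier R" if "j <= Suc p" for j using g(3) l(1) that by auto
 have "(\<Oplus>j\<in>{..Suc p}. l j \<otimes> g j) = l j0 \<otimes> g j0 \<oplus> (\<Oplus>j\<in>{..p}. l (?s j) \<otimes> g (?s j))"
  by (rule finsum_skip[OF l(3)]) (use gc in auto)
 then have "l j0 \<otimes> g j0 \<oplus> (\<Oplus>j\<in>{..p}. l (?s j) \<otimes> g (?s j)) = \<zero>" using l(5) by simp
 then have "inv (l j0) \<otimes> (l j0 \<otimes> g j0 \<oplus> (\<Oplus>j\<in>{..p}. l (?s j) \<otimes> g (?s j))) = \<zero>" using ik by simp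
 moreover have "(\<Oplus>j\<in>{..p}. v j \<otimes> g (?s j)) = inv (l j0) \<otimes> (\<Oplus>j\<in>{..p}. l (?s j) \<otimes> g (?s j))"
 proof -
  have "inv (l j0) \<otimes> (\<Oplus>j\<in>{..p}. l (?s j) \<otimes> g (?s j)) = (\<Oplus>j\<in>{..p}. inv (l j0) \<otimes> (l (?s j) \<otimes> g (?s j)))"
   by (rule finsum_rdistr) (use gc ik in auto)
  also have "\<dots> = (\<Oplus>j\<in>{..p}. v j \<otimes> g (?s j))"
   by (rule finsum_cong') (use gc ik in "auto simp: v_def m_assoc")
  finally show ?thesis by simp
 qed
 moreover have sc: "(\<Oplus>j\<in>{..p}. l (?s j) \<otimes> g (?s j)) \<in> carrier R" "(\<Oplus>j\<in>{..p}. v j \<otimes> g (?s j)) \<in> carrier R"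
  using gc vk by (auto intro!: finsum_closed)
 ultimately have "g j0 \<oplus> (\<Oplus>j\<in>{..p}. v j \<otimes> g (?s j)) = \<zero>"
  using ik gc[OF l(3)] scal_closed[OF ik(1)] by (simp add: r_distr flip: m_assoc)
 then have "g j0 = \<ominus> (\<Oplus>j\<in>{..p}. v j \<otimes> g (?s j))" using gc[OF l(3)] sc by (simp add: minus_equality)
 then have "\<psi> (g j0) = \<ominus>\<^sub>A \<psi> (\<Oplus>j\<in>{..p}. v j \<otimes> g (?s j))" using sc by simp
 also have "\<psi> (\<Oplus>j\<in>{..p}. v j \<otimes> g (?s j)) = (\<Oplus>\<^sub>A j\<in>{..p}. \<psi> (v j) \<otimes>\<^sub>A \<psi> (g (?s j)))"
  by (rule psi.hom_finsum_mult) (use gc vk in auto)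
 finally have gj0: "\<psi> (g j0) = \<ominus>\<^sub>A (\<Oplus>\<^sub>A j\<in>{..p}. \<psi> (v j) \<otimes>\<^sub>A \<psi> (g (?s j)))" .
 have pc: "\<psi> (v j) \<in> carrier A" "\<psi> (g (?s j)) \<in> carrier A" "\<tau> (?s j) \<in> carrier A" "\<tau> j0 \<in> carrier A" if "j <= p" for j
  using gc vk that l(3) by auto
 have t0: "\<tau> j0 \<in> carrier A" using gc l(3) by blast
 define \<tau>' where "\<tau>' j = \<tau> (?s j) \<ominus>\<^sub>A \<tau> j0 \<otimes>\<^sub>A \<psi> (v j)" for j
 have "(\<Oplus>\<^sub>A j\<in>{..Suc p}. \<tau> j \<otimes>\<^sub>A \<psi> (g j)) = \<tau> j0 \<otimes>\<^sub>A \<psi> (g j0) \<oplus>\<^sub>A (\<Oplus>\<^sub>A j\<in>{..p}. \<tau> (?s j) \<otimes>\<^sub>A \<psi> (g (?s j)))"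
  by (rule psi.S.finsum_skip[OF l(3)]) (use gc in auto)
 also have "\<tau> j0 \<otimes>\<^sub>A \<psi> (g j0) = (\<Oplus>\<^sub>A j\<in>{..p}. (\<ominus>\<^sub>A \<tau> j0) \<otimes>\<^sub>A (\<psi> (v j) \<otimes>\<^sub>A \<psi> (g (?s j))))"
 proof -
  have "\<tau> j0 \<otimes>\<^sub>A \<psi> (g j0) = (\<ominus>\<^sub>A \<tau> j0) \<otimes>\<^sub>A (\<Oplus>\<^sub>A j\<in>{..p}. \<psi> (v j) \<otimes>\<^sub>A \<psi> (g (?s j)))"
   unfolding gj0 using t0 pc by (subst psi.S.r_minus psi.S.l_minus, auto intro!: psi.S.finsum_closed)+
  also have "\<dots> = (\<Oplus>\<^sub>A j\<in>{..p}. (\<ominus>\<^sub>A \<tau> j0) \<otimes>\<^sub>A (\<psi> (v j) \<otimes>\<^sub>A \<psi> (g (?s j))))"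
   by (rule psi.S.finsum_rdistr) (use t0 pc in auto)
  finally show ?thesis .
 qed
 also have "\<dots> \<oplus>\<^sub>A (\<Oplus>\<^sub>A j\<in>{..p}. \<tau> (?s j) \<otimes>\<^sub>A \<psi> (g (?s j)))
   = (\<Oplus>\<^sub>A j\<in>{..p}. (\<ominus>\<^sub>A \<tau> j0) \<otimes>\<^sub>A (\<psi> (v j) \<otimes>\<^sub>A \<psi> (g (?s j))) \<oplus>\<^sub>A \<tau> (?s j) \<otimes>\<^sub>A \<psi> (g (?s j)))"
  by (rule psi.S.finsum_addf[symmetric]) (use t0 pc in auto)
 also have "\<dots> = (\<Oplus>\<^sub>A j\<in>{..p}. \<tau>' j \<otimes>\<^sub>A \<psi> (g (?s j)))"
 proof (rule psi.S.finsum_cong', simp)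
  fix j assume "j \<in> {..p}"
  then have j: "j <= p" by simp
  have "(\<ominus>\<^sub>A a) \<otimes>\<^sub>A (b \<otimes>\<^sub>A c) \<oplus>\<^sub>A e \<otimes>\<^sub>A c = (e \<ominus>\<^sub>A a \<otimes>\<^sub>A b) \<otimes>\<^sub>A c"
   if "a \<in> carrier A" "b \<in> carrier A" "c \<in> carrier A" "e \<in> carrier A" for a b c e using that by algebra
  from this[OF t0 pc(1,2,3)[OF j]]
  show "(\<ominus>\<^sub>A \<tau> j0) \<otimes>\<^sub>A (\<psi> (v j) \<otimes>\<^sub>A \<psi> (g (?s j))) \<oplus>\<^sub>A \<tau> (?s j) \<otimes>\<^sub>A \<psi> (g (?s j)) = \<tau>' j \<otimes>\<^sub>A \<psi> (g (?s j))"
   unfolding \<tau>'_def .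
 qed (use t0 pc in "auto simp: \<tau>'_def")
 finally have e: "(\<Oplus>\<^sub>A j\<in>{..Suc p}. \<tau> j \<otimes>\<^sub>A \<psi> (g j)) = (\<Oplus>\<^sub>A j\<in>{..p}. \<tau>' j \<otimes>\<^sub>A \<psi> (g (?s j)))" .
 have "v 0 = \<zero>" unfolding v_def using j0 l(2) ik by simp
 then have "\<tau>' 0 = \<one>\<^sub>A" unfolding \<tau>'_def using g(2) j0 t0 by (simp add: a_minus_def)
 moreover have "\<forall>j\<le>p. \<tau>' j \<in> carrier A & g (?s j) \<in> gr d0" using g(3) pc t0 unfolding \<tau>'_def by simp
 moreover have "\<forall>j\<le>p. 0 < j --> g (?s j) \<in> I" using g(4) by simp
 moreover have "g (?s 0) = f0" using g(1) j0 by simp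
 ultimately show ?thesis unfolding forced_def using g(5)[unfolded e]
  by (intro exI[of _ "%j. g (?s j)"] exI[of _ \<tau>'] conjI)
qed

text \<open>If \<open>1\<close> were not in the limit ideal, the top degree of the image of \<open>R\<close> modulo a limit ideal would carry
 a pencil of linear maps that the forcing equation makes solvable for every parameter, which is impossible.\<close>

theorem forced_limit:
 fixes f :: "nat => 'a" and d :: "nat => nat" and n :: nat
 assumes I: "ideal I R" and f: "f0 \<notin> I" "!!i. i \<in> {1..n} ==> f i \<in> I"
  and d: "f0 \<in> gr d0" "!!i. i \<in> {1..n} ==> f i \<in> gr (d i) & d0 <= d i"
  and \<tau>: "!!i. i \<in> {1..n} ==> \<tau> i \<in> carrier A"
   "(\<Oplus>\<^sub>A i\<in>{1..n}. \<psi> (f i) \<otimes>\<^sub>A \<tau> i) \<oplus>\<^sub>A \<psi> f0 = \<zero>\<^sub>A"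
 shows "\<one>\<^sub>A \<in> limit_ideal t0"
proof (rule ccontr)
 assume bad: "\<one>\<^sub>A \<notin> limit_ideal t0"
 have f0c: "f0 \<in> carrier R" "!!i. i \<in> {1..n} ==> f i \<in> carrier R" using d gr_closed by blast+
 \<comment> \<open>A numerator of degree \<open>c + r * v\<close> over the exponent
   \<open>t0 + v\<close> gives a fraction of degree \<open>c - r * t0\<close>, whatever
   \<open>v\<close> is; \<open>P c\<close> says that some fraction of this degree survives.\<close>
 define P where "P c \<longleftrightarrow> (\<exists>v. \<not> gr (c + r * v) <= kernel_ideal (t0 + v))" for c
 have "\<one> \<in> gr 0" "\<one> \<notin> kernel_ideal t0" using gr_0 scal_ring(2) bad unfolding kernel_ideal_def by auto
 then have P0: "P 0" unfolding P_def by (intro exI[of _ 0]) auto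
 have bound: "c <= r * t0 + N" if "P c" for c
 proof (rule ccontr)
  assume c: "\<not> c <= r * t0 + N"
  have "gr (c + r * v) <= kernel_ideal (t0 + v)" for v
   by (rule gr_large_in_kernel) (use c in "simp add: algebra_simps")
  then show False using that unfolding P_def by blast
 qed
 have "\<exists>c. P c & (\<forall>c'. P c' --> c' <= c)"
  by (rule ex_has_greatest_nat[of P 0 "%c. c"]) (use P0 bound in "auto simp: less_Suc_eq_le intro: le_imp_less_Suc")
 \<comment> \<open>The largest surviving degree, in the role of an a-invariant.\<close>
 then obtain c where c: "P c" "!!c'. P c' ==> c' <= c" by blast
 from c(1)[unfolded P_def] obtain v0 where v0: "\<not> gr (c + r * v0) <= kernel_ideal (t0 + v0)" by (elim exE)
 define q where "q = relation_count * d0 + 1"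
 \<comment> \<open>Expansion by \<open>V\<close> makes the exponent as large as
   \<open>top_degree_surjective\<close> demands and leaves the degree of fractions
   unchanged.\<close>
 define V where "V = (\<Sum>i<r. (r * t0 + N) * q ^ i) + q"
 define t m where "t = t0 + (v0 + V)" and "m = c + r * (v0 + V)"
 have m: "m + r * t0 = c + r * t" unfolding t_def m_def by (simp add: algebra_simps)
 \<comment> \<open>Expansion by a power product is injective on fractions, so a surviving numerator
   is carried from the exponent \<open>t0 + v0\<close> to \<open>t\<close>.\<close>
 have nt: "\<not> gr m <= kernel_ideal t"
 proof -
  obtain a where a: "a \<in> gr (c + r * v0)" "a \<notin> kernel_ideal (t0 + v0)" using v0 by blast
  have ac: "a \<in> carrier R" using a by simp
  have "mon (%i. V) \<otimes> a \<in> gr m"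
   using gr_mult[OF mon_gr a(1), of "%i. V"] unfolding m_def by (simp add: algebra_simps)
  moreover have "mon (%i. V) \<otimes> a \<notin> kernel_ideal t"
  proof
   assume "mon (%i. V) \<otimes> a \<in> kernel_ideal t"
   then have "xprods V \<otimes>\<^sub>A \<psi> a \<in> limit_ideal (t0 + v0 + V)" unfolding kernel_ideal_def t_def using ac by (simp add: add.assoc)
   then show False using limit_ideal_shift[of "\<psi> a" V "t0 + v0"] ac a(2) unfolding kernel_ideal_def by simp
  qed
  ultimately show ?thesis by blast
 qed
 have top: "gr m' <= kernel_ideal t" if "m < m'" for m'
 proof (rule ccontr)
  assume "\<not> ?thesis"
  moreover have "m' = (c + (m' - m)) + r * (v0 + V)" using that unfolding m_def by simp
  ultimately have "P (c + (m' - m))" unfolding P_def t_def by metis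
  then show False using c(2)[of "c + (m' - m)"] that by simp
 qed
 have Z: "ideal (limit_ideal t) A" by (rule limit_ideal)
 have one: "\<one>\<^sub>A ~= \<zero>\<^sub>A"
 proof
  assume "\<one>\<^sub>A = \<zero>\<^sub>A"
  then show False using bad ideal_zero[OF limit_ideal[of t0]] by simp
 qed
 interpret Ak: alg_closed_over A "\<psi> ` k" by (rule image_alg_closed[OF one])
 have "forced d0 t I f0 n"
 proof -
  \<comment> \<open>Forms of degree above \<open>d0\<close> are replaced by zero; their terms vanish
    on the multipliers \<open>h\<close> under consideration.\<close>
  define g where "g j = (if j = 0 then f0 else if d j = d0 then f j else \<zero>)" for j
  define \<sigma> where "\<sigma> j = (if j = 0 then \<one>\<^sub>A else \<tau> j)" for j
  have "(\<Oplus>\<^sub>A j\<in>{..n}. \<sigma> j \<otimes>\<^sub>A \<psi> (g j)) \<otimes>\<^sub>A \<psi> h \<in> limit_ideal t"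
   if h: "h \<in> carrier R" "\<forall>j>d0. \<forall>g\<in>gr j. g \<otimes> h \<in> kernel_ideal t" for h
  proof -
   have gc: "g j \<in> carrier R" "\<sigma> j \<in> carrier A" if "j <= n" for j using that f0c \<tau>(1) unfolding g_def \<sigma>_def by auto
   define s1 s2 where "s1 = (\<Oplus>\<^sub>A i\<in>{1..n}. \<sigma> i \<otimes>\<^sub>A \<psi> (g i))"
    and "s2 = (\<Oplus>\<^sub>A i\<in>{1..n}. \<tau> i \<otimes>\<^sub>A \<psi> (f i \<ominus> g i))"
   have fg: "f i \<ominus> g i \<in> carrier R" if "i \<in> {1..n}" for i using that gc f0c by auto
   have sc: "s1 \<in> carrier A" "s2 \<in> carrier A" unfolding s1_def s2_def using gc fg \<tau>(1) by (auto intro!: psi.S.finsum_closed)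
   have "{..n} = insert 0 {1..n}" by auto
   then have "(\<Oplus>\<^sub>A j\<in>{..n}. \<sigma> j \<otimes>\<^sub>A \<psi> (g j)) = (\<Oplus>\<^sub>A j\<in>insert 0 {1..n}. \<sigma> j \<otimes>\<^sub>A \<psi> (g j))" by simp
   also have "\<dots> = \<sigma> 0 \<otimes>\<^sub>A \<psi> (g 0) \<oplus>\<^sub>A s1"
    unfolding s1_def by (rule psi.S.finsum_insert) (use gc in auto)
   also have "\<dots> = \<psi> f0 \<oplus>\<^sub>A s1" unfolding \<sigma>_def g_def using f0c by simp
   finally have e1: "(\<Oplus>\<^sub>A j\<in>{..n}. \<sigma> j \<otimes>\<^sub>A \<psi> (g j)) = \<psi> f0 \<oplus>\<^sub>A s1" .
   have "(\<Oplus>\<^sub>A i\<in>{1..n}. \<psi> (f i) \<otimes>\<^sub>A \<tau> i) = (\<Oplus>\<^sub>A i\<in>{1..n}. \<sigma> i \<otimes>\<^sub>A \<psi> (g i) \<oplus>\<^sub>A \<tau> i \<otimes>\<^sub>A \<psi> (f i \<ominus> g i))"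
   proof (rule psi.S.finsum_cong', simp)
    fix i assume i: "i \<in> {1..n}"
    have cl: "f i \<in> carrier R" "g i \<in> carrier R" "\<tau> i \<in> carrier A" using i f0c gc \<tau>(1) by auto
    have "a \<otimes>\<^sub>A b = b \<otimes>\<^sub>A e \<oplus>\<^sub>A b \<otimes>\<^sub>A (a \<ominus>\<^sub>A e)"
     if "a \<in> carrier A" "b \<in> carrier A" "e \<in> carrier A" for a b e using that by algebra
    from this[of "\<psi> (f i)" "\<tau> i" "\<psi> (g i)"] have "\<psi> (f i) \<otimes>\<^sub>A \<tau> i = \<tau> i \<otimes>\<^sub>A \<psi> (g i) \<oplus>\<^sub>A \<tau> i \<otimes>\<^sub>A (\<psi> (f i) \<ominus>\<^sub>A \<psi> (g i))"
     using cl by simp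
    moreover have "\<psi> (f i \<ominus> g i) = \<psi> (f i) \<ominus>\<^sub>A \<psi> (g i)" using cl by (simp add: a_minus_def)
    ultimately show "\<psi> (f i) \<otimes>\<^sub>A \<tau> i = \<sigma> i \<otimes>\<^sub>A \<psi> (g i) \<oplus>\<^sub>A \<tau> i \<otimes>\<^sub>A \<psi> (f i \<ominus> g i)" unfolding \<sigma>_def using i by simp
   qed (use gc fg \<tau>(1) in auto)
   also have "\<dots> = s1 \<oplus>\<^sub>A s2" unfolding s1_def s2_def by (rule psi.S.finsum_addf) (use gc fg \<tau>(1) in auto)
   finally have "s1 \<oplus>\<^sub>A s2 \<oplus>\<^sub>A \<psi> f0 = \<zero>\<^sub>A" using \<tau>(2) by simp
   moreover have "a \<oplus>\<^sub>A b = (b \<oplus>\<^sub>A e \<oplus>\<^sub>A a) \<ominus>\<^sub>A e" if "a \<in> carrier A" "b \<in> carrier A" "e \<in> carrier A" for a b e using that by algebra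
   from this[of "\<psi> f0" s1 s2] have "\<psi> f0 \<oplus>\<^sub>A s1 = (s1 \<oplus>\<^sub>A s2 \<oplus>\<^sub>A \<psi> f0) \<ominus>\<^sub>A s2" using sc f0c by simp
   ultimately have e2: "\<psi> f0 \<oplus>\<^sub>A s1 = \<ominus>\<^sub>A s2" using sc by (simp add: a_minus_def)
   have "s2 \<otimes>\<^sub>A \<psi> h = (\<Oplus>\<^sub>A i\<in>{1..n}. \<tau> i \<otimes>\<^sub>A \<psi> (f i \<ominus> g i) \<otimes>\<^sub>A \<psi> h)"
    unfolding s2_def by (rule psi.S.finsum_ldistr) (use fg \<tau>(1) h in auto)
   also have "\<dots> \<in> limit_ideal t"
   proof (rule psi.S.ideal_finsum[OF Z])
    fix i assume i: "i \<in> {1..n}"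
    have "(f i \<ominus> g i) \<otimes> h \<in> kernel_ideal t"
    proof (cases "d i = d0")
     case True
     then have "f i \<ominus> g i = \<zero>" unfolding g_def using i f0c(2)[OF i] by (auto simp: r_neg a_minus_def)
     then show ?thesis using h ideal_zero[OF kernel_ideal] by simp
    next
     case False
     then have "f i \<ominus> g i = f i" unfolding g_def using i f0c(2)[OF i] by (auto simp: a_minus_def)
     moreover have "d0 < d i" using d(2)[OF i] False by simp
     ultimately show ?thesis using h(2) d(2)[OF i] by simp
    qed
    then have "\<psi> (f i \<ominus> g i) \<otimes>\<^sub>A \<psi> h \<in> limit_ideal t" unfolding kernel_ideal_def using psi.hom_mult[OF fg[OF i] h(1)] by simp
    then have "\<tau> i \<otimes>\<^sub>A (\<psi> (f i \<ominus> g i) \<otimes>\<^sub>A \<psi> h) \<in> limit_ideal t" by (rule ideal.I_l_closed[OF Z _ \<tau>(1)[OF i]])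
    then show "\<tau> i \<otimes>\<^sub>A \<psi> (f i \<ominus> g i) \<otimes>\<^sub>A \<psi> h \<in> limit_ideal t"
     using psi.S.m_assoc[OF \<tau>(1)[OF i] psi.hom_closed[OF fg[OF i]] psi.hom_closed[OF h(1)]] by simp
   qed
   finally have "\<ominus>\<^sub>A (s2 \<otimes>\<^sub>A \<psi> h) \<in> limit_ideal t" by (rule ideal_neg[OF Z])
   then show ?thesis unfolding e1 e2 using psi.S.l_minus[OF sc(2) psi.hom_closed[OF h(1)]] by simp
  qed
  moreover have "\<forall>j\<le>n. \<sigma> j \<in> carrier A & g j \<in> gr d0" "\<forall>j\<le>n. 0 < j --> g j \<in> I"
   using \<tau>(1) d f(2) ideal_zero[OF I] unfolding \<sigma>_def g_def by auto
  moreover have "g 0 = f0" "\<sigma> 0 = \<one>\<^sub>A" unfolding g_def \<sigma>_def by auto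
  ultimately show ?thesis unfolding forced_def by (intro exI[of _ g] exI[of _ \<sigma>] conjI) auto
 qed
 \<comment> \<open>By minimality there is no linear relation without \<open>f0\<close>, and one that
   involves \<open>f0\<close> would place it in \<open>I\<close>.\<close>
 then obtain p where p: "forced d0 t I f0 p" "!!p'. p' < p ==> \<not> forced d0 t I f0 p'"
  using exists_least_iff[of "forced d0 t I f0"] by blast
 then obtain g \<sigma> where g: "g 0 = f0" "\<sigma> 0 = \<one>\<^sub>A" "\<forall>j\<le>p. \<sigma> j \<in> carrier A & g j \<in> gr d0" "\<forall>j\<le>p. 0 < j --> g j \<in> I"
   "\<forall>h\<in>carrier R. (\<forall>j>d0. \<forall>g\<in>gr j. g \<otimes> h \<in> kernel_ideal t) -->
   (\<Oplus>\<^sub>A j\<in>{..p}. \<sigma> j \<otimes>\<^sub>A \<psi> (g j)) \<otimes>\<^sub>A \<psi> h \<in> limit_ideal t" unfolding forced_def by blast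
 have gc: "g j \<in> carrier R" "\<sigma> j \<in> carrier A" if "j <= p" for j using g(3) that by auto
 have indep: "(\<Oplus>j\<in>{..p}. l j \<otimes> g j) ~= \<zero>" if l: "\<forall>j\<le>p. l j \<in> k" "\<exists>j\<le>p. l j ~= \<zero>" for l
 proof
  assume z: "(\<Oplus>j\<in>{..p}. l j \<otimes> g j) = \<zero>"
  have lc: "l j \<in> carrier R" if "j <= p" for j using l(1) that by auto
  have "{..p} = insert 0 {1..p}" by auto
  then have "(\<Oplus>j\<in>{..p}. l j \<otimes> g j) = (\<Oplus>j\<in>insert 0 {1..p}. l j \<otimes> g j)" by simp
  also have "\<dots> = l 0 \<otimes> g 0 \<oplus> (\<Oplus>j\<in>{1..p}. l j \<otimes> g j)" by (rule finsum_insert) (use gc lc in auto)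
  finally have "l 0 \<otimes> f0 \<oplus> (\<Oplus>j\<in>{1..p}. l j \<otimes> g j) = \<zero>" using z g(1) by simp
  moreover have sI: "(\<Oplus>j\<in>{1..p}. l j \<otimes> g j) \<in> I"
   by (rule ideal_finsum[OF I]) (use g(4) lc in "auto intro!: ideal.I_l_closed[OF I]")
  ultimately have "l 0 \<otimes> f0 = \<ominus> (\<Oplus>j\<in>{1..p}. l j \<otimes> g j)" using lc f0c ideal_Hcarr[OF I sI] by (simp add: minus_equality)
  then have lI: "l 0 \<otimes> f0 \<in> I" using ideal_neg[OF I sI] by simp
  have l0: "l 0 = \<zero>"
  proof (rule ccontr)
   assume "l 0 ~= \<zero>"
   then have i: "inv (l 0) \<in> carrier R" "inv (l 0) \<otimes> l 0 = \<one>" using scal_inv[of "l 0"] l(1) by auto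
   have "inv (l 0) \<otimes> (l 0 \<otimes> f0) \<in> I" by (rule ideal.I_l_closed[OF I lI i(1)])
   then show False using f(1) i lc f0c by (simp flip: m_assoc)
  qed
  obtain j0 where j0: "j0 <= p" "l j0 ~= \<zero>" using l(2) by blast
  then obtain p' where p': "p = Suc p'" using l0 by (cases p) auto
  have "forced d0 t I f0 p'" by (rule forced_eliminate[of g f0 \<sigma> p' d0 I t l j0]) (use g l l0 j0 z p' in auto)
  then show False using p(2) p' by blast
 qed
 \<comment> \<open>A finite spanning set of the image of the top degree, not contained in the limit
   ideal.\<close>
 let ?W = "\<psi> ` mons m"
 have Wc: "?W <= carrier A" using mons_closed by auto
 have "lin_sub {a \<in> carrier R. \<psi> a \<in> Ak.lin_span ?W}"
  unfolding lin_sub_def using Ak.lin_subD[OF Ak.lin_sub_span[OF Wc]] by auto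
 moreover have "mons m <= {a \<in> carrier R. \<psi> a \<in> Ak.lin_span ?W}" using Ak.lin_span_base[of ?W] mons_closed by blast
 ultimately have span: "\<psi> a \<in> Ak.lin_span ?W" if "a \<in> gr m" for a
  using that lin_span_least unfolding gr_span[of m] by blast
 have nW: "\<not> ?W <= limit_ideal t"
 proof
  assume "?W <= limit_ideal t"
  then have "mons m <= kernel_ideal t" unfolding kernel_ideal_def using mons_closed by blast
  then have "gr m <= kernel_ideal t" unfolding gr_span[of m] by (rule lin_span_least[OF ideal_lin_sub[OF kernel_ideal]])
  then show False using nt by blast
 qed
 have "\<exists>\<mu>. (\<forall>j\<le>p. \<mu> j \<in> \<psi> ` k) & (\<exists>j\<le>p. \<mu> j ~= \<zero>\<^sub>A) &
  \<not> (\<forall>w\<in>?W. \<exists>v. (\<forall>j\<le>p. v j \<in> Ak.lin_span ?W) & w \<ominus>\<^sub>A (\<Oplus>\<^sub>A j\<in>{..p}. \<mu> j \<otimes>\<^sub>A v j) \<in> limit_ideal t &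
    (\<Oplus>\<^sub>A j\<in>{..p}. \<sigma> j \<otimes>\<^sub>A v j) \<in> limit_ideal t)"
  by (rule Ak.pencil_eigenvector[OF Z _ Wc nW]) (use gc g(2) finite_mons in auto)
 then obtain \<mu> where mu: "\<forall>j\<le>p. \<mu> j \<in> \<psi> ` k" "\<exists>j\<le>p. \<mu> j ~= \<zero>\<^sub>A"
  and no: "\<not> (\<forall>w\<in>?W. \<exists>v. (\<forall>j\<le>p. v j \<in> Ak.lin_span ?W) & w \<ominus>\<^sub>A (\<Oplus>\<^sub>A j\<in>{..p}. \<mu> j \<otimes>\<^sub>A v j) \<in> limit_ideal t &
    (\<Oplus>\<^sub>A j\<in>{..p}. \<sigma> j \<otimes>\<^sub>A v j) \<in> limit_ideal t)" by blast
 have "\<forall>j. \<exists>b. j <= p --> b \<in> k & \<mu> j = \<psi> b" using mu(1) by blast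
 from choice[OF this] obtain l where l: "!!j. j <= p ==> l j \<in> k & \<mu> j = \<psi> (l j)" by blast
 have lc: "l j \<in> carrier R" if "j <= p" for j using l[OF that] by auto
 \<comment> \<open>The form with the eigenvector as coefficients. It is nonzero by independence,
   hence onto in the top degree, and the elements \<open>\<psi> (g j) \<otimes> \<psi> h\<close>
   then solve the very system that the eigenvector excludes.\<close>
 define F where "F = (\<Oplus>j\<in>{..p}. l j \<otimes> g j)"
 have Fz: "F ~= \<zero>" unfolding F_def
 proof (rule indep)
  obtain j where "j <= p" "\<mu> j ~= \<zero>\<^sub>A" using mu(2) by blast
  then show "\<exists>j\<le>p. l j ~= \<zero>" using l[of j] by (intro exI[of _ j]) auto
 qed (use l in auto)
 have Fg: "F \<in> gr d0" unfolding F_def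
  by (rule lin_sub_finsum[OF gr_lin_sub]) (use g(3) l in "auto intro!: lin_subD(4)[OF gr_lin_sub]")
 have "\<exists>v. (\<forall>j\<le>p. v j \<in> Ak.lin_span ?W) & w \<ominus>\<^sub>A (\<Oplus>\<^sub>A j\<in>{..p}. \<mu> j \<otimes>\<^sub>A v j) \<in> limit_ideal t &
    (\<Oplus>\<^sub>A j\<in>{..p}. \<sigma> j \<otimes>\<^sub>A v j) \<in> limit_ideal t" if w: "w \<in> ?W" for w
 proof -
  obtain a where a: "w = \<psi> a" "a \<in> gr m" using w mons_gr by blast
  obtain h where h: "h \<in> carrier R" "\<forall>g\<in>gr d0. g \<otimes> h \<in> gr m" "\<forall>j>d0. \<forall>g\<in>gr j. g \<otimes> h \<in> kernel_ideal t"
    "a \<ominus> F \<otimes> h \<in> kernel_ideal t"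
   using top_degree_surjective[OF Fg Fz q_def _ m a(2) top] unfolding t_def V_def by auto
  define v where "v j = \<psi> (g j) \<otimes>\<^sub>A \<psi> h" for j
  have vc: "\<psi> (g j) \<in> carrier A" "\<psi> h \<in> carrier A" "\<mu> j \<in> carrier A" "\<sigma> j \<in> carrier A" if "j <= p" for j
   using gc[OF that] h(1) l[OF that] by auto
  have "v j \<in> Ak.lin_span ?W" if "j <= p" for j
   unfolding v_def using span[of "g j \<otimes> h"] h(1,2) g(3) that by auto
  moreover have "(\<Oplus>\<^sub>A j\<in>{..p}. \<sigma> j \<otimes>\<^sub>A v j) \<in> limit_ideal t"
  proof -
   have "(\<Oplus>\<^sub>A j\<in>{..p}. \<sigma> j \<otimes>\<^sub>A v j) = (\<Oplus>\<^sub>A j\<in>{..p}. \<sigma> j \<otimes>\<^sub>A \<psi> (g j) \<otimes>\<^sub>A \<psi> h)"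
    by (rule psi.S.finsum_cong') (use vc in "auto simp: v_def psi.S.m_assoc")
   also have "\<dots> = (\<Oplus>\<^sub>A j\<in>{..p}. \<sigma> j \<otimes>\<^sub>A \<psi> (g j)) \<otimes>\<^sub>A \<psi> h"
    by (rule psi.S.finsum_ldistr[symmetric]) (use vc h(1) in auto)
   finally show ?thesis using g(5) h(1,3) by simp
  qed
  moreover have "w \<ominus>\<^sub>A (\<Oplus>\<^sub>A j\<in>{..p}. \<mu> j \<otimes>\<^sub>A v j) \<in> limit_ideal t"
  proof -
   have "(\<Oplus>\<^sub>A j\<in>{..p}. \<mu> j \<otimes>\<^sub>A v j) = (\<Oplus>\<^sub>A j\<in>{..p}. (\<psi> \<circ> (%j. l j \<otimes> g j)) j \<otimes>\<^sub>A \<psi> h)"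
   proof (rule psi.S.finsum_cong', simp)
    fix j assume "j \<in> {..p}"
    then have j: "j <= p" by simp
    then show "\<mu> j \<otimes>\<^sub>A v j = (\<psi> \<circ> (%j. l j \<otimes> g j)) j \<otimes>\<^sub>A \<psi> h"
     using l[OF j] gc[OF j] lc[OF j] h(1) by (simp add: v_def psi.S.m_assoc)
   qed (use gc lc h(1) in auto)
   also have "\<dots> = (\<Oplus>\<^sub>A j\<in>{..p}. (\<psi> \<circ> (%j. l j \<otimes> g j)) j) \<otimes>\<^sub>A \<psi> h"
    by (rule psi.S.finsum_ldistr[symmetric]) (use gc lc h(1) in auto)
   also have "(\<Oplus>\<^sub>A j\<in>{..p}. (\<psi> \<circ> (%j. l j \<otimes> g j)) j) = \<psi> F"
    unfolding F_def by (subst psi.hom_finsum) (use gc lc in auto)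
   also have "\<psi> F \<otimes>\<^sub>A \<psi> h = \<psi> (F \<otimes> h)" using Fg h(1) by simp
   finally have e: "(\<Oplus>\<^sub>A j\<in>{..p}. \<mu> j \<otimes>\<^sub>A v j) = \<psi> (F \<otimes> h)" .
   have "\<psi> (a \<ominus> F \<otimes> h) = w \<ominus>\<^sub>A \<psi> (F \<otimes> h)" unfolding a(1) using a(2) Fg h(1) by (simp add: a_minus_def)
   then show ?thesis unfolding e using h(4) unfolding kernel_ideal_def by simp
  qed
  ultimately show ?thesis by (intro exI[of _ v]) auto
 qed
 then show False using no by blast
qed

end

section \<open>The local ring at the irrelevant ideal and its completion\<close>

context std_graded
begin

definition denoms :: "'a set" where
 "denoms = carrier R - tail 1"

abbreviation frac :: "'a => 'a => ('a \<times> 'a) set" where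
 "frac a s \<equiv> loc_frac R denoms a s"

definition local_ring :: "('a \<times> 'a) set ring" where
 "local_ring = local_ring_at R (tail 1)"

lemma denoms_closed [simp]: "s \<in> denoms ==> s \<in> carrier R"
 unfolding denoms_def by simp

lemma one_denominator [simp]: "\<one> \<in> denoms"
 unfolding denoms_def
 using primeideal.I_notcarr[OF tail_1_prime] ideal.one_imp_carrier[OF primeideal.axioms(1)[OF tail_1_prime]] by auto

lemma mult_denominator [simp]: "s \<in> denoms ==> t \<in> denoms ==> s \<otimes> t \<in> denoms"
 unfolding denoms_def using primeideal.I_prime[OF tail_1_prime, of s t] by auto

lemma denominator_nonzero: "s \<in> denoms ==> s ~= \<zero>"
 unfolding denoms_def by auto

lemma denominator_comp: "s \<in> denoms ==> hcomp s 0 ~= \<zero>"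
 unfolding denoms_def using tail_1_iff by blast

text \<open>In a domain the factor \<open>u\<close> in the definition of the localisation cancels,
  so fractions are compared by cross multiplication.\<close>

lemma frac_set:
 assumes "a \<in> carrier R" "s \<in> denoms"
 shows "frac a s = {(b, t). b \<in> carrier R & t \<in> denoms & a \<otimes> t = b \<otimes> s}"
proof -
 have "(\<exists>u\<in>denoms. u \<otimes> (a \<otimes> t \<ominus> b \<otimes> s) = \<zero>) \<longleftrightarrow> a \<otimes> t = b \<otimes> s"
  if "b \<in> carrier R" "t \<in> denoms" for b t
 proof
  have c: "a \<otimes> t \<in> carrier R" "b \<otimes> s \<in> carrier R" using assms that by auto
  show "a \<otimes> t = b \<otimes> s" if ex: "\<exists>u\<in>denoms. u \<otimes> (a \<otimes> t \<ominus> b \<otimes> s) = \<zero>"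
  proof -
   obtain u where u: "u \<in> denoms" "u \<otimes> (a \<otimes> t \<ominus> b \<otimes> s) = \<zero>" using ex by blast
   then have "a \<otimes> t \<ominus> b \<otimes> s = \<zero>" using integral[OF u(2)] denominator_nonzero c by auto
   then show ?thesis using c r_right_minus_eq by blast
  qed
  show "\<exists>u\<in>denoms. u \<otimes> (a \<otimes> t \<ominus> b \<otimes> s) = \<zero>" if "a \<otimes> t = b \<otimes> s"
   using that c r_right_minus_eq[of "b \<otimes> s" "b \<otimes> s"] by (intro bexI[of _ \<one>]) auto
 qed
 then have "((a, s), (b, t)) \<in> loc_rel R denoms \<longleftrightarrow> b \<in> carrier R & t \<in> denoms & a \<otimes> t = b \<otimes> s" for b t
  unfolding loc_rel_def mem_Collect_eq using assms by blast
 then show ?thesis unfolding loc_frac_def by auto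
qed

lemma frac_eq:
 assumes "a \<in> carrier R" "s \<in> denoms" "b \<in> carrier R" "t \<in> denoms"
 shows "frac a s = frac b t \<longleftrightarrow> a \<otimes> t = b \<otimes> s"
proof
 assume "frac a s = frac b t"
 then have "(b, t) \<in> frac a s" using assms by (simp add: frac_set)
 then show "a \<otimes> t = b \<otimes> s" using assms by (simp add: frac_set)
next
 assume e: "a \<otimes> t = b \<otimes> s"
 have "a \<otimes> v = c \<otimes> s \<longleftrightarrow> b \<otimes> v = c \<otimes> t" if "c \<in> carrier R" "v \<in> denoms" for c v
 proof -
  have cl: "a \<in> carrier R" "b \<in> carrier R" "s \<in> carrier R" "t \<in> carrier R" "v \<in> carrier R" using assms that by auto
  have "a \<otimes> v = c \<otimes> s \<longleftrightarrow> t \<otimes> (a \<otimes> v) = t \<otimes> (c \<otimes> s)"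
   by (rule m_lcancel[symmetric]) (use denominator_nonzero assms that cl in auto)
  also have "t \<otimes> (a \<otimes> v) = (a \<otimes> t) \<otimes> v" using cl by (simp add: m_ac)
  also have "\<dots> = s \<otimes> (b \<otimes> v)" unfolding e using cl by (simp add: m_ac)
  also have "t \<otimes> (c \<otimes> s) = s \<otimes> (c \<otimes> t)" using cl that by (simp add: m_ac)
  also have "s \<otimes> (b \<otimes> v) = s \<otimes> (c \<otimes> t) \<longleftrightarrow> b \<otimes> v = c \<otimes> t"
   by (rule m_lcancel) (use denominator_nonzero assms that cl in auto)
  finally show ?thesis .
 qed
 then show "frac a s = frac b t" using assms by (auto simp: frac_set)
qed

lemma local_carrier: "carrier local_ring = {frac a s | a s. a \<in> carrier R & s \<in> denoms}"
 unfolding local_ring_def local_ring_at_def localization_def quotient_def loc_frac_def denoms_def by auto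

lemma frac_closed [simp]: "a \<in> carrier R ==> s \<in> denoms ==> frac a s \<in> carrier local_ring"
 unfolding local_carrier by blast

text \<open>Operations are unions over representatives; when all pairs of representatives give the
  same set, the union is that set.\<close>

lemma UN_frac:
 assumes "a \<in> carrier R" "s \<in> denoms" "b \<in> carrier R" "t \<in> denoms"
  and "!!p q. p \<in> frac a s ==> q \<in> frac b t ==> h p q = c"
 shows "(\<Union>p\<in>frac a s. \<Union>q\<in>frac b t. h p q) = c"
proof -
 have "(a, s) \<in> frac a s" "(b, t) \<in> frac b t" using assms by (auto simp: frac_set)
 then show ?thesis using assms(5) by blast
qed

lemma local_mult:
 assumes "a \<in> carrier R" "s \<in> denoms" "b \<in> carrier R" "t \<in> denoms"
 shows "frac a s \<otimes>\<^sub>local_ring frac b t = frac (a \<otimes> b) (s \<otimes> t)"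
proof -
 have "(\<Union>p\<in>frac a s. \<Union>q\<in>frac b t. frac (fst p \<otimes> fst q) (snd p \<otimes> snd q)) = frac (a \<otimes> b) (s \<otimes> t)"
 proof (rule UN_frac[OF assms])
  fix p q assume "p \<in> frac a s" "q \<in> frac b t"
  then have pq: "fst p \<in> carrier R" "snd p \<in> denoms" "a \<otimes> snd p = fst p \<otimes> s"
   "fst q \<in> carrier R" "snd q \<in> denoms" "b \<otimes> snd q = fst q \<otimes> t" using assms by (auto simp: frac_set)
  have c: "fst p \<in> carrier R" "snd p \<in> carrier R" "fst q \<in> carrier R" "snd q \<in> carrier R" "s \<in> carrier R" "t \<in> carrier R" using pq assms by auto
  have "(fst p \<otimes> fst q) \<otimes> (s \<otimes> t) = (fst p \<otimes> s) \<otimes> (fst q \<otimes> t)" using c by (simp add: m_ac)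
  also have "\<dots> = (a \<otimes> b) \<otimes> (snd p \<otimes> snd q)" unfolding pq(3,6)[symmetric] using c assms by (simp add: m_ac)
  finally show "frac (fst p \<otimes> fst q) (snd p \<otimes> snd q) = frac (a \<otimes> b) (s \<otimes> t)"
   by (subst frac_eq) (use pq assms in auto)
 qed
 then show ?thesis unfolding local_ring_def local_ring_at_def localization_def denoms_def by simp
qed

lemma local_add:
 assumes "a \<in> carrier R" "s \<in> denoms" "b \<in> carrier R" "t \<in> denoms"
 shows "frac a s \<oplus>\<^sub>local_ring frac b t = frac (a \<otimes> t \<oplus> b \<otimes> s) (s \<otimes> t)"
proof -
 have "(\<Union>p\<in>frac a s. \<Union>q\<in>frac b t. frac (fst p \<otimes> snd q \<oplus> fst q \<otimes> snd p) (snd p \<otimes> snd q)) = frac (a \<otimes> t \<oplus> b \<otimes> s) (s \<otimes> t)"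
 proof (rule UN_frac[OF assms])
  fix p q assume "p \<in> frac a s" "q \<in> frac b t"
  then have pq: "fst p \<in> carrier R" "snd p \<in> denoms" "a \<otimes> snd p = fst p \<otimes> s"
   "fst q \<in> carrier R" "snd q \<in> denoms" "b \<otimes> snd q = fst q \<otimes> t" using assms by (auto simp: frac_set)
  have c: "fst p \<in> carrier R" "snd p \<in> carrier R" "fst q \<in> carrier R" "snd q \<in> carrier R" "s \<in> carrier R" "t \<in> carrier R" using pq assms by auto
  have "(fst p \<otimes> snd q \<oplus> fst q \<otimes> snd p) \<otimes> (s \<otimes> t) = (fst p \<otimes> s) \<otimes> (snd q \<otimes> t) \<oplus> (fst q \<otimes> t) \<otimes> (snd p \<otimes> s)"
   using c by (simp add: l_distr r_distr m_ac)
  also have "\<dots> = (a \<otimes> t \<oplus> b \<otimes> s) \<otimes> (snd p \<otimes> snd q)" unfolding pq(3,6)[symmetric] using c assms by (simp add: l_distr r_distr m_ac)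
  finally show "frac (fst p \<otimes> snd q \<oplus> fst q \<otimes> snd p) (snd p \<otimes> snd q) = frac (a \<otimes> t \<oplus> b \<otimes> s) (s \<otimes> t)"
   by (subst frac_eq) (use pq assms in auto)
 qed
 then show ?thesis unfolding local_ring_def local_ring_at_def localization_def denoms_def by simp
qed

lemma local_one: "\<one>\<^sub>local_ring = frac \<one> \<one>" and local_zero: "\<zero>\<^sub>local_ring = frac \<zero> \<one>"
 unfolding local_ring_def local_ring_at_def localization_def denoms_def by auto

lemma local_cases:
 assumes "x \<in> carrier local_ring" obtains a s where "x = frac a s" "a \<in> carrier R" "s \<in> denoms" "s \<in> carrier R"
 using assms unfolding local_carrier by auto

lemma local_cring: "cring local_ring"
proof (rule cringI)
 show "abelian_group local_ring"
 proof (rule abelian_groupI)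
  fix x y z assume "x \<in> carrier local_ring" "y \<in> carrier local_ring" "z \<in> carrier local_ring"
  then obtain a s b t c u where *: "x = frac a s" "y = frac b t" "z = frac c u" "a \<in> carrier R" "s \<in> denoms" "s \<in> carrier R"
   "b \<in> carrier R" "t \<in> denoms" "t \<in> carrier R" "c \<in> carrier R" "u \<in> denoms" "u \<in> carrier R"
   by (elim local_cases)
  show "x \<oplus>\<^sub>local_ring y \<oplus>\<^sub>local_ring z = x \<oplus>\<^sub>local_ring (y \<oplus>\<^sub>local_ring z)"
   unfolding *(1-3) using *(4-) by (simp add: local_add l_distr r_distr m_ac a_ac)
 next
  fix x y assume "x \<in> carrier local_ring" "y \<in> carrier local_ring"
  then obtain a s b t where *: "x = frac a s" "y = frac b t" "a \<in> carrier R" "s \<in> denoms" "s \<in> carrier R"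
   "b \<in> carrier R" "t \<in> denoms" "t \<in> carrier R" by (elim local_cases)
  show "x \<oplus>\<^sub>local_ring y \<in> carrier local_ring" unfolding *(1-2) using *(3-) by (simp add: local_add)
  show "x \<oplus>\<^sub>local_ring y = y \<oplus>\<^sub>local_ring x" unfolding *(1-2) using *(3-) by (simp add: local_add m_ac a_ac)
 next
  show "\<zero>\<^sub>local_ring \<in> carrier local_ring" unfolding local_zero by simp
  fix x assume "x \<in> carrier local_ring"
  then obtain a s where *: "x = frac a s" "a \<in> carrier R" "s \<in> denoms" "s \<in> carrier R" by (elim local_cases)
  show "\<zero>\<^sub>local_ring \<oplus>\<^sub>local_ring x = x" unfolding *(1) local_zero using *(2-) by (simp add: local_add)
  have "frac (\<ominus> a) s \<oplus>\<^sub>local_ring x = \<zero>\<^sub>local_ring" unfolding *(1) local_zero using *(2-) by (simp add: local_add frac_eq l_minus l_neg)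
  then show "\<exists>y\<in>carrier local_ring. y \<oplus>\<^sub>local_ring x = \<zero>\<^sub>local_ring" using * by (intro bexI[of _ "frac (\<ominus> a) s"]) auto
 qed
 show "comm_monoid local_ring"
 proof (rule comm_monoidI)
  show "\<one>\<^sub>local_ring \<in> carrier local_ring" unfolding local_one by simp
  fix x y z assume "x \<in> carrier local_ring" "y \<in> carrier local_ring" "z \<in> carrier local_ring"
  then obtain a s b t c u where *: "x = frac a s" "y = frac b t" "z = frac c u" "a \<in> carrier R" "s \<in> denoms" "s \<in> carrier R"
   "b \<in> carrier R" "t \<in> denoms" "t \<in> carrier R" "c \<in> carrier R" "u \<in> denoms" "u \<in> carrier R"
   by (elim local_cases)
  show "x \<otimes>\<^sub>local_ring y \<otimes>\<^sub>local_ring z = x \<otimes>\<^sub>local_ring (y \<otimes>\<^sub>local_ring z)"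
   unfolding *(1-3) using *(4-) by (simp add: local_mult m_ac)
 next
  fix x y assume "x \<in> carrier local_ring" "y \<in> carrier local_ring"
  then obtain a s b t where *: "x = frac a s" "y = frac b t" "a \<in> carrier R" "s \<in> denoms" "s \<in> carrier R"
   "b \<in> carrier R" "t \<in> denoms" "t \<in> carrier R" by (elim local_cases)
  show "x \<otimes>\<^sub>local_ring y \<in> carrier local_ring" unfolding *(1-2) using *(3-) by (simp add: local_mult)
  show "x \<otimes>\<^sub>local_ring y = y \<otimes>\<^sub>local_ring x" unfolding *(1-2) using *(3-) by (simp add: local_mult m_ac)
 next
  fix x assume "x \<in> carrier local_ring"
  then obtain a s where *: "x = frac a s" "a \<in> carrier R" "s \<in> denoms" "s \<in> carrier R" by (elim local_cases)
  show "\<one>\<^sub>local_ring \<otimes>\<^sub>local_ring x = x" unfolding *(1) local_one using *(2-) by (simp add: local_mult)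
 qed
 fix x y z assume "x \<in> carrier local_ring" "y \<in> carrier local_ring" "z \<in> carrier local_ring"
 then obtain a s b t c u where *: "x = frac a s" "y = frac b t" "z = frac c u" "a \<in> carrier R" "s \<in> denoms" "s \<in> carrier R"
  "b \<in> carrier R" "t \<in> denoms" "t \<in> carrier R" "c \<in> carrier R" "u \<in> denoms" "u \<in> carrier R"
  by (elim local_cases)
 have "((a \<otimes> t \<oplus> b \<otimes> s) \<otimes> c) \<otimes> (s \<otimes> u \<otimes> (t \<otimes> u)) = ((a \<otimes> c) \<otimes> (t \<otimes> u) \<oplus> (b \<otimes> c) \<otimes> (s \<otimes> u)) \<otimes> (s \<otimes> t \<otimes> u)"
  using *(4-) by algebra
 then show "(x \<oplus>\<^sub>local_ring y) \<otimes>\<^sub>local_ring z = x \<otimes>\<^sub>local_ring z \<oplus>\<^sub>local_ring y \<otimes>\<^sub>local_ring z"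
  unfolding *(1-3) using *(4-) by (simp add: local_add local_mult frac_eq)
qed

interpretation L: cring local_ring by (rule local_cring)

lemma local_neg: "a \<in> carrier R ==> s \<in> denoms ==> \<ominus>\<^sub>local_ring frac a s = frac (\<ominus> a) s"
 by (rule L.minus_equality) (simp_all add: local_add local_zero frac_eq l_minus l_neg)

section \<open>The powers of the maximal ideal of the local ring\<close>

definition local_tail :: "nat => ('a \<times> 'a) set set" where
 "local_tail N = {frac a s | a s. a \<in> tail N & s \<in> denoms}"

lemma frac_tail: assumes "a \<in> carrier R" "s \<in> denoms" shows "frac a s \<in> local_tail N \<longleftrightarrow> a \<in> tail N"
proof
 assume "frac a s \<in> local_tail N"
 then obtain b t where b: "frac a s = frac b t" "b \<in> tail N" "t \<in> denoms" unfolding local_tail_def by blast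
 then have "a \<otimes> t = b \<otimes> s" using assms tail_closed by (subst (asm) frac_eq) auto
 then have "t \<otimes> a = s \<otimes> b" using assms b tail_closed[OF b(2)] by (simp add: m_comm)
 then have "t \<otimes> a \<in> tail N" using ideal.I_l_closed[OF tail_ideal b(2)] assms by simp
 then show "a \<in> tail N" using tail_unit[OF assms(1) _ denominator_comp[OF b(3)]] b(3) by simp
qed (use assms in "auto simp: local_tail_def")

lemma local_tail_ideal: "ideal (local_tail N) local_ring"
proof (rule L.idealI_comm)
 show "local_tail N <= carrier local_ring" unfolding local_tail_def using tail_closed by auto
 show "\<zero>\<^sub>local_ring \<in> local_tail N" unfolding local_zero by (simp add: frac_tail)
 fix x assume "x \<in> local_tail N"
 then obtain a s where a: "x = frac a s" "a \<in> tail N" "s \<in> denoms" unfolding local_tail_def by blast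
 have ac: "a \<in> carrier R" using tail_closed[OF a(2)] .
 {
  fix y assume "y \<in> local_tail N"
  then obtain b t where b: "y = frac b t" "b \<in> tail N" "t \<in> denoms" unfolding local_tail_def by blast
  have "a \<otimes> t \<oplus> b \<otimes> s \<in> tail N" using a b by (intro tail_add ideal.I_r_closed[OF tail_ideal]) auto
  then show "x \<oplus>\<^sub>local_ring y \<in> local_tail N" unfolding a(1) b(1) local_add[OF ac a(3) tail_closed[OF b(2)] b(3)]
   unfolding local_tail_def using mult_denominator[OF a(3) b(3)] by blast
 next
  fix y assume "y \<in> carrier local_ring"
  then obtain b t where b: "y = frac b t" "b \<in> carrier R" "t \<in> denoms" by (elim local_cases)
  have "b \<otimes> a \<in> tail N" by (rule ideal.I_l_closed[OF tail_ideal a(2) b(2)])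
  then show "y \<otimes>\<^sub>local_ring x \<in> local_tail N" unfolding a(1) b(1) local_mult[OF b(2,3) ac a(3)]
   unfolding local_tail_def using mult_denominator[OF b(3) a(3)] by blast
 }
qed

lemma local_proper: assumes J: "ideal J local_ring" "J ~= carrier local_ring" shows "J <= local_tail 1"
proof
 fix x assume x: "x \<in> J"
 obtain a s where a: "x = frac a s" "a \<in> carrier R" "s \<in> denoms" using L.ideal_Hcarr[OF J(1) x] by (elim local_cases)
 show "x \<in> local_tail 1"
 proof (rule ccontr)
  assume "x \<notin> local_tail 1"
  then have "a \<notin> tail 1" unfolding a(1) frac_tail[OF a(2,3)] .
  then have ad: "a \<in> denoms" using a(2) unfolding denoms_def by blast
  have "frac s a \<otimes>\<^sub>local_ring x = \<one>\<^sub>local_ring"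
   unfolding a(1) local_one using a(2,3) ad by (simp add: local_mult frac_eq m_comm)
  then have "\<one>\<^sub>local_ring \<in> J" using ideal.I_l_closed[OF J(1) x, of "frac s a"] a(3) ad by simp
  then show False using ideal.one_imp_carrier[OF J(1)] J(2) by simp
 qed
qed

lemma local_max_ideal: "max_ideal_of local_ring = local_tail 1"
proof -
 have n: "local_tail 1 ~= carrier local_ring"
 proof
  assume "local_tail 1 = carrier local_ring"
  then have "frac \<one> \<one> \<in> local_tail 1" by simp
  then show False using frac_tail[of \<one> \<one> 1] one_denominator unfolding denoms_def by simp
 qed
 have m: "maximalideal (local_tail 1) local_ring"
 proof (rule maximalidealI[OF local_tail_ideal])
  show "carrier local_ring ~= local_tail 1" using n by simp
  show "J = local_tail 1 \<or> J = carrier local_ring" if "ideal J local_ring" "local_tail 1 <= J" "J <= carrier local_ring" for J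
   using local_proper[OF that(1)] that by blast
 qed
 show ?thesis unfolding max_ideal_of_def
 proof (rule the_equality)
  show "maximalideal (local_tail 1) local_ring" by (rule m)
  fix m' assume m': "maximalideal m' local_ring"
  have "m' <= local_tail 1"
   by (rule local_proper[OF maximalideal.axioms(1)[OF m']]) (use maximalideal.I_notcarr[OF m'] in auto)
  moreover have "local_tail 1 <= carrier local_ring" using L.ideal_Hcarr[OF local_tail_ideal] by (rule subsetI)
  ultimately have "local_tail 1 = m' \<or> local_tail 1 = carrier local_ring"
   by (rule maximalideal.I_maximal[OF m' local_tail_ideal])
  then show "m' = local_tail 1" using n by simp
 qed
qed

text \<open>One inclusion is additivity of orders. For the other, a form of degree at least
  \<open>N + 1\<close> is a sum of products of a form of degree at least \<open>N\<close> with one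
  of degree one.\<close>

lemma local_power: "ideal_power local_ring (local_tail 1) N = local_tail N"
proof (induction N)
 case 0
 have "local_tail 0 = carrier local_ring" unfolding local_tail_def local_carrier by simp
 then show ?case unfolding ideal_power_def ideals_set_def nat_pow_def by simp
next
 case (Suc N)
 have P: "ideal_power local_ring (local_tail 1) (Suc N) = ideal_prod local_ring (local_tail N) (local_tail 1)"
  using Suc unfolding ideal_power_def ideals_set_def nat_pow_def by simp
 have ID: "ideal (ideal_prod local_ring (local_tail N) (local_tail 1)) local_ring"
  by (rule L.ideal_prod_is_ideal[OF local_tail_ideal local_tail_ideal])
 have "ideal_prod local_ring (local_tail N) (local_tail 1) <= local_tail (Suc N)"
 proof
  fix x assume "x \<in> ideal_prod local_ring (local_tail N) (local_tail 1)"
  then show "x \<in> local_tail (Suc N)"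
  proof (induction rule: ideal_prod.induct)
   case (prod x y)
   then obtain a s b t where *: "x = frac a s" "a \<in> tail N" "s \<in> denoms" "y = frac b t" "b \<in> tail 1" "t \<in> denoms"
    unfolding local_tail_def by blast
   have "a \<otimes> b \<in> tail (Suc N)" using tail_mult[OF *(2,5)] by simp
   then show ?case unfolding *(1,4) local_mult[OF tail_closed[OF *(2)] *(3) tail_closed[OF *(5)] *(6)]
    unfolding local_tail_def using mult_denominator[OF *(3,6)] by blast
  next
   case (sum x y)
   then show ?case using L.ideal_add[OF local_tail_ideal] by blast
  qed
 qed
 moreover have "local_tail (Suc N) <= ideal_prod local_ring (local_tail N) (local_tail 1)"
 proof
  fix x assume "x \<in> local_tail (Suc N)"
  then obtain a s where a: "x = frac a s" "a \<in> tail (Suc N)" "s \<in> denoms" unfolding local_tail_def by blast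
  have ac: "a \<in> carrier R" using tail_closed[OF a(2)] .
  let ?T = "{b \<in> carrier R. frac b \<one> \<in> ideal_prod local_ring (local_tail N) (local_tail 1)}"
  have T: "lin_sub ?T" unfolding lin_sub_def
  proof (intro conjI ballI)
   show "\<zero> \<in> ?T" using ideal_zero[OF ID] unfolding local_zero by simp
  next
   fix b c assume "b \<in> ?T" "c \<in> ?T"
   then have *: "b \<in> carrier R" "c \<in> carrier R" "frac b \<one> \<oplus>\<^sub>local_ring frac c \<one> \<in> ideal_prod local_ring (local_tail N) (local_tail 1)"
    using L.ideal_add[OF ID] by auto
   then show "b \<oplus> c \<in> ?T" by (simp add: local_add)
  next
   fix l b assume l: "l \<in> k" and b: "b \<in> ?T"
   then have "frac l \<one> \<otimes>\<^sub>local_ring frac b \<one> \<in> ideal_prod local_ring (local_tail N) (local_tail 1)"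
    by (intro ideal.I_l_closed[OF ID]) auto
   then show "l \<otimes> b \<in> ?T" using l b by (simp add: local_mult)
  qed auto
  have gr: "gr n <= ?T" if n: "Suc N <= n" for n
  proof -
   obtain n' where n': "n = Suc n'" "N <= n'" using n by (cases n) auto
   show ?thesis unfolding n'(1)
   proof (rule gr_Suc_induct[OF T])
    fix g b assume g: "g \<in> gr 1" and b: "b \<in> gr n'"
    have "frac b \<one> \<in> local_tail N" "frac g \<one> \<in> local_tail 1" using g b n'(2) by (auto simp: frac_tail gr_tail)
    then have "frac b \<one> \<otimes>\<^sub>local_ring frac g \<one> \<in> ideal_prod local_ring (local_tail N) (local_tail 1)" by (rule ideal_prod.prod)
    then show "g \<otimes> b \<in> ?T" using g b by (simp add: local_mult m_comm)
   qed
  qed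
  have "a = (\<Oplus>n\<in>{n. hcomp a n ~= \<zero>}. hcomp a n)" by (rule sum_comp[OF ac finite_comp[OF ac]]) simp
  also have "\<dots> \<in> ?T"
  proof (rule lin_sub_finsum[OF T])
   fix n assume "n \<in> {n. hcomp a n ~= \<zero>}"
   then have "\<not> n < Suc N" using a(2) unfolding tail_def by blast
   then show "hcomp a n \<in> ?T" using gr[of n] comp_gr[OF ac, of n] by auto
  qed
  finally have "frac \<one> s \<otimes>\<^sub>local_ring frac a \<one> \<in> ideal_prod local_ring (local_tail N) (local_tail 1)"
   by (intro ideal.I_l_closed[OF ID]) (use a(3) in auto)
  then show "x \<in> ideal_prod local_ring (local_tail N) (local_tail 1)" unfolding a(1) using a(3) ac by (simp add: local_mult)
 qed
 ultimately show ?case unfolding P by blast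
qed

text \<open>If \<open>c\<close> and \<open>c1\<close> invert \<open>s\<close> up to the orders
  \<open>N\<close> and \<open>1\<close>, then \<open>c + c1 - s c c1\<close> inverts it up to order
  \<open>N + 1\<close>, because \<open>(s c - 1) (s c1 - 1) = 1 - s (c + c1 - s c c1)\<close>. Here
  \<open>c1\<close> is the inverse of the constant term of \<open>s\<close>.\<close>

lemma denominator_inverse: assumes s: "s \<in> denoms" shows "\<exists>c\<in>carrier R. s \<otimes> c \<ominus> \<one> \<in> tail N"
proof (induction N)
 case 0
 show ?case using s by (intro bexI[of _ \<one>]) auto
next
 case (Suc N)
 have sc: "s \<in> carrier R" using s by simp
 then obtain c where c: "c \<in> carrier R" "s \<otimes> c \<ominus> \<one> \<in> tail N" using Suc by blast
 have h: "hcomp s 0 \<in> k" using comp_gr[OF sc, of 0] gr_0 by simp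
 define c1 where "c1 = inv (hcomp s 0)"
 have c1: "c1 \<in> k" "hcomp s 0 \<otimes> c1 = \<one>" unfolding c1_def using scal_inv[OF h denominator_comp[OF s]] by auto
 have c1c: "c1 \<in> carrier R" "c1 \<in> gr 0" using c1 gr_0 by auto
 have "hcomp (s \<otimes> c1 \<ominus> \<one>) 0 = hcomp (c1 \<otimes> s) 0 \<ominus> hcomp \<one> 0" using sc c1c by (simp add: comp_minus m_comm)
 also have "hcomp (c1 \<otimes> s) 0 = c1 \<otimes> hcomp s 0" using comp_mult_homogeneous[OF c1c(2) sc, of 0] by simp
 also have "\<dots> = \<one>" using c1(2) c1c sc by (simp add: m_comm)
 also have "hcomp \<one> 0 = \<one>" using comp_homogeneous[of \<one> 0 0] gr_0 scal_ring(2) by simp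
 finally have "hcomp (s \<otimes> c1 \<ominus> \<one>) 0 = \<zero>" by (simp add: a_minus_def r_neg)
 then have t1: "s \<otimes> c1 \<ominus> \<one> \<in> tail 1" unfolding tail_1_iff using sc c1c by simp
 have "(s \<otimes> c \<ominus> \<one>) \<otimes> (s \<otimes> c1 \<ominus> \<one>) = \<ominus> (s \<otimes> (c \<oplus> c1 \<ominus> s \<otimes> c \<otimes> c1) \<ominus> \<one>)"
  using sc c(1) c1c(1) by algebra
 then have "\<ominus> (s \<otimes> (c \<oplus> c1 \<ominus> s \<otimes> c \<otimes> c1) \<ominus> \<one>) \<in> tail (Suc N)" using tail_mult[OF c(2) t1] by simp
 then have "\<ominus> (\<ominus> (s \<otimes> (c \<oplus> c1 \<ominus> s \<otimes> c \<otimes> c1) \<ominus> \<one>)) \<in> tail (Suc N)" by (rule tail_neg)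
 then have "s \<otimes> (c \<oplus> c1 \<ominus> s \<otimes> c \<otimes> c1) \<ominus> \<one> \<in> tail (Suc N)" using sc c(1) c1c(1) by simp
 then show ?case using sc c(1) c1c(1) by (intro bexI[of _ "c \<oplus> c1 \<ominus> s \<otimes> c \<otimes> c1"]) auto
qed

text \<open>A fraction \<open>a / s\<close> is approximated by \<open>a c\<close>, with
  \<open>c\<close> an approximate inverse of \<open>s\<close>.\<close>

lemma local_dense:
 assumes x: "x \<in> carrier local_ring" shows "\<exists>a\<in>carrier R. x \<ominus>\<^sub>local_ring frac a \<one> \<in> local_tail N"
proof -
 obtain a s where a: "x = frac a s" "a \<in> carrier R" "s \<in> denoms" "s \<in> carrier R" using x by (elim local_cases)
 obtain c where c: "c \<in> carrier R" "s \<otimes> c \<ominus> \<one> \<in> tail N" using denominator_inverse[OF a(3)] by blast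
 have "x \<ominus>\<^sub>local_ring frac (a \<otimes> c) \<one> = frac (a \<oplus> (\<ominus> (a \<otimes> c)) \<otimes> s) s"
  unfolding a(1) a_minus_def using a c by (simp add: local_neg local_add)
 also have "a \<oplus> (\<ominus> (a \<otimes> c)) \<otimes> s = (\<ominus> a) \<otimes> (s \<otimes> c \<ominus> \<one>)" using a(2,4) c(1) by algebra
 also have "frac ((\<ominus> a) \<otimes> (s \<otimes> c \<ominus> \<one>)) s \<in> local_tail N"
  by (subst frac_tail) (use a c ideal.I_l_closed[OF tail_ideal c(2)] in auto)
 finally show ?thesis using a c by (intro bexI[of _ "a \<otimes> c"]) auto
qed

end

section \<open>Adic completion as an inverse limit\<close>

locale adic = cring L for L (structure) +
 fixes I
 assumes power_ideal: "!!N. ideal (ideal_power L I N) L"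
  and power_Suc: "!!N. ideal_power L I (Suc N) <= ideal_power L I N"
begin

abbreviation M where "M N \<equiv> ideal_power L I N"
abbreviation C where "C \<equiv> adic_completion L I"

lemma Q_cring: "cring (L Quot M N)"
 by (rule ideal.quotient_is_cring[OF power_ideal cring_axioms])

lemma coset_hom: "(+>) (M N) \<in> ring_hom L (L Quot M N)"
 by (rule ideal.rcos_ring_hom[OF power_ideal])

lemma coset_eq: "p \<in> carrier L ==> q \<in> carrier L ==> M N +> p = M N +> q \<longleftrightarrow> p \<ominus> q \<in> M N"
 using quotient_eq_iff_same_a_r_cos[OF power_ideal] by blast

lemma Q_carrier: "x \<in> carrier (L Quot M N) \<longleftrightarrow> (\<exists>p\<in>carrier L. x = M N +> p)"
 unfolding FactRing_def by (auto simp: A_RCOSETS_def')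

lemma Q_zero: "\<zero>\<^sub>(L Quot M N) = M N"
 unfolding FactRing_def by simp

lemma coset_zero: "p \<in> carrier L ==> M N +> p = M N \<longleftrightarrow> p \<in> M N"
 using coset_eq[of p \<zero> N] ring_hom_zero[OF coset_hom ring_axioms cring.axioms(1)[OF Q_cring], of N]
 by (simp add: Q_zero a_minus_def)

lemma coset_mono: "p \<in> carrier L ==> M (Suc N) +> p <= M N +> p"
 using power_Suc[of N] unfolding a_r_coset_def' by blast

lemma coset_sub: assumes "p \<in> carrier L" "q \<in> carrier L" "M (Suc N) +> p <= M N +> q" shows "M N +> q = M N +> p"
proof -
 have "p \<in> M (Suc N) +> p"
 proof -
  have "\<zero> \<in> M (Suc N)" by (rule ideal_zero[OF power_ideal])
  then show ?thesis unfolding a_r_coset_def' using assms(1) by force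
 qed
 then have "p \<in> M N +> q" using assms(3) by blast
 then show ?thesis by (rule a_repr_independence[OF _ assms(2) additive_subgroup.a_subgroup[OF ideal.axioms(1)[OF power_ideal]]])
qed

lemma C_simps:
 "x \<in> carrier C \<longleftrightarrow> (\<forall>N. x N \<in> carrier (L Quot M N)) & (\<forall>N. x (Suc N) <= x N)"
 "(x \<otimes>\<^sub>C y) N = x N \<otimes>\<^sub>(L Quot M N) y N" "(x \<oplus>\<^sub>C y) N = x N \<oplus>\<^sub>(L Quot M N) y N"
 "\<one>\<^sub>C N = \<one>\<^sub>(L Quot M N)" "\<zero>\<^sub>C N = \<zero>\<^sub>(L Quot M N)"
 unfolding adic_completion_def by auto

lemma C_comp: "x \<in> carrier C ==> x N \<in> carrier (L Quot M N)"
 unfolding C_simps by blast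

text \<open>Containment between cosets of consecutive powers amounts to a common representative.
  With the converse \<open>C_I\<close>, closure under the operations can be checked on
  representatives.\<close>

lemma C_rep: assumes x: "x \<in> carrier C" shows "\<exists>p\<in>carrier L. x N = M N +> p & x (Suc N) = M (Suc N) +> p"
proof -
 obtain p where p: "p \<in> carrier L" "x (Suc N) = M (Suc N) +> p" using C_comp[OF x, of "Suc N"] unfolding Q_carrier by blast
 obtain q where q: "q \<in> carrier L" "x N = M N +> q" using C_comp[OF x, of N] unfolding Q_carrier by blast
 have "M (Suc N) +> p <= M N +> q" using x p(2) q(2) unfolding C_simps by metis
 then have "M N +> q = M N +> p" by (rule coset_sub[OF p(1) q(1)])
 then show ?thesis using p q(2) by auto
qed

lemma C_I:
 assumes "!!N. \<exists>p\<in>carrier L. x N = M N +> p & x (Suc N) = M (Suc N) +> p"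
 shows "x \<in> carrier C"
 unfolding C_simps
proof (intro conjI allI)
 fix N
 obtain p where p: "p \<in> carrier L" "x N = M N +> p" "x (Suc N) = M (Suc N) +> p" using assms by blast
 show "x N \<in> carrier (L Quot M N)" unfolding Q_carrier using p by blast
 show "x (Suc N) <= x N" unfolding p(2,3) by (rule coset_mono[OF p(1)])
qed

lemma coset_ops:
 assumes "p \<in> carrier L" "q \<in> carrier L"
 shows "(M N +> p) \<oplus>\<^sub>(L Quot M N) (M N +> q) = M N +> (p \<oplus> q)" "(M N +> p) \<otimes>\<^sub>(L Quot M N) (M N +> q) = M N +> (p \<otimes> q)"
 using ring_hom_add[OF coset_hom assms] ring_hom_mult[OF coset_hom assms] by auto

lemma C_add: assumes "x \<in> carrier C" "y \<in> carrier C" shows "x \<oplus>\<^sub>C y \<in> carrier C"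
proof (rule C_I)
 fix N
 obtain p where p: "p \<in> carrier L" "x N = M N +> p" "x (Suc N) = M (Suc N) +> p" using C_rep[OF assms(1)] by blast
 obtain q where q: "q \<in> carrier L" "y N = M N +> q" "y (Suc N) = M (Suc N) +> q" using C_rep[OF assms(2)] by blast
 show "\<exists>p\<in>carrier L. (x \<oplus>\<^sub>C y) N = M N +> p & (x \<oplus>\<^sub>C y) (Suc N) = M (Suc N) +> p"
  by (intro bexI[of _ "p \<oplus> q"]) (use p q in "auto simp: C_simps coset_ops")
qed

lemma C_mult: assumes "x \<in> carrier C" "y \<in> carrier C" shows "x \<otimes>\<^sub>C y \<in> carrier C"
proof (rule C_I)
 fix N
 obtain p where p: "p \<in> carrier L" "x N = M N +> p" "x (Suc N) = M (Suc N) +> p" using C_rep[OF assms(1)] by blast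
 obtain q where q: "q \<in> carrier L" "y N = M N +> q" "y (Suc N) = M (Suc N) +> q" using C_rep[OF assms(2)] by blast
 show "\<exists>p\<in>carrier L. (x \<otimes>\<^sub>C y) N = M N +> p & (x \<otimes>\<^sub>C y) (Suc N) = M (Suc N) +> p"
  by (intro bexI[of _ "p \<otimes> q"]) (use p q in "auto simp: C_simps coset_ops")
qed

lemma C_const: "p \<in> carrier L ==> (%N. M N +> p) \<in> carrier C"
 by (rule C_I) auto

lemma C_one: "\<one>\<^sub>C = (%N. M N +> \<one>)" and C_zero: "\<zero>\<^sub>C = (%N. M N +> \<zero>)"
 by (auto simp: C_simps fun_eq_iff ring_hom_one[OF coset_hom] ring_hom_zero[OF coset_hom ring_axioms cring.axioms(1)[OF Q_cring]])

lemma C_cring: "cring C"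
proof -
 interpret Q: cring "L Quot M N" for N by (rule Q_cring)
 show ?thesis
 proof (rule cringI)
  show "abelian_group C"
  proof (rule abelian_groupI)
   show "\<zero>\<^sub>C \<in> carrier C" unfolding C_zero by (rule C_const) simp
   fix x assume x: "x \<in> carrier C"
   show "\<zero>\<^sub>C \<oplus>\<^sub>C x = x" using C_comp[OF x] by (auto simp: C_simps fun_eq_iff)
   define y where "y N = \<ominus>\<^sub>(L Quot M N) x N" for N
   have "y \<in> carrier C"
   proof (rule C_I)
    fix N
    obtain p where p: "p \<in> carrier L" "x N = M N +> p" "x (Suc N) = M (Suc N) +> p" using C_rep[OF x] by blast
    have "\<ominus>\<^sub>(L Quot M N) (M N +> p) = M N +> (\<ominus> p)" for N
     by (rule Q.minus_equality) (use p coset_ops[of "\<ominus> p" p N] ring_hom_zero[OF coset_hom ring_axioms Q.ring_axioms, of N] in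
      \<open>auto simp: l_neg Q_carrier\<close>)
    then show "\<exists>p\<in>carrier L. y N = M N +> p & y (Suc N) = M (Suc N) +> p"
     unfolding y_def by (intro bexI[of _ "\<ominus> p"]) (use p in auto)
   qed
   moreover have "y \<oplus>\<^sub>C x = \<zero>\<^sub>C" using C_comp[OF x] by (auto simp: C_simps fun_eq_iff y_def Q.l_neg)
   ultimately show "\<exists>y\<in>carrier C. y \<oplus>\<^sub>C x = \<zero>\<^sub>C" by blast
  qed (use C_comp in "simp_all add: C_add C_simps(3) fun_eq_iff Q.a_ac")
  show "comm_monoid C"
  proof (rule comm_monoidI)
   show "\<one>\<^sub>C \<in> carrier C" unfolding C_one by (rule C_const) simp
  qed (use C_comp in "simp_all add: C_mult C_simps(2,4) fun_eq_iff Q.m_ac")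
 qed (use C_comp in "simp_all add: C_simps(2,3) fun_eq_iff Q.l_distr")
qed

lemma const_hom: "(%p N. M N +> p) \<in> ring_hom L C"
 by (rule ring_hom_memI) (auto simp: C_const C_one C_simps(2,3) fun_eq_iff coset_ops)

lemma comp_hom: "(%x. x N) \<in> ring_hom C (L Quot M N)"
 by (rule ring_hom_memI) (auto simp: C_comp C_simps(2-4))

lemma comp_ring_hom: "ring_hom_ring C (L Quot M N) (%x. x N)"
 by (rule ring_hom_ringI2[OF cring.axioms(1)[OF C_cring] cring.axioms(1)[OF Q_cring] comp_hom])

text \<open>The kernel of the projection to the \<open>N\<close>-th quotient, so that congruence
  modulo it is equality of the \<open>N\<close>-th entries.\<close>

definition limit_fil :: "nat => (nat => 'a set) set" where
 "limit_fil N = {x \<in> carrier C. x N = M N}"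

lemma limit_fil_ideal: "ideal (limit_fil N) C"
 using ring_hom_ring.kernel_is_ideal[OF comp_ring_hom, of N] unfolding limit_fil_def a_kernel_def' Q_zero .

lemma limit_fil_minus:
 assumes "x \<in> carrier C" "y \<in> carrier C" shows "x \<ominus>\<^sub>C y \<in> limit_fil N \<longleftrightarrow> x N = y N"
proof -
 interpret Q: cring "L Quot M N" by (rule Q_cring)
 interpret C: cring C by (rule C_cring)
 interpret h: ring_hom_ring C "L Quot M N" "%x. x N" by (rule comp_ring_hom)
 have "(x \<ominus>\<^sub>C y) N = x N \<ominus>\<^sub>(L Quot M N) y N" using assms unfolding a_minus_def by simp
 then show ?thesis unfolding limit_fil_def using assms Q.r_right_minus_eq[of "x N" "y N"] by (simp add: Q_zero C_comp)
qed

end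

context std_graded
begin

section \<open>The completion of the local ring of a graded domain\<close>

lemma local_adic: "adic local_ring (max_ideal_of local_ring)"
proof (intro adic.intro adic_axioms.intro local_cring)
 fix N
 show "ideal (ideal_power local_ring (max_ideal_of local_ring) N) local_ring"
  unfolding local_max_ideal local_power by (rule local_tail_ideal)
 show "ideal_power local_ring (max_ideal_of local_ring) (Suc N) <= ideal_power local_ring (max_ideal_of local_ring) N"
  unfolding local_max_ideal local_power unfolding local_tail_def using tail_antimono[of N "Suc N"] by auto
qed

lemma frac_hom: "(%a. frac a \<one>) \<in> ring_hom R local_ring"
 by (rule ring_hom_memI) (auto simp: local_mult local_add local_one)

text \<open>Fractions are limits of elements of \<open>R\<close>, so completing the local ring at
  the irrelevant ideal amounts to allowing infinite sums of forms of increasing degree.\<close>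

theorem completed_graded:
 "\<exists>fil. graded_completion R k gr G (completed_local_ring_at R (tail 1)) (to_completed_local_ring R (tail 1)) fil"
proof -
 interpret L: cring local_ring by (rule local_cring)
 interpret A: adic local_ring "max_ideal_of local_ring" by (rule local_adic)
 note M = local_power[folded local_max_ideal]
 let ?\<phi> = "to_completed_local_ring R (tail 1)"
 have phi: "?\<phi> a = (%N. A.M N +>\<^sub>local_ring frac a \<one>)" for a
  unfolding to_completed_local_ring_def Let_def local_ring_def denoms_def ..
 have C: "completed_local_ring_at R (tail 1) = A.C" unfolding completed_local_ring_at_def local_ring_def ..
 interpret C: cring A.C by (rule A.C_cring)
 have hom: "?\<phi> \<in> ring_hom R A.C"
  using ring_hom_trans[OF frac_hom A.const_hom] unfolding comp_def phi .
 interpret phi: ring_hom_cring R A.C ?\<phi> by unfold_locales (rule hom)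
 have fc: "a \<in> carrier R ==> frac a \<one> \<in> carrier local_ring" for a by simp
 have eq_iff: "?\<phi> a N = ?\<phi> b N \<longleftrightarrow> a \<ominus> b \<in> tail N" if "a \<in> carrier R" "b \<in> carrier R" for a b N
 proof -
  have "frac a \<one> \<ominus>\<^sub>local_ring frac b \<one> = frac (a \<ominus> b) \<one>" unfolding a_minus_def using that by (simp add: local_neg local_add)
  then show ?thesis using A.coset_eq[OF fc[OF that(1)] fc[OF that(2)], of N] that unfolding phi M by (simp add: frac_tail)
 qed
 have "graded_completion R k gr G A.C ?\<phi> A.limit_fil"
 proof (intro graded_completion.intro graded_completion_axioms.intro std_graded_axioms C.cring_axioms hom A.limit_fil_ideal)
  fix a N assume a: "a \<in> carrier R"
  have "?\<phi> a \<in> A.limit_fil N \<longleftrightarrow> ?\<phi> a N = A.M N" using phi.hom_closed[OF a] unfolding A.limit_fil_def by blast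
  also have "\<dots> \<longleftrightarrow> a \<in> tail N" unfolding phi A.coset_zero[OF fc[OF a]] unfolding M using a by (simp add: frac_tail)
  finally show "?\<phi> a \<in> A.limit_fil N \<longleftrightarrow> a \<in> tail N" .
 next
  fix N show "A.limit_fil (Suc N) <= A.limit_fil N"
  proof
   fix x assume x: "x \<in> A.limit_fil (Suc N)"
   then have xc: "x \<in> carrier A.C" "x (Suc N) = A.M (Suc N)" unfolding A.limit_fil_def by auto
   obtain p where p: "p \<in> carrier local_ring" "x N = A.M N +>\<^sub>local_ring p" "x (Suc N) = A.M (Suc N) +>\<^sub>local_ring p"
    using A.C_rep[OF xc(1)] by blast
   have "p \<in> A.M (Suc N)" using xc(2) A.coset_zero[OF p(1)] p(3) by simp
   then have "p \<in> A.M N" using A.power_Suc by blast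
   then show "x \<in> A.limit_fil N" unfolding A.limit_fil_def using xc(1) p(2) A.coset_zero[OF p(1)] by simp
  qed
 next
  fix b N assume b: "b \<in> carrier A.C"
  obtain p where p: "p \<in> carrier local_ring" "b N = A.M N +>\<^sub>local_ring p" using A.C_comp[OF b] unfolding A.Q_carrier by blast
  obtain a where a: "a \<in> carrier R" "p \<ominus>\<^sub>local_ring frac a \<one> \<in> local_tail N" using local_dense[OF p(1)] by blast
  have "b N = ?\<phi> a N" unfolding phi p(2) A.coset_eq[OF p(1) fc[OF a(1)]] unfolding M by (rule a(2))
  then show "\<exists>a\<in>carrier R. b \<ominus>\<^sub>A.C ?\<phi> a \<in> A.limit_fil N"
   using A.limit_fil_minus[OF b phi.hom_closed[OF a(1)]] a(1) by blast
 next
  fix b assume b: "!!N. b \<in> A.limit_fil N"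
  show "b = \<zero>\<^sub>A.C" using b unfolding A.limit_fil_def by (auto simp: A.C_simps A.Q_zero fun_eq_iff)
 next
  fix c assume c: "!!n. c n \<in> gr n"
  define s where "s N = (\<Oplus>n\<in>{..<N}. c n)" for N :: nat
  have cc: "c n \<in> carrier R" for n using c gr_closed by blast
  have sc: "s N \<in> carrier R" for N unfolding s_def using cc by (auto intro!: finsum_closed)
  \<comment> \<open>The sum of the series: modulo the \<open>N\<close>-th power of the maximal ideal
    only the first \<open>N\<close> forms count.\<close>
  define b where "b N = ?\<phi> (s N) N" for N
  have "b \<in> carrier A.C"
  proof (rule A.C_I)
   fix N
   have "s (Suc N) = c N \<oplus> s N" unfolding s_def lessThan_Suc by (rule finsum_insert) (use cc in auto)
   moreover have "c N \<in> tail N" using gr_tail[OF c] by simp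
   moreover have "(y \<oplus> z) \<ominus> z = y" if "y \<in> carrier R" "z \<in> carrier R" for y z using that by algebra
   ultimately have "s (Suc N) \<ominus> s N \<in> tail N" using cc sc by simp
   then have "?\<phi> (s (Suc N)) N = ?\<phi> (s N) N" using eq_iff[OF sc sc] by blast
   then show "\<exists>p\<in>carrier local_ring. b N = A.M N +>\<^sub>local_ring p & b (Suc N) = A.M (Suc N) +>\<^sub>local_ring p"
    using sc fc unfolding b_def phi by (intro bexI[of _ "frac (s (Suc N)) \<one>"]) auto
  qed
  moreover have "b \<ominus>\<^sub>A.C (\<Oplus>\<^sub>A.C n\<in>{..<N}. ?\<phi> (c n)) \<in> A.limit_fil N" if "b \<in> carrier A.C" for N
  proof -
   have "?\<phi> (s N) = (\<Oplus>\<^sub>A.C n\<in>{..<N}. (?\<phi> \<circ> c) n)" unfolding s_def by (subst phi.hom_finsum) (use cc in auto)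
   then have "(\<Oplus>\<^sub>A.C n\<in>{..<N}. ?\<phi> (c n)) = ?\<phi> (s N)" by simp
   then show ?thesis using A.limit_fil_minus[OF that phi.hom_closed[OF sc], of N] unfolding b_def by simp
  qed
  ultimately show "\<exists>b\<in>carrier A.C. \<forall>N. b \<ominus>\<^sub>A.C (\<Oplus>\<^sub>A.C n\<in>{..<N}. ?\<phi> (c n)) \<in> A.limit_fil N" by blast
 qed
 then show ?thesis unfolding C by blast
qed

end

context graded_completion
begin

text \<open>Solid closure passes to the quotient by a minimal prime. For the zero ideal the cosets
  are singletons, so all axioms transfer along a bijection.\<close>

lemma quotient_zero:
 "\<exists>fil'. graded_completion R k gr G (B Quot {\<zero>\<^sub>B}) (%a. {\<zero>\<^sub>B} +>\<^sub>B \<phi> a) fil'"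
proof -
 let ?Z = "{\<zero>\<^sub>B}" and ?h = "%x. {\<zero>\<^sub>B} +>\<^sub>B x"
 have Z: "ideal ?Z B" by (rule B.zeroideal)
 let ?Q = "B Quot ?Z"
 interpret Q: cring ?Q by (rule ideal.quotient_is_cring[OF Z B.cring_axioms])
 interpret h: ring_hom_cring B ?Q ?h by unfold_locales (rule ideal.rcos_ring_hom[OF Z])
 have h: "?h x = {x}" if "x \<in> carrier B" for x unfolding a_r_coset_def' using that by simp
 have inj: "?h x \<in> ?h ` fil N \<longleftrightarrow> x \<in> fil N" if "x \<in> carrier B" for x N
  using that h fil_closed by (auto simp: image_iff)
 have hm: "?h x \<ominus>\<^sub>?Q ?h y = ?h (x \<ominus>\<^sub>B y)" if "x \<in> carrier B" "y \<in> carrier B" for x y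
  unfolding a_minus_def using that by simp
 have surj: "\<exists>x\<in>carrier B. b = ?h x" if "b \<in> carrier ?Q" for b
  using that unfolding FactRing_def by (auto simp: A_RCOSETS_def')
 have "graded_completion R k gr G ?Q (%a. ?h (\<phi> a)) (%N. ?h ` fil N)"
 proof (intro graded_completion.intro graded_completion_axioms.intro std_graded_axioms Q.cring_axioms)
  show "(%a. ?h (\<phi> a)) \<in> ring_hom R ?Q" using ring_hom_trans[OF phi_hom h.homh] unfolding comp_def .
  show "?h (\<phi> a) \<in> ?h ` fil N \<longleftrightarrow> a \<in> tail N" if "a \<in> carrier R" for a N
   using inj[of "\<phi> a" N] phi_fil[OF that] that by simp
  show "ideal (?h ` fil N) ?Q" for N by (rule B.ring_ideal_imp_quot_ideal[OF Z fil_ideal])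
  show "?h ` fil (Suc N) <= ?h ` fil N" for N using fil_Suc by blast
  show "\<exists>a\<in>carrier R. b \<ominus>\<^sub>?Q ?h (\<phi> a) \<in> ?h ` fil N" if b: "b \<in> carrier ?Q" for b N
  proof -
   obtain x where x: "x \<in> carrier B" "b = ?h x" using surj[OF b] by blast
   obtain a where "a \<in> carrier R" "x \<ominus>\<^sub>B \<phi> a \<in> fil N" using dense[OF x(1)] by blast
   then show ?thesis unfolding x(2) using hm[OF x(1) phi.hom_closed] by (intro bexI[of _ a]) auto
  qed
  show "b = \<zero>\<^sub>?Q" if b: "!!N. b \<in> ?h ` fil N" for b
  proof -
   obtain x where x: "x \<in> fil 0" "b = ?h x" using b[of 0] by blast
   have xc: "x \<in> carrier B" by (rule fil_closed[OF x(1)])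
   have "x \<in> fil N" for N using b[of N] inj[OF xc] x(2) by simp
   then have "x = \<zero>\<^sub>B" by (rule separated)
   then show ?thesis using x(2) by simp
  qed
  show "\<exists>b\<in>carrier ?Q. \<forall>N. b \<ominus>\<^sub>?Q (\<Oplus>\<^sub>?Q n\<in>{..<N}. ?h (\<phi> (c n))) \<in> ?h ` fil N" if c: "!!n. c n \<in> gr n" for c
  proof -
   obtain b where b: "b \<in> carrier B" "!!N. b \<ominus>\<^sub>B (\<Oplus>\<^sub>B n\<in>{..<N}. \<phi> (c n)) \<in> fil N" using complete[OF c] by blast
   have cc: "\<phi> (c n) \<in> carrier B" for n using gr_closed[OF c] by simp
   have "?h (\<Oplus>\<^sub>B n\<in>{..<N}. \<phi> (c n)) = (\<Oplus>\<^sub>?Q n\<in>{..<N}. (?h \<circ> (%n. \<phi> (c n))) n)" for N :: nat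
    by (subst h.hom_finsum) (use cc in auto)
   then have "?h b \<ominus>\<^sub>?Q (\<Oplus>\<^sub>?Q n\<in>{..<N}. ?h (\<phi> (c n))) = ?h (b \<ominus>\<^sub>B (\<Oplus>\<^sub>B n\<in>{..<N}. \<phi> (c n)))" for N :: nat
    using hm[OF b(1), of "\<Oplus>\<^sub>B n\<in>{..<N}. \<phi> (c n)"] cc by simp
   then show ?thesis using b by (intro bexI[of _ "?h b"]) auto
  qed
 qed
 then show ?thesis by blast
qed

lemma zero_minimal_prime: "minimal_prime {\<zero>\<^sub>B} B"
 unfolding minimal_prime_def
proof (intro conjI allI impI)
 show "primeideal {\<zero>\<^sub>B} B" using domain.zeroprimeideal[OF B_domain] .
 fix p assume p: "primeideal p B & p <= {\<zero>\<^sub>B}"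
 then have "\<zero>\<^sub>B \<in> p" using ideal_zero[OF primeideal.axioms(1)] by blast
 then show "p = {\<zero>\<^sub>B}" using p by blast
qed

end

section \<open>Algebraically closed subfields\<close>

context cring_over
begin

text \<open>Polynomials are lists with the leading coefficient first, hence the reversal.\<close>

lemma eval_hom_form:
 "(!!j. j <= p ==> c j \<in> carrier R) ==> l \<in> carrier R ==> eval (rev (map c [0..<Suc p])) l = hom_form p c l \<one>"
proof (induction p arbitrary: c)
 case (Suc p)
 have e: "rev (map c [0..<Suc (Suc p)]) = rev (map (%j. c (Suc j)) [0..<Suc p]) @ [c 0]"
  by (simp add: upt_conv_Cons map_Suc_upt[symmetric] comp_def del: upt_Suc)
 have h: "hom_form p (%j. c (Suc j)) l \<one> \<in> carrier R" by (rule hom_form_closed) (use Suc.prems in auto)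
 have "eval (rev (map (%j. c (Suc j)) [0..<Suc p]) @ [c 0]) l = eval (rev (map (%j. c (Suc j)) [0..<Suc p])) l \<otimes> l \<oplus> c 0"
  by (rule eval_append_aux) (use Suc.prems in auto)
 also have "\<dots> = hom_form p (%j. c (Suc j)) l \<one> \<otimes> l \<oplus> c 0" using Suc.IH[of "%j. c (Suc j)"] Suc.prems by simp
 also have "\<dots> = hom_form (Suc p) c l \<one>" using Suc.prems(1)[of 0] Suc.prems(2) h by (simp add: a_comm m_comm)
 finally show ?case unfolding e .
qed simp

text \<open>A polynomial that splits has as many roots, with multiplicity, as its degree, here at
  least one.\<close>

lemma alg_closed_overI: assumes "algebraically_closed (R\<lparr>carrier := k\<rparr>)" shows "alg_closed_over R k"
proof unfold_locales
 fix p c assume c: "!!j. j <= Suc p ==> c j \<in> k" "c (Suc p) ~= \<zero>"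
 interpret K: algebraically_closed "R\<lparr>carrier := k\<rparr>" by fact
 define P where "P = rev (map c [0..<Suc (Suc p)])"
 have len: "length P = Suc (Suc p)" and hd: "hd P = c (Suc p)" unfolding P_def by simp_all
 have ne: "P ~= []" using len by auto
 have set: "set P <= k" unfolding P_def using c(1) by auto
 have Pc: "P \<in> carrier (poly_ring (R\<lparr>carrier := k\<rparr>))"
  unfolding univ_poly_carrier[symmetric] polynomial_def using set hd c(2) by simp
 have "K.splitted P" by (rule K.roots_over_carrier[OF Pc])
 then have "size (K.roots P) ~= 0" unfolding K.splitted_def len by simp
 then obtain l where "l \<in># K.roots P" by fastforce
 then have "K.is_root P l" using K.roots_mem_iff_is_root[OF Pc] by simp
 then have l: "l \<in> k" "K.eval P l = \<zero>" unfolding K.is_root_def by auto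
 have "eval P l = \<zero>" using l(2) unfolding eval_consistent[OF subfieldE(1)[OF subfield]] .
 then have "hom_form (Suc p) c l \<one> = \<zero>" unfolding P_def by (subst (asm) eval_hom_form) (use c l in auto)
 then show "\<exists>l\<in>k. hom_form (Suc p) c l \<one> = \<zero>" using l(1) by blast
qed

end

text \<open>Over a finite field the map \<open>l \<mapsto> l\<^sup>2 - l\<close> is not injective, hence not surjective.\<close>

lemma (in alg_closed_over) infinite_field: "infinite k"
proof
 assume fin: "finite k"
 define h where "h l = l \<otimes> l \<ominus> l" for l
 have hk: "h ` k <= k" unfolding h_def a_minus_def using scal_ring by auto
 have "k <= h ` k"
 proof
  fix a assume a: "a \<in> k"
  define c where "c j = (if j = 0 then \<ominus> a else if j = 1 then \<ominus> \<one> else \<one>)" for j :: nat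
  have ck: "c j \<in> k" for j unfolding c_def using a scal_ring by auto
  have one: "\<one> ~= \<zero>" using subfieldE(6)[OF subfield] .
  then have "c (Suc 1) ~= \<zero>" unfolding c_def by simp
  then obtain l where l: "l \<in> k" "hom_form (Suc 1) c l \<one> = \<zero>" using root[of 1 c] ck by blast
  have cl: "a \<in> carrier R" "l \<in> carrier R" using a l by auto
  have "hom_form (Suc 1) c l \<one> = \<ominus> a \<oplus> l \<otimes> (\<ominus> \<one> \<oplus> l)"
   unfolding c_def using cl by (simp add: One_nat_def)
  also have "\<dots> = h l \<ominus> a" unfolding h_def using cl by algebra
  finally have "h l \<ominus> a = \<zero>" using l(2) by simp
  moreover have "h l \<in> carrier R" unfolding h_def using cl by simp
  ultimately have "h l = a" using cl r_right_minus_eq by blast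
  then show "a \<in> h ` k" using l(1) by blast
 qed
 then have "h ` k = k" using hk by blast
 then have "inj_on h k" using eq_card_imp_inj_on[OF fin, of h] by simp
 moreover have "h \<zero> = h \<one>" unfolding h_def by (simp add: a_minus_def r_neg)
 ultimately have "\<zero> = \<one>" using scal_ring(1,2) by (simp add: inj_on_def)
 then show False using subfieldE(6)[OF subfield] by simp
qed

section \<open>Local cohomology of the forcing algebra\<close>

text \<open>The ideals \<open>(J : y^n)\<close> form an ascending chain, so in a Noetherian ring
  their union is one of them.\<close>

lemma (in cring) colon_power_stable:
 assumes N: "noetherian_ring R" and J: "ideal J R" and y: "y \<in> carrier R"
 shows "\<exists>N::nat. \<forall>n::nat. \<forall>c\<in>carrier R. y [^] (N + n) \<otimes> c \<in> J --> y [^] N \<otimes> c \<in> J"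
proof -
 interpret noetherian_ring R by (rule N)
 define D where "D n = colon J (y [^] n)" for n :: nat
 have D: "ideal (D n) R" for n unfolding D_def by (rule colon_ideal[OF J]) (use y in simp)
 have step: "D m <= D (m + n)" for m n
 proof
  fix c assume "c \<in> D m"
  then have c: "c \<in> carrier R" "y [^] m \<otimes> c \<in> J" unfolding D_def colon_def by auto
  have "y [^] (m + n) \<otimes> c = y [^] n \<otimes> (y [^] m \<otimes> c)" using y c by (simp add: m_ac flip: nat_pow_mult)
  then show "c \<in> D (m + n)" unfolding D_def colon_def using c ideal.I_l_closed[OF J c(2), of "y [^] n"] y by simp
 qed
 have "subset.chain {I. ideal I R} (range D)"
  unfolding subset.chain_def
 proof (intro conjI ballI)
  show "range D <= {I. ideal I R}" using D by blast
  fix U V assume "U \<in> range D" "V \<in> range D"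
  then obtain i j where "U = D i" "V = D j" by blast
  moreover have "D i <= D j \<or> D j <= D i"
   using step[of i "j - i"] step[of j "i - j"] by (cases "i <= j") auto
  ultimately show "(\<subset>)\<^sup>=\<^sup>= U V \<or> (\<subset>)\<^sup>=\<^sup>= V U" by blast
 qed
 then have "\<Union>(range D) \<in> range D" by (intro ideal_chain_is_trivial) auto
 then obtain N where N: "\<Union>(range D) = D N" by blast
 have "y [^] N \<otimes> c \<in> J" if "c \<in> carrier R" "y [^] (N + n) \<otimes> c \<in> J" for n :: nat and c
 proof -
  have "c \<in> D (N + n)" unfolding D_def colon_def using that by simp
  then have "c \<in> D N" using N by blast
  then show ?thesis unfolding D_def colon_def by simp
 qed
 then show ?thesis by blast
qed

lemma (in cring) pow_in_ideal_power:
 "a \<in> I ==> a \<in> carrier R ==> a [^] (t::nat) \<in> ideal_power R I t"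
proof (induction t)
 case 0
 then show ?case unfolding ideal_power_def ideals_set_def by (simp add: nat_pow_def)
next
 case (Suc t)
 have "ideal_power R I (Suc t) = ideal_prod R (ideal_power R I t) I"
  unfolding ideal_power_def ideals_set_def by (simp add: nat_pow_def)
 then show ?case using Suc ideal_prod.prod[of "a [^] t" "ideal_power R I t" a I R] by simp
qed

context graded_completion
begin

lemma power_fil: "ideal_power B (fil 1) t <= fil t"
proof (induction t)
 case 0
 then show ?case unfolding ideal_power_def ideals_set_def fil_0 by (simp add: nat_pow_def)
next
 case (Suc t)
 have "ideal_power B (fil 1) (Suc t) = ideal_prod B (ideal_power B (fil 1) t) (fil 1)"
  unfolding ideal_power_def ideals_set_def by (simp add: nat_pow_def)
 moreover have "y \<in> fil (Suc t)" if "y \<in> ideal_prod B (ideal_power B (fil 1) t) (fil 1)" for y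
  using that
 proof (induction rule: ideal_prod.induct)
  case (prod a b)
  then show ?case using Suc fil_mult[of a t b 1] by auto
 next
  case (sum a b)
  then show ?case using fil_add by blast
 qed
 ultimately show ?case by blast
qed

text \<open>Two comparisons link the algebra to the cohomology: torsion for the maximal ideal equals
  torsion for the parameters, and membership of one in every limit ideal, multiplied through by
  \<open>a\<close>, is the condition \<open>top\<close> of \<open>vanish_top\<close>.\<close>

theorem cohomology_vanishes:
 fixes f :: "nat => 'a" and d :: "nat => nat" and n :: nat
 assumes closed: "alg_closed_over R k"
  and f: "f0 \<notin> Idl (f ` {1..n})" "f0 \<in> gr d0" "!!i. i \<in> {1..n} ==> f i \<in> gr (d i) & d0 <= d i"
 shows "\<not> local_cohomology_nonzero B (max_ideal_of B)
  (forcing_algebra B n (%i. \<phi> (f i)) (\<phi> f0)) (the_enat (krull_dim B))"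
proof -
 interpret alg_closed_over R k by (rule closed)
 obtain r x N where x: "!!j. j < r ==> x j \<in> gr 1" "gr N <= Idl (x ` {..<r})" and dim: "enat r <= krull_dim B"
  using parameters[OF infinite_field] by blast
 have xc: "x j \<in> carrier R" if "j < r" for j using gr_closed[OF x(1)[OF that]] .
 have xsub: "x ` {..<r} <= carrier R" using xc by auto
 \<comment> \<open>Passing to \<open>Suc N\<close> makes the bound positive.\<close>
 interpret graded_parameters R k gr G x r "Suc N"
 proof (unfold_locales)
  show "gr (Suc N) <= Idl (x ` {..<r})" by (rule gr_in_ideal[OF genideal_ideal[OF xsub] x(2)]) simp
 qed (use x in auto)
 \<comment> \<open>Finiteness of the dimension matters here, because \<open>the_enat\<close> is
   specified only on finite values.\<close>
 have r_le: "r <= the_enat (krull_dim B)"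
  using dim krull_dim_finite by (cases "krull_dim B") auto
 let ?A = "forcing_algebra B n (%i. \<phi> (f i)) (\<phi> f0)"
 have fc: "f0 \<in> carrier R" "!!i. i \<in> {1..n} ==> f i \<in> carrier R" using f gr_closed by blast+
 have "\<exists>\<psi> \<tau>. cring ?A & \<psi> \<in> ring_hom B ?A & (\<forall>i\<in>{1..n}. \<tau> i \<in> carrier ?A) &
  (\<Oplus>\<^sub>?A i\<in>{1..n}. \<psi> (\<phi> (f i)) \<otimes>\<^sub>?A \<tau> i) \<oplus>\<^sub>?A \<psi> (\<phi> f0) = \<zero>\<^sub>?A &
  (\<forall>a\<in>carrier B. \<forall>z\<in>carrier ?A. a \<odot>\<^sub>?A z = \<psi> a \<otimes>\<^sub>?A z) & module B ?A"
  by (rule B.forcing_algebra_structure) (use fc in auto)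
 then obtain \<psi> \<tau> where A: "cring ?A" "\<psi> \<in> ring_hom B ?A" "!!i. i \<in> {1..n} ==> \<tau> i \<in> carrier ?A"
  "(\<Oplus>\<^sub>?A i\<in>{1..n}. \<psi> (\<phi> (f i)) \<otimes>\<^sub>?A \<tau> i) \<oplus>\<^sub>?A \<psi> (\<phi> f0) = \<zero>\<^sub>?A"
  "!!a z. a \<in> carrier B ==> z \<in> carrier ?A ==> a \<odot>\<^sub>?A z = \<psi> a \<otimes>\<^sub>?A z" "module B ?A" by blast
 interpret A: cring ?A by (rule A(1))
 interpret psi: ring_hom_cring B ?A \<psi> by unfold_locales (rule A(2))
 define \<chi> where "\<chi> a = \<psi> (\<phi> a)" for a
 have chi: "\<chi> \<in> ring_hom R ?A" using ring_hom_trans[OF phi_hom A(2)] unfolding comp_def \<chi>_def .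
 interpret P: parameter_algebra R k gr G x r "Suc N" ?A \<chi>
  by (intro parameter_algebra.intro graded_parameters_axioms closed ring_hom_cring.intro
    ring_hom_cring_axioms.intro A.cring_axioms cring_axioms chi)
 have fsub: "f ` {1..n} <= carrier R" using fc by auto
 have lim: "\<one>\<^sub>?A \<in> P.limit_ideal t" for t
 proof (rule P.forced_limit[OF genideal_ideal[OF fsub] f(1) _ f(2,3)])
  show "f i \<in> Idl (f ` {1..n})" if "i \<in> {1..n}" for i using genideal_self[OF fsub] that by blast
  show "(\<Oplus>\<^sub>?A i\<in>{1..n}. \<chi> (f i) \<otimes>\<^sub>?A \<tau> i) \<oplus>\<^sub>?A \<chi> f0 = \<zero>\<^sub>?A" using A(4) unfolding \<chi>_def .
 qed (use A(3) in auto)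
 define y where "y j = \<phi> (x j)" for j
 have yc: "y j \<in> carrier B" if "j < r" for j unfolding y_def using xc[OF that] by simp
 have phi_pow: "\<phi> (a [^] (t::nat)) = \<phi> a [^]\<^sub>B t" if "a \<in> carrier R" for a t using that by (induction t) auto
 have psi_pow: "\<psi> (a [^]\<^sub>B (t::nat)) = \<psi> a [^]\<^sub>?A t" if "a \<in> carrier B" for a t using that by (induction t) auto
 \<comment> \<open>The ideal of \<open>t\<close>-th powers of the parameters contains a step of the
   filtration; so an element killed by these powers is killed by a power of the maximal
   ideal.\<close>
 have fil_powers: "\<exists>s. fil s <= Idl\<^bsub>B\<^esub> ((%j. y j [^]\<^sub>B t) ` {..<r})" for t :: nat
 proof -
  have pc: "powers t <= carrier R" by auto
  have "fil (r * t + Suc N) <= Idl\<^bsub>B\<^esub> ((%j. \<phi> (x j [^] t)) ` {..<r})"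
  proof (rule fil_generated)
   show "x i [^] t \<in> gr t" if "i \<in> {..<r}" for i using pow_gr[OF x(1), of i t] that by simp
   show "gr m <= Idl (powers t)" if "r * t + Suc N <= m" for m
    by (rule gr_large_subset[OF genideal_ideal[OF pc] genideal_self[OF pc] that])
  qed simp
  moreover have "(%j. \<phi> (x j [^] t)) ` {..<r} = (%j. y j [^]\<^sub>B t) ` {..<r}"
   unfolding y_def by (rule image_cong) (use xc phi_pow in auto)
  ultimately show ?thesis by auto
 qed

 have triv: "carrier (torsion_cohomology B (max_ideal_of B) E dd j) = {\<one>\<^sub>(torsion_cohomology B (max_ideal_of B) E dd j)}"
  if res: "injective_resolution B ?A E \<epsilon> dd" and j: "r <= j"
  for E :: "nat => ('c, ('c, (nat multiset => 'c) set) resolution_elt) module" and \<epsilon> dd j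
 proof -
  interpret res: resolution B ?A E \<epsilon> dd y r
  proof (unfold_locales)
   fix i k assume i: "i < r"
   have s: "(%j. y j [^]\<^sub>B (k::nat)) ` {..<i} <= carrier B" using yc i by auto
   show "\<exists>N::nat. \<forall>n::nat. \<forall>c\<in>carrier B. y i [^]\<^sub>B (N + n) \<otimes>\<^sub>B c \<in> Idl\<^bsub>B\<^esub> ((%j. y j [^]\<^sub>B k) ` {..<i}) -->
     y i [^]\<^sub>B N \<otimes>\<^sub>B c \<in> Idl\<^bsub>B\<^esub> ((%j. y j [^]\<^sub>B k) ` {..<i})"
    by (rule B.colon_power_stable[OF B_noetherian B.genideal_ideal[OF s] yc[OF i]])
  qed (use res yc in auto)
  have xprod_eq: "res.xprod r = \<phi> (mon (%i. 1))"
  proof -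
   have "res.xprod j = \<phi> (\<Otimes>i\<in>{..<j}. x i [^] (1::nat))" if "j <= r" for j
    using that
   proof (induction j)
    case (Suc j)
    have "(\<Otimes>i\<in>{..<Suc j}. x i [^] (1::nat)) = x j [^] (1::nat) \<otimes> (\<Otimes>i\<in>{..<j}. x i [^] (1::nat))"
     unfolding lessThan_Suc by (rule finprod_insert) (use Suc.prems xc in auto)
    moreover have "(\<Otimes>i\<in>{..<j}. x i [^] (1::nat)) \<in> carrier R" using Suc.prems xc by (auto intro!: finprod_closed)
    ultimately have "\<phi> (\<Otimes>i\<in>{..<Suc j}. x i [^] (1::nat)) = y j \<otimes>\<^sub>B \<phi> (\<Otimes>i\<in>{..<j}. x i [^] (1::nat))"
     using Suc.prems xc[of j] by (simp add: y_def)
    then show ?case unfolding res.xprod.simps using Suc by simp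
   qed simp
   from this[of r] show ?thesis unfolding mon_def by simp
  qed
  have xprod_pow: "\<psi> (res.xprod r [^]\<^sub>B u) = P.xprods u" for u :: nat
  proof -
   have "res.xprod r [^]\<^sub>B u = \<phi> (mon (%i. 1) [^] u)" unfolding xprod_eq by (rule phi_pow[symmetric]) simp
   then show ?thesis unfolding \<chi>_def mon_pow by simp
  qed
  show ?thesis
  proof (rule res.cohomology_trivial[OF A(6) _ _ j])
   fix a t assume a: "a \<in> carrier ?A"
   \<comment> \<open>The exponent depends on \<open>t\<close> alone: a combination that expresses
     the power product, multiplied by \<open>a\<close>, is one for \<open>a\<close>.\<close>
   obtain u where u: "P.xprods u \<otimes>\<^sub>?A \<one>\<^sub>?A \<in> P.power_ideal (t + u)" using lim[of t] unfolding P.limit_ideal_def by blast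
   then have "P.xprods u \<in> P.power_ideal (t + u)" by simp
   then obtain b where b: "\<forall>j\<in>{..<r}. b j \<in> carrier ?A"
    "P.xprods u = (\<Oplus>\<^sub>?A j\<in>{..<r}. b j \<otimes>\<^sub>?A \<chi> (x j) [^]\<^sub>?A (t + u))"
    using A.genideal_combination[of "{..<r}" "%j. \<chi> (x j) [^]\<^sub>?A (t + u)" "P.xprods u"] by auto
   have xk: "\<chi> (x j) [^]\<^sub>?A (t + u) \<in> carrier ?A" if "j < r" for j using that by simp
   have main: "res.xprod r [^]\<^sub>B u \<odot>\<^sub>?A a \<in> T"
    if T: "\<zero>\<^sub>?A \<in> T" "\<forall>u\<in>T. \<forall>v\<in>T. u \<oplus>\<^sub>?A v \<in> T" "\<forall>j<r. \<forall>b\<in>carrier ?A. y j [^]\<^sub>B (t + u) \<odot>\<^sub>?A b \<in> T" for T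
   proof -
    have term_in: "b j \<otimes>\<^sub>?A \<chi> (x j) [^]\<^sub>?A (t + u) \<otimes>\<^sub>?A a \<in> T" if j: "j < r" for j
    proof -
     have bj: "b j \<in> carrier ?A" using b(1) j by simp
     have "y j [^]\<^sub>B (t + u) \<odot>\<^sub>?A (b j \<otimes>\<^sub>?A a) = \<chi> (x j) [^]\<^sub>?A (t + u) \<otimes>\<^sub>?A (b j \<otimes>\<^sub>?A a)"
      using A(5)[of "y j [^]\<^sub>B (t + u)" "b j \<otimes>\<^sub>?A a"] psi_pow[OF yc[OF j], of "t + u"] yc[OF j] bj a
      unfolding \<chi>_def y_def by simp
     also have "\<dots> = b j \<otimes>\<^sub>?A \<chi> (x j) [^]\<^sub>?A (t + u) \<otimes>\<^sub>?A a" using bj a xk[OF j] by (simp add: A.m_ac)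
     finally show ?thesis using T(3) j bj a by (metis A.m_closed)
    qed
    have sum_in: "(\<Oplus>\<^sub>?A j\<in>{..<i}. b j \<otimes>\<^sub>?A \<chi> (x j) [^]\<^sub>?A (t + u) \<otimes>\<^sub>?A a) \<in> T" if "i <= r" for i
     using that
    proof (induction i)
     case (Suc i)
     have "(\<Oplus>\<^sub>?A j\<in>{..<Suc i}. b j \<otimes>\<^sub>?A \<chi> (x j) [^]\<^sub>?A (t + u) \<otimes>\<^sub>?A a)
      = b i \<otimes>\<^sub>?A \<chi> (x i) [^]\<^sub>?A (t + u) \<otimes>\<^sub>?A a \<oplus>\<^sub>?A (\<Oplus>\<^sub>?A j\<in>{..<i}. b j \<otimes>\<^sub>?A \<chi> (x j) [^]\<^sub>?A (t + u) \<otimes>\<^sub>?A a)"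
      unfolding lessThan_Suc by (rule A.finsum_insert) (use Suc.prems b(1) a xk in auto)
     then show ?case using T(2) term_in[of i] Suc by simp
    qed (use T(1) in simp)
    have "res.xprod r [^]\<^sub>B u \<odot>\<^sub>?A a = P.xprods u \<otimes>\<^sub>?A a"
     using A(5)[of "res.xprod r [^]\<^sub>B u" a] xprod_pow a by simp
    also have "\<dots> = (\<Oplus>\<^sub>?A j\<in>{..<r}. b j \<otimes>\<^sub>?A \<chi> (x j) [^]\<^sub>?A (t + u) \<otimes>\<^sub>?A a)"
     unfolding b(2) by (rule A.finsum_ldistr) (use b(1) a xk in auto)
    finally show ?thesis using sum_in[OF order_refl] by simp
   qed
   show "\<exists>s. \<forall>T. \<zero>\<^sub>?A \<in> T & (\<forall>u\<in>T. \<forall>v\<in>T. u \<oplus>\<^sub>?A v \<in> T) &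
     (\<forall>j<r. \<forall>b\<in>carrier ?A. y j [^]\<^sub>B (t + s) \<odot>\<^sub>?A b \<in> T) --> res.xprod r [^]\<^sub>B s \<odot>\<^sub>?A a \<in> T"
    by (intro exI[of _ u] allI impI, elim conjE) (rule main)
  next
   fix i
   show "\<Gamma> B (max_ideal_of B) (E i) = res.tor r i"
   proof
    show "\<Gamma> B (max_ideal_of B) (E i) <= res.tor r i"
    proof
     fix e assume "e \<in> \<Gamma> B (max_ideal_of B) (E i)"
     then obtain t where e: "e \<in> carrier (E i)" "\<forall>a\<in>ideal_power B (fil 1) t. a \<odot>\<^sub>(E i) e = \<zero>\<^sub>(E i)"
      unfolding torsion_part_def max_ideal by blast
     have "y j [^]\<^sub>B t \<in> ideal_power B (fil 1) t" if "j < r" for j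
      by (rule B.pow_in_ideal_power) (use phi_fil[OF xc[OF that], of 1] gr_tail[OF x(1)[OF that], of 1] yc[OF that] in "auto simp: y_def")
     then show "e \<in> res.tor r i" unfolding res.tor_def using e by blast
    qed
    show "res.tor r i <= \<Gamma> B (max_ideal_of B) (E i)"
    proof
     fix e assume "e \<in> res.tor r i"
     then obtain t :: nat where e: "e \<in> carrier (E i)" "\<forall>j<r. y j [^]\<^sub>B t \<odot>\<^sub>(E i) e = \<zero>\<^sub>(E i)" unfolding res.tor_def by blast
     obtain s where s: "fil s <= Idl\<^bsub>B\<^esub> ((%j. y j [^]\<^sub>B t) ` {..<r})" using fil_powers by blast
     have sub: "(%j. y j [^]\<^sub>B t) ` {..<r} <= carrier B" using yc by auto
     have "a \<odot>\<^sub>(E i) e = \<zero>\<^sub>(E i)" if "a \<in> ideal_power B (fil 1) s" for a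
     proof -
      have "Idl\<^bsub>B\<^esub> ((%j. y j [^]\<^sub>B t) ` {..<r}) <= {a \<in> carrier B. a \<odot>\<^sub>(E i) e = \<zero>\<^sub>(E i)}"
       by (rule B.genideal_minimal[OF res.E.annihilator_ideal[OF e(1)]]) (use sub e(2) in auto)
      then show ?thesis using that power_fil[of s] s by blast
     qed
     then show "e \<in> \<Gamma> B (max_ideal_of B) (E i)" unfolding torsion_part_def max_ideal using e(1) by blast
    qed
   qed
  qed
 qed
 show ?thesis unfolding local_cohomology_nonzero_def using triv r_le by blast
qed

end

theorem corollary4p5:
  fixes R :: "('a, 'x) ring_scheme" and K :: "'a set" and gr :: "nat \<Rightarrow> 'a set"
    and n :: nat and f :: "nat \<Rightarrow> 'a" and d :: "nat \<Rightarrow> nat" and f0 :: 'a and d0 :: nat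
  assumes "algebraically_closed (R \<lparr>carrier := K\<rparr>)"
    and "standard_graded_algebra K R gr"
    and "normal_domain R"
    and "n \<ge> 1"
    and "\<forall>i\<in>{1..n}. f i \<in> gr (d i)"
    and "primary_family R gr n f"
    and "f0 \<in> gr d0"
    and "d0 \<le> Min (d ` {1..n})"
    and "f0 \<in> solid_closure R n f"
  shows "f0 \<in> Idl\<^bsub>R\<^esub> (f ` {1..n})"
proof (rule ccontr)
 assume f0: "f0 \<notin> Idl\<^bsub>R\<^esub> (f ` {1..n})"
 obtain G where G: "graded_ring R gr" "subfield K R" "gr 0 = K" "finite G" "G <= gr 1" "carrier R = generate_ring R (K \<union> G)"
  using assms(2) unfolding standard_graded_algebra_def by blast
 have dom: "domain R" using assms(3) unfolding normal_domain_def by simp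
 have "cring_over R K" by (intro cring_over.intro cring_over_axioms.intro G(2) domain.axioms(1)[OF dom])
 then interpret std_graded R K gr G
  by (intro std_graded.intro std_graded_axioms.intro dom G)
 obtain fil where "graded_completion R K gr G (completed_local_ring_at R (tail 1)) (to_completed_local_ring R (tail 1)) fil"
  using completed_graded by blast
 then interpret C: graded_completion R K gr G "completed_local_ring_at R (tail 1)" "to_completed_local_ring R (tail 1)" fil .
 let ?C = "completed_local_ring_at R (tail 1)"
 obtain fil' where Q: "graded_completion R K gr G (?C Quot {\<zero>\<^bsub>?C\<^esub>}) (%a. {\<zero>\<^bsub>?C\<^esub>} +>\<^bsub>?C\<^esub> to_completed_local_ring R (tail 1) a) fil'"
  using C.quotient_zero by blast
 have le: "d0 <= d i" if "i \<in> {1..n}" for i using assms(8) that by (meson Min_le finite_atLeastAtMost finite_imageI image_eqI order_trans)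
 have "\<not> local_cohomology_nonzero (?C Quot {\<zero>\<^bsub>?C\<^esub>}) (max_ideal_of (?C Quot {\<zero>\<^bsub>?C\<^esub>}))
   (forcing_algebra (?C Quot {\<zero>\<^bsub>?C\<^esub>}) n (%i. {\<zero>\<^bsub>?C\<^esub>} +>\<^bsub>?C\<^esub> to_completed_local_ring R (tail 1) (f i))
    ({\<zero>\<^bsub>?C\<^esub>} +>\<^bsub>?C\<^esub> to_completed_local_ring R (tail 1) f0)) (the_enat (krull_dim (?C Quot {\<zero>\<^bsub>?C\<^esub>})))"
  by (rule graded_completion.cohomology_vanishes[OF Q alg_closed_overI[OF assms(1)] f0 assms(7)]) (use assms(5) le in auto)
 \<comment> \<open>Solid closure speaks about all maximal ideals and minimal primes; it is
   contradicted at the irrelevant ideal and the zero ideal of the completion.\<close>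
 moreover have "maximalideal (tail 1) R" "minimal_prime {\<zero>\<^bsub>?C\<^esub>} ?C" by (rule tail_1_maximal, rule C.zero_minimal_prime)
 ultimately show False using assms(9) unfolding solid_closure_def Let_def by blast
qed

end
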